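(* Let $n\in\mathbb N$, $1<p<\infty$, $-\frac np<r<0$, $r+\varrho=-n$ and $1<q<\infty$, and let $\frac1p+\frac1{p'}=1$, $\frac1q+\frac1{q'}=1$. Then the dual space of $\overset{\circ}{L}{}^r_p(\ell_q,\mathbb R^n)$ is $H^{\varrho}L_{p'}(\ell_{q'},\mathbb R^n)$. More precisely, $L_{-\frac nr}(\ell_q,\mathbb R^n)$ is continuously embedded in $\overset{\circ}{L}{}^r_p(\ell_q,\mathbb R^n)$, and $g\in\left(\overset{\circ}{L}{}^r_p(\ell_q,\mathbb R^n)\right)'$ if, and only if, it can be uniquely represented as $$g(f)=\int_{\mathbb R^n}\sum_{j\in\mathbb N_0}g_j(x)f_j(x)\,dx\qquad\text{for all } f=\{f_j\}\in L_{-\frac nr}(\ell_q,\mathbb R^n),$$ where $\{g_j\}\in H^{\varrho}L_{p'}(\ell_{q'},\mathbb R^n)$ and $$\left\|g\,\middle|\,\left(\overset{\circ}{L}{}^r_p(\ell_q,\mathbb R^n)\right)'\right\|=\left\|\{g_j\}\,|\,H^{\varrho}L_{p'}(\ell_{q'},\mathbb R^n)\right\|.$$ Moreover, if $\{g_j\}\in H^{\varrho}L_{p'}(\ell_{q'},\mathbb R^n)$, then $$\left\|\{g_j\}\,|\,H^{\varrho}L_{p'}(\ell_{q'},\mathbb R^n)\right\|=\sup_f\left|\int_{\mathbb R^n}\sum_{j\in\mathbb N_0}g_j(x)f_j(x)\,dx\right|,$$ where the supremum is taken over all $f=\{f_j\}\in\overset{\circ}{L}{}^r_p(\ell_q,\mathbb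 R^n)$ with $\|f\,|\,L^r_p(\ell_q,\mathbb R^n)\|\le1$.
   Context: Functions are complex-valued; $X'$ denotes the topological dual of $X$; $D(\mathbb R^n)=C_0^\infty(\mathbb R^n)$. For $J\in\mathbb Z$, $M\in\mathbb Z^n$ put $Q_{J,M}=2^{-J}(M+[-1,1]^n)$. Morrey space: for $1<p<\infty$, $-\frac np\le r<0$, $L^r_p(\mathbb R^n)$ is the set of all $f\in L_p^{\rm loc}(\mathbb R^n)$ with $\|f|L^r_p(\mathbb R^n)\|=\sup_{J\in\mathbb Z,M\in\mathbb Z^n}2^{J(\frac np+r)}\|f|L_p(Q_{J,M})\|<\infty$. Predual Morrey space: for $1<p<\infty$, $-n<\varrho<-\frac np$, $H^\varrho L_p(\mathbb R^n)$ is the set of all $h\in S'(\mathbb R^n)$ which can be represented as $h=\sum_{J\in\mathbb Z,M\in\mathbb Z^n}\lambda_{J,M}a_{J,M}$ (convergence in $S'(\mathbb R^n)$) with $\operatorname{supp}a_{J,M}\subset Q_{J,M}$, $\|a_{J,M}|L_p(\mathbb R^n)\|\le2^{-J(\frac np+\varrho)}$ and $\sum_{J,M}|\lambda_{J,M}|<\infty$; its norm $\|h|H^\varrho L_p(\mathbb R^n)\|$ is the infimum of $\sum_{J,M}|\lambda_{J,M}|$ over all such representations. One has $H^\varrho L_p(\mathbb R^n)\subset L_u(\mathbb R^n)$ with $u=-n/\varrho$, so its elements are functions. (Here this is used with $p'$ in place of $p$; note that $r>-n/p$ and $r+\varrho=-n$ give $-n<\varrho<-n/p'$.) Vector-valued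 versions: $L^r_p(\ell_q,\mathbb R^n)$ is the set of all sequences $\{f_j\}_{j\in\mathbb N_0}$ in $L^r_p(\mathbb R^n)$ with $\|\{f_j\}|L^r_p(\ell_q,\mathbb R^n)\|=\big\|\big(\sum_{j\ge0}|f_j(\cdot)|^q\big)^{1/q}\big|L^r_p(\mathbb R^n)\big\|<\infty$. $\overset{\circ}{L}{}^r_p(\ell_q,\mathbb R^n)$ is the subspace of those $\{f_j\}\in L^r_p(\ell_q,\mathbb R^n)$ for which there exist $f_j^k\in D(\mathbb R^n)$ ($j\in\mathbb N_0$, $k\in\mathbb N$) with $f_j^k=0$ for $j>k$ and $\|\{f_j-f_j^k\}_j|L^r_p(\ell_q,\mathbb R^n)\|\to0$ as $k\to\infty$. $L_u(\ell_q,\mathbb R^n)$ is defined like $L^r_p(\ell_q,\mathbb R^n)$ with the Lebesgue norm of $L_u(\mathbb R^n)$ in place of the Morrey norm. $H^\varrho L_p(\ell_q,\mathbb R^n)$ is the set of all sequences $\{g_j\}_{j\in\mathbb N_0}$ in $H^\varrho L_p(\mathbb R^n)$ such that $\big(\sum_{j\ge0}|g_j(\cdot)|^q\big)^{1/q}\in H^\varrho L_p(\mathbb R^n)$, normed by the $H^\varrho L_p(\mathbb R^n)$-norm of this function. *)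

theory Defs
  imports "HOL-Analysis.Analysis"
begin

text \<open>
  Elements of the function spaces below are represented by functions
  \<open>real ^ 'n \<Rightarrow> complex\<close> that are Lebesgue measurable; functions that agree almost everywhere
  are the same element. The real-valued norms are meaningful on members of the respective space only.
\<close>

section \<open>Test functions and tempered distributions\<close>

definition pderiv_at :: "'n::finite \<Rightarrow> (real ^ 'n \<Rightarrow> complex) \<Rightarrow> real ^ 'n \<Rightarrow> complex" where
  "pderiv_at i f x = frechet_derivative f (at x) (axis i 1)"

definition iter_pderiv :: "'n::finite list \<Rightarrow> (real ^ 'n \<Rightarrow> complex) \<Rightarrow> real ^ 'n \<Rightarrow> complex" where
  "iter_pderiv is f = foldr pderiv_at is f"

definition smooth_fun :: "(real ^ 'n::finite \<Rightarrow> complex) \<Rightarrow> bool" where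
  "smooth_fun f \<longleftrightarrow> (\<forall>is x. iter_pderiv is f differentiable (at x))"

definition test_functions :: "(real ^ 'n::finite \<Rightarrow> complex) set" where
  "test_functions = {f. smooth_fun f \<and> compact (closure {x. f x \<noteq> 0})}"

definition schwartz_functions :: "(real ^ 'n::finite \<Rightarrow> complex) set" where
  "schwartz_functions =
     {\<phi>. smooth_fun \<phi> \<and> (\<forall>is N. bounded (range (\<lambda>x. (1 + norm x) ^ N *\<^sub>R iter_pderiv is \<phi> x)))}"

definition schwartz_converges ::
  "(nat \<Rightarrow> real ^ 'n::finite \<Rightarrow> complex) \<Rightarrow> (real ^ 'n \<Rightarrow> complex) \<Rightarrow> bool" where
  "schwartz_converges \<Phi> \<phi> \<longleftrightarrow>
     (\<forall>is N. uniform_limit UNIV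
        (\<lambda>k x. (1 + norm x) ^ N *\<^sub>R iter_pderiv is (\<Phi> k) x)
        (\<lambda>x. (1 + norm x) ^ N *\<^sub>R iter_pderiv is \<phi> x) sequentially)"

text \<open>The values of a tempered distribution outside \<open>schwartz_functions\<close> are irrelevant.
  As the Schwartz space is metrizable, sequential continuity is continuity.\<close>

definition tempered_distribution :: "((real ^ 'n::finite \<Rightarrow> complex) \<Rightarrow> complex) \<Rightarrow> bool" where
  "tempered_distribution T \<longleftrightarrow>
     (\<forall>\<phi>\<in>schwartz_functions. \<forall>\<psi>\<in>schwartz_functions. T (\<lambda>x. \<phi> x + \<psi> x) = T \<phi> + T \<psi>) \<and>
     (\<forall>c. \<forall>\<phi>\<in>schwartz_functions. T (\<lambda>x. c * \<phi> x) = c * T \<phi>) \<and>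
     (\<forall>\<Phi>. \<forall>\<phi>\<in>schwartz_functions. (\<forall>k. \<Phi> k \<in> schwartz_functions) \<longrightarrow>
        schwartz_converges \<Phi> \<phi> \<longrightarrow> (\<lambda>k. T (\<Phi> k)) \<longlonglongrightarrow> T \<phi>)"

definition function_distribution ::
  "(real ^ 'n::finite \<Rightarrow> complex) \<Rightarrow> (real ^ 'n \<Rightarrow> complex) \<Rightarrow> complex" where
  "function_distribution h \<phi> = (LINT x|lebesgue. h x * \<phi> x)"


section \<open>Lebesgue and Morrey spaces\<close>

definition Lp_norm_on :: "real \<Rightarrow> (real ^ 'n::finite) set \<Rightarrow> (real ^ 'n \<Rightarrow> complex) \<Rightarrow> real" where
  "Lp_norm_on p A f = (LINT x:A|lebesgue. norm (f x) powr p) powr (1 / p)"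

definition Lp_space :: "real \<Rightarrow> (real ^ 'n::finite \<Rightarrow> complex) set" where
  "Lp_space p =
     {f. f \<in> borel_measurable lebesgue \<and> integrable lebesgue (\<lambda>x. norm (f x) powr p)}"

definition Lp_loc :: "real \<Rightarrow> (real ^ 'n::finite \<Rightarrow> complex) set" where
  "Lp_loc p =
     {f. f \<in> borel_measurable lebesgue \<and>
         (\<forall>K. compact K \<longrightarrow> set_integrable lebesgue K (\<lambda>x. norm (f x) powr p))}"

definition dyadic_cube :: "int \<times> (int ^ 'n::finite) \<Rightarrow> (real ^ 'n) set" where
  "dyadic_cube = (\<lambda>(J, M). (\<lambda>y. (2 powr - real_of_int J) *\<^sub>R ((\<chi> i. real_of_int (M $ i)) + y)) `
     cbox (\<chi> i. - 1) (\<chi> i. 1))"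

definition morrey_term ::
  "real \<Rightarrow> real \<Rightarrow> (real ^ 'n::finite \<Rightarrow> complex) \<Rightarrow> int \<times> (int ^ 'n) \<Rightarrow> real" where
  "morrey_term p r f = (\<lambda>(J, M).
     2 powr (real_of_int J * (real CARD('n) / p + r)) * Lp_norm_on p (dyadic_cube (J, M)) f)"

definition morrey_space :: "real \<Rightarrow> real \<Rightarrow> (real ^ 'n::finite \<Rightarrow> complex) set" where
  "morrey_space p r = {f \<in> Lp_loc p. bdd_above (range (morrey_term p r f))}"

definition morrey_norm :: "real \<Rightarrow> real \<Rightarrow> (real ^ 'n::finite \<Rightarrow> complex) \<Rightarrow> real" where
  "morrey_norm p r f = (SUP JM. morrey_term p r f JM)"


section \<open>Predual Morrey spaces\<close>

definition predual_representation ::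
  "real \<Rightarrow> real \<Rightarrow> ((real ^ 'n::finite \<Rightarrow> complex) \<Rightarrow> complex) \<Rightarrow>
   (int \<times> (int ^ 'n) \<Rightarrow> complex) \<Rightarrow> (int \<times> (int ^ 'n) \<Rightarrow> real ^ 'n \<Rightarrow> complex) \<Rightarrow> bool" where
  "predual_representation p \<rho> T c a \<longleftrightarrow>
     (\<forall>J M. a (J, M) \<in> Lp_space p \<and>
            (AE x in lebesgue. x \<notin> dyadic_cube (J, M) \<longrightarrow> a (J, M) x = 0) \<and>
            Lp_norm_on p UNIV (a (J, M)) \<le> 2 powr (- real_of_int J * (real CARD('n) / p + \<rho>))) \<and>
     (\<lambda>JM. norm (c JM)) summable_on UNIV \<and>
     (\<forall>\<phi>\<in>schwartz_functions.
        ((\<lambda>JM. c JM * function_distribution (a JM) \<phi>) has_sum T \<phi>) UNIV)"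

definition predual_dist_space ::
  "real \<Rightarrow> real \<Rightarrow> ((real ^ 'n::finite \<Rightarrow> complex) \<Rightarrow> complex) set" where
  "predual_dist_space p \<rho> =
     {T. tempered_distribution T \<and> (\<exists>c a. predual_representation p \<rho> T c a)}"

definition predual_dist_norm ::
  "real \<Rightarrow> real \<Rightarrow> ((real ^ 'n::finite \<Rightarrow> complex) \<Rightarrow> complex) \<Rightarrow> real" where
  "predual_dist_norm p \<rho> T =
     Inf {infsum (\<lambda>JM. norm (c JM)) UNIV |c. \<exists>a. predual_representation p \<rho> T c a}"

text \<open>The elements of the predual space are regular distributions; the following set consists of
  the functions that generate them.\<close>

definition predual_space :: "real \<Rightarrow> real \<Rightarrow> (real ^ 'n::finite \<Rightarrow> complex) set" where
  "predual_space p \<rho> =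
     {h. h \<in> borel_measurable lebesgue \<and>
         (\<forall>\<phi>\<in>schwartz_functions. integrable lebesgue (\<lambda>x. h x * \<phi> x)) \<and>
         function_distribution h \<in> predual_dist_space p \<rho>}"

definition predual_norm :: "real \<Rightarrow> real \<Rightarrow> (real ^ 'n::finite \<Rightarrow> complex) \<Rightarrow> real" where
  "predual_norm p \<rho> h = predual_dist_norm p \<rho> (function_distribution h)"


section \<open>Vector-valued versions\<close>

definition lq_fun ::
  "real \<Rightarrow> (nat \<Rightarrow> real ^ 'n::finite \<Rightarrow> complex) \<Rightarrow> real ^ 'n \<Rightarrow> complex" where
  "lq_fun q f x = complex_of_real ((\<Sum>j. norm (f j x) powr q) powr (1 / q))"

text \<open>The almost-everywhere clause says that the \<open>\<ell>\<^sub>q\<close>-norm of the sequence is finite almost everywhere,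
  so that \<^const>\<open>lq_fun\<close> is not the junk value of a divergent series.\<close>

definition lq_valued ::
  "real \<Rightarrow> (real ^ 'n::finite \<Rightarrow> complex) set \<Rightarrow> (nat \<Rightarrow> real ^ 'n \<Rightarrow> complex) set" where
  "lq_valued q X =
     {f. (\<forall>j. f j \<in> X) \<and> (AE x in lebesgue. summable (\<lambda>j. norm (f j x) powr q)) \<and> lq_fun q f \<in> X}"

definition Lp_lq :: "real \<Rightarrow> real \<Rightarrow> (nat \<Rightarrow> real ^ 'n::finite \<Rightarrow> complex) set" where
  "Lp_lq u q = lq_valued q (Lp_space u)"

definition Lp_lq_norm :: "real \<Rightarrow> real \<Rightarrow> (nat \<Rightarrow> real ^ 'n::finite \<Rightarrow> complex) \<Rightarrow> real" where
  "Lp_lq_norm u q f = Lp_norm_on u UNIV (lq_fun q f)"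

definition morrey_lq :: "real \<Rightarrow> real \<Rightarrow> real \<Rightarrow> (nat \<Rightarrow> real ^ 'n::finite \<Rightarrow> complex) set" where
  "morrey_lq p r q = lq_valued q (morrey_space p r)"

definition morrey_lq_norm ::
  "real \<Rightarrow> real \<Rightarrow> real \<Rightarrow> (nat \<Rightarrow> real ^ 'n::finite \<Rightarrow> complex) \<Rightarrow> real" where
  "morrey_lq_norm p r q f = morrey_norm p r (lq_fun q f)"

definition morrey0_lq :: "real \<Rightarrow> real \<Rightarrow> real \<Rightarrow> (nat \<Rightarrow> real ^ 'n::finite \<Rightarrow> complex) set" where
  "morrey0_lq p r q =
     {f \<in> morrey_lq p r q.
        \<exists>F. (\<forall>j k. F k j \<in> test_functions) \<and> (\<forall>j k. j > k \<longrightarrow> F k j = (\<lambda>x. 0)) \<and>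
            (\<lambda>k. morrey_lq_norm p r q (\<lambda>j x. f j x - F k j x)) \<longlonglongrightarrow> 0}"

definition predual_lq :: "real \<Rightarrow> real \<Rightarrow> real \<Rightarrow> (nat \<Rightarrow> real ^ 'n::finite \<Rightarrow> complex) set" where
  "predual_lq p \<rho> q = lq_valued q (predual_space p \<rho>)"

definition predual_lq_norm ::
  "real \<Rightarrow> real \<Rightarrow> real \<Rightarrow> (nat \<Rightarrow> real ^ 'n::finite \<Rightarrow> complex) \<Rightarrow> real" where
  "predual_lq_norm p \<rho> q g = predual_norm p \<rho> (lq_fun q g)"


section \<open>Duality\<close>

text \<open>Bounded linear functionals on a space \<open>V\<close> of sequences of functions with norm \<open>N\<close>.
  Boundedness forces a functional to agree on sequences that are equal almost everywhere. Only the
  values on \<open>V\<close> matter.\<close>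

definition dual_space ::
  "(nat \<Rightarrow> real ^ 'n::finite \<Rightarrow> complex) set \<Rightarrow> ((nat \<Rightarrow> real ^ 'n \<Rightarrow> complex) \<Rightarrow> real) \<Rightarrow>
   ((nat \<Rightarrow> real ^ 'n \<Rightarrow> complex) \<Rightarrow> complex) set" where
  "dual_space V N =
     {G. (\<forall>f\<in>V. \<forall>h\<in>V. G (\<lambda>j x. f j x + h j x) = G f + G h) \<and>
         (\<forall>c. \<forall>f\<in>V. G (\<lambda>j x. c * f j x) = c * G f) \<and>
         (\<exists>C. \<forall>f\<in>V. norm (G f) \<le> C * N f)}"

definition dual_norm ::
  "(nat \<Rightarrow> real ^ 'n::finite \<Rightarrow> complex) set \<Rightarrow> ((nat \<Rightarrow> real ^ 'n \<Rightarrow> complex) \<Rightarrow> real) \<Rightarrow>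
   ((nat \<Rightarrow> real ^ 'n \<Rightarrow> complex) \<Rightarrow> complex) \<Rightarrow> real" where
  "dual_norm V N G = (SUP f\<in>{f \<in> V. N f \<le> 1}. norm (G f))"

definition pairing ::
  "(nat \<Rightarrow> real ^ 'n::finite \<Rightarrow> complex) \<Rightarrow> (nat \<Rightarrow> real ^ 'n \<Rightarrow> complex) \<Rightarrow> complex" where
  "pairing g f = (LINT x|lebesgue. (\<Sum>j. g j x * f j x))"

definition pairing_exists ::
  "(nat \<Rightarrow> real ^ 'n::finite \<Rightarrow> complex) \<Rightarrow> (nat \<Rightarrow> real ^ 'n \<Rightarrow> complex) \<Rightarrow> bool" where
  "pairing_exists g f \<longleftrightarrow>
     (AE x in lebesgue. summable (\<lambda>j. g j x * f j x)) \<and>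
     integrable lebesgue (\<lambda>x. \<Sum>j. g j x * f j x)"

definition represents_on ::
  "(nat \<Rightarrow> real ^ 'n::finite \<Rightarrow> complex) set \<Rightarrow> (nat \<Rightarrow> real ^ 'n \<Rightarrow> complex) \<Rightarrow>
   ((nat \<Rightarrow> real ^ 'n \<Rightarrow> complex) \<Rightarrow> complex) \<Rightarrow> bool" where
  "represents_on U g G \<longleftrightarrow> (\<forall>f\<in>U. pairing_exists g f \<and> G f = pairing g f)"

definition ae_equal ::
  "(nat \<Rightarrow> real ^ 'n::finite \<Rightarrow> complex) \<Rightarrow> (nat \<Rightarrow> real ^ 'n \<Rightarrow> complex) \<Rightarrow> bool" where
  "ae_equal g h \<longleftrightarrow> (\<forall>j. AE x in lebesgue. g j x = h j x)"

end

theory Submission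
  imports Defs "HOL-Library.Function_Algebras" "HOL-Computational_Algebra.Polynomial"
begin

text \<open>
  Since cubes are countable, the map sending \<open>f\<close> to the constant family \<open>(f)\<^sub>k\<close>, normed by the supremum over
  \<open>k\<close> of the weighted \<open>L\<^sub>p(\<ell>\<^sub>q, Q\<^sub>k)\<close> norms, is an isometric embedding of the Morrey space.
  A functional \<open>G\<close> on the closure of the test sequences is extended by Hahn--Banach to all such
  families. On families supported on a single cube the Riesz representation (Radon--Nikodym) yields
  functions \<open>a\<^sub>k\<close>, and testing with the extremal functions of Hoelder's inequality on finitely many
  cubes bounds the sum of their weighted dual norms by the norm of \<open>G\<close>. Because the weighted norms of a bounded,
  boundedly supported sequence tend to 0 along the cubes, nothing of \<open>G\<close> is lost at
  infinity, and \<open>G\<close> is the pairing with \<open>g = \<Sum>\<^sub>k a\<^sub>k\<close>. The predual space has the lattice property: a function dominated by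
  \<open>\<Sum>\<^sub>k b\<^sub>k\<close> is the sum of the pieces \<open>h b\<^sub>k / \<Sum>\<^sub>l b\<^sub>l\<close>, so the pointwise \<open>\<ell>\<^sub>q\<^sub>'\<close> norm of \<open>g\<close>
  belongs to it with norm at most that of \<open>G\<close>. The converse estimate is Hoelder's inequality on each cube.
\<close>

section \<open>The Hahn--Banach theorem\<close>

text \<open>Since r + \<rho> = -n, the exponent n/p' + \<rho> equals -(n/p + r): the Morrey weight
  of a cube is exactly the bound on its atoms, so Hoelder's inequality on one cube costs no constant
  and the norms agree exactly. The weighted norms become small on small cubes because r < 0 and on
  large ones because n/p + r > 0. The obstacle is that the dual of a supremum-normed space of
  families is larger than the absolutely summable families: it contains functionals that ignore
  every finite set of cells. The extension of \<open>G\<close> may have such a part, but it vanishes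
  on constant families whose cell norms tend to 0. The Hahn--Banach theorem is used over the reals,
  for Re G; replacing f by \<i> f recovers Im G. A second obstacle is that the predual is defined by
  convergence of distributions, whereas the estimates concern functions. An atomic series has to be
  shown to converge almost everywhere, to a function that test functions cannot tell from the given
  one.\<close>

instantiation "fun" :: (type, scaleR) scaleR
begin
definition "scaleR c f = (\<lambda>x. c *\<^sub>R f x)"
instance ..
end

lemma scaleR_fun_apply [simp]: "(c *\<^sub>R f) x = c *\<^sub>R f x"
  by (simp add: scaleR_fun_def)

text \<open>Iterating this instance turns sequences of functions, and families of such sequences,
  into real vector spaces, the setting of the extension theorem below.\<close>

instance "fun" :: (type, real_vector) real_vector
  by standard (simp_all add: fun_eq_iff algebra_simps)

text \<open>Relative to a set, because the families of finite norm are only a subspace of their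
  function type.\<close>

definition sublinear_on :: "'v::real_vector set \<Rightarrow> ('v \<Rightarrow> real) \<Rightarrow> bool" where
  "sublinear_on W P \<longleftrightarrow>
     (\<forall>x\<in>W. \<forall>y\<in>W. P (x + y) \<le> P x + P y) \<and> (\<forall>x\<in>W. \<forall>t>0. P (t *\<^sub>R x) = t * P x)"

lemma sublinear_on_zero:
  assumes "subspace W" "sublinear_on W P"
  shows "P 0 = 0"
proof -
  have "P (2 *\<^sub>R 0) = 2 * P 0"
    using assms subspace_0 unfolding sublinear_on_def by (metis zero_less_numeral)
  then show ?thesis by simp
qed

lemma sublinear_on_ge:
  assumes "subspace W" "sublinear_on W P" "x \<in> W"
  shows "- P (- x) \<le> P x"
proof -
  have "P (x + - x) \<le> P x + P (- x)"
    using assms subspace_neg unfolding sublinear_on_def by blast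
  then show ?thesis using sublinear_on_zero[OF assms(1,2)] by simp
qed

text \<open>Lowers a sublinear functional as far as possible while forcing the value at \<open>y\<close> to stay
  above \<open>s\<close> for all \<open>(y, s)\<close> in a convex cone.\<close>

lemma sublinear_on_cone_inf:
  fixes K :: "('v::real_vector \<times> real) set"
  assumes W: "subspace W" and P: "sublinear_on W P"
    and KW: "\<And>y s. (y, s) \<in> K \<Longrightarrow> y \<in> W \<and> s \<le> P y"
    and K0: "(0, 0) \<in> K"
    and Kadd: "\<And>y s z t. (y, s) \<in> K \<Longrightarrow> (z, t) \<in> K \<Longrightarrow> (y + z, s + t) \<in> K"
    and Kscale: "\<And>y s c. (y, s) \<in> K \<Longrightarrow> c > 0 \<Longrightarrow> (c *\<^sub>R y, c * s) \<in> K"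
  defines "R \<equiv> \<lambda>x. INF (y, s)\<in>K. P (x + y) - s"
  shows "sublinear_on W R"
    and "\<And>x y s. x \<in> W \<Longrightarrow> (y, s) \<in> K \<Longrightarrow> R x \<le> P (x + y) - s"
proof -
  \<comment> \<open>Subadditivity at \<open>y = (x + y) + (- x)\<close> together with
    \<open>s \<le> P y\<close>; this keeps the infimum finite.\<close>
  have lower: "- P (- x) \<le> P (x + y) - s" if "x \<in> W" "(y, s) \<in> K" for x y s
  proof -
    have "y \<in> W" "s \<le> P y" using KW that by auto
    have "P ((x + y) + - x) \<le> P (x + y) + P (- x)"
      using P W that \<open>y \<in> W\<close> subspace_add subspace_neg unfolding sublinear_on_def by blast
    then show ?thesis using \<open>s \<le> P y\<close> by simp
  qed
  have bdd: "bdd_below ((\<lambda>(y, s). P (x + y) - s) ` K)" if "x \<in> W" for x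
    using lower[OF that] by (intro bdd_belowI[of _ "- P (- x)"]) auto
  show le: "R x \<le> P (x + y) - s" if "x \<in> W" "(y, s) \<in> K" for x y s
    unfolding R_def using cINF_lower[OF bdd[OF that(1)] that(2)] by simp
  have ne: "K \<noteq> {}" using K0 by auto
  have ge: "c \<le> R x" if "\<And>y s. (y, s) \<in> K \<Longrightarrow> c \<le> P (x + y) - s" for c x
    unfolding R_def using that by (intro cINF_greatest[OF ne]) auto
  show "sublinear_on W R"
    unfolding sublinear_on_def
  proof (intro conjI ballI allI impI)
    fix x x' assume x: "x \<in> W" "x' \<in> W"
    have "R (x + x') - (P (x' + z) - t) \<le> R x" if zt: "(z, t) \<in> K" for z t
    proof (rule ge)
      fix y s assume ys: "(y, s) \<in> K"
      have "R (x + x') \<le> P ((x + x') + (y + z)) - (s + t)"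
        using le x W subspace_add Kadd[OF ys zt] by blast
      also have "(x + x') + (y + z) = (x + y) + (x' + z)" by (simp add: algebra_simps)
      also have "P \<dots> \<le> P (x + y) + P (x' + z)"
        using P x KW[OF ys] KW[OF zt] W subspace_add unfolding sublinear_on_def by blast
      finally show "R (x + x') - (P (x' + z) - t) \<le> P (x + y) - s" by linarith
    qed
    then have "R (x + x') - R x \<le> R x'"
      by (intro ge) (simp add: algebra_simps)
    then show "R (x + x') \<le> R x + R x'" by simp
  next
    fix x and t :: real assume x: "x \<in> W" and t: "t > 0"
    \<comment> \<open>Used for \<open>t\<close> and for \<open>1 / t\<close>, the one-sided estimate
      becomes an equality.\<close>
    have le': "R (c *\<^sub>R z) \<le> c * R z" if "z \<in> W" "c > 0" for z c
    proof -
      have "R (c *\<^sub>R z) / c \<le> R z"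
      proof (rule ge)
        fix y s assume ys: "(y, s) \<in> K"
        have "R (c *\<^sub>R z) \<le> P (c *\<^sub>R z + c *\<^sub>R y) - c * s"
          using le that W subspace_scale Kscale[OF ys] by blast
        also have "c *\<^sub>R z + c *\<^sub>R y = c *\<^sub>R (z + y)" by (simp add: algebra_simps)
        also have "P \<dots> = c * P (z + y)"
          using P that KW[OF ys] W subspace_add unfolding sublinear_on_def by blast
        finally show "R (c *\<^sub>R z) / c \<le> P (z + y) - s" using \<open>c > 0\<close> by (simp add: field_simps)
      qed
      then show ?thesis using \<open>c > 0\<close> by (simp add: field_simps)
    qed
    have "R x = R ((1 / t) *\<^sub>R (t *\<^sub>R x))" using t by simp
    also have "\<dots> \<le> (1 / t) * R (t *\<^sub>R x)"
      using le'[of "t *\<^sub>R x" "1 / t"] W x t subspace_scale by auto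
    finally have "t * R x \<le> R (t *\<^sub>R x)" using t by (simp add: field_simps)
    with le'[OF x t] show "R (t *\<^sub>R x) = t * R x" by simp
  qed
qed

text \<open>Zorn's lemma for the reversed pointwise order. The infimum of a chain is finite because
  every member lies above - P0 (- x), and it is subadditive because of any two members the smaller
  one serves both arguments.\<close>

lemma sublinear_on_minimal:
  fixes P0 :: "'v::real_vector \<Rightarrow> real"
  assumes W: "subspace W" and P0: "sublinear_on W P0"
  obtains P where "sublinear_on W P" "\<And>x. x \<in> W \<Longrightarrow> P x \<le> P0 x"
    "\<And>R. sublinear_on W R \<Longrightarrow> (\<And>x. x \<in> W \<Longrightarrow> R x \<le> P x) \<Longrightarrow> (\<And>x. x \<in> W \<Longrightarrow> R x = P x)"
proof -
  \<comment> \<open>Vanishing outside \<open>W\<close> makes functionals that agree on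
    \<open>W\<close> equal, as antisymmetry of the order demands.\<close>
  define A where "A = {P. sublinear_on W P \<and> (\<forall>x\<in>W. P x \<le> P0 x) \<and> (\<forall>x. x \<notin> W \<longrightarrow> P x = 0)}"
  define r where "r = {(P, R) | P R. P \<in> A \<and> R \<in> A \<and> (\<forall>x\<in>W. R x \<le> P x)}"
  have eqI: "P = R" if "P \<in> A" "R \<in> A" "\<And>x. x \<in> W \<Longrightarrow> P x = R x" for P R
  proof
    fix x
    show "P x = R x" using that by (cases "x \<in> W") (simp_all add: A_def)
  qed
  have po: "Partial_order r"
    unfolding partial_order_on_def preorder_on_def
  proof (intro conjI)
    have F: "Field r = A" unfolding r_def Field_def by auto
    show "refl_on (Field r) r" unfolding F refl_on_def by (auto simp: r_def)
    show "trans r" unfolding trans_def r_def by (auto intro: order_trans)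
    show "antisym r"
    proof (rule antisymI)
      fix P R assume "(P, R) \<in> r" "(R, P) \<in> r"
      then show "P = R" by (intro eqI) (auto simp: r_def intro: antisym)
    qed
    show "r \<subseteq> Field r \<times> Field r" by (auto simp: Field_def)
  qed
  have F: "Field r = A" unfolding r_def Field_def by auto
  have "\<exists>m\<in>Field r. \<forall>a\<in>Field r. (m, a) \<in> r \<longrightarrow> a = m"
  proof (rule Zorns_po_lemma[OF po])
    fix C assume C: "C \<in> Chains r"
    have CA: "C \<subseteq> A" using C unfolding Chains_def r_def by blast
    have cmp: "(\<forall>x\<in>W. P x \<le> R x) \<or> (\<forall>x\<in>W. R x \<le> P x)" if "P \<in> C" "R \<in> C" for P R
      using C that unfolding Chains_def r_def by blast
    show "\<exists>u\<in>Field r. \<forall>a\<in>C. (a, u) \<in> r"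
    proof (cases "C = {}")
      case True
      have "(\<lambda>x. if x \<in> W then P0 x else 0) \<in> A"
        using P0 W unfolding A_def sublinear_on_def by (auto simp: subspace_add subspace_scale)
      then show ?thesis using True F by auto
    next
      case False
      define I where "I = (\<lambda>x. if x \<in> W then INF P\<in>C. P x else 0)"
      have lower: "- P0 (- x) \<le> P x" if "P \<in> C" "x \<in> W" for P x
      proof -
        have "sublinear_on W P" "P (- x) \<le> P0 (- x)"
          using that CA subspace_neg[OF W that(2)] unfolding A_def by auto
        with sublinear_on_ge[OF W this(1) that(2)] show ?thesis by simp
      qed
      have bdd: "bdd_below ((\<lambda>P. P x) ` C)" if "x \<in> W" for x
        using lower that by (intro bdd_belowI[of _ "- P0 (- x)"]) auto
      have Ile: "I x \<le> P x" if "P \<in> C" "x \<in> W" for P x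
        using cINF_lower[OF bdd[OF that(2)] that(1)] that unfolding I_def by simp
      have Ige: "c \<le> I x" if "x \<in> W" "\<And>P. P \<in> C \<Longrightarrow> c \<le> P x" for c x
        unfolding I_def using that by (auto intro!: cINF_greatest[OF False])
      have sub: "sublinear_on W P" if "P \<in> C" for P using CA that unfolding A_def by auto
      have "sublinear_on W I"
        unfolding sublinear_on_def
      proof (intro conjI ballI allI impI)
        fix x y assume xy: "x \<in> W" "y \<in> W"
        have *: "I (x + y) \<le> P x + R y" if PR: "P \<in> C" "R \<in> C" for P R
        proof -
          obtain S where S: "S \<in> C" "S x \<le> P x" "S y \<le> R y" using cmp[OF PR] PR xy by blast
          have "I (x + y) \<le> S (x + y)" using Ile S(1) xy W subspace_add by blast
          also have "\<dots> \<le> S x + S y" using sub[OF S(1)] xy unfolding sublinear_on_def by blast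
          finally show ?thesis using S by simp
        qed
        have "I (x + y) - R y \<le> I x" if "R \<in> C" for R
          using * that by (intro Ige xy) (simp add: algebra_simps)
        then have "I (x + y) - I x \<le> I y" by (intro Ige xy) (simp add: algebra_simps)
        then show "I (x + y) \<le> I x + I y" by simp
      next
        fix x and t :: real assume x: "x \<in> W" and t: "t > 0"
        have tx: "t *\<^sub>R x \<in> W" using W x subspace_scale by blast
        have hom: "P (t *\<^sub>R x) = t * P x" if "P \<in> C" for P
          using sub[OF that] x t unfolding sublinear_on_def by blast
        have "I (t *\<^sub>R x) / t \<le> I x"
        proof (rule Ige[OF x])
          fix P assume "P \<in> C"
          then show "I (t *\<^sub>R x) / t \<le> P x" using Ile[OF _ tx, of P] hom[of P] t by (simp add: field_simps)
        qed
        moreover have "t * I x \<le> I (t *\<^sub>R x)"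
        proof (rule Ige[OF tx])
          fix P assume "P \<in> C"
          then show "t * I x \<le> P (t *\<^sub>R x)" using Ile[OF _ x, of P] hom[of P] t by simp
        qed
        ultimately show "I (t *\<^sub>R x) = t * I x" using t by (simp add: field_simps)
      qed
      moreover have "I x \<le> P0 x" if "x \<in> W" for x
      proof -
        obtain P where "P \<in> C" using False by blast
        then have "I x \<le> P x" "P x \<le> P0 x" using Ile that CA unfolding A_def by auto
        then show ?thesis by simp
      qed
      ultimately have "I \<in> A" unfolding A_def I_def by auto
      then show ?thesis using F CA Ile unfolding r_def by (intro bexI[of _ I]) auto
    qed
  qed
  then obtain m where m: "m \<in> A" "\<And>a. a \<in> A \<Longrightarrow> (m, a) \<in> r \<Longrightarrow> a = m" using F by auto
  show thesis
  proof
    show "sublinear_on W m" and "\<And>x. x \<in> W \<Longrightarrow> m x \<le> P0 x" using m(1) unfolding A_def by auto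
    fix R x assume R: "sublinear_on W R" "\<And>x. x \<in> W \<Longrightarrow> R x \<le> m x" and x: "x \<in> W"
    let ?R = "\<lambda>x. if x \<in> W then R x else 0"
    have "?R \<in> A" using R m(1) W unfolding A_def sublinear_on_def
      by (auto simp: subspace_add subspace_scale) (use order_trans in blast)
    moreover from this have "(m, ?R) \<in> r" using R m(1) unfolding r_def by auto
    ultimately have "?R = m" using m(2) by blast
    from fun_cong[OF this, of x] show "R x = m x" using x by simp
  qed
qed

text \<open>A minimal sublinear functional is linear: lowering it along the ray of \<open>y\<close>,
  with its own values on that ray as floor, cannot change it, and this says that it is superadditive
  at \<open>y\<close>.\<close>

theorem hahn_banach_sublinear:
  fixes P0 :: "'v::real_vector \<Rightarrow> real"
  assumes W: "subspace W" and P0: "sublinear_on W P0"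
  obtains L where "\<And>x. x \<in> W \<Longrightarrow> L x \<le> P0 x"
    "\<And>x y. x \<in> W \<Longrightarrow> y \<in> W \<Longrightarrow> L (x + y) = L x + L y"
    "\<And>t x. x \<in> W \<Longrightarrow> L (t *\<^sub>R x) = t * L x"
proof -
  obtain P where P: "sublinear_on W P" "\<And>x. x \<in> W \<Longrightarrow> P x \<le> P0 x"
    and min: "\<And>R x. sublinear_on W R \<Longrightarrow> (\<And>x. x \<in> W \<Longrightarrow> R x \<le> P x) \<Longrightarrow> x \<in> W \<Longrightarrow> R x = P x"
    by (rule sublinear_on_minimal[OF W P0]) blast
  have hom: "P (t *\<^sub>R x) = t * P x" if "x \<in> W" "t > 0" for t x
    using P(1) that unfolding sublinear_on_def by blast
  have add: "P (x + y) = P x + P y" if x: "x \<in> W" and y: "y \<in> W" for x y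
  proof -
    let ?K = "{(t *\<^sub>R y, t * P y) | t. t \<ge> 0}"
    have K1: "z \<in> W \<and> s \<le> P z" if "(z, s) \<in> ?K" for z s
    proof -
      from that obtain t where t: "t \<ge> 0" "z = t *\<^sub>R y" "s = t * P y" by auto
      then show ?thesis
        using hom[OF y, of t] W y subspace_scale sublinear_on_zero[OF W P(1)]
        by (cases "t = 0") (auto simp: subspace_0)
    qed
    have K2: "(0, 0) \<in> ?K" by force
    have K3: "(a + b, s + t) \<in> ?K" if "(a, s) \<in> ?K" "(b, t) \<in> ?K" for a s b t
    proof -
      from that obtain u v where "u \<ge> 0" "a = u *\<^sub>R y" "s = u * P y" "v \<ge> 0" "b = v *\<^sub>R y" "t = v * P y" by auto
      then show ?thesis by (intro CollectI exI[of _ "u + v"]) (auto simp: algebra_simps)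
    qed
    have K4: "(c *\<^sub>R a, c * s) \<in> ?K" if "(a, s) \<in> ?K" "c > 0" for a s and c :: real
    proof -
      from that obtain t where "t \<ge> 0" "a = t *\<^sub>R y" "s = t * P y" by auto
      then show ?thesis using that(2) by (intro CollectI exI[of _ "c * t"]) auto
    qed
    let ?R = "\<lambda>x. INF (y, s)\<in>?K. P (x + y) - s"
    have R1: "sublinear_on W ?R"
      by (rule sublinear_on_cone_inf(1)[OF W P(1)]) (fact K1 K2 K3 K4)+
    have R2: "?R z \<le> P (z + v) - s" if "z \<in> W" "(v, s) \<in> ?K" for z v s
      by (rule sublinear_on_cone_inf(2)[OF W P(1)]) (fact K1 K2 K3 K4 that)+
    have "?R z \<le> P z" if "z \<in> W" for z using R2[OF that K2] by simp
    then have "?R x = P x" using min[OF R1 _ x] by blast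
    moreover have "(1 *\<^sub>R y, 1 * P y) \<in> ?K" by (intro CollectI exI[of _ 1]) auto
    then have "?R x \<le> P (x + 1 *\<^sub>R y) - 1 * P y" by (rule R2[OF x])
    ultimately have "P x + P y \<le> P (x + y)" by simp
    moreover have "P (x + y) \<le> P x + P y" using P(1) x y unfolding sublinear_on_def by blast
    ultimately show ?thesis by simp
  qed
  have neg: "P (- x) = - P x" if "x \<in> W" for x
    using add[OF that subspace_neg[OF W that]] sublinear_on_zero[OF W P(1)] by simp
  show thesis
  proof
    show "P (t *\<^sub>R x) = t * P x" if "x \<in> W" for t x
    proof (cases t "0 :: real" rule: linorder_cases)
      case less
      then show ?thesis using hom[OF that, of "- t"] neg[of "(- t) *\<^sub>R x"] W that subspace_scale
        by (metis minus_minus mult_minus_left neg_0_less_iff_less scaleR_minus_left)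
    qed (use hom that sublinear_on_zero[OF W P(1)] in auto)
  qed (use P add in auto)
qed

section \<open>Inequalities and densities\<close>

lemma conjugate_exponent:
  fixes p p' :: real
  assumes "1 < p" "1 / p + 1 / p' = 1"
  shows "1 < p'" "p' = p / (p - 1)" "(p' - 1) * p = p'" "p' / p = p' - 1"
proof -
  have "p' \<noteq> 0" using assms by auto
  then have *: "p' * (p - 1) = p" using assms by (simp add: field_simps)
  then show "p' = p / (p - 1)" using assms by (simp add: field_simps)
  then have "p' - 1 = 1 / (p - 1)" using assms by (simp add: field_simps)
  then show "1 < p'" using assms by (smt (verit) divide_pos_pos)
  show "(p' - 1) * p = p'" using * by (simp add: algebra_simps)
  then show "p' / p = p' - 1" using assms by (simp add: field_simps)
qed

text \<open>Convexity of the power at the points a / s and b / (1 - s). The parameter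
  \<open>s\<close> stays free so that it can later be the share of the first norm in Minkowski's
  inequality.\<close>

lemma powr_add_le_convex:
  fixes a b s p :: real
  assumes "1 \<le> p" "0 < s" "s < 1" "0 \<le> a" "0 \<le> b"
  shows "(a + b) powr p \<le> s powr (1 - p) * a powr p + (1 - s) powr (1 - p) * b powr p"
proof -
  have scale: "t * (x / t) powr p = t powr (1 - p) * x powr p" if "0 < t" "0 < x" for t x :: real
    using that by (simp add: powr_divide powr_diff)
  have le1: "1 \<le> t powr (1 - p)" if "0 < t" "t < 1" for t :: real
    using powr_mono2'[of "1 - p" t 1] that assms by simp
  show ?thesis
  proof (cases "a = 0 \<or> b = 0")
    case True
    then show ?thesis
      using le1[of s] le1[of "1 - s"] assms
        mult_right_mono[of 1 "s powr (1 - p)" "a powr p"]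
        mult_right_mono[of 1 "(1 - s) powr (1 - p)" "b powr p"] by auto
  next
    case False
    then have pos: "a > 0" "b > 0" using assms by auto
    have "\<forall>x\<in>{0<..}. \<forall>y\<in>{0<..}. \<forall>u\<ge>0. \<forall>v\<ge>0. u + v = 1 \<longrightarrow>
        (u * x + v * y) powr p \<le> u * x powr p + v * y powr p"
      using powr_convex[OF assms(1)] unfolding convex_on_def by auto
    from this[rule_format, of "a / s" "b / (1 - s)" s "1 - s"]
    have "(a + b) powr p \<le> s * (a / s) powr p + (1 - s) * (b / (1 - s)) powr p"
      using pos assms by simp
    then show ?thesis
      using scale[of s a] scale[of "1 - s" b] pos assms by simp
  qed
qed

lemma Minkowski_integral:
  fixes F G :: "'a \<Rightarrow> real"
  assumes p: "1 \<le> p" and [measurable]: "F \<in> borel_measurable M" "G \<in> borel_measurable M"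
    and nn: "\<And>x. 0 \<le> F x" "\<And>x. 0 \<le> G x"
    and iF: "integrable M (\<lambda>x. F x powr p)" and iG: "integrable M (\<lambda>x. G x powr p)"
  shows "integrable M (\<lambda>x. (F x + G x) powr p)"
    and "(LINT x|M. (F x + G x) powr p) powr (1 / p)
      \<le> (LINT x|M. F x powr p) powr (1 / p) + (LINT x|M. G x powr p) powr (1 / p)"
proof -
  have bound: "(F x + G x) powr p
      \<le> s powr (1 - p) * F x powr p + (1 - s) powr (1 - p) * G x powr p"
    if "0 < s" "s < 1" for s x
    using powr_add_le_convex[OF p that] nn by simp
  show int: "integrable M (\<lambda>x. (F x + G x) powr p)"
  proof (rule Bochner_Integration.integrable_bound)
    show "integrable M (\<lambda>x. (1/2) powr (1 - p) * F x powr p + (1 - 1/2) powr (1 - p) * G x powr p)"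
      using iF iG by (intro Bochner_Integration.integrable_add integrable_mult_right)
    show "AE x in M. norm ((F x + G x) powr p)
        \<le> norm ((1/2) powr (1 - p) * F x powr p + (1 - 1/2) powr (1 - p) * G x powr p)"
      using bound[of "1/2"] by (auto intro!: AE_I2 order_trans[OF _ abs_ge_self])
  qed measurable
  \<comment> \<open>Positive upper bounds \<open>A\<close> and \<open>B\<close> in place of the
    norms allow the choice s = A / (A + B); enlarging the norms by \<open>e / 2\<close> supplies
    such bounds even where a norm is 0.\<close>
  have main: "(LINT x|M. (F x + G x) powr p) powr (1 / p) \<le> A + B"
    if AB: "A > 0" "B > 0" and A: "(LINT x|M. F x powr p) \<le> A powr p"
      and B: "(LINT x|M. G x powr p) \<le> B powr p" for A B
  proof -
    let ?s = "A / (A + B)"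
    have s: "0 < ?s" "?s < 1" "1 - ?s = B / (A + B)" using AB by (auto simp: field_simps)
    have e: "(C / (A + B)) powr (1 - p) * C powr p = C * (A + B) powr (p - 1)" if "C > 0" for C
    proof -
      have "C powr (1 - p) * C powr p = C" using that by (simp flip: powr_add)
      moreover have "(A + B) powr (p - 1) = 1 / (A + B) powr (1 - p)"
        by (simp flip: powr_minus_divide)
      ultimately show ?thesis using that AB by (simp add: powr_divide)
    qed
    have "(LINT x|M. (F x + G x) powr p)
        \<le> (LINT x|M. ?s powr (1 - p) * F x powr p + (1 - ?s) powr (1 - p) * G x powr p)"
      using bound[OF s(1,2)] iF iG int
      by (intro integral_mono Bochner_Integration.integrable_add integrable_mult_right) auto
    also have "\<dots> = ?s powr (1 - p) * (LINT x|M. F x powr p)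
        + (1 - ?s) powr (1 - p) * (LINT x|M. G x powr p)"
      using iF iG by simp
    also have "\<dots> \<le> ?s powr (1 - p) * A powr p + (1 - ?s) powr (1 - p) * B powr p"
      using A B by (intro add_mono mult_left_mono) auto
    also have "\<dots> = A * (A + B) powr (p - 1) + B * (A + B) powr (p - 1)"
      unfolding s(3) using e AB by simp
    also have "\<dots> = (A + B) powr p"
      using AB powr_add[of "A + B" 1 "p - 1"] by (simp flip: distrib_right)
    finally have "(LINT x|M. (F x + G x) powr p) \<le> (A + B) powr p" .
    from powr_mono2[OF _ _ this, of "1 / p"] show ?thesis
      using p AB by (simp add: powr_powr integral_nonneg_AE)
  qed
  let ?A = "(LINT x|M. F x powr p) powr (1 / p)" and ?B = "(LINT x|M. G x powr p) powr (1 / p)"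
  have Ap: "(LINT x|M. F x powr p) \<le> ?A powr p" "(LINT x|M. G x powr p) \<le> ?B powr p"
    using p by (simp_all add: powr_powr integral_nonneg_AE)
  show "(LINT x|M. (F x + G x) powr p) powr (1 / p) \<le> ?A + ?B"
  proof (rule field_le_epsilon)
    fix e :: real assume e: "e > 0"
    have "(LINT x|M. (F x + G x) powr p) powr (1 / p) \<le> (?A + e / 2) + (?B + e / 2)"
    proof (rule main)
      show "?A + e / 2 > 0" "?B + e / 2 > 0" using e by (simp_all add: add_nonneg_pos)
      show "(LINT x|M. F x powr p) \<le> (?A + e / 2) powr p"
        using e p by (intro order_trans[OF Ap(1)] powr_mono2) auto
      show "(LINT x|M. G x powr p) \<le> (?B + e / 2) powr p"
        using e p by (intro order_trans[OF Ap(2)] powr_mono2) auto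
    qed
    then show "(LINT x|M. (F x + G x) powr p) powr (1 / p) \<le> ?A + ?B + e" by simp
  qed
qed

text \<open>Young's inequality for F / t and t * G, integrated. The scale \<open>t\<close> balances
  the two terms, and a slack \<open>e\<close> tending to 0 covers vanishing norms.\<close>

lemma Hoelder_integral:
  fixes F G :: "'a \<Rightarrow> real"
  assumes p: "1 < p" "1 / p + 1 / p' = 1"
    and [measurable]: "F \<in> borel_measurable M" "G \<in> borel_measurable M"
    and nn: "\<And>x. 0 \<le> F x" "\<And>x. 0 \<le> G x"
    and iF: "integrable M (\<lambda>x. F x powr p)" and iG: "integrable M (\<lambda>x. G x powr p')"
  shows "integrable M (\<lambda>x. F x * G x)"
    and "(LINT x|M. F x * G x)
      \<le> (LINT x|M. F x powr p) powr (1 / p) * (LINT x|M. G x powr p') powr (1 / p')"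
proof -
  note p' = conjugate_exponent(1)[OF p]
  have young: "F x * G x \<le> t powr (- p) * F x powr p / p + t powr p' * G x powr p' / p'"
    if "t > 0" for t x
    using Youngs_inequality[OF p(1) p' p(2), of "F x / t" "t * G x"] nn that
    by (simp add: powr_divide powr_mult powr_minus field_simps)
  show int: "integrable M (\<lambda>x. F x * G x)"
  proof (rule Bochner_Integration.integrable_bound)
    show "integrable M (\<lambda>x. 1 powr (- p) * F x powr p / p + 1 powr p' * G x powr p' / p')"
      using iF iG by simp
    show "AE x in M. norm (F x * G x)
        \<le> norm (1 powr (- p) * F x powr p / p + 1 powr p' * G x powr p' / p')"
      using young[of 1] nn by (auto intro!: AE_I2 order_trans[OF _ abs_ge_self])
  qed measurable
  have main: "(LINT x|M. F x * G x) \<le> A * B"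
    if AB: "A > 0" "B > 0" and A: "(LINT x|M. F x powr p) \<le> A powr p"
      and B: "(LINT x|M. G x powr p') \<le> B powr p'" for A B
  proof -
    \<comment> \<open>Chosen so that t powr (- p) * A powr p and t powr p' * B powr p' are both A *
      B, which \<open>e1\<close> and \<open>e2\<close> verify.\<close>
    define t where "t = A powr (1 / p') * B powr (- 1 / p)"
    have t: "t > 0" using AB by (simp add: t_def)
    have lt: "ln t = ln A / p' - ln B / p" using AB by (simp add: t_def ln_mult ln_powr)
    have pp: "p \<noteq> 0" "p' \<noteq> 0" "1 / p' = 1 - 1 / p" using p p' by auto
    have rel: "p / p' = p - 1" "p' / p = p' - 1"
      using p p' by (simp_all add: field_simps)
    have "p * ln t = ln A * (p / p') - ln B * (p / p)" by (simp add: lt algebra_simps)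
    then have "- p * ln t + p * ln A = ln A + ln B"
      unfolding rel using pp(1) by (simp add: algebra_simps)
    then have e1: "t powr (- p) * A powr p = A * B"
      using AB t by (simp add: powr_def mult_exp_exp) (simp add: exp_add)
    have "p' * ln t = ln A * (p' / p') - ln B * (p' / p)" by (simp add: lt algebra_simps)
    then have "p' * ln t + p' * ln B = ln A + ln B"
      unfolding rel using pp(2) by (simp add: algebra_simps)
    then have e2: "t powr p' * B powr p' = A * B"
      using AB t by (simp add: powr_def mult_exp_exp) (simp add: exp_add)
    have "(LINT x|M. F x * G x)
        \<le> (LINT x|M. t powr (- p) * F x powr p / p + t powr p' * G x powr p' / p')"
      using young[OF t] iF iG int by (intro integral_mono) auto
    also have "\<dots> = t powr (- p) * (LINT x|M. F x powr p) / p
        + t powr p' * (LINT x|M. G x powr p') / p'"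
      using iF iG by simp
    also have "\<dots> \<le> t powr (- p) * A powr p / p + t powr p' * B powr p' / p'"
      using A B p p' by (intro add_mono divide_right_mono mult_left_mono) auto
    also have "\<dots> = A * B * (1 / p + 1 / p')" unfolding e1 e2 by (simp add: algebra_simps)
    finally show ?thesis using p by simp
  qed
  let ?A = "(LINT x|M. F x powr p) powr (1 / p)" and ?B = "(LINT x|M. G x powr p') powr (1 / p')"
  have Ap: "(LINT x|M. F x powr p) \<le> ?A powr p" "(LINT x|M. G x powr p') \<le> ?B powr p'"
    using p p' by (simp_all add: powr_powr integral_nonneg_AE)
  have "(LINT x|M. F x * G x) \<le> (?A + e) * (?B + e)" if e: "e > 0" for e
  proof (rule main)
    show "?A + e > 0" "?B + e > 0" using e by (simp_all add: add_nonneg_pos)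
    show "(LINT x|M. F x powr p) \<le> (?A + e) powr p"
      using e p by (intro order_trans[OF Ap(1)] powr_mono2) auto
    show "(LINT x|M. G x powr p') \<le> (?B + e) powr p'"
      using e p' by (intro order_trans[OF Ap(2)] powr_mono2) auto
  qed
  then have ev: "\<forall>\<^sub>F e in at_right 0. (LINT x|M. F x * G x) \<le> (?A + e) * (?B + e)"
    using eventually_at_right_less[of "0 :: real"] by (auto elim: eventually_mono)
  have "((\<lambda>e. (?A + e) * (?B + e)) \<longlongrightarrow> (?A + 0) * (?B + 0)) (at_right 0)"
    by (intro tendsto_intros)
  from tendsto_lowerbound[OF this ev] show "(LINT x|M. F x * G x) \<le> ?A * ?B" by simp
qed

lemma Minkowski_series:
  fixes a b :: "nat \<Rightarrow> real"
  assumes p: "1 \<le> p" and nn: "\<And>j. 0 \<le> a j" "\<And>j. 0 \<le> b j"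
    and "summable (\<lambda>j. a j powr p)" "summable (\<lambda>j. b j powr p)"
  shows "summable (\<lambda>j. (a j + b j) powr p)"
    and "(\<Sum>j. (a j + b j) powr p) powr (1 / p)
      \<le> (\<Sum>j. a j powr p) powr (1 / p) + (\<Sum>j. b j powr p) powr (1 / p)"
proof -
  let ?C = "count_space (UNIV :: nat set)"
  have ab: "integrable ?C (\<lambda>j. a j powr p)" "integrable ?C (\<lambda>j. b j powr p)"
    using assms by (simp_all add: integrable_count_space_nat_iff)
  note M = Minkowski_integral[of p a ?C b, OF p _ _ nn ab]
  have ci: "integrable ?C (\<lambda>j. (a j + b j) powr p)" by (rule M(1)) auto
  then show "summable (\<lambda>j. (a j + b j) powr p)" by (simp add: integrable_count_space_nat_iff)
  show "(\<Sum>j. (a j + b j) powr p) powr (1 / p)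
      \<le> (\<Sum>j. a j powr p) powr (1 / p) + (\<Sum>j. b j powr p) powr (1 / p)"
    using M(2) by (simp add: integral_count_space_nat ab ci)
qed

lemma Hoelder_series:
  fixes a b :: "nat \<Rightarrow> real"
  assumes p: "1 < p" "1 / p + 1 / p' = 1" and nn: "\<And>j. 0 \<le> a j" "\<And>j. 0 \<le> b j"
    and "summable (\<lambda>j. a j powr p)" "summable (\<lambda>j. b j powr p')"
  shows "summable (\<lambda>j. a j * b j)"
    and "(\<Sum>j. a j * b j) \<le> (\<Sum>j. a j powr p) powr (1 / p) * (\<Sum>j. b j powr p') powr (1 / p')"
proof -
  let ?C = "count_space (UNIV :: nat set)"
  have ab: "integrable ?C (\<lambda>j. a j powr p)" "integrable ?C (\<lambda>j. b j powr p')"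
    using assms by (simp_all add: integrable_count_space_nat_iff)
  note M = Hoelder_integral[of p p' a ?C b, OF p _ _ nn ab]
  have ci: "integrable ?C (\<lambda>j. a j * b j)" by (rule M(1)) auto
  then show "summable (\<lambda>j. a j * b j)"
    using nn by (simp add: integrable_count_space_nat_iff)
  show "(\<Sum>j. a j * b j) \<le> (\<Sum>j. a j powr p) powr (1 / p) * (\<Sum>j. b j powr p') powr (1 / p')"
    using M(2) by (simp add: integral_count_space_nat ab ci)
qed

text \<open>The positive part of the set function is the supremum over measurable subsets, to which
  the Radon--Nikodym theorem for measures applies.\<close>

lemma additive_set_function_density:
  fixes \<nu> :: "'a set \<Rightarrow> real"
  assumes M: "finite_measure M" and s: "0 < s"
    and add: "\<And>A B. A \<in> sets M \<Longrightarrow> B \<in> sets M \<Longrightarrow> A \<inter> B = {} \<Longrightarrow> \<nu> (A \<union> B) = \<nu> A + \<nu> B"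
    and bound: "\<And>A. A \<in> sets M \<Longrightarrow> \<bar>\<nu> A\<bar> \<le> c * measure M A powr s"
  obtains g :: "'a \<Rightarrow> real" where "integrable M g" "\<And>A. A \<in> sets M \<Longrightarrow> \<nu> A = (LINT x:A|M. g x)"
proof -
  interpret finite_measure M by fact
  \<comment> \<open>For a nonnegative set function the power bound does double duty: along sets
    decreasing to the empty set the values tend to 0, which gives countable additivity, and on null
    sets the value is 0, which gives absolute continuity.\<close>
  have density: "\<exists>g::'a \<Rightarrow> real. integrable M g \<and> (\<forall>A\<in>sets M. \<mu> A = (LINT x:A|M. g x))"
    if nn: "\<And>A. A \<in> sets M \<Longrightarrow> 0 \<le> \<mu> A"
      and madd: "\<And>A B. A \<in> sets M \<Longrightarrow> B \<in> sets M \<Longrightarrow> A \<inter> B = {} \<Longrightarrow> \<mu> (A \<union> B) = \<mu> A + \<mu> B"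
      and mb: "\<And>A. A \<in> sets M \<Longrightarrow> \<mu> A \<le> d * measure M A powr s" for \<mu> d
  proof -
    have \<mu>0: "\<mu> {} = 0" using madd[of "{}" "{}"] by simp
    define N where "N = measure_of (space M) (sets M) (\<lambda>A. ennreal (\<mu> A))"
    have ca: "countably_additive (sets M) (\<lambda>A. ennreal (\<mu> A))"
    proof (rule sets.empty_continuous_imp_countably_additive)
      show "positive (sets M) (\<lambda>A. ennreal (\<mu> A))" using \<mu>0 by (simp add: positive_def)
      show "additive (sets M) (\<lambda>A. ennreal (\<mu> A))"
        using madd nn by (simp add: additive_def ennreal_plus)
      show "\<forall>A\<in>sets M. ennreal (\<mu> A) \<noteq> \<infinity>" by simp
      fix A :: "nat \<Rightarrow> 'a set" assume A: "range A \<subseteq> sets M" "decseq A" "(\<Inter>i. A i) = {}"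
      have "(\<lambda>i. measure M (A i)) \<longlonglongrightarrow> 0"
        using finite_Lim_measure_decseq[OF A(1,2)] A(3) by simp
      then have "(\<lambda>i. d * measure M (A i) powr s) \<longlonglongrightarrow> d * 0 powr s"
        using s by (intro tendsto_intros) auto
      then have lim: "(\<lambda>i. d * measure M (A i) powr s) \<longlonglongrightarrow> 0" by simp
      have "(\<lambda>i. \<mu> (A i)) \<longlonglongrightarrow> 0"
      proof (rule tendsto_sandwich[OF _ _ tendsto_const lim])
        show "\<forall>\<^sub>F i in sequentially. 0 \<le> \<mu> (A i)" using A(1) by (intro always_eventually allI nn) auto
        show "\<forall>\<^sub>F i in sequentially. \<mu> (A i) \<le> d * measure M (A i) powr s"
          using A(1) by (intro always_eventually allI mb) auto
      qed
      from tendsto_ennrealI[OF this] show "(\<lambda>i. ennreal (\<mu> (A i))) \<longlonglongrightarrow> 0" by simp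
    qed
    have sN: "sets N = sets M" and spN: "space N = space M"
      by (simp_all add: N_def)
    have eN: "emeasure N A = ennreal (\<mu> A)" if "A \<in> sets M" for A
      unfolding N_def using that ca \<mu>0
      by (intro emeasure_measure_of_sigma) (auto simp: positive_def sets.sigma_algebra_axioms)
    have "absolutely_continuous M N"
    proof -
      have "A \<in> null_sets N" if "A \<in> null_sets M" for A
      proof -
        have "measure M A = 0" "A \<in> sets M" using that by (auto simp: measure_def)
        then have "\<mu> A \<le> 0" using mb[of A] s by simp
        then show ?thesis using eN[OF \<open>A \<in> sets M\<close>] sN \<open>A \<in> sets M\<close> by (auto simp: ennreal_eq_0_iff)
      qed
      then show ?thesis by (auto simp: absolutely_continuous_def)
    qed
    from Radon_Nikodym[OF this sN] obtain f where f: "f \<in> borel_measurable M" "density M f = N" by auto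
    note [measurable] = f(1)
    have ef: "(\<integral>\<^sup>+x. f x * indicator A x \<partial>M) = ennreal (\<mu> A)" if "A \<in> sets M" for A
      using emeasure_density[OF f(1) that] eN[OF that] f(2) by simp
    have fin: "(\<integral>\<^sup>+x. f x \<partial>M) = ennreal (\<mu> (space M))"
      using ef[of "space M"] by (simp cong: nn_integral_cong)
    have ae: "AE x in M. f x \<noteq> \<infinity>"
      using fin by (intro nn_integral_PInf_AE) auto
    have er: "AE x in M. ennreal (enn2real (f x)) = f x"
      using ae by eventually_elim (simp add: top.not_eq_extremum)
    have int: "integrable M (\<lambda>x. enn2real (f x))"
    proof (rule integrableI_nonneg)
      have "(\<integral>\<^sup>+x. ennreal (enn2real (f x)) \<partial>M) = (\<integral>\<^sup>+x. f x \<partial>M)"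
        using er by (rule nn_integral_cong_AE)
      then show "(\<integral>\<^sup>+x. ennreal (enn2real (f x)) \<partial>M) < \<infinity>" using fin by simp
    qed auto
    have "\<mu> A = (LINT x:A|M. enn2real (f x))" if A[measurable]: "A \<in> sets M" for A
    proof -
      have "(LINT x:A|M. enn2real (f x)) = enn2real (\<integral>\<^sup>+x. ennreal (indicator A x * enn2real (f x)) \<partial>M)"
        unfolding set_lebesgue_integral_def by (subst integral_eq_nn_integral) auto
      also have "(\<integral>\<^sup>+x. ennreal (indicator A x * enn2real (f x)) \<partial>M) = (\<integral>\<^sup>+x. f x * indicator A x \<partial>M)"
        using er by (intro nn_integral_cong_AE) (auto simp: indicator_def elim!: eventually_mono)
      finally show ?thesis using ef[OF A] nn[OF A] by simp
    qed
    with int show ?thesis by blast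
  qed
  \<comment> \<open>The sign of \<open>c\<close> is not given, so monotonicity in the measure is
    obtained with \<open>max c 0\<close>.\<close>
  have c: "\<bar>\<nu> A\<bar> \<le> max c 0 * measure M (space M) powr s" if "A \<in> sets M" for A
  proof -
    have "\<bar>\<nu> A\<bar> \<le> c * measure M A powr s" using bound[OF that] .
    also have "\<dots> \<le> max c 0 * measure M A powr s" by (intro mult_right_mono) auto
    also have "\<dots> \<le> max c 0 * measure M (space M) powr s"
      using bounded_measure s by (intro mult_left_mono powr_mono2) auto
    finally show ?thesis .
  qed
  have cmono: "\<nu> B \<le> max c 0 * measure M A powr s" if "A \<in> sets M" "B \<in> sets M" "B \<subseteq> A" for A B
  proof -
    have "\<nu> B \<le> c * measure M B powr s" using bound[OF that(2)] by simp
    also have "\<dots> \<le> max c 0 * measure M B powr s" by (intro mult_right_mono) auto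
    also have "\<dots> \<le> max c 0 * measure M A powr s"
      using finite_measure_mono[OF that(3,1)] s by (intro mult_left_mono powr_mono2) auto
    finally show ?thesis .
  qed
  have \<nu>0: "\<nu> {} = 0" using add[of "{}" "{}"] by simp
  define \<pi> where "\<pi> A = (SUP B\<in>{B \<in> sets M. B \<subseteq> A}. \<nu> B)" for A
  have bdd: "bdd_above (\<nu> ` {B \<in> sets M. B \<subseteq> A})" for A
    using c by (intro bdd_aboveI[of _ "max c 0 * measure M (space M) powr s"]) (auto dest: c simp: abs_le_iff)
  have ge: "\<nu> B \<le> \<pi> A" if "B \<in> sets M" "B \<subseteq> A" for A B
    unfolding \<pi>_def using that by (intro cSUP_upper bdd) auto
  have le: "\<pi> A \<le> d" if "\<And>B. B \<in> sets M \<Longrightarrow> B \<subseteq> A \<Longrightarrow> \<nu> B \<le> d" for A d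
    unfolding \<pi>_def using that by (intro cSUP_least) auto
  have \<pi>add: "\<pi> (A \<union> B) = \<pi> A + \<pi> B" if A: "A \<in> sets M" and B: "B \<in> sets M" and AB: "A \<inter> B = {}" for A B
  proof (rule antisym)
    show "\<pi> (A \<union> B) \<le> \<pi> A + \<pi> B"
    proof (rule le)
      fix C assume C: "C \<in> sets M" "C \<subseteq> A \<union> B"
      have "C = (C \<inter> A) \<union> (C \<inter> B)" using C by auto
      then have "\<nu> C = \<nu> (C \<inter> A) + \<nu> (C \<inter> B)"
        using add[of "C \<inter> A" "C \<inter> B"] C(1) A B AB by (metis (no_types, lifting) Int_assoc Int_commute Int_empty_right sets.Int)
      also have "\<dots> \<le> \<pi> A + \<pi> B" using C(1) A B by (intro add_mono ge) auto
      finally show "\<nu> C \<le> \<pi> A + \<pi> B" .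
    qed
    have "\<nu> C + \<nu> D \<le> \<pi> (A \<union> B)" if "C \<in> sets M" "C \<subseteq> A" "D \<in> sets M" "D \<subseteq> B" for C D
    proof -
      have "C \<inter> D = {}" using that AB by auto
      then have "\<nu> C + \<nu> D = \<nu> (C \<union> D)" using add that by simp
      also have "\<dots> \<le> \<pi> (A \<union> B)" using that by (intro ge) auto
      finally show ?thesis .
    qed
    then have "\<pi> A \<le> \<pi> (A \<union> B) - \<nu> D" if "D \<in> sets M" "D \<subseteq> B" for D
      using that by (intro le) (simp add: le_diff_eq)
    then have "\<pi> B \<le> \<pi> (A \<union> B) - \<pi> A"
      by (intro le) (simp add: le_diff_eq add.commute)
    then show "\<pi> A + \<pi> B \<le> \<pi> (A \<union> B)" by simp
  qed
  obtain g1 :: "'a \<Rightarrow> real" where g1: "integrable M g1" "\<And>A. A \<in> sets M \<Longrightarrow> \<pi> A = (LINT x:A|M. g1 x)"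
    using density[of \<pi> "max c 0"] \<pi>add ge[of "{}"] \<nu>0 le cmono by (metis empty_subsetI sets.empty_sets)
  \<comment> \<open>The negative part is a second nonnegative additive set function; both of its
    terms contribute to the bound, hence the factor 2.\<close>
  have "\<exists>g::'a \<Rightarrow> real. integrable M g \<and> (\<forall>A\<in>sets M. \<pi> A - \<nu> A = (LINT x:A|M. g x))"
  proof (rule density[of _ "2 * max c 0"])
    fix A assume A: "A \<in> sets M"
    show "0 \<le> \<pi> A - \<nu> A" using ge[OF A, of A] by simp
    have "\<pi> A \<le> max c 0 * measure M A powr s" using A cmono by (intro le) auto
    moreover have "- \<nu> A \<le> c * measure M A powr s" using bound[OF A] by simp
    moreover have "c * measure M A powr s \<le> max c 0 * measure M A powr s" by (intro mult_right_mono) auto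
    ultimately show "\<pi> A - \<nu> A \<le> 2 * max c 0 * measure M A powr s" by simp
  qed (simp add: \<pi>add add)
  then obtain g2 :: "'a \<Rightarrow> real" where g2: "integrable M g2" "\<And>A. A \<in> sets M \<Longrightarrow> \<pi> A - \<nu> A = (LINT x:A|M. g2 x)"
    by blast
  show thesis
  proof
    show "integrable M (\<lambda>x. g1 x - g2 x)" using g1 g2 by simp
    fix A assume A: "A \<in> sets M"
    have "set_integrable M A g1" "set_integrable M A g2"
      unfolding set_integrable_def by (rule integrable_mult_indicator[OF A] g1(1) g2(1))+
    then have "(LINT x:A|M. g1 x - g2 x) = \<pi> A - (\<pi> A - \<nu> A)"
      using g1(2)[OF A] g2(2)[OF A] by (simp add: set_integral_diff)
    then show "\<nu> A = (LINT x:A|M. g1 x - g2 x)" by simp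
  qed
qed

section \<open>Test functions\<close>

text \<open>The polynomial in 1 / t makes the family closed under differentiation: the derivative
  replaces P by X^2 (c P - P'). The rate \<open>c\<close> is a parameter because letting it tend to
  0 turns the function for P = 1 into the indicator of the positive half line.\<close>

definition flat_fun :: "real \<Rightarrow> real poly \<Rightarrow> real \<Rightarrow> real" where
  "flat_fun c P t = (if t > 0 then poly P (1 / t) * exp (- c / t) else 0)"

lemma poly_times_exp_minus_tendsto:
  fixes c :: real
  assumes c: "c > 0"
  shows "((\<lambda>s. poly P s * exp (- c * s)) \<longlongrightarrow> 0) at_top"
proof -
  have mono: "((\<lambda>s. s ^ k * exp (- c * s)) \<longlongrightarrow> 0) at_top" for k
  proof -
    have "filterlim (\<lambda>s. c * s) at_top at_top"
      using c by (intro filterlim_tendsto_pos_mult_at_top[OF tendsto_const]) (auto simp: filterlim_ident)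
    from filterlim_compose[OF tendsto_power_div_exp_0[of k] this]
    have "((\<lambda>s. (c * s) ^ k / exp (c * s)) \<longlongrightarrow> 0) at_top" .
    then have "((\<lambda>s. (1 / c ^ k) * ((c * s) ^ k / exp (c * s))) \<longlongrightarrow> (1 / c ^ k) * 0) at_top"
      by (intro tendsto_intros)
    then show ?thesis using c by (simp add: power_mult_distrib exp_minus field_simps)
  qed
  have "((\<lambda>s. \<Sum>i\<le>degree P. coeff P i * (s ^ i * exp (- c * s))) \<longlongrightarrow> (\<Sum>i\<le>degree P. coeff P i * 0)) at_top"
    by (intro tendsto_intros mono)
  then show ?thesis by (simp add: poly_altdef sum_distrib_right mult.assoc)
qed

lemma flat_fun_has_real_derivative:
  assumes c: "c > 0"
  shows "(flat_fun c P has_real_derivative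
    flat_fun c ([:0, 0, 1:] * (smult c P - pderiv P)) t) (at t)"
proof (cases t "0 :: real" rule: linorder_cases)
  case less
  have "((\<lambda>_. 0) has_real_derivative 0) (at t)" by simp
  moreover have "\<forall>\<^sub>F s in nhds t. flat_fun c P s = 0"
    using eventually_nhds_in_open[of "{..<0}" t] less by (auto simp: flat_fun_def elim: eventually_mono)
  ultimately show ?thesis
    using less by (subst DERIV_cong_ev[OF refl _ refl]) (auto simp: flat_fun_def)
next
  case greater
  have ev: "\<forall>\<^sub>F s in nhds t. flat_fun c P s = poly P (1 / s) * exp (- c / s)"
    using eventually_nhds_in_open[of "{0<..}" t] greater by (auto simp: flat_fun_def elim: eventually_mono)
  have "((\<lambda>s. poly P (1 / s) * exp (- c / s)) has_real_derivative
      flat_fun c ([:0, 0, 1:] * (smult c P - pderiv P)) t) (at t)"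
    using greater
    by (auto intro!: derivative_eq_intros DERIV_chain'[where g = "poly P"]
        simp: flat_fun_def power2_eq_square field_simps)
  then show ?thesis by (subst DERIV_cong_ev[OF refl ev refl])
next
  case equal
  \<comment> \<open>Dividing by \<open>h\<close> multiplies the polynomial in 1 / h by its variable,
    so the difference quotient at 0 is again a polynomial times an exponential, with 1 / h tending
    to infinity.\<close>
  have "((\<lambda>h. flat_fun c P h / h) \<longlongrightarrow> 0) (at_right 0)"
  proof (rule Lim_transform_eventually)
    have "filterlim (\<lambda>h::real. 1 / h) at_top (at_right 0)"
      using filterlim_inverse_at_top_right by (simp add: inverse_eq_divide)
    from filterlim_compose[OF poly_times_exp_minus_tendsto[OF c, of "[:0, 1:] * P"] this]
    show "((\<lambda>h. poly ([:0, 1:] * P) (1 / h) * exp (- c * (1 / h))) \<longlongrightarrow> 0) (at_right 0)" .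
    show "\<forall>\<^sub>F h in at_right 0. poly ([:0, 1:] * P) (1 / h) * exp (- c * (1 / h)) = flat_fun c P h / h"
      by (auto simp: eventually_at_right_field flat_fun_def intro: exI[of _ 1])
  qed
  moreover have "((\<lambda>h. flat_fun c P h / h) \<longlongrightarrow> 0) (at_left 0)"
    by (rule tendsto_eventually) (auto simp: eventually_at_left_field flat_fun_def intro: exI[of _ "-1"])
  ultimately have "((\<lambda>h. flat_fun c P h / h) \<longlongrightarrow> 0) (at 0)"
    by (simp add: filterlim_split_at)
  then show ?thesis using equal by (simp add: DERIV_def flat_fun_def)
qed

text \<open>A class of functions that is closed under partial derivatives, hence consists of smooth
  functions, and contains the bumps needed below.\<close>

inductive_set flat_class :: "(real ^ 'n::finite \<Rightarrow> complex) set" where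
  const: "(\<lambda>x. c) \<in> flat_class"
| up: "c > 0 \<Longrightarrow> (\<lambda>x. complex_of_real (flat_fun c P (x $ i - a))) \<in> flat_class"
| down: "c > 0 \<Longrightarrow> (\<lambda>x. complex_of_real (flat_fun c P (a - x $ i))) \<in> flat_class"
| add: "f \<in> flat_class \<Longrightarrow> g \<in> flat_class \<Longrightarrow> (\<lambda>x. f x + g x) \<in> flat_class"
| mult: "f \<in> flat_class \<Longrightarrow> g \<in> flat_class \<Longrightarrow> (\<lambda>x. f x * g x) \<in> flat_class"

text \<open>Closure under partial derivatives is what iterates to smoothness. Constants are in the
  class so that the derivatives in the other coordinate directions, which are 0, stay inside
  it.\<close>

lemma flat_class_has_derivative:
  assumes "f \<in> (flat_class :: (real ^ 'n::finite \<Rightarrow> complex) set)"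
  shows "\<exists>D. (\<forall>x. (f has_derivative D x) (at x)) \<and> (\<forall>i. (\<lambda>x. D x (axis i 1)) \<in> flat_class)"
  using assms
proof induction
  case (const c)
  show ?case by (intro exI[of _ "\<lambda>x h. 0"]) (auto intro: flat_class.const)
next
  case (up c P i a)
  let ?P = "[:0, 0, 1:] * (smult c P - pderiv P)"
  let ?D = "\<lambda>x h. complex_of_real (h $ i * flat_fun c ?P (x $ i - a))"
  have "((\<lambda>x. complex_of_real (flat_fun c P (x $ i - a))) has_derivative ?D x) (at x)" for x
  proof -
    have "((\<lambda>x :: real ^ 'n. x $ i - a) has_derivative (\<lambda>h. h $ i)) (at x)"
      by (auto intro!: derivative_eq_intros bounded_linear_vec_nth bounded_linear_imp_has_derivative)
    from has_derivative_of_real[OF has_derivative_compose[OF this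
        flat_fun_has_real_derivative[OF up, unfolded has_field_derivative_def, of P]]]
    show ?thesis by (simp add: mult.commute)
  qed
  moreover have "(\<lambda>x. ?D x (axis j 1)) \<in> flat_class" for j
    using flat_class.up[OF up, of ?P i a] flat_class.const[of 0]
    by (cases "j = i") (simp_all add: axis_def)
  ultimately show ?case by (intro exI[of _ ?D] conjI allI)
next
  case (down c P a i)
  let ?P = "[:0, 0, 1:] * (smult c P - pderiv P)"
  let ?D = "\<lambda>x h. complex_of_real (- h $ i * flat_fun c ?P (a - x $ i))"
  have "((\<lambda>x. complex_of_real (flat_fun c P (a - x $ i))) has_derivative ?D x) (at x)" for x
  proof -
    have "((\<lambda>x :: real ^ 'n. a - x $ i) has_derivative (\<lambda>h. - h $ i)) (at x)"
      by (auto intro!: derivative_eq_intros bounded_linear_vec_nth bounded_linear_imp_has_derivative)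
    from has_derivative_of_real[OF has_derivative_compose[OF this
        flat_fun_has_real_derivative[OF down, unfolded has_field_derivative_def, of P]]]
    show ?thesis by (simp add: mult.commute)
  qed
  moreover have "(\<lambda>x. ?D x (axis j 1)) \<in> flat_class" for j
    using flat_class.mult[OF flat_class.const[of "-1"] flat_class.down[OF down, of ?P a i]]
      flat_class.const[of 0]
    by (cases "j = i") (simp_all add: axis_def)
  ultimately show ?case by (intro exI[of _ ?D] conjI allI)
next
  case (add f g)
  then obtain Df Dg where "\<And>x. (f has_derivative Df x) (at x)" "\<And>i. (\<lambda>x. Df x (axis i 1)) \<in> flat_class"
    "\<And>x. (g has_derivative Dg x) (at x)" "\<And>i. (\<lambda>x. Dg x (axis i 1)) \<in> flat_class" by blast
  then show ?case
    by (intro exI[of _ "\<lambda>x h. Df x h + Dg x h"])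
      (auto intro!: has_derivative_add flat_class.add)
next
  case (mult f g)
  then obtain Df Dg where "\<And>x. (f has_derivative Df x) (at x)" "\<And>i. (\<lambda>x. Df x (axis i 1)) \<in> flat_class"
    "\<And>x. (g has_derivative Dg x) (at x)" "\<And>i. (\<lambda>x. Dg x (axis i 1)) \<in> flat_class" by blast
  with mult.hyps show ?case
    by (intro exI[of _ "\<lambda>x h. f x * Dg x h + Df x h * g x"])
      (auto intro!: has_derivative_mult flat_class.add flat_class.mult)
qed

lemma flat_class_smooth: "f \<in> flat_class \<Longrightarrow> smooth_fun f"
proof -
  assume f: "f \<in> flat_class"
  have pd: "pderiv_at i g \<in> flat_class" if g: "g \<in> flat_class" for g i
  proof -
    obtain D where D: "\<And>x. (g has_derivative D x) (at x)" "\<And>i. (\<lambda>x. D x (axis i 1)) \<in> flat_class"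
      using flat_class_has_derivative[OF g] by blast
    have "pderiv_at i g = (\<lambda>x. D x (axis i 1))"
      unfolding pderiv_at_def using frechet_derivative_at[OF D(1)] by metis
    then show ?thesis using D by simp
  qed
  have "iter_pderiv is f \<in> flat_class" for "is"
    by (induction "is") (simp_all add: iter_pderiv_def f pd)
  then show ?thesis
    using flat_class_has_derivative unfolding smooth_fun_def differentiable_def by blast
qed

section \<open>Smooth functions, test functions and Schwartz functions\<close>

lemma iter_pderiv_simps:
  "iter_pderiv [] f = f" "iter_pderiv (i # is) f = pderiv_at i (iter_pderiv is f)"
  by (simp_all add: iter_pderiv_def)

lemma smooth_fun_add:
  assumes f: "smooth_fun f" and g: "smooth_fun g"
  shows "smooth_fun (\<lambda>x. f x + g x)"
proof -
  have "iter_pderiv is (\<lambda>x. f x + g x) = (\<lambda>x. iter_pderiv is f x + iter_pderiv is g x)" for "is"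
  proof (induction "is")
    case (Cons i "is")
    have "frechet_derivative (\<lambda>x. iter_pderiv is f x + iter_pderiv is g x) (at x)
        = (\<lambda>h. frechet_derivative (iter_pderiv is f) (at x) h + frechet_derivative (iter_pderiv is g) (at x) h)" for x
      using f g unfolding smooth_fun_def
      by (intro frechet_derivative_at[symmetric] has_derivative_add)
        (auto simp flip: frechet_derivative_works)
    then show ?case by (simp add: iter_pderiv_simps Cons pderiv_at_def fun_eq_iff)
  qed (simp add: iter_pderiv_simps)
  then show ?thesis using f g unfolding smooth_fun_def by (auto intro: differentiable_add)
qed

lemma smooth_fun_cmult:
  assumes f: "smooth_fun f"
  shows "smooth_fun (\<lambda>x. c * f x)"
proof -
  have "iter_pderiv is (\<lambda>x. c * f x) = (\<lambda>x. c * iter_pderiv is f x)" for "is"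
  proof (induction "is")
    case (Cons i "is")
    have "frechet_derivative (\<lambda>x. c * iter_pderiv is f x) (at x)
        = (\<lambda>h. c * frechet_derivative (iter_pderiv is f) (at x) h)" for x
      using f unfolding smooth_fun_def
      by (intro frechet_derivative_at[symmetric] has_derivative_mult_right)
        (auto simp flip: frechet_derivative_works)
    then show ?case by (simp add: iter_pderiv_simps Cons pderiv_at_def fun_eq_iff)
  qed (simp add: iter_pderiv_simps)
  then show ?thesis using f unfolding smooth_fun_def by (auto intro: differentiable_mult)
qed

lemma test_functions_add:
  assumes "f \<in> test_functions" "g \<in> test_functions"
  shows "(\<lambda>x. f x + g x) \<in> test_functions"
proof -
  have "bounded ({x. f x \<noteq> 0} \<union> {x. g x \<noteq> 0})"
    using assms by (simp add: test_functions_def compact_closure)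
  then have "bounded {x. f x + g x \<noteq> 0}" by (rule bounded_subset) auto
  then show ?thesis using assms smooth_fun_add by (auto simp: test_functions_def compact_closure)
qed

lemma test_functions_cmult:
  assumes "f \<in> test_functions"
  shows "(\<lambda>x. c * f x) \<in> test_functions"
proof -
  have "bounded {x. f x \<noteq> 0}" using assms by (simp add: test_functions_def compact_closure)
  then have "bounded {x. c * f x \<noteq> 0}" by (rule bounded_subset) auto
  then show ?thesis using assms smooth_fun_cmult by (auto simp: test_functions_def compact_closure)
qed

lemma smooth_fun_continuous_on: "smooth_fun f \<Longrightarrow> continuous_on A (iter_pderiv is f)"
  unfolding smooth_fun_def
  by (meson continuous_at_imp_continuous_on differentiable_imp_continuous_within)

lemma smooth_fun_continuous: "smooth_fun f \<Longrightarrow> continuous_on A f"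
  using smooth_fun_continuous_on[of f A "[]"] by (simp add: iter_pderiv_simps)

lemma smooth_fun_measurable [measurable_dest]:
  "smooth_fun f \<Longrightarrow> f \<in> borel_measurable lebesgue"
  using borel_measurable_continuous_onI[OF smooth_fun_continuous]
  by (intro measurable_completion) simp

lemma test_functions_subset_schwartz: "test_functions \<subseteq> schwartz_functions"
proof
  fix \<phi> :: "real ^ 'n \<Rightarrow> complex" assume \<phi>: "\<phi> \<in> test_functions"
  let ?K = "closure {x. \<phi> x \<noteq> 0}"
  have s: "smooth_fun \<phi>" and K: "compact ?K" using \<phi> by (auto simp: test_functions_def)
  \<comment> \<open>The complement of the closed support is open, so there an iterated derivative is
    locally 0 and its next derivative is 0 as well.\<close>
  have off: "iter_pderiv is \<phi> x = 0" if "x \<notin> ?K" for "is" x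
    using that
  proof (induction "is" arbitrary: x)
    case Nil
    then show ?case using closure_subset[of "{x. \<phi> x \<noteq> 0}"] by (auto simp: iter_pderiv_simps)
  next
    case (Cons i "is")
    have "(iter_pderiv is \<phi> has_derivative (\<lambda>h. 0)) (at x)"
    proof (rule has_derivative_transform_within_open)
      show "((\<lambda>x. 0) has_derivative (\<lambda>h. 0)) (at x)" by simp
      show "open (- ?K)" "x \<in> - ?K" using Cons.prems by auto
    qed (use Cons.IH in auto)
    from frechet_derivative_at[OF this] show ?case
      by (metis iter_pderiv_simps(2) pderiv_at_def)
  qed
  have "bounded (range (\<lambda>x. (1 + norm x) ^ N *\<^sub>R iter_pderiv is \<phi> x))" for N "is"
  proof -
    have "compact ((\<lambda>x. (1 + norm x) ^ N *\<^sub>R iter_pderiv is \<phi> x) ` ?K)"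
      by (intro compact_continuous_image continuous_intros smooth_fun_continuous_on s K)
    then have "bounded (insert 0 ((\<lambda>x. (1 + norm x) ^ N *\<^sub>R iter_pderiv is \<phi> x) ` ?K))"
      by (simp add: compact_imp_bounded)
    then show ?thesis
    proof (rule bounded_subset, safe)
      fix x assume "(1 + norm x) ^ N *\<^sub>R iter_pderiv is \<phi> x \<notin> (\<lambda>x. (1 + norm x) ^ N *\<^sub>R iter_pderiv is \<phi> x) ` ?K"
      then have "x \<notin> ?K" by blast
      then show "(1 + norm x) ^ N *\<^sub>R iter_pderiv is \<phi> x = 0" using off by simp
    qed
  qed
  then show "\<phi> \<in> schwartz_functions" using s by (simp add: schwartz_functions_def)
qed

text \<open>The exponential rate 1 / (m + 1) tends to 0, so the bumps approach the indicator of the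
  open box while their support stays in its closure and their values stay at most 1.\<close>

definition box_bump :: "real ^ 'n::finite \<Rightarrow> real ^ 'n \<Rightarrow> nat \<Rightarrow> real ^ 'n \<Rightarrow> complex" where
  "box_bump a b m x = (\<Prod>i\<in>UNIV. complex_of_real (flat_fun (1 / Suc m) 1 (x $ i - a $ i)) *
     complex_of_real (flat_fun (1 / Suc m) 1 (b $ i - x $ i)))"

lemma box_bump_eq_0:
  assumes "x \<notin> box a b"
  shows "box_bump a b m x = 0"
proof -
  obtain i where "\<not> (a $ i < x $ i \<and> x $ i < b $ i)" using assms by (auto simp: mem_box_cart)
  then show ?thesis unfolding box_bump_def by (intro prod_zero bexI[of _ i]) (auto simp: flat_fun_def)
qed

lemma norm_box_bump_le: "norm (box_bump a b m x) \<le> indicator (box a b) x"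
proof (cases "x \<in> box a b")
  case True
  have "norm (box_bump a b m x) \<le> 1"
    unfolding box_bump_def prod_norm[symmetric]
    by (intro prod_le_1) (auto simp: norm_mult flat_fun_def intro!: mult_le_one)
  then show ?thesis using True by simp
qed (simp add: box_bump_eq_0)

lemma box_bump_test_function: "box_bump a b m \<in> test_functions"
proof -
  have "(\<lambda>x. \<Prod>i\<in>I. complex_of_real (flat_fun (1 / Suc m) 1 (x $ i - a $ i)) *
     complex_of_real (flat_fun (1 / Suc m) 1 (b $ i - x $ i))) \<in> flat_class" if "finite I" for I
    using that
    by induction (auto intro!: flat_class.const flat_class.mult flat_class.up flat_class.down)
  from this[of UNIV] have "box_bump a b m \<in> flat_class" by (simp add: box_bump_def[abs_def])
  moreover have "bounded {x. box_bump a b m x \<noteq> 0}"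
    by (rule bounded_subset[OF bounded_box[of a b]]) (use box_bump_eq_0 in auto)
  ultimately show ?thesis
    by (simp add: test_functions_def compact_closure flat_class_smooth)
qed

lemma box_bump_tendsto: "(\<lambda>m. box_bump a b m x) \<longlonglongrightarrow> indicator (box a b) x"
proof (cases "x \<in> box a b")
  case True
  have lim: "(\<lambda>m. complex_of_real (flat_fun (1 / Suc m) 1 t)) \<longlonglongrightarrow> 1" if "t > 0" for t
  proof -
    have "(\<lambda>m. exp (- (1 / real (Suc m)) / t)) \<longlonglongrightarrow> exp (- 0 / t)"
      using that lim_inverse_n' by (intro tendsto_intros LIMSEQ_Suc) auto
    then have "(\<lambda>m. complex_of_real (exp (- (1 / real (Suc m)) / t))) \<longlonglongrightarrow> of_real 1"
      by (intro tendsto_of_real) simp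
    then show ?thesis using that by (simp add: flat_fun_def)
  qed
  have "(\<lambda>m. box_bump a b m x) \<longlonglongrightarrow> (\<Prod>i\<in>(UNIV :: 'a set). 1 * 1)"
    unfolding box_bump_def using True
    by (intro tendsto_prod tendsto_mult lim) (auto simp: mem_box_cart)
  then show ?thesis using True by simp
qed (simp add: box_bump_eq_0)

section \<open>From test functions to bounded functions of bounded support, and
  orthogonality\<close>

lemma bounded_subset_cballD:
  fixes S :: "'a::real_normed_vector set"
  assumes "bounded S"
  shows "\<exists>R. S \<subseteq> cball 0 R"
  using assms by (auto simp: bounded_iff dist_norm subset_iff)

lemma borel_measurable_cnj_sgn [measurable]:
  assumes [measurable]: "f \<in> borel_measurable M"
  shows "(\<lambda>x. cnj (sgn (f x))) \<in> borel_measurable M"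
proof -
  have "cnj \<in> borel_measurable borel"
    by (intro borel_measurable_continuous_onI continuous_intros)
  moreover have "(\<lambda>x. sgn (f x)) \<in> borel_measurable M" unfolding sgn_div_norm by measurable
  ultimately show ?thesis by (rule measurable_compose[rotated])
qed

lemma mult_cnj_sgn: "z * cnj (sgn z) = of_real (norm z)"
  by (cases "z = 0") (simp_all add: sgn_eq power2_eq_square flip: complex_norm_square)

lemma indicator_ball_box_measurable [measurable]:
  fixes a b :: "'a::euclidean_space"
  shows "(indicator (cball a R) :: 'a \<Rightarrow> 'b::{real_normed_algebra_1, second_countable_topology}) \<in> borel_measurable lebesgue"
    and "(indicator (box a b) :: 'a \<Rightarrow> 'b) \<in> borel_measurable lebesgue"
  by (intro borel_measurable_indicator, simp)+

text \<open>Approximating simple functions can be chosen with norm at most twice that of the limit.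
  The limit step therefore concerns uniformly bounded pointwise convergence only, the situation in
  which dominated convergence applies.\<close>

lemma bounded_measurable_induct:
  fixes f :: "'a \<Rightarrow> complex"
  assumes f: "f \<in> borel_measurable M" "\<And>x. x \<in> space M \<Longrightarrow> norm (f x) \<le> C"
    and ind: "\<And>A. A \<in> sets M \<Longrightarrow> P (indicator A)"
    and cmult: "\<And>f c. P f \<Longrightarrow> P (\<lambda>x. c * f x)"
    and add: "\<And>f g. P f \<Longrightarrow> P g \<Longrightarrow> P (\<lambda>x. f x + g x)"
    and lim: "\<And>F f C. (\<And>i. P (F i)) \<Longrightarrow> (\<And>i. F i \<in> borel_measurable M) \<Longrightarrow> f \<in> borel_measurable M \<Longrightarrow>
      (\<And>i x. x \<in> space M \<Longrightarrow> norm (F i x) \<le> C) \<Longrightarrow>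
      (\<And>x. x \<in> space M \<Longrightarrow> (\<lambda>i. F i x) \<longlonglongrightarrow> f x) \<Longrightarrow> P f"
  shows "P f"
proof -
  obtain F where F: "\<And>i. simple_function M (F i)" "\<And>x. x \<in> space M \<Longrightarrow> (\<lambda>i. F i x) \<longlonglongrightarrow> f x"
    "\<And>i x. x \<in> space M \<Longrightarrow> norm (F i x) \<le> 2 * norm (f x)"
  proof -
    from borel_measurable_implies_sequence_metric[OF f(1), of 0] obtain F
      where "\<forall>i. simple_function M (F i)" "\<forall>x\<in>space M. (\<lambda>i. F i x) \<longlonglongrightarrow> f x"
        "\<forall>i. \<forall>x\<in>space M. dist (F i x) 0 \<le> 2 * dist (f x) 0" by blast
    then show thesis by (intro that[of F]) (auto simp: dist_norm)
  qed
  have zero: "P (\<lambda>x. 0)" using cmult[OF ind[of "{}"], of 0] by simp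
  \<comment> \<open>\<open>F i\<close> as a finite sum of multiples of indicators. The two agree on
    the space of \<open>M\<close>; outside it all these indicators vanish.\<close>
  define G where "G i x = (\<Sum>y\<in>F i ` space M. y * indicator (F i -` {y} \<inter> space M) x)" for i x
  have GF: "G i x = F i x" if "x \<in> space M" for i x
  proof -
    have "G i x = (\<Sum>y\<in>F i ` space M. if y = F i x then y else 0)"
      unfolding G_def using that by (intro sum.cong) (auto simp: indicator_def)
    then show ?thesis using that simple_functionD(1)[OF F(1), of i] by simp
  qed
  have GP: "P (G i)" for i
  proof -
    have "finite (F i ` space M)" using F(1) by (rule simple_functionD)
    then have "P (\<lambda>x. \<Sum>y\<in>F i ` space M. y * indicator (F i -` {y} \<inter> space M) x)"
    proof (induction rule: finite_induct)
      case (insert y Y)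
      have "P (\<lambda>x. y * indicator (F i -` {y} \<inter> space M) x)"
        by (intro cmult ind simple_functionD F)
      from add[OF this insert.IH] show ?case by (simp only: sum.insert[OF insert.hyps])
    qed (simp add: zero)
    then show ?thesis by (simp add: G_def[abs_def])
  qed
  show ?thesis
  proof (rule lim[OF GP])
    show "G i \<in> borel_measurable M" for i
      using borel_measurable_simple_function[OF F(1)] GF by (simp cong: measurable_cong)
    show "norm (G i x) \<le> 2 * C" if "x \<in> space M" for i x
      using F(3)[OF that, of i] f(2)[OF that] GF[OF that] by simp
    show "(\<lambda>i. G i x) \<longlonglongrightarrow> f x" if "x \<in> space M" for x
      using F(2)[OF that] GF[OF that] by simp
  qed (use f in auto)
qed

lemma cball_subset_symmetric_box:
  "cball 0 R \<subseteq> box (\<chi> i. - (\<bar>R\<bar> + 1)) (\<chi> i. (\<bar>R\<bar> + 1))"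
proof
  fix x :: "real ^ 'a" assume "x \<in> cball 0 R"
  then have "- (\<bar>R\<bar> + 1) < x $ i \<and> x $ i < \<bar>R\<bar> + 1" for i
    using component_le_norm_cart[of x i] by (auto simp: dist_norm)
  then show "x \<in> box (\<chi> i. - (\<bar>R\<bar> + 1)) (\<chi> i. (\<bar>R\<bar> + 1))"
    by (simp add: mem_box_cart)
qed

text \<open>A Dynkin argument: open boxes are limits of bumps, they are stable under intersection
  and generate the Borel sets, and the class of sets that satisfy \<open>P\<close> is closed under
  complements and disjoint unions. Cutting with one fixed box keeps every function inside one ball,
  as the limit hypothesis demands.\<close>

lemma indicator_Int_approximation_induct:
  fixes P :: "(real ^ 'n::finite \<Rightarrow> complex) \<Rightarrow> bool"
  assumes test: "\<And>\<phi>. \<phi> \<in> test_functions \<Longrightarrow> P \<phi>"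
    and cmult: "\<And>f c. P f \<Longrightarrow> P (\<lambda>x. c * f x)"
    and add: "\<And>f g. P f \<Longrightarrow> P g \<Longrightarrow> P (\<lambda>x. f x + g x)"
    and lim: "\<And>F f C R. (\<And>i. P (F i)) \<Longrightarrow> (\<And>i. F i \<in> borel_measurable lebesgue) \<Longrightarrow>
      f \<in> borel_measurable lebesgue \<Longrightarrow> (\<And>i x. norm (F i x) \<le> C * indicator (cball 0 R) x) \<Longrightarrow>
      (AE x in lebesgue. (\<lambda>i. F i x) \<longlonglongrightarrow> f x) \<Longrightarrow> P f"
    and A: "A \<in> sets lebesgue"
  shows "P (indicator (A \<inter> box a b))"
proof -
  obtain R where R: "box a b \<subseteq> cball 0 R"
    using bounded_box bounded_subset_cballD by blast
  have le: "indicator (C \<inter> box a b) x \<le> (1::real) * indicator (cball 0 R) x" for x C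
    using R by (auto simp: indicator_def)
  have box: "P (indicator (box c d))" for c d
  proof -
    obtain R where R: "box c d \<subseteq> cball 0 R"
      using bounded_box bounded_subset_cballD by blast
    show ?thesis
    proof (rule lim[of "box_bump c d" _ 1 R])
      show "P (box_bump c d i)" for i using box_bump_test_function test by blast
      show "box_bump c d i \<in> borel_measurable lebesgue" for i
        using box_bump_test_function[of c d i] smooth_fun_measurable by (auto simp: test_functions_def)
      show "norm (box_bump c d i x) \<le> 1 * indicator (cball 0 R) x" for i x
        by (rule order_trans[OF norm_box_bump_le]) (use R in \<open>auto simp: indicator_def\<close>)
    show "indicator (box c d) \<in> borel_measurable lebesgue"
        by (intro borel_measurable_indicator) auto
    qed (simp add: box_bump_tendsto)
  qed
  have zero: "P (\<lambda>x. 0)" using cmult[OF box, of 0 0 0] by simp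
  have borel: "P (indicator (B \<inter> box a b))" if "B \<in> sets borel" for B
  proof -
    have "Int_stable (range (\<lambda>(c, d). box c d :: (real ^ 'n) set))"
      by (force simp: Int_stable_def box_Int_box)
    moreover have "range (\<lambda>(c, d). box c d :: (real ^ 'n) set) \<subseteq> Pow UNIV" by simp
    moreover have "B \<in> sigma_sets UNIV (range (\<lambda>(c, d). box c d :: (real ^ 'n) set))"
      using that unfolding borel_eq_box by simp
    ultimately show ?thesis
    proof (induction rule: sigma_sets_induct_disjoint)
      case (basic B)
      then obtain c d where "B = box c d" by auto
      then show ?case using box by (simp add: box_Int_box)
    next
      case empty
      then show ?case using zero by (simp add: indicator_def[abs_def])
    next
      case (compl B)
      have "P (\<lambda>x. indicator (box a b) x + (- 1) * indicator (B \<inter> box a b) x)"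
        by (intro add cmult compl box)
      also have "(\<lambda>x. indicator (box a b) x + (- 1) * indicator (B \<inter> box a b) x)
          = (indicator ((UNIV - B) \<inter> box a b) :: _ \<Rightarrow> complex)"
        by (auto simp: indicator_def)
      finally show ?case .
    next
      case (union B)
      have B: "B i \<in> sets borel" for i using union(2) unfolding borel_eq_box by auto
      then have [measurable]: "(\<Union>i<k. B i) \<in> sets borel" "(\<Union>i. B i) \<in> sets borel" for k
        by (auto intro!: sets.finite_UN)
      show ?case
      proof (rule lim[of "\<lambda>k. indicator ((\<Union>i<k. B i) \<inter> box a b)" _ 1 R])
        show "P (indicator ((\<Union>i<k. B i) \<inter> box a b))" for k
        proof (induction k)
          case 0
          then show ?case using zero by (simp add: indicator_def[abs_def])
        next
          case (Suc k)
          have "P (\<lambda>x. indicator ((\<Union>i<k. B i) \<inter> box a b) x + indicator (B k \<inter> box a b) x)"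
            by (intro add Suc union)
          also have "(\<lambda>x. indicator ((\<Union>i<k. B i) \<inter> box a b) x + indicator (B k \<inter> box a b) x)
              = (indicator ((\<Union>i<Suc k. B i) \<inter> box a b) :: _ \<Rightarrow> complex)"
          proof
            fix x
            have "\<not> (x \<in> B k \<and> x \<in> B i)" if "i < k" for i
              using union(1) that unfolding disjoint_family_on_def by (metis UNIV_I disjoint_iff less_irrefl)
            then have "\<not> (x \<in> B k \<and> x \<in> (\<Union>i<k. B i))" by blast
            moreover have "(\<Union>i<Suc k. B i) = (\<Union>i<k. B i) \<union> B k" by (auto simp: lessThan_Suc)
            ultimately show "indicator ((\<Union>i<k. B i) \<inter> box a b) x + indicator (B k \<inter> box a b) x
                = (indicator ((\<Union>i<Suc k. B i) \<inter> box a b) x :: complex)"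
              by (simp only:) (simp add: indicator_def)
          qed
          finally show ?case .
        qed
        show "AE x in lebesgue. (\<lambda>k. indicator ((\<Union>i<k. B i) \<inter> box a b) x :: complex)
            \<longlonglongrightarrow> indicator ((\<Union>i. B i) \<inter> box a b) x"
        proof (rule AE_I2)
          fix x
          have "(\<lambda>k. indicator (\<Union>i<k. B i) x * indicator (box a b) x :: complex)
              \<longlonglongrightarrow> indicator (\<Union>i. B i) x * indicator (box a b) x"
            by (intro tendsto_intros LIMSEQ_indicator_UN)
          then show "(\<lambda>k. indicator ((\<Union>i<k. B i) \<inter> box a b) x :: complex)
              \<longlonglongrightarrow> indicator ((\<Union>i. B i) \<inter> box a b) x"
            by (simp add: indicator_inter_arith)
        qed
        show "norm (indicator ((\<Union>i<k. B i) \<inter> box a b) x :: complex) \<le> 1 * indicator (cball 0 R) x" for k x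
          using le[of "\<Union>i<k. B i" x] by (auto simp: indicator_def)
      qed (auto intro!: measurable_completion)
    qed
  qed
  \<comment> \<open>A Lebesgue set differs from a Borel set by part of a null set. The limit
    hypothesis asks for convergence almost everywhere only, so a constant sequence passes from one
    indicator to the other.\<close>
  obtain S N N' where S: "A = S \<union> N" "N \<subseteq> N'" "N' \<in> null_sets lborel" "S \<in> sets lborel"
    using A by (rule sets_completionE)
  have [measurable]: "A \<in> sets lebesgue" "S \<in> sets lebesgue" using A S(4) by auto
  show ?thesis
  proof (rule lim[of "\<lambda>i. indicator (S \<inter> box a b)" _ 1 R])
    show "P (indicator (S \<inter> box a b))" using borel S(4) by simp
    have "N' \<in> null_sets lebesgue" using S(3) null_sets_completionI by blast
    then have "AE x in lebesgue. x \<notin> N'" by (rule AE_not_in)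
    then show "AE x in lebesgue. (\<lambda>i. indicator (S \<inter> box a b) x :: complex) \<longlonglongrightarrow> indicator (A \<inter> box a b) x"
      by eventually_elim (use S in \<open>auto simp: indicator_def\<close>)
    show "norm (indicator (S \<inter> box a b) x :: complex) \<le> 1 * indicator (cball 0 R) x" for x
      using le[of S x] by (auto simp: indicator_def)
  qed (auto intro!: borel_measurable_indicator)
qed

text \<open>Serves two ends: test functions detect locally integrable functions, and they are dense
  in the Lebesgue spaces. Multiplication by the indicator of a box around the ball changes nothing
  in \<open>f\<close>, but it puts all approximating simple functions under one bounded
  support.\<close>

lemma bounded_support_approximation_induct:
  fixes P :: "(real ^ 'n::finite \<Rightarrow> complex) \<Rightarrow> bool"
  assumes test: "\<And>\<phi>. \<phi> \<in> test_functions \<Longrightarrow> P \<phi>"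
    and cmult: "\<And>f c. P f \<Longrightarrow> P (\<lambda>x. c * f x)"
    and add: "\<And>f g. P f \<Longrightarrow> P g \<Longrightarrow> P (\<lambda>x. f x + g x)"
    and lim: "\<And>F f C R. (\<And>i. P (F i)) \<Longrightarrow> (\<And>i. F i \<in> borel_measurable lebesgue) \<Longrightarrow>
      f \<in> borel_measurable lebesgue \<Longrightarrow> (\<And>i x. norm (F i x) \<le> C * indicator (cball 0 R) x) \<Longrightarrow>
      (AE x in lebesgue. (\<lambda>i. F i x) \<longlonglongrightarrow> f x) \<Longrightarrow> P f"
    and f: "f \<in> borel_measurable lebesgue" "\<And>x. norm (f x) \<le> C * indicator (cball 0 R) x"
  shows "P f"
proof -
  let ?B = "box (\<chi> i. - (\<bar>R\<bar> + 1)) (\<chi> i. (\<bar>R\<bar> + 1)) :: (real ^ 'n) set"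
  obtain R' where R': "?B \<subseteq> cball 0 R'"
    using bounded_box bounded_subset_cballD by blast
  have "P (\<lambda>x. indicator ?B x * f x)"
  proof (rule bounded_measurable_induct[of f lebesgue "\<bar>C\<bar>" "\<lambda>f. P (\<lambda>x. indicator ?B x * f x)"])
    show "norm (f x) \<le> \<bar>C\<bar>" for x
      using f(2)[of x] by (cases "x \<in> cball 0 R") (auto simp del: mem_cball)
    show "P (\<lambda>x. indicator ?B x * indicator A x)" if "A \<in> sets lebesgue" for A
    proof -
      have "P (indicator (A \<inter> ?B))"
        by (rule indicator_Int_approximation_induct[of P, OF test cmult add lim that])
      then show ?thesis by (simp add: indicator_inter_arith[abs_def] mult.commute)
    qed
    show "P (\<lambda>x. indicator ?B x * (c * g x))" if "P (\<lambda>x. indicator ?B x * g x)" for g c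
      using cmult[OF that, of c] by (simp add: mult.left_commute)
    show "P (\<lambda>x. indicator ?B x * (g x + h x))"
      if "P (\<lambda>x. indicator ?B x * g x)" "P (\<lambda>x. indicator ?B x * h x)" for g h
      using add[OF that] by (simp add: distrib_left)
    fix F g D
    assume F: "\<And>i. P (\<lambda>x. indicator ?B x * F i x)" "\<And>i. F i \<in> borel_measurable lebesgue"
      "g \<in> borel_measurable lebesgue" "\<And>i x. x \<in> space lebesgue \<Longrightarrow> norm (F i x) \<le> D"
      "\<And>x. x \<in> space lebesgue \<Longrightarrow> (\<lambda>i. F i x) \<longlonglongrightarrow> g x"
    note [measurable] = F(2,3)
    show "P (\<lambda>x. indicator ?B x * g x)"
    proof (rule lim[of "\<lambda>i x. indicator ?B x * F i x" _ D R'])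
      show "norm (indicator ?B x * F i x) \<le> D * indicator (cball 0 R') x" for i x
        using F(4)[of x i] order_trans[OF norm_ge_zero F(4)[of x i]] R'
        by (auto simp: indicator_def)
      show "AE x in lebesgue. (\<lambda>i. indicator ?B x * F i x) \<longlonglongrightarrow> indicator ?B x * g x"
        using F(5) by (intro AE_I2 tendsto_intros) auto
      show "(\<lambda>x. indicator ?B x * F i x) \<in> borel_measurable lebesgue"
        "(\<lambda>x. indicator ?B x * g x) \<in> borel_measurable lebesgue" for i by measurable
    qed (rule F(1))
  qed (use f in auto)
  also have "(\<lambda>x. indicator ?B x * f x) = f"
  proof
    fix x
    show "indicator ?B x * f x = f x"
      using f(2)[of x] cball_subset_symmetric_box[of R]
      by (cases "x \<in> cball 0 R") (auto simp: indicator_def split: if_splits)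
  qed
  finally show ?thesis .
qed

text \<open>Testing with the conjugate sign of \<open>h\<close> on a ball turns the integral into
  that of the absolute value of \<open>h\<close> over this ball.\<close>

lemma AE_eq_0_if_orthogonal_bounded:
  fixes h :: "real ^ 'n::finite \<Rightarrow> complex"
  assumes h: "h \<in> borel_measurable lebesgue" "\<And>R. set_integrable lebesgue (cball 0 R) h"
    and orth: "\<And>f C R. f \<in> borel_measurable lebesgue \<Longrightarrow> (\<And>x. norm (f x) \<le> C * indicator (cball 0 R) x) \<Longrightarrow>
      (LINT x|lebesgue. h x * f x) = 0"
  shows "AE x in lebesgue. h x = 0"
proof -
  note [measurable] = h(1)
  have "AE x in lebesgue. x \<in> cball 0 (real k) \<longrightarrow> h x = 0" for k
  proof -
    let ?f = "\<lambda>x. cnj (sgn (h x)) * indicator (cball 0 (real k)) x"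
    have eq: "h x * ?f x = of_real (norm (h x) * indicator (cball 0 (real k)) x)" for x
      by (simp add: mult_cnj_sgn indicator_def flip: mult.assoc)
    have int: "integrable lebesgue (\<lambda>x. norm (h x) * indicator (cball 0 (real k)) x)"
      using integrable_norm[OF h(2)[unfolded set_integrable_def], of "real k"]
      by (simp add: mult.commute)
    have "(LINT x|lebesgue. h x * ?f x) = 0"
    proof (rule orth[of _ 1 "real k"])
      show "?f \<in> borel_measurable lebesgue"
        by (intro borel_measurable_times borel_measurable_cnj_sgn borel_measurable_indicator h) auto
    qed (auto simp: indicator_def norm_mult norm_sgn)
    then have "(LINT x|lebesgue. norm (h x) * indicator (cball 0 (real k)) x) = 0"
      unfolding eq integral_complex_of_real by simp
    then have "AE x in lebesgue. norm (h x) * indicator (cball 0 (real k)) x = 0"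
      using integral_nonneg_eq_0_iff_AE[OF int] by simp
    then show ?thesis by eventually_elim (auto simp: indicator_def)
  qed
  then have "AE x in lebesgue. \<forall>k. x \<in> cball 0 (real k) \<longrightarrow> h x = 0" by (subst AE_all_countable) blast
  then show ?thesis
  proof eventually_elim
    case (elim x)
    obtain k :: nat where "norm x \<le> k" using real_arch_simple by blast
    then show ?case using elim by (auto simp: dist_norm)
  qed
qed

lemma integrable_mult_bounded_support:
  fixes h f :: "real ^ 'n::finite \<Rightarrow> complex"
  assumes h: "h \<in> borel_measurable lebesgue" "\<And>R. set_integrable lebesgue (cball 0 R) h"
    and f: "f \<in> borel_measurable lebesgue" "\<And>x. norm (f x) \<le> C * indicator (cball 0 R) x"
  shows "integrable lebesgue (\<lambda>x. h x * f x)"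
proof (rule Bochner_Integration.integrable_bound)
  show "integrable lebesgue (\<lambda>x. C * norm (indicator (cball 0 R) x *\<^sub>R h x))"
    using h(2)[of R] unfolding set_integrable_def by (intro integrable_mult_right integrable_norm)
  show "AE x in lebesgue. norm (h x * f x) \<le> norm (C * norm (indicator (cball 0 R) x *\<^sub>R h x))"
  proof (rule AE_I2)
    fix x
    have "norm (h x * f x) \<le> norm (h x) * (C * indicator (cball 0 R) x)"
      unfolding norm_mult by (intro mult_left_mono f) auto
    also have "norm (h x) * (C * indicator (cball 0 R) x) = C * norm (indicator (cball 0 R) x *\<^sub>R h x)"
      by simp
    also have "\<dots> \<le> norm \<dots>" by simp
    finally show "norm (h x * f x) \<le> norm (C * norm (indicator (cball 0 R) x *\<^sub>R h x))" .
  qed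
qed (use h f in measurable)

lemma test_function_bounded_support:
  fixes \<phi> :: "real ^ 'n::finite \<Rightarrow> complex"
  assumes "\<phi> \<in> test_functions"
  shows "\<exists>C R. 0 \<le> C \<and> (\<forall>x. norm (\<phi> x) \<le> C * indicator (cball 0 R) x)"
proof -
  let ?K = "closure {x. \<phi> x \<noteq> 0}"
  have K: "compact ?K" and s: "smooth_fun \<phi>" using assms by (auto simp: test_functions_def)
  have "bounded (\<phi> ` ?K)"
    by (intro compact_imp_bounded compact_continuous_image smooth_fun_continuous s K)
  then obtain C where C: "C > 0" "\<And>x. x \<in> ?K \<Longrightarrow> norm (\<phi> x) \<le> C"
    by (auto simp: bounded_pos)
  obtain R where R: "?K \<subseteq> cball 0 R"
    using bounded_subset_cballD[OF compact_imp_bounded[OF K]] by blast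
  have "norm (\<phi> x) \<le> C * indicator (cball 0 R) x" for x
  proof (cases "x \<in> ?K")
    case True
    then show ?thesis using C(2)[OF True] R by (auto simp: indicator_def)
  next
    case False
    then have "\<phi> x = 0" using closure_subset[of "{x. \<phi> x \<noteq> 0}"] by blast
    then show ?thesis using C(1) by simp
  qed
  then show ?thesis using C(1) less_imp_le by blast
qed

text \<open>The fundamental lemma of the calculus of variations. Orthogonality survives dominated
  limits, so it spreads from test functions to the bounded functions of the previous
  criterion.\<close>

lemma AE_eq_0_if_orthogonal_test_functions:
  fixes h :: "real ^ 'n::finite \<Rightarrow> complex"
  assumes h: "h \<in> borel_measurable lebesgue" "\<And>R. set_integrable lebesgue (cball 0 R) h"
    and orth: "\<And>\<phi>. \<phi> \<in> test_functions \<Longrightarrow> (LINT x|lebesgue. h x * \<phi> x) = 0"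
  shows "AE x in lebesgue. h x = 0"
proof (rule AE_eq_0_if_orthogonal_bounded[OF h])
  fix f :: "real ^ 'n \<Rightarrow> complex" and C R :: real
  assume f: "f \<in> borel_measurable lebesgue" "\<And>x. norm (f x) \<le> C * indicator (cball 0 R) x"
  note int = integrable_mult_bounded_support[OF h]
  \<comment> \<open>Integrability is part of the induction claim because additivity of the integral
    depends on it.\<close>
  have "integrable lebesgue (\<lambda>x. h x * f x) \<and> (LINT x|lebesgue. h x * f x) = 0"
  proof (rule bounded_support_approximation_induct[OF _ _ _ _ f])
    fix \<phi> :: "real ^ 'n \<Rightarrow> complex" assume \<phi>: "\<phi> \<in> test_functions"
    then obtain C R where "\<And>x. norm (\<phi> x) \<le> C * indicator (cball 0 R) x"
      using test_function_bounded_support by blast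
    then have "integrable lebesgue (\<lambda>x. h x * \<phi> x)"
      using \<phi> smooth_fun_measurable by (intro int) (auto simp: test_functions_def)
    then show "integrable lebesgue (\<lambda>x. h x * \<phi> x) \<and> (LINT x|lebesgue. h x * \<phi> x) = 0"
      using orth \<phi> by simp
  next
    fix f :: "real ^ 'n \<Rightarrow> complex" and c
    assume "integrable lebesgue (\<lambda>x. h x * f x) \<and> (LINT x|lebesgue. h x * f x) = 0"
    then show "integrable lebesgue (\<lambda>x. h x * (c * f x)) \<and> (LINT x|lebesgue. h x * (c * f x)) = 0"
      by (simp add: mult.left_commute)
  next
    fix f g :: "real ^ 'n \<Rightarrow> complex"
    assume "integrable lebesgue (\<lambda>x. h x * f x) \<and> (LINT x|lebesgue. h x * f x) = 0"
      "integrable lebesgue (\<lambda>x. h x * g x) \<and> (LINT x|lebesgue. h x * g x) = 0"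
    then show "integrable lebesgue (\<lambda>x. h x * (f x + g x)) \<and> (LINT x|lebesgue. h x * (f x + g x)) = 0"
      by (simp add: distrib_left)
  next
    fix F :: "nat \<Rightarrow> real ^ 'n \<Rightarrow> complex" and f C R
    assume F: "\<And>i. integrable lebesgue (\<lambda>x. h x * F i x) \<and> (LINT x|lebesgue. h x * F i x) = 0"
      "\<And>i. F i \<in> borel_measurable lebesgue" "f \<in> borel_measurable lebesgue"
      "\<And>i x. norm (F i x) \<le> C * indicator (cball 0 R) x" "AE x in lebesgue. (\<lambda>i. F i x) \<longlonglongrightarrow> f x"
    note [measurable] = F(2,3) h(1)
    let ?w = "\<lambda>x. norm (h x * (of_real C * indicator (cball 0 R) x))"
    have w: "integrable lebesgue ?w"
    proof (intro integrable_norm int[of _ "\<bar>C\<bar>" R])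
      show "norm (of_real C * indicator (cball 0 R) x :: complex) \<le> \<bar>C\<bar> * indicator (cball 0 R) x" for x :: "real ^ 'n"
        by (simp add: norm_mult indicator_def)
    qed measurable
    have le: "AE x in lebesgue. norm (h x * F i x) \<le> ?w x" for i
    proof (rule AE_I2)
      fix x
      have "norm (F i x) \<le> norm (of_real C * indicator (cball 0 R) x :: complex)"
        using F(4)[of i x] by (cases "x \<in> cball 0 R") (auto simp: norm_mult simp del: mem_cball)
      then show "norm (h x * F i x) \<le> ?w x" unfolding norm_mult[of "h x"] by (rule mult_left_mono) simp
    qed
    have lim: "AE x in lebesgue. (\<lambda>i. h x * F i x) \<longlonglongrightarrow> h x * f x"
      using F(5) by eventually_elim (intro tendsto_intros)
    have "integrable lebesgue (\<lambda>x. h x * f x)"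
      by (rule integrable_dominated_convergence[OF _ _ w lim le]) measurable
    moreover have "(\<lambda>i. LINT x|lebesgue. h x * F i x) \<longlonglongrightarrow> (LINT x|lebesgue. h x * f x)"
      by (rule integral_dominated_convergence[OF _ _ w lim le]) measurable
    ultimately show "integrable lebesgue (\<lambda>x. h x * f x) \<and> (LINT x|lebesgue. h x * f x) = 0"
      using F(1) by (simp add: LIMSEQ_const_iff)
  qed
  then show "(LINT x|lebesgue. h x * f x) = 0" by simp
qed

section \<open>Pointwise sequence norms and Riesz representation\<close>

definition lqn :: "real \<Rightarrow> (nat \<Rightarrow> 'a \<Rightarrow> complex) \<Rightarrow> 'a \<Rightarrow> real" where
  "lqn q f x = (\<Sum>j. norm (f j x) powr q) powr (1 / q)"

lemma lq_fun_eq_lqn: "lq_fun q f x = complex_of_real (lqn q f x)"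
  by (simp add: lq_fun_def lqn_def)

lemma lqn_nonneg [simp]: "0 \<le> lqn q f x"
  by (simp add: lqn_def)

lemma lqn_measurable [measurable]:
  assumes [measurable]: "\<And>j. f j \<in> borel_measurable M"
  shows "lqn q f \<in> borel_measurable M"
  unfolding lqn_def[abs_def] by measurable

lemma lqn_powr:
  assumes "1 \<le> q" "summable (\<lambda>j. norm (f j x) powr q)"
  shows "lqn q f x powr q = (\<Sum>j. norm (f j x) powr q)"
  using assms by (simp add: lqn_def powr_powr suminf_nonneg)

lemma norm_le_lqn:
  assumes "1 \<le> q" "summable (\<lambda>j. norm (f j x) powr q)"
  shows "norm (f j x) \<le> lqn q f x"
proof -
  have "norm (f j x) powr q \<le> (\<Sum>j. norm (f j x) powr q)"
    using sum_le_suminf[OF assms(2), of "{j}"] by simp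
  then have "(norm (f j x) powr q) powr (1 / q) \<le> lqn q f x"
    unfolding lqn_def using assms by (intro powr_mono2) auto
  then show ?thesis using assms by (simp add: powr_powr)
qed

lemma lqn_mono:
  assumes "1 \<le> q" "\<And>j. norm (f j x) \<le> norm (g j x)" "summable (\<lambda>j. norm (g j x) powr q)"
  shows "summable (\<lambda>j. norm (f j x) powr q)" "lqn q f x \<le> lqn q g x"
proof -
  have le: "norm (f j x) powr q \<le> norm (g j x) powr q" for j
    using assms by (intro powr_mono2) auto
  then show s: "summable (\<lambda>j. norm (f j x) powr q)"
    by (intro summable_comparison_test'[OF assms(3)]) simp
  show "lqn q f x \<le> lqn q g x"
    unfolding lqn_def using assms(1) suminf_le[OF le s assms(3)] suminf_nonneg[OF s]
    by (intro powr_mono2) auto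
qed

lemma lqn_add:
  assumes q: "1 \<le> q" and f: "summable (\<lambda>j. norm (f j x) powr q)" and g: "summable (\<lambda>j. norm (g j x) powr q)"
  shows "summable (\<lambda>j. norm (f j x + g j x) powr q)"
    and "lqn q (\<lambda>j x. f j x + g j x) x \<le> lqn q f x + lqn q g x"
proof -
  note M = Minkowski_series[OF q, of "\<lambda>j. norm (f j x)" "\<lambda>j. norm (g j x)", OF _ _ f g]
  have le: "norm (f j x + g j x) powr q \<le> (norm (f j x) + norm (g j x)) powr q" for j
    using q by (intro powr_mono2 norm_triangle_ineq) auto
  show s: "summable (\<lambda>j. norm (f j x + g j x) powr q)"
    using le by (intro summable_comparison_test'[OF M(1)]) auto
  have "lqn q (\<lambda>j x. f j x + g j x) x \<le> (\<Sum>j. (norm (f j x) + norm (g j x)) powr q) powr (1 / q)"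
    unfolding lqn_def using q suminf_le[OF le s M(1)] suminf_nonneg[OF s] by (intro powr_mono2) auto
  also have "\<dots> \<le> lqn q f x + lqn q g x" using M(2) by (simp add: lqn_def)
  finally show "lqn q (\<lambda>j x. f j x + g j x) x \<le> lqn q f x + lqn q g x" .
qed

lemma lqn_cmult:
  assumes q: "1 \<le> q" and f: "summable (\<lambda>j. norm (f j x) powr q)"
  shows "summable (\<lambda>j. norm (c * f j x) powr q)"
    and "lqn q (\<lambda>j x. c * f j x) x = norm c * lqn q f x"
proof -
  show "summable (\<lambda>j. norm (c * f j x) powr q)"
    using summable_mult[OF f, of "norm c powr q"] by (simp add: norm_mult powr_mult)
  have "(\<Sum>j. norm c powr q * norm (f j x) powr q) = norm c powr q * (\<Sum>j. norm (f j x) powr q)"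
    using f by (rule suminf_mult)
  then show "lqn q (\<lambda>j x. c * f j x) x = norm c * lqn q f x"
    using q f by (simp add: lqn_def norm_mult powr_mult powr_powr suminf_nonneg)
qed

lemma lqn_finite:
  assumes "\<And>j. m \<le> j \<Longrightarrow> f j x = 0"
  shows "summable (\<lambda>j. norm (f j x) powr q)"
    and "lqn q f x = (\<Sum>j<m. norm (f j x) powr q) powr (1 / q)"
proof -
  have z: "j \<notin> {..<m} \<Longrightarrow> norm (f j x) powr q = 0" for j using assms by (simp add: not_less)
  show "summable (\<lambda>j. norm (f j x) powr q)" by (rule summable_finite[of "{..<m}"]) (use z in auto)
  show "lqn q f x = (\<Sum>j<m. norm (f j x) powr q) powr (1 / q)"
    unfolding lqn_def by (subst suminf_finite[of "{..<m}"]) (use z in auto)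
qed

lemma lqn_single:
  assumes "1 \<le> q"
  shows "summable (\<lambda>i. norm ((if i = j then \<phi> else (\<lambda>_. 0)) x) powr q)"
    and "lqn q (\<lambda>i. if i = j then \<phi> else (\<lambda>_. 0)) x = norm (\<phi> x)"
proof -
  let ?f = "\<lambda>i. if i = j then \<phi> else (\<lambda>_. 0 :: complex)"
  note F = lqn_finite[of "Suc j" ?f x q]
  show "summable (\<lambda>i. norm (?f i x) powr q)" by (rule F) auto
  have "lqn q ?f x = (\<Sum>i<Suc j. norm (?f i x) powr q) powr (1 / q)" by (rule F) auto
  also have "(\<Sum>i<Suc j. norm (?f i x) powr q) = norm (\<phi> x) powr q" by simp
  finally show "lqn q ?f x = norm (\<phi> x)" using assms by (simp add: powr_powr)
qed

lemma lqn_Hoelder: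
  assumes q: "1 < q" "1 / q + 1 / q' = 1"
    and f: "summable (\<lambda>j. norm (f j x) powr q)" and g: "summable (\<lambda>j. norm (g j x) powr q')"
  shows "summable (\<lambda>j. norm (g j x * f j x))"
    and "(\<Sum>j. norm (g j x * f j x)) \<le> lqn q' g x * lqn q f x"
  using Hoelder_series[OF q, of "\<lambda>j. norm (f j x)" "\<lambda>j. norm (g j x)", OF _ _ f g]
  by (simp_all add: lqn_def norm_mult mult.commute)


section \<open>Lebesgue norms of real functions over a set, and bounded finite sequences\<close>

definition Lpr :: "real \<Rightarrow> 'a::euclidean_space set \<Rightarrow> ('a \<Rightarrow> real) \<Rightarrow> real" where
  "Lpr p A F = (LINT x:A|lebesgue. F x powr p) powr (1 / p)"

lemma Lp_norm_on_eq_Lpr: "Lp_norm_on p A f = Lpr p A (\<lambda>x. norm (f x))"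
  by (simp add: Lp_norm_on_def Lpr_def)

lemma Lp_norm_on_lq_fun: "Lp_norm_on p A (lq_fun q f) = Lpr p A (lqn q f)"
  by (simp add: Lp_norm_on_eq_Lpr lq_fun_eq_lqn)

lemma Lpr_nonneg [simp]: "0 \<le> Lpr p A F"
  by (simp add: Lpr_def)

lemma Lpr_mono:
  assumes p: "0 < p" and A[measurable]: "A \<in> sets lebesgue" and F[measurable]: "F \<in> borel_measurable lebesgue"
    and G: "set_integrable lebesgue A (\<lambda>x. G x powr p)"
    and le: "AE x in lebesgue. x \<in> A \<longrightarrow> 0 \<le> F x \<and> F x \<le> G x"
  shows "set_integrable lebesgue A (\<lambda>x. F x powr p)" "Lpr p A F \<le> Lpr p A G"
proof -
  have le': "AE x in lebesgue. indicator A x *\<^sub>R F x powr p \<le> indicator A x *\<^sub>R G x powr p"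
    using le by eventually_elim (use p in \<open>auto simp: indicator_def intro!: powr_mono2\<close>)
  show s: "set_integrable lebesgue A (\<lambda>x. F x powr p)"
    unfolding set_integrable_def
  proof (rule Bochner_Integration.integrable_bound[OF G[unfolded set_integrable_def]])
    show "AE x in lebesgue. norm (indicator A x *\<^sub>R F x powr p) \<le> norm (indicator A x *\<^sub>R G x powr p)"
      using le' by eventually_elim (simp add: abs_mult)
  qed measurable
  show "Lpr p A F \<le> Lpr p A G"
    unfolding Lpr_def set_lebesgue_integral_def
    using p le' s G unfolding set_integrable_def
    by (intro powr_mono2 integral_mono_AE integral_nonneg_AE) auto
qed

lemma Lpr_triangle:
  assumes p: "1 \<le> p" and A[measurable]: "A \<in> sets lebesgue"
    and [measurable]: "F \<in> borel_measurable lebesgue" "G \<in> borel_measurable lebesgue" "H \<in> borel_measurable lebesgue"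
    and iF: "set_integrable lebesgue A (\<lambda>x. F x powr p)" and iG: "set_integrable lebesgue A (\<lambda>x. G x powr p)"
    and nn: "\<And>x. 0 \<le> F x" "\<And>x. 0 \<le> G x"
    and le: "AE x in lebesgue. x \<in> A \<longrightarrow> 0 \<le> H x \<and> H x \<le> F x + G x"
  shows "set_integrable lebesgue A (\<lambda>x. H x powr p)" "Lpr p A H \<le> Lpr p A F + Lpr p A G"
proof -
  have e: "(indicator A x * F x) powr p = indicator A x *\<^sub>R F x powr p" for F :: "'a \<Rightarrow> real" and x
    using p by (simp add: indicator_def)
  have e2: "(indicator A x * F x + indicator A x * G x) powr p = indicator A x *\<^sub>R (F x + G x) powr p" for x
    using p by (simp add: indicator_def)
  note M = Minkowski_integral[OF p, of "\<lambda>x. indicator A x * F x" lebesgue "\<lambda>x. indicator A x * G x", unfolded e e2]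
  have "set_integrable lebesgue A (\<lambda>x. (F x + G x) powr p)" 
    using M(1) nn iF iG unfolding set_integrable_def by simp
  note H = Lpr_mono[OF _ A _ this, of H]
  show "set_integrable lebesgue A (\<lambda>x. H x powr p)" using H(1) le p by simp
  have "Lpr p A H \<le> Lpr p A (\<lambda>x. F x + G x)" using H(2) le p by simp
  also have "\<dots> \<le> Lpr p A F + Lpr p A G"
    using M(2) nn iF iG unfolding set_integrable_def Lpr_def set_lebesgue_integral_def by simp
  finally show "Lpr p A H \<le> Lpr p A F + Lpr p A G" .
qed

lemma Lpr_cmult:
  assumes "p \<noteq> 0" "0 \<le> c"
  shows "Lpr p A (\<lambda>x. c * F x) = c * Lpr p A F"
  using assms
  by (simp add: Lpr_def powr_mult powr_powr set_lebesgue_integral_def integral_nonneg_AE mult.left_commute[of "indicator _ _"])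

lemma Lpr_cong:
  assumes "\<And>x. x \<in> A \<Longrightarrow> F x = G x"
  shows "Lpr p A F = Lpr p A G"
  unfolding Lpr_def set_lebesgue_integral_def
  by (intro arg_cong2[where f = "(powr)"] Bochner_Integration.integral_cong) (auto simp: assms indicator_def)

lemma set_integrable_bounded_powr:
  assumes A: "A \<in> lmeasurable" and F: "F \<in> borel_measurable lebesgue" and p: "0 \<le> p"
    and bd: "\<And>x. x \<in> A \<Longrightarrow> \<bar>F x\<bar> \<le> C" and nn: "\<And>x. x \<in> A \<Longrightarrow> 0 \<le> F x"
  shows "set_integrable lebesgue A (\<lambda>x. F x powr p :: real)"
  unfolding set_integrable_def
proof (rule Bochner_Integration.integrable_bound)
  note [measurable] = F fmeasurableD[OF A]
  show "integrable lebesgue (\<lambda>x. C powr p * indicator A x)"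
    using A by (intro integrable_mult_right) (auto simp: fmeasurable_def)
  have "F x powr p \<le> C powr p" if "x \<in> A" for x
    using bd[OF that] nn[OF that] p by (intro powr_mono2) auto
  then show "AE x in lebesgue. norm (indicator A x *\<^sub>R F x powr p) \<le> norm (C powr p * indicator A x)"
    by (auto simp: indicator_def)
  show "(\<lambda>x. indicator A x *\<^sub>R F x powr p) \<in> borel_measurable lebesgue" by measurable
qed

text \<open>For such sequences the ell_q norm converges at every point and is bounded. Cell norms
  are then finite and subadditive without exceptional null sets, and members can be split into
  finitely many bounded components.\<close>

definition bfin :: "(nat \<Rightarrow> 'a::euclidean_space \<Rightarrow> complex) set" where
  "bfin = {f. (\<forall>j. f j \<in> borel_measurable lebesgue) \<and> (\<exists>C. \<forall>j x. norm (f j x) \<le> C) \<and>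
     (\<exists>m. \<forall>j\<ge>m. f j = (\<lambda>_. 0))}"

lemma bfinE:
  assumes "f \<in> bfin"
  obtains C m where "\<And>j. f j \<in> borel_measurable lebesgue" "\<And>j x. norm (f j x) \<le> C"
    "\<And>j. m \<le> j \<Longrightarrow> f j = (\<lambda>_. 0)" "0 \<le> C"
proof -
  obtain C m where C: "\<And>j. f j \<in> borel_measurable lebesgue" "\<And>j x. norm (f j x) \<le> C"
    "\<And>j. m \<le> j \<Longrightarrow> f j = (\<lambda>_. 0)"
    using assms unfolding bfin_def by blast
  then show thesis using that order_trans[OF norm_ge_zero C(2)] by blast
qed

lemma bfin_measurable: "f \<in> bfin \<Longrightarrow> f j \<in> borel_measurable lebesgue"
  by (auto simp: bfin_def)

lemma bfin_summable:
  assumes "f \<in> bfin"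
  shows "summable (\<lambda>j. norm (f j x) powr q)"
proof -
  obtain m where "\<And>j. m \<le> j \<Longrightarrow> f j = (\<lambda>_. 0)" using assms by (metis bfinE)
  then show ?thesis by (intro lqn_finite[of m]) auto
qed

lemma bfin_lqn_bounded:
  assumes "f \<in> bfin" "1 \<le> q"
  shows "\<exists>C. \<forall>x. lqn q f x \<le> C"
proof -
  obtain C m where C: "\<And>j x. norm (f j x) \<le> C" "\<And>j. m \<le> j \<Longrightarrow> f j = (\<lambda>_. 0)"
    using assms by (metis bfinE)
  have "(\<Sum>j<m. norm (f j x) powr q) \<le> (\<Sum>j<m. C powr q)" for x
    using assms(2) C(1) by (intro sum_mono powr_mono2) auto
  then have "lqn q f x \<le> (\<Sum>j<m. C powr q) powr (1 / q)" for x
    using assms(2) C(2) by (subst lqn_finite(2)[of m]) (auto intro!: powr_mono2 sum_nonneg simp del: sum_constant)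
  then show ?thesis by blast
qed

lemma bfin_add: 
  assumes "f \<in> bfin" "g \<in> bfin"
  shows "(\<lambda>j x. f j x + g j x) \<in> bfin"
proof -
  obtain C m where f: "\<And>j. f j \<in> borel_measurable lebesgue" "\<And>j x. norm (f j x) \<le> C" "\<And>j. m \<le> j \<Longrightarrow> f j = (\<lambda>_. 0)"
    using assms(1) by (metis bfinE)
  obtain D l where g: "\<And>j. g j \<in> borel_measurable lebesgue" "\<And>j x. norm (g j x) \<le> D" "\<And>j. l \<le> j \<Longrightarrow> g j = (\<lambda>_. 0)"
    using assms(2) by (metis bfinE)
  note [measurable] = f(1) g(1)
  have "norm (f j x + g j x) \<le> C + D" for j x
    using norm_triangle_ineq[of "f j x" "g j x"] f(2)[of j x] g(2)[of j x] by simp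
  moreover have "\<forall>j\<ge>max m l. (\<lambda>x. f j x + g j x) = (\<lambda>_. 0)" using f(3) g(3) by simp
  moreover have "(\<lambda>x. f j x + g j x) \<in> borel_measurable lebesgue" for j by measurable
  ultimately show ?thesis unfolding bfin_def
    by (intro CollectI conjI allI exI[of _ "C + D"] exI[of _ "max m l"]) blast+
qed

lemma bfin_cmult:
  assumes "f \<in> bfin"
  shows "(\<lambda>j x. c * f j x) \<in> bfin"
proof -
  obtain C m where f: "\<And>j. f j \<in> borel_measurable lebesgue" "\<And>j x. norm (f j x) \<le> C" "\<And>j. m \<le> j \<Longrightarrow> f j = (\<lambda>_. 0)"
    using assms by (metis bfinE)
  note [measurable] = f(1)
  have "norm (c * f j x) \<le> norm c * C" for j x
    unfolding norm_mult using f(2) by (intro mult_left_mono) auto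
  moreover have "\<forall>j\<ge>m. (\<lambda>x. c * f j x) = (\<lambda>_. 0)" using f(3) by simp
  moreover have "(\<lambda>x. c * f j x) \<in> borel_measurable lebesgue" for j by measurable
  ultimately show ?thesis unfolding bfin_def
    by (intro CollectI conjI allI exI[of _ "norm c * C"] exI[of _ m]) blast+
qed

lemma bfin_single:
  assumes "\<phi> \<in> borel_measurable lebesgue" "\<And>x. norm (\<phi> x) \<le> C"
  shows "(\<lambda>i. if i = j then \<phi> else (\<lambda>_. 0)) \<in> bfin"
proof -
  have "0 \<le> C" using order_trans[OF norm_ge_zero assms(2)] .
  then show ?thesis unfolding bfin_def using assms
    by (intro CollectI conjI allI exI[of _ C] exI[of _ "Suc j"]) auto
qed

text \<open>The cone of pairs (\<iota> f, G f) is linear. Lowering \<open>P\<close> along it forces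
  every linear functional below the result to be at least \<open>G f\<close> at \<iota> f; the same
  for - f gives equality.\<close>

lemma sublinear_extension:
  fixes P :: "'v::real_vector \<Rightarrow> real" and \<iota> :: "'u::real_vector \<Rightarrow> 'v"
  assumes W: "subspace W" and P: "sublinear_on W P" and B: "subspace B"
    and \<iota>W: "\<And>f. f \<in> B \<Longrightarrow> \<iota> f \<in> W"
    and \<iota>add: "\<And>f g. \<iota> (f + g) = \<iota> f + \<iota> g" and \<iota>scale: "\<And>t f. \<iota> (t *\<^sub>R f) = t *\<^sub>R \<iota> f"
    and Gadd: "\<And>f g. f \<in> B \<Longrightarrow> g \<in> B \<Longrightarrow> G (f + g) = G f + G g"
    and Gscale: "\<And>t f. f \<in> B \<Longrightarrow> G (t *\<^sub>R f) = t * G f"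
    and GP: "\<And>f. f \<in> B \<Longrightarrow> G f \<le> P (\<iota> f)"
  obtains L where "\<And>x. x \<in> W \<Longrightarrow> L x \<le> P x"
    "\<And>x y. x \<in> W \<Longrightarrow> y \<in> W \<Longrightarrow> L (x + y) = L x + L y"
    "\<And>t x. x \<in> W \<Longrightarrow> L (t *\<^sub>R x) = t * L x"
    "\<And>f. f \<in> B \<Longrightarrow> L (\<iota> f) = G f"
proof -
  let ?K = "{(\<iota> f, G f) | f. f \<in> B}"
  have K1: "z \<in> W \<and> s \<le> P z" if "(z, s) \<in> ?K" for z s
    using that \<iota>W GP by auto
  have zero: "\<iota> 0 = 0" "G 0 = 0"
    using \<iota>scale[of 0 0] Gscale[of 0 0] subspace_0[OF B] by simp_all
  then have K2: "(0, 0) \<in> ?K" using subspace_0[OF B] by force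
  have K3: "(a + b, s + t) \<in> ?K" if "(a, s) \<in> ?K" "(b, t) \<in> ?K" for a s b t
  proof -
    from that obtain f g where "f \<in> B" "a = \<iota> f" "s = G f" "g \<in> B" "b = \<iota> g" "t = G g" by auto
    then show ?thesis using \<iota>add Gadd subspace_add[OF B]
      by (intro CollectI exI[of _ "f + g"]) auto
  qed
  have K4: "(c *\<^sub>R a, c * s) \<in> ?K" if "(a, s) \<in> ?K" "c > 0" for a s and c :: real
  proof -
    from that obtain f where "f \<in> B" "a = \<iota> f" "s = G f" by auto
    then show ?thesis using \<iota>scale Gscale subspace_scale[OF B]
      by (intro CollectI exI[of _ "c *\<^sub>R f"]) auto
  qed
  let ?R = "\<lambda>x. INF (y, s)\<in>?K. P (x + y) - s"
  have R1: "sublinear_on W ?R"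
    by (rule sublinear_on_cone_inf(1)[OF W P]) (fact K1 K2 K3 K4)+
  have R2: "?R z \<le> P (z + v) - s" if "z \<in> W" "(v, s) \<in> ?K" for z v s
    by (rule sublinear_on_cone_inf(2)[OF W P]) (fact K1 K2 K3 K4 that)+
  obtain L where L: "\<And>x. x \<in> W \<Longrightarrow> L x \<le> ?R x"
    "\<And>x y. x \<in> W \<Longrightarrow> y \<in> W \<Longrightarrow> L (x + y) = L x + L y"
    "\<And>t x. x \<in> W \<Longrightarrow> L (t *\<^sub>R x) = t * L x"
    by (rule hahn_banach_sublinear[OF W R1]) blast
  have ge: "G f \<le> L (\<iota> f)" if f: "f \<in> B" for f
  proof -
    have m: "(-1) *\<^sub>R \<iota> f \<in> W" using \<iota>W[OF f] by (intro subspace_scale[OF W])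
    have "L ((-1) *\<^sub>R \<iota> f) \<le> ?R ((-1) *\<^sub>R \<iota> f)" by (rule L(1)[OF m])
    also have "\<dots> \<le> P ((-1) *\<^sub>R \<iota> f + \<iota> f) - G f" using f by (intro R2[OF m]) auto
    also have "P ((-1) *\<^sub>R \<iota> f + \<iota> f) = 0" using sublinear_on_zero[OF W P] by simp
    finally show ?thesis using L(3)[OF \<iota>W[OF f], of "-1"] by simp
  qed
  show thesis
  proof
    fix x assume x: "x \<in> W"
    show "L x \<le> P x" using L(1)[OF x] R2[OF x K2] by simp
  next
    fix f assume f: "f \<in> B"
    have "G ((-1) *\<^sub>R f) \<le> L (\<iota> ((-1) *\<^sub>R f))" using f by (intro ge subspace_scale[OF B])
    then have "L (\<iota> f) \<le> G f" using Gscale[OF f, of "-1"] \<iota>scale[of "-1" f] L(3)[OF \<iota>W[OF f], of "-1"] by simp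
    then show "L (\<iota> f) = G f" using ge[OF f] by simp
  qed (use L in auto)
qed

text \<open>A real-linear functional on complex functions is determined by its values on indicators
  and on \<i> times indicators. Both are additive set functions on \<open>Q\<close>, dominated by a
  power of the measure, and so have densities. Staying with bounded functions lets dominated
  convergence on the set \<open>Q\<close> of finite measure carry the formula from indicators to all
  of them.\<close>

lemma Riesz_representation_bounded:
  fixes \<Lambda> :: "('a::euclidean_space \<Rightarrow> complex) \<Rightarrow> real"
  assumes p: "1 \<le> p" and Q: "Q \<in> lmeasurable" and c: "0 \<le> c"
    and add: "\<And>f g. f \<in> borel_measurable lebesgue \<Longrightarrow> bounded (range f) \<Longrightarrow>
      g \<in> borel_measurable lebesgue \<Longrightarrow> bounded (range g) \<Longrightarrow> \<Lambda> (\<lambda>x. f x + g x) = \<Lambda> f + \<Lambda> g"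
    and scale: "\<And>f t. f \<in> borel_measurable lebesgue \<Longrightarrow> bounded (range f) \<Longrightarrow>
      \<Lambda> (\<lambda>x. of_real t * f x) = t * \<Lambda> f"
    and bound: "\<And>f. f \<in> borel_measurable lebesgue \<Longrightarrow> bounded (range f) \<Longrightarrow>
      \<bar>\<Lambda> f\<bar> \<le> c * Lpr p Q (\<lambda>x. norm (f x))"
  obtains g where "g \<in> borel_measurable lebesgue" "integrable lebesgue g" "\<And>x. x \<notin> Q \<Longrightarrow> g x = 0"
    "\<And>f. f \<in> borel_measurable lebesgue \<Longrightarrow> bounded (range f) \<Longrightarrow> \<Lambda> f = (LINT x|lebesgue. Re (g x * f x))"
proof -
  have Qs[measurable]: "Q \<in> sets lebesgue" using Q by auto
  have bind: "bounded (range (\<lambda>x. d * indicator A x))" for d :: complex and A :: "'a set"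
    by (rule boundedI[of _ "norm d"]) (auto simp: indicator_def)
  have density: "\<exists>h. integrable (lebesgue_on Q) h \<and>
      (\<forall>A\<in>sets lebesgue. A \<subseteq> Q \<longrightarrow> \<Lambda> (\<lambda>x. d * indicator A x) = (LINT x:A|lebesgue_on Q. h x))"
    if d: "norm d = 1" for d
  proof -
    have sets: "A \<in> sets (lebesgue_on Q) \<longleftrightarrow> A \<in> sets lebesgue \<and> A \<subseteq> Q" for A
      by (auto simp: sets_restrict_space_iff)
    obtain h :: "'a \<Rightarrow> real" where h: "integrable (lebesgue_on Q) h"
      "\<And>A. A \<in> sets (lebesgue_on Q) \<Longrightarrow> \<Lambda> (\<lambda>x. d * indicator A x) = (LINT x:A|lebesgue_on Q. h x)"
    proof (rule additive_set_function_density[of "lebesgue_on Q" "1 / p" "\<lambda>A. \<Lambda> (\<lambda>x. d * indicator A x)" c])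
      show "finite_measure (lebesgue_on Q)" using Q by (rule finite_measure_lebesgue_on)
      show "0 < 1 / p" using p by simp
      fix A assume A: "A \<in> sets (lebesgue_on Q)"
      then have [measurable]: "A \<in> sets lebesgue" and AQ: "A \<subseteq> Q" using sets by auto
      \<comment> \<open>With \<open>norm d = 1\<close> this norm is exactly the power 1 / p of the
        measure, the bound that yields a density.\<close>
      have "Lpr p Q (\<lambda>x. norm (d * indicator A x)) = (LINT x:Q|lebesgue. indicator A x) powr (1 / p)"
        unfolding Lpr_def set_lebesgue_integral_def using p d
        by (intro arg_cong2[where f = "(powr)"] Bochner_Integration.integral_cong)
          (auto simp: indicator_def norm_mult)
      also have "(LINT x:Q|lebesgue. indicator A x) = (LINT x|lebesgue. indicator A x :: real)"
        unfolding set_lebesgue_integral_def using AQ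
        by (intro Bochner_Integration.integral_cong) (auto simp: indicator_def)
      also have "\<dots> = measure (lebesgue_on Q) A"
        using AQ by (simp add: measure_restrict_space)
      finally have "Lpr p Q (\<lambda>x. norm (d * indicator A x)) = measure (lebesgue_on Q) A powr (1 / p)" .
      then show "\<bar>\<Lambda> (\<lambda>x. d * indicator A x)\<bar> \<le> c * measure (lebesgue_on Q) A powr (1 / p)"
        using bound[OF _ bind, of d A] by simp
    next
      fix A B assume AB: "A \<in> sets (lebesgue_on Q)" "B \<in> sets (lebesgue_on Q)" "A \<inter> B = {}"
      then have [measurable]: "A \<in> sets lebesgue" "B \<in> sets lebesgue" using sets by auto
      have "(\<lambda>x. d * indicator (A \<union> B) x) = (\<lambda>x. d * indicator A x + d * indicator B x)"
        using AB(3) by (auto simp: indicator_def fun_eq_iff)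
      then show "\<Lambda> (\<lambda>x. d * indicator (A \<union> B) x) = \<Lambda> (\<lambda>x. d * indicator A x) + \<Lambda> (\<lambda>x. d * indicator B x)"
        using add[OF _ bind[of d A] _ bind[of d B]] by simp
    qed blast
    then show ?thesis using sets by blast
  qed
  obtain g1 where g1: "integrable (lebesgue_on Q) g1"
    "\<And>A. A \<in> sets lebesgue \<Longrightarrow> A \<subseteq> Q \<Longrightarrow> \<Lambda> (\<lambda>x. 1 * indicator A x) = (LINT x:A|lebesgue_on Q. g1 x)"
    using density[of 1] by auto
  obtain g2 where g2: "integrable (lebesgue_on Q) g2"
    "\<And>A. A \<in> sets lebesgue \<Longrightarrow> A \<subseteq> Q \<Longrightarrow> \<Lambda> (\<lambda>x. \<i> * indicator A x) = (LINT x:A|lebesgue_on Q. g2 x)"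
    using density[of \<i>] by auto
  define h1 h2 where "h1 x = indicator Q x * g1 x" and "h2 x = indicator Q x * g2 x" for x
  have int: "integrable lebesgue h1" "integrable lebesgue h2"
    using g1(1) g2(1) by (simp_all add: integrable_restrict_space h1_def[abs_def] h2_def[abs_def] set_integrable_def)
  then have [measurable]: "h1 \<in> borel_measurable lebesgue" "h2 \<in> borel_measurable lebesgue" by auto
  have h: "(LINT x:A|lebesgue_on Q. g1 x) = (LINT x|lebesgue. h1 x * indicator A x)"
    "(LINT x:A|lebesgue_on Q. g2 x) = (LINT x|lebesgue. h2 x * indicator A x)" for A
    by (simp_all add: set_lebesgue_integral_def integral_restrict_space h1_def h2_def mult_ac)
  \<comment> \<open>The sign is such that the real part of g * d is Re d * h1 + Im d * h2.\<close>
  define g where "g x = Complex (h1 x) (- h2 x)" for x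
  have g_eq: "g = (\<lambda>x. of_real (h1 x) - \<i> * of_real (h2 x))"
    by (auto simp: g_def fun_eq_iff complex_eq_iff)
  have gint: "integrable lebesgue g" unfolding g_eq using int by simp
  then have [measurable]: "g \<in> borel_measurable lebesgue" by auto
  define S :: "('a \<Rightarrow> complex) set" where "S = {f. f \<in> borel_measurable lebesgue \<and> bounded (range f)}"
  have S_add: "(\<lambda>x. f x + g x) \<in> S" if "f \<in> S" "g \<in> S" for f g
    using that unfolding S_def by (auto intro!: bounded_plus_comp borel_measurable_add)
  have S_cmult: "(\<lambda>x. d * f x) \<in> S" if fS: "f \<in> S" for f d
  proof -
    obtain C where "\<And>x. norm (f x) \<le> C" using fS by (auto simp: S_def bounded_iff)
    then have "bounded (range (\<lambda>x. d * f x))"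
      by (intro boundedI[of _ "norm d * C"]) (auto simp: norm_mult intro!: mult_left_mono)
    moreover have "f \<in> borel_measurable lebesgue" using that by (simp add: S_def)
    ultimately show ?thesis by (simp add: S_def)
  qed
  have gf: "integrable lebesgue (\<lambda>x. g x * f x)" if fS: "f \<in> S" for f
  proof -
    obtain C where C: "\<And>x. norm (f x) \<le> C" using fS unfolding S_def bounded_iff by auto
    have "f \<in> borel_measurable lebesgue" using that by (simp add: S_def)
    then show ?thesis
    proof (intro Bochner_Integration.integrable_bound[OF integrable_mult_right[OF gint, of "of_real C"]])
      assume [measurable]: "f \<in> borel_measurable lebesgue"
      show "(\<lambda>x. g x * f x) \<in> borel_measurable lebesgue" by measurable
      have "norm (g x * f x) \<le> norm (of_real C * g x)" for x
        using mult_left_mono[OF order_trans[OF C[of x] abs_ge_self], of "norm (g x)"]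
        by (simp add: norm_mult mult.commute)
      then show "AE x in lebesgue. norm (g x * f x) \<le> norm (of_real C * g x)" by simp
    qed
  qed
  have ind: "\<Lambda> (\<lambda>x. d * indicator A x) = (LINT x|lebesgue. Re (g x * (d * indicator A x)))"
    if A[measurable]: "A \<in> sets lebesgue" for d A
  proof -
    let ?A = "A \<inter> Q"
    have S: "(\<lambda>x. e * indicator B x) \<in> S" if "B \<in> sets lebesgue" for e B
      using bind that by (simp add: S_def)
    \<comment> \<open>The part of \<open>A\<close> outside \<open>Q\<close> has norm 0 over
      \<open>Q\<close>, so the bound makes the functional vanish on it.\<close>
    have "Lpr p Q (\<lambda>x. norm (d * indicator (A - Q) x)) = Lpr p Q (\<lambda>x. 0)"
      by (rule Lpr_cong) (simp add: indicator_def)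
    then have "\<Lambda> (\<lambda>x. d * indicator (A - Q) x) = 0"
      using bound[OF _ bind, of d "A - Q"] p by (simp add: Lpr_def set_lebesgue_integral_def)
    moreover have "(\<lambda>x. d * indicator A x) = (\<lambda>x. d * indicator ?A x + d * indicator (A - Q) x)"
      by (auto simp: indicator_def fun_eq_iff)
    ultimately have "\<Lambda> (\<lambda>x. d * indicator A x) = \<Lambda> (\<lambda>x. d * indicator ?A x)"
      using add[OF _ bind[of d ?A] _ bind[of d "A - Q"]] by simp
    also have "(\<lambda>x. d * indicator ?A x) = (\<lambda>x. of_real (Re d) * (1 * indicator ?A x) + of_real (Im d) * (\<i> * indicator ?A x))"
      by (auto simp: indicator_def fun_eq_iff complex_eq_iff)
    also have "\<Lambda> \<dots> = Re d * \<Lambda> (\<lambda>x. 1 * indicator ?A x) + Im d * \<Lambda> (\<lambda>x. \<i> * indicator ?A x)"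
      using S_cmult[OF S[of ?A 1], of "of_real (Re d)"] S_cmult[OF S[of ?A \<i>], of "of_real (Im d)"] S[of ?A 1] S[of ?A \<i>]
      unfolding S_def by (subst add) (auto simp: scale simp del: mult_1)
    also have "\<dots> = Re d * (LINT x|lebesgue. h1 x * indicator ?A x) + Im d * (LINT x|lebesgue. h2 x * indicator ?A x)"
      using g1(2)[of ?A] g2(2)[of ?A] h by simp
    also have "\<dots> = (LINT x|lebesgue. Re d * (h1 x * indicator ?A x) + Im d * (h2 x * indicator ?A x))"
    proof -
      have "integrable lebesgue (\<lambda>x. h1 x * indicator ?A x)" "integrable lebesgue (\<lambda>x. h2 x * indicator ?A x)"
        using integrable_mult_indicator[OF _ int(1), of ?A] integrable_mult_indicator[OF _ int(2), of ?A]
        by (simp_all add: mult.commute)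
      then show ?thesis by simp
    qed
    also have "\<dots> = (LINT x|lebesgue. Re (g x * (d * indicator A x)))"
      by (intro Bochner_Integration.integral_cong) (auto simp: g_def h1_def h2_def indicator_def algebra_simps)
    finally show ?thesis .
  qed
  \<comment> \<open>The complex factor \<open>d\<close> is quantified inside the claim: the
    functional is only real-linear, so complex multiples cannot be pulled out in the
    induction.\<close>
  have main: "f \<in> S \<and> (\<forall>d. \<Lambda> (\<lambda>x. d * f x) = (LINT x|lebesgue. Re (g x * (d * f x))))"
    if f: "f \<in> borel_measurable lebesgue" "\<And>x. norm (f x) \<le> C" for f C
  proof (rule bounded_measurable_induct[OF f(1)])
    show "norm (f x) \<le> C" for x by fact
    show "indicator A \<in> S \<and> (\<forall>d. \<Lambda> (\<lambda>x. d * indicator A x) = (LINT x|lebesgue. Re (g x * (d * indicator A x))))"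
      if "A \<in> sets lebesgue" for A
      using ind[OF that] bind[of 1 A] that by (auto simp: S_def)
  next
    fix f c
    assume f: "f \<in> S \<and> (\<forall>d. \<Lambda> (\<lambda>x. d * f x) = (LINT x|lebesgue. Re (g x * (d * f x))))"
    have "\<Lambda> (\<lambda>x. d * (c * f x)) = (LINT x|lebesgue. Re (g x * (d * (c * f x))))" for d
      using f[THEN conjunct2, rule_format, of "d * c"] by (simp only: mult.assoc)
    then show "(\<lambda>x. c * f x) \<in> S \<and> (\<forall>d. \<Lambda> (\<lambda>x. d * (c * f x)) = (LINT x|lebesgue. Re (g x * (d * (c * f x)))))"
      using S_cmult f by blast
  next
    fix f h
    assume f: "f \<in> S \<and> (\<forall>d. \<Lambda> (\<lambda>x. d * f x) = (LINT x|lebesgue. Re (g x * (d * f x))))"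
      and h: "h \<in> S \<and> (\<forall>d. \<Lambda> (\<lambda>x. d * h x) = (LINT x|lebesgue. Re (g x * (d * h x))))"
    have "\<Lambda> (\<lambda>x. d * (f x + h x)) = (LINT x|lebesgue. Re (g x * (d * (f x + h x))))" for d
    proof -
      have S: "(\<lambda>x. d * f x) \<in> S" "(\<lambda>x. d * h x) \<in> S" using f h S_cmult by auto
      then have "\<Lambda> (\<lambda>x. d * f x + d * h x) = \<Lambda> (\<lambda>x. d * f x) + \<Lambda> (\<lambda>x. d * h x)"
        unfolding S_def by (intro add) auto
      also have "\<dots> = (LINT x|lebesgue. Re (g x * (d * f x))) + (LINT x|lebesgue. Re (g x * (d * h x)))"
        using f[THEN conjunct2, rule_format, of d] h[THEN conjunct2, rule_format, of d] by (simp only:)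
      also have "\<dots> = (LINT x|lebesgue. Re (g x * (d * f x)) + Re (g x * (d * h x)))"
        by (intro Bochner_Integration.integral_add[symmetric] integrable_Re gf S)
      finally show ?thesis by (simp only: distrib_left plus_complex.sel)
    qed
    then show "(\<lambda>x. f x + h x) \<in> S \<and> (\<forall>d. \<Lambda> (\<lambda>x. d * (f x + h x)) = (LINT x|lebesgue. Re (g x * (d * (f x + h x)))))"
      using f h S_add by blast
  next
    fix F f C
    assume F: "\<And>i. F i \<in> S \<and> (\<forall>d. \<Lambda> (\<lambda>x. d * F i x) = (LINT x|lebesgue. Re (g x * (d * F i x))))"
      and [measurable]: "\<And>i. F i \<in> borel_measurable lebesgue" "f \<in> borel_measurable lebesgue"
      and C: "\<And>i x. x \<in> space lebesgue \<Longrightarrow> norm (F i x) \<le> C"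
      and lim: "\<And>x. x \<in> space lebesgue \<Longrightarrow> (\<lambda>i. F i x) \<longlonglongrightarrow> f x"
    have fC: "norm (f x) \<le> C" for x
      using tendsto_upperbound[OF tendsto_norm[OF lim[of x]]] C by auto
    then have fS: "f \<in> S" by (auto simp: S_def bounded_iff)
    have "\<Lambda> (\<lambda>x. d * f x) = (LINT x|lebesgue. Re (g x * (d * f x)))" for d
    proof -
      have S: "(\<lambda>x. d * F i x) \<in> S" "(\<lambda>x. d * (F i x - f x)) \<in> S" "(\<lambda>x. d * f x) \<in> S" for i
      proof -
        have Fi: "F i \<in> S" using F by blast
        have "(\<lambda>x. F i x + (- 1) * f x) \<in> S" by (intro S_add[OF Fi] S_cmult fS)
        then show "(\<lambda>x. d * (F i x - f x)) \<in> S" using S_cmult[of "\<lambda>x. F i x + (- 1) * f x" d] by simp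
      qed (use F fS S_cmult in auto)
      have split: "\<Lambda> (\<lambda>x. d * F i x) = \<Lambda> (\<lambda>x. d * (F i x - f x)) + \<Lambda> (\<lambda>x. d * f x)" for i
        using add[of "\<lambda>x. d * (F i x - f x)" "\<lambda>x. d * f x"] S(2)[of i] S(3) by (simp add: S_def right_diff_distrib)
      \<comment> \<open>Convergence of the p-th means over \<open>Q\<close>, dominated by a constant
        on a set of finite measure; through the bound it gives continuity of the functional along
        the sequence.\<close>
      have lim1: "(\<lambda>i. LINT x:Q|lebesgue. norm (d * (F i x - f x)) powr p) \<longlonglongrightarrow> (LINT x|(lebesgue :: 'a measure). 0)"
        unfolding set_lebesgue_integral_def
      proof (rule integral_dominated_convergence[where w = "\<lambda>x. (norm d * (2 * C)) powr p * indicator Q x"])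
        show "integrable lebesgue (\<lambda>x. (norm d * (2 * C)) powr p * indicator Q x)"
          using Q by (intro integrable_mult_right) (auto simp: fmeasurable_def)
        show "AE x in lebesgue. (\<lambda>i. indicator Q x *\<^sub>R norm (d * (F i x - f x)) powr p) \<longlonglongrightarrow> 0"
        proof (rule AE_I2)
          fix x
          have "(\<lambda>i. norm (d * (F i x - f x)) powr p) \<longlonglongrightarrow> norm (d * (f x - f x)) powr p"
            using p lim[of x] by (intro tendsto_powr' tendsto_intros) auto
          then have "(\<lambda>i. indicator Q x * norm (d * (F i x - f x)) powr p) \<longlonglongrightarrow> indicator Q x * 0"
            by (intro tendsto_intros) simp
          then show "(\<lambda>i. indicator Q x *\<^sub>R norm (d * (F i x - f x)) powr p) \<longlonglongrightarrow> 0" by simp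
        qed
        fix i
        have "norm (d * (F i x - f x)) powr p \<le> (norm d * (2 * C)) powr p" for x
        proof -
          have "norm (F i x - f x) \<le> 2 * C"
            using norm_triangle_ineq4[of "F i x" "f x"] C[of x i] fC[of x] by simp
          then show ?thesis unfolding norm_mult using p by (intro powr_mono2 mult_left_mono) auto
        qed
        then show "AE x in lebesgue. norm (indicator Q x *\<^sub>R norm (d * (F i x - f x)) powr p)
            \<le> (norm d * (2 * C)) powr p * indicator Q x"
          by (auto simp: indicator_def)
      qed measurable
      have "(\<lambda>i. c * Lpr p Q (\<lambda>x. norm (d * (F i x - f x)))) \<longlonglongrightarrow> c * 0 powr (1 / p)"
        unfolding Lpr_def using lim1 p
        by (intro tendsto_mult tendsto_const tendsto_powr')
          (auto simp: set_lebesgue_integral_def intro!: always_eventually integral_nonneg_AE)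
      then have l0: "(\<lambda>i. c * Lpr p Q (\<lambda>x. norm (d * (F i x - f x)))) \<longlonglongrightarrow> 0" by simp
      have "(\<lambda>i. \<Lambda> (\<lambda>x. d * (F i x - f x))) \<longlonglongrightarrow> 0"
        by (rule Lim_null_comparison[OF _ l0]) (use bound S(2) in \<open>auto simp: S_def\<close>)
      then have "(\<lambda>i. \<Lambda> (\<lambda>x. d * F i x)) \<longlonglongrightarrow> 0 + \<Lambda> (\<lambda>x. d * f x)"
        unfolding split by (intro tendsto_intros)
      moreover have "(\<lambda>i. LINT x|lebesgue. Re (g x * (d * F i x))) \<longlonglongrightarrow> (LINT x|lebesgue. Re (g x * (d * f x)))"
      proof (rule integral_dominated_convergence[where w = "\<lambda>x. norm (g x * of_real (norm d * C))"])
        show "integrable lebesgue (\<lambda>x. norm (g x * of_real (norm d * C)))"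
          using gint by (intro integrable_norm integrable_mult_left)
        show "AE x in lebesgue. (\<lambda>i. Re (g x * (d * F i x))) \<longlonglongrightarrow> Re (g x * (d * f x))"
          using lim by (intro AE_I2 tendsto_intros) auto
        fix i
        have "\<bar>Re (g x * (d * F i x))\<bar> \<le> norm (g x * of_real (norm d * C))" for x
        proof -
          have "\<bar>Re (g x * (d * F i x))\<bar> \<le> norm (g x) * (norm d * norm (F i x))"
            using abs_Re_le_cmod[of "g x * (d * F i x)"] by (simp add: norm_mult)
          also have "\<dots> \<le> norm (g x) * (norm d * C)"
            using C by (intro mult_left_mono) auto
          also have "\<dots> \<le> norm (g x * of_real (norm d * C))"
            by (simp add: norm_mult abs_mult) (intro mult_left_mono abs_ge_self, auto)
          finally show ?thesis .
        qed
        then show "AE x in lebesgue. norm (Re (g x * (d * F i x))) \<le> norm (g x * of_real (norm d * C))" by simp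
      qed measurable
      ultimately show ?thesis using F LIMSEQ_unique by fastforce
    qed
    with fS show "f \<in> S \<and> (\<forall>d. \<Lambda> (\<lambda>x. d * f x) = (LINT x|lebesgue. Re (g x * (d * f x))))" by blast
  qed
  show thesis
  proof
    show "g \<in> borel_measurable lebesgue" "integrable lebesgue g" using gint by auto
    show "g x = 0" if "x \<notin> Q" for x using that by (simp add: g_def h1_def h2_def complex_eq_iff)
    fix f :: "'a \<Rightarrow> complex" assume f: "f \<in> borel_measurable lebesgue" "bounded (range f)"
    then obtain C where "\<And>x. norm (f x) \<le> C" by (auto simp: bounded_iff)
    from main[OF f(1) this] have "\<Lambda> (\<lambda>x. 1 * f x) = (LINT x|lebesgue. Re (g x * (1 * f x)))" by blast
    then show "\<Lambda> f = (LINT x|lebesgue. Re (g x * f x))" by simp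
  qed
qed

section \<open>Functionals on spaces normed by a supremum over cells\<close>

text \<open>Separates the functional analysis from the geometry of cubes: only finite measure of the
  cells and positivity of the weights enter. The enumerated dyadic cubes with the Morrey weights are
  the instance.\<close>

locale weighted_cells =
  fixes p p' q q' :: real and Q :: "nat \<Rightarrow> 'a::euclidean_space set" and w :: "nat \<Rightarrow> real"
  assumes p: "1 < p" "1 / p + 1 / p' = 1" and q: "1 < q" "1 / q + 1 / q' = 1"
    and Q: "\<And>k. Q k \<in> lmeasurable" and w: "\<And>k. 0 < w k"
begin

lemma p': "1 < p'" and q': "1 < q'"
  using conjugate_exponent(1) p q by auto

lemma Q_sets [measurable, simp]: "Q k \<in> sets lebesgue"
  using Q by auto

definition cell_norm :: "nat \<Rightarrow> (nat \<Rightarrow> 'a \<Rightarrow> complex) \<Rightarrow> real" where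
  "cell_norm k f = w k * Lpr p (Q k) (lqn q f)"

lemma bfin_set_integrable:
  assumes "f \<in> bfin" "1 \<le> r" "0 \<le> s"
  shows "set_integrable lebesgue (Q k) (\<lambda>x. lqn r f x powr s)"
proof -
  obtain C where "\<And>x. lqn r f x \<le> C" using bfin_lqn_bounded assms by blast
  then show ?thesis
    using assms bfin_measurable[OF assms(1)]
    by (intro set_integrable_bounded_powr[of _ _ _ C] Q) (auto intro!: lqn_measurable)
qed

lemma cell_norm_nonneg [simp]: "0 \<le> cell_norm k f"
  using w[of k] by (simp add: cell_norm_def)

lemma cell_norm_add:
  assumes f: "f \<in> bfin" and g: "g \<in> bfin"
  shows "cell_norm k (f + g) \<le> cell_norm k f + cell_norm k g"
proof -
  have eq: "f + g = (\<lambda>j x. f j x + g j x)" by (simp add: fun_eq_iff)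
  have fg: "f + g \<in> bfin" unfolding eq using f g by (rule bfin_add)
  have "Lpr p (Q k) (lqn q (f + g)) \<le> Lpr p (Q k) (lqn q f) + Lpr p (Q k) (lqn q g)"
  proof (rule Lpr_triangle)
    have m: "lqn q h \<in> borel_measurable lebesgue" if "h \<in> bfin" for h :: "nat \<Rightarrow> 'a \<Rightarrow> complex"
      using bfin_measurable[OF that] by (rule lqn_measurable)
    show "lqn q f \<in> borel_measurable lebesgue" "lqn q g \<in> borel_measurable lebesgue"
      "lqn q (f + g) \<in> borel_measurable lebesgue" by (rule m; fact)+
    show "set_integrable lebesgue (Q k) (\<lambda>x. lqn q f x powr p)"
      "set_integrable lebesgue (Q k) (\<lambda>x. lqn q g x powr p)"
      using p q by (intro bfin_set_integrable f g; simp)+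
    have "lqn q (f + g) x \<le> lqn q f x + lqn q g x" for x
      unfolding eq using q by (intro lqn_add(2) bfin_summable f g) simp
    then show "AE x in lebesgue. x \<in> Q k \<longrightarrow> 0 \<le> lqn q (f + g) x \<and> lqn q (f + g) x \<le> lqn q f x + lqn q g x"
      by simp
  qed (use p in simp_all)
  from mult_left_mono[OF this less_imp_le[OF w[of k]]]
  show ?thesis by (simp only: cell_norm_def distrib_left)
qed

lemma cell_norm_scale:
  assumes f: "f \<in> bfin"
  shows "cell_norm k (t *\<^sub>R f) = \<bar>t\<bar> * cell_norm k f"
proof -
  have eq: "t *\<^sub>R f = (\<lambda>j x. of_real t * f j x)" by (simp add: fun_eq_iff scaleR_conv_of_real)
  have "lqn q (t *\<^sub>R f) = (\<lambda>x. \<bar>t\<bar> * lqn q f x)"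
  proof
    fix x
    show "lqn q (t *\<^sub>R f) x = \<bar>t\<bar> * lqn q f x"
      unfolding eq using lqn_cmult(2)[of q f x "of_real t"] bfin_summable[OF f] q by simp
  qed
  then show ?thesis using p by (simp add: cell_norm_def Lpr_cmult)
qed

lemma cell_norm_eq_0:
  assumes "\<And>j x. x \<in> Q k \<Longrightarrow> f j x = 0"
  shows "cell_norm k f = 0"
proof -
  have "Lpr p (Q k) (lqn q f) = Lpr p (Q k) (\<lambda>x. 0)"
    by (rule Lpr_cong) (simp add: lqn_def assms)
  then show ?thesis using p by (simp add: cell_norm_def Lpr_def)
qed

text \<open>A part of the ell_\<infinity> sum of the weighted spaces L_p(ell_q, Q_k): one sequence
  for each cell, whose values off that cell do not enter the norm. Unlike a single sequence, a
  family may be changed on one cell independently of the overlapping ones.\<close>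

definition cell_families :: "(nat \<Rightarrow> nat \<Rightarrow> 'a \<Rightarrow> complex) set" where
  "cell_families = {F. (\<forall>k. F k \<in> bfin) \<and> bdd_above (range (\<lambda>k. cell_norm k (F k)))}"

definition family_norm :: "(nat \<Rightarrow> nat \<Rightarrow> 'a \<Rightarrow> complex) \<Rightarrow> real" where
  "family_norm F = (SUP k. cell_norm k (F k))"

lemma cell_familiesI:
  "(\<And>k. F k \<in> bfin) \<Longrightarrow> (\<And>k. cell_norm k (F k) \<le> D) \<Longrightarrow> F \<in> cell_families"
  unfolding cell_families_def by (intro CollectI conjI allI bdd_aboveI2)

lemma cell_norm_le: "F \<in> cell_families \<Longrightarrow> cell_norm k (F k) \<le> family_norm F"
  unfolding cell_families_def family_norm_def by (rule cSUP_upper) auto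

lemma family_norm_le: "(\<And>k. cell_norm k (F k) \<le> D) \<Longrightarrow> family_norm F \<le> D"
  unfolding family_norm_def by (rule cSUP_least) auto

lemma bfin_zero: "(\<lambda>j x. 0) \<in> bfin" "(0 :: nat \<Rightarrow> 'a \<Rightarrow> complex) \<in> bfin"
  by (auto simp: bfin_def zero_fun_def)

lemma bfin_plus: "f \<in> bfin \<Longrightarrow> g \<in> bfin \<Longrightarrow> f + g \<in> bfin"
  using bfin_add[of f g] by (simp add: plus_fun_def)

lemma bfin_scale: "f \<in> bfin \<Longrightarrow> t *\<^sub>R f \<in> bfin"
  using bfin_cmult[of f "of_real t"] by (simp add: scaleR_fun_def scaleR_conv_of_real)

lemma subspace_cell_families: "subspace cell_families"
proof (rule subspaceI)
  show "0 \<in> cell_families"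
    by (rule cell_familiesI[of _ 0]) (auto simp: bfin_zero cell_norm_eq_0)
  fix F G assume FG: "F \<in> cell_families" "G \<in> cell_families"
  show "F + G \<in> cell_families"
  proof (rule cell_familiesI)
    fix k
    have b: "F k \<in> bfin" "G k \<in> bfin" using FG by (auto simp: cell_families_def)
    then show "(F + G) k \<in> bfin" by (simp add: bfin_plus)
    show "cell_norm k ((F + G) k) \<le> family_norm F + family_norm G"
      using cell_norm_add[OF b, of k] cell_norm_le[OF FG(1), of k] cell_norm_le[OF FG(2), of k] by simp
  qed
next
  fix F t assume F: "F \<in> cell_families"
  show "t *\<^sub>R F \<in> cell_families"
  proof (rule cell_familiesI)
    fix k
    have b: "F k \<in> bfin" using F by (auto simp: cell_families_def)
    then show "(t *\<^sub>R F) k \<in> bfin" by (simp add: bfin_scale)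
    show "cell_norm k ((t *\<^sub>R F) k) \<le> \<bar>t\<bar> * family_norm F"
      using cell_norm_scale[OF b, of k t] cell_norm_le[OF F, of k] by (simp add: mult_left_mono)
  qed
qed

lemma family_norm_add:
  assumes FG: "F \<in> cell_families" "G \<in> cell_families"
  shows "family_norm (F + G) \<le> family_norm F + family_norm G"
proof (rule family_norm_le)
  fix k
  have b: "F k \<in> bfin" "G k \<in> bfin" using FG by (auto simp: cell_families_def)
  show "cell_norm k ((F + G) k) \<le> family_norm F + family_norm G"
    using cell_norm_add[OF b, of k] cell_norm_le[OF FG(1), of k] cell_norm_le[OF FG(2), of k] by simp
qed

lemma family_norm_scale_le:
  assumes F: "F \<in> cell_families"
  shows "family_norm (t *\<^sub>R F) \<le> \<bar>t\<bar> * family_norm F"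
proof (rule family_norm_le)
  fix k
  have b: "F k \<in> bfin" using F by (auto simp: cell_families_def)
  show "cell_norm k ((t *\<^sub>R F) k) \<le> \<bar>t\<bar> * family_norm F"
    using cell_norm_scale[OF b, of k t] cell_norm_le[OF F, of k] by (simp add: mult_left_mono)
qed

lemma sublinear_family_norm:
  assumes "0 \<le> C"
  shows "sublinear_on cell_families (\<lambda>F. C * family_norm F)"
  unfolding sublinear_on_def
proof (intro conjI ballI allI impI)
  fix F G assume FG: "F \<in> cell_families" "G \<in> cell_families"
  show "C * family_norm (F + G) \<le> C * family_norm F + C * family_norm G"
    using mult_left_mono[OF family_norm_add[OF FG] assms] by (simp add: distrib_left)
next
  fix F and t :: real assume F: "F \<in> cell_families" and t: "t > 0"
  have "(1 / t) *\<^sub>R (t *\<^sub>R F) = F" using t by simp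
  then have "family_norm F \<le> (1 / t) * family_norm (t *\<^sub>R F)"
    using family_norm_scale_le[OF subspace_scale[OF subspace_cell_families F], of "1 / t" t] t by simp
  then have "family_norm (t *\<^sub>R F) = t * family_norm F"
    using family_norm_scale_le[OF F, of t] t by (simp add: field_simps)
  then show "C * family_norm (t *\<^sub>R F) = t * (C * family_norm F)" by simp
qed

definition single :: "nat \<Rightarrow> nat \<Rightarrow> ('a \<Rightarrow> complex) \<Rightarrow> nat \<Rightarrow> nat \<Rightarrow> 'a \<Rightarrow> complex" where
  "single k j \<phi> = (\<lambda>k' j'. if k' = k \<and> j' = j then \<phi> else (\<lambda>_. 0))"

definition truncate :: "nat set \<Rightarrow> nat \<Rightarrow> (nat \<Rightarrow> nat \<Rightarrow> 'a \<Rightarrow> complex) \<Rightarrow> nat \<Rightarrow> nat \<Rightarrow> 'a \<Rightarrow> complex" where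
  "truncate K m F = (\<lambda>k j. if k \<in> K \<and> j < m then F k j else (\<lambda>_. 0))"

lemma cell_norm_single:
  "cell_norm k' (single k j \<phi> k') = (if k' = k then w k * Lpr p (Q k) (\<lambda>x. norm (\<phi> x)) else 0)"
proof (cases "k' = k")
  case True
  then have "single k j \<phi> k' = (\<lambda>i. if i = j then \<phi> else (\<lambda>_. 0))" by (simp add: single_def)
  moreover have "lqn q (\<lambda>i. if i = j then \<phi> else (\<lambda>_. 0)) = (\<lambda>x. norm (\<phi> x))"
    using lqn_single(2)[of q j \<phi>] q by (intro ext) simp
  ultimately show ?thesis using True by (simp add: cell_norm_def)
qed (simp add: single_def cell_norm_eq_0)

lemma single_cell_families:
  assumes "\<phi> \<in> borel_measurable lebesgue" "bounded (range \<phi>)"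
  shows "single k j \<phi> \<in> cell_families"
proof (rule cell_familiesI)
  obtain C where C: "\<And>x. norm (\<phi> x) \<le> C" using assms(2) by (auto simp: bounded_iff)
  show "single k j \<phi> k' \<in> bfin" for k'
    using bfin_single[OF assms(1) C, of j] by (cases "k' = k") (simp_all add: single_def bfin_zero)
  show "cell_norm k' (single k j \<phi> k') \<le> w k * Lpr p (Q k) (\<lambda>x. norm (\<phi> x))" for k'
    using w[of k] by (simp add: cell_norm_single)
qed

lemma family_norm_single:
  "family_norm (single k j \<phi>) \<le> w k * Lpr p (Q k) (\<lambda>x. norm (\<phi> x))"
  using w[of k] by (intro family_norm_le) (simp add: cell_norm_single)

lemma truncate_insert:
  "a \<notin> K \<Longrightarrow> truncate (insert a K) m F = truncate K m F + truncate {a} m F"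
proof (intro ext)
  fix k j x assume "a \<notin> K"
  then show "truncate (insert a K) m F k j x = (truncate K m F + truncate {a} m F) k j x"
    by (cases "k = a") (simp_all add: truncate_def)
qed

lemma truncate_Suc: "truncate {a} (Suc m) F = truncate {a} m F + single a m (F a m)"
proof (intro ext)
  fix k j x
  show "truncate {a} (Suc m) F k j x = (truncate {a} m F + single a m (F a m)) k j x"
      by (auto simp: truncate_def single_def less_Suc_eq)
qed

text \<open>Additivity splits a functional over finitely many cells and components. Membership in
  \<open>cell_families\<close> is proved along with the formula because additivity is available on
  that subspace only.\<close>

lemma truncate_linear:
  assumes Ladd: "\<And>F G. F \<in> cell_families \<Longrightarrow> G \<in> cell_families \<Longrightarrow> L (F + G) = L F + L G"
    and L0: "L 0 = (0 :: real)"
    and K: "finite K"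
    and F: "\<And>k j. k \<in> K \<Longrightarrow> j < m \<Longrightarrow> F k j \<in> borel_measurable lebesgue \<and> bounded (range (F k j))"
  shows "truncate K m F \<in> cell_families \<and>
    L (truncate K m F) = (\<Sum>k\<in>K. \<Sum>j<m. L (single k j (F k j)))"
proof -
  have one: "truncate {a} l F \<in> cell_families \<and> L (truncate {a} l F) = (\<Sum>j<l. L (single a j (F a j)))"
    if "a \<in> K" "l \<le> m" for a l
    using that(2)
  proof (induction l)
    case 0
    have e: "truncate {a} 0 F = 0" by (simp add: truncate_def fun_eq_iff)
    show ?case unfolding e using L0 subspace_0[OF subspace_cell_families] by (simp only: lessThan_0 sum.empty)
  next
    case (Suc l)
    have 1: "single a l (F a l) \<in> cell_families"
      using F[OF \<open>a \<in> K\<close>, of l] Suc.prems by (intro single_cell_families) auto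
    have 2: "truncate {a} l F \<in> cell_families \<and> L (truncate {a} l F) = (\<Sum>j<l. L (single a j (F a j)))"
      by (rule Suc.IH[OF Suc_leD[OF Suc.prems]])
    have "L (truncate {a} l F + single a l (F a l)) = L (truncate {a} l F) + L (single a l (F a l))"
      using 1 2 by (intro Ladd) blast+
    moreover have "truncate {a} l F + single a l (F a l) \<in> cell_families"
      using 1 2 by (intro subspace_add[OF subspace_cell_families]) blast+
    ultimately show ?case unfolding truncate_Suc sum.lessThan_Suc using 2 by (simp only:)
  qed
  show ?thesis
    using K one
  proof (induction K rule: finite_induct)
    case empty
    have e: "truncate {} m F = 0" by (simp add: truncate_def fun_eq_iff)
    show ?case unfolding e using L0 subspace_0[OF subspace_cell_families] by (simp only: sum.empty)
  next
    case (insert a K)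
    have 1: "truncate K m F \<in> cell_families \<and> L (truncate K m F) = (\<Sum>k\<in>K. \<Sum>j<m. L (single k j (F k j)))"
      using insert.prems by (intro insert.IH) auto
    have 2: "truncate {a} m F \<in> cell_families \<and> L (truncate {a} m F) = (\<Sum>j<m. L (single a j (F a j)))"
      by (rule insert.prems) auto
    have e: "L (truncate K m F + truncate {a} m F) = L (truncate K m F) + L (truncate {a} m F)"
      using 1 2 by (intro Ladd) blast+
    have "truncate K m F + truncate {a} m F \<in> cell_families"
      using 1 2 by (intro subspace_add[OF subspace_cell_families]) blast+
    moreover have "L (truncate K m F + truncate {a} m F)
        = (\<Sum>j<m. L (single a j (F a j))) + (\<Sum>k\<in>K. \<Sum>j<m. L (single k j (F k j)))"
      unfolding e conjunct2[OF 1] conjunct2[OF 2] by (rule add.commute)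
    ultimately show ?case
      unfolding truncate_insert[OF insert.hyps(2)] sum.insert[OF insert.hyps] by (rule conjI)
  qed
qed

end

text \<open>Beppo Levi: the supremum has integral at most \<open>D\<close> and is therefore finite
  almost everywhere.\<close>

lemma monotone_bounded_integrals:
  fixes f :: "nat \<Rightarrow> 'a \<Rightarrow> real"
  assumes int: "\<And>n. integrable M (f n)" and nn: "\<And>n x. 0 \<le> f n x"
    and mono: "\<And>x. incseq (\<lambda>n. f n x)" and D: "\<And>n. (LINT x|M. f n x) \<le> D"
  shows "AE x in M. \<exists>c. \<forall>n. f n x \<le> c"
proof -
  have [measurable]: "f n \<in> borel_measurable M" for n using int by auto
  have "(\<integral>\<^sup>+x. (SUP n. ennreal (f n x)) \<partial>M) = (SUP n. \<integral>\<^sup>+x. ennreal (f n x) \<partial>M)"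
    using mono by (intro nn_integral_monotone_convergence_SUP) (auto simp: incseq_def le_fun_def intro!: ennreal_leI)
  also have "\<dots> \<le> ennreal D"
  proof (rule SUP_least)
    fix n
    have "(\<integral>\<^sup>+x. ennreal (f n x) \<partial>M) = ennreal (LINT x|M. f n x)"
      using int nn by (intro nn_integral_eq_integral) auto
    then show "(\<integral>\<^sup>+x. ennreal (f n x) \<partial>M) \<le> ennreal D" using D by (simp add: ennreal_leI)
  qed
  also have "\<dots> < \<infinity>" by simp
  finally have "(\<integral>\<^sup>+x. (SUP n. ennreal (f n x)) \<partial>M) \<noteq> \<infinity>" by simp
  then have "AE x in M. (SUP n. ennreal (f n x)) \<noteq> \<infinity>"
    by (intro nn_integral_PInf_AE) measurable
  then show ?thesis
  proof eventually_elim
    case (elim x)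
    then obtain c where c: "0 \<le> c" "(SUP n. ennreal (f n x)) = ennreal c"
      by (cases "SUP n. ennreal (f n x)") auto
    have "ennreal (f n x) \<le> ennreal c" for n unfolding c(2)[symmetric] by (intro SUP_upper) simp
    then show ?case using c(1) by auto
  qed
qed

text \<open>The extremal sequence for Hoelder's inequality in L_p(ell_q). The factor norm (a j) powr
  (q' - 1) is extremal in the sequence variable, and the power p' - q' of the sequence norm
  \<open>b\<close> corrects it for the space variable. As (p' - 1) * p = p', the p-th power of the
  ell_q norm of \<open>F\<close> is the p'-th power of \<open>b\<close> up to \<theta> powr
  p.\<close>

lemma Hoelder_extremal:
  fixes a :: "nat \<Rightarrow> complex" and q q' p' \<theta> :: real and N :: nat
  assumes q: "1 < q" "1 / q + 1 / q' = 1" and p': "1 < p'" and \<theta>: "0 \<le> \<theta>"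
  defines "b \<equiv> (\<Sum>j<N. norm (a j) powr q') powr (1 / q')"
  defines "F \<equiv> \<lambda>j. of_real (\<theta> * norm (a j) powr (q' - 1) * b powr (p' - q')) * cnj (sgn (a j))"
  shows "(\<Sum>j<N. norm (F j) powr q) powr (1 / q) = \<theta> * b powr (p' - 1)"
    and "(\<Sum>j<N. a j * F j) = of_real (\<theta> * b powr p')"
    and "a j * F j = of_real (\<theta> * norm (a j) powr q' * b powr (p' - q'))"
proof -
  note q' = conjugate_exponent[OF q]
  let ?S = "\<Sum>j<N. norm (a j) powr q'"
  have b0: "0 \<le> b" by (simp add: b_def)
  have S: "?S = b powr q'" using q'(1) by (simp add: b_def powr_powr sum_nonneg)
  show each: "a j * F j = of_real (\<theta> * norm (a j) powr q' * b powr (p' - q'))" for j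
  proof (cases "a j = 0")
    case False
    have "a j * F j = of_real (\<theta> * norm (a j) powr (q' - 1) * b powr (p' - q')) * (a j * cnj (sgn (a j)))"
      by (simp add: F_def)
    also have "\<dots> = of_real (\<theta> * (norm (a j) powr (q' - 1) * norm (a j) powr 1) * b powr (p' - q'))"
      using False by (simp add: mult_cnj_sgn)
    also have "norm (a j) powr (q' - 1) * norm (a j) powr 1 = norm (a j) powr q'"
      unfolding powr_add[symmetric] by simp
    finally show ?thesis .
  qed simp
  have nF: "norm (F j) powr q = \<theta> powr q * norm (a j) powr q' * b powr ((p' - q') * q)" for j
  proof -
    have "norm (F j) = \<theta> * norm (a j) powr (q' - 1) * b powr (p' - q')"
      using \<theta> by (cases "a j = 0") (simp_all add: F_def norm_mult norm_sgn)
    then show ?thesis using \<theta> q'(3) by (simp add: powr_mult powr_powr)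
  qed
  have bp: "b powr (p' - q') * b powr q' = b powr p'" by (simp flip: powr_add)
  show "(\<Sum>j<N. a j * F j) = of_real (\<theta> * b powr p')"
  proof -
    have "(\<Sum>j<N. a j * F j) = of_real (\<theta> * b powr (p' - q') * ?S)"
      unfolding each by (simp add: sum_distrib_left mult_ac)
    then show ?thesis unfolding S by (simp only: mult.assoc bp)
  qed
  have "(\<Sum>j<N. norm (F j) powr q) = \<theta> powr q * b powr ((p' - q') * q) * ?S"
    unfolding nF by (simp add: sum_distrib_left mult_ac)
  also have "\<dots> = \<theta> powr q * b powr ((p' - q') * q + q')" unfolding S by (simp add: powr_add)
  finally have "(\<Sum>j<N. norm (F j) powr q) powr (1 / q) = \<theta> * b powr (((p' - q') * q + q') / q)"
    using q \<theta> by (simp add: powr_mult powr_powr)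
  also have "((p' - q') * q + q') / q = p' - 1" using q q'(4) by (simp add: add_divide_distrib)
  finally show "(\<Sum>j<N. norm (F j) powr q) powr (1 / q) = \<theta> * b powr (p' - 1)" .
qed

context weighted_cells
begin

text \<open>The singular part of the extended functional is never split off. The representation is
  claimed on \<open>B\<close> only, where \<open>vanish\<close> makes the contribution of all cells
  from \<open>n\<close> on tend to 0.\<close>

theorem functional_decomposition:
  assumes C: "0 \<le> C" and B: "subspace B" "B \<subseteq> bfin"
    and vanish: "\<And>f. f \<in> B \<Longrightarrow> (\<lambda>k. cell_norm k f) \<longlonglongrightarrow> 0"
    and Gadd: "\<And>f h. f \<in> B \<Longrightarrow> h \<in> B \<Longrightarrow> G (f + h) = G f + G h"
    and Gscale: "\<And>t f. f \<in> B \<Longrightarrow> G (t *\<^sub>R f) = t * G f"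
    and bound: "\<And>f. f \<in> B \<Longrightarrow> G f \<le> C * (SUP k. cell_norm k f)"
  obtains g :: "nat \<Rightarrow> nat \<Rightarrow> 'a \<Rightarrow> complex"
  where "\<And>k j. g k j \<in> borel_measurable lebesgue" "\<And>k j x. x \<notin> Q k \<Longrightarrow> g k j x = 0"
    "\<And>k. AE x in lebesgue. summable (\<lambda>j. norm (g k j x) powr q')"
    "\<And>k. integrable lebesgue (\<lambda>x. lqn q' (g k) x powr p')"
    "\<And>n. (\<Sum>k<n. Lpr p' UNIV (lqn q' (g k)) / w k) \<le> C"
    "\<And>f. f \<in> B \<Longrightarrow> (\<lambda>n. \<Sum>k<n. LINT x|lebesgue. Re (\<Sum>j. g k j x * f j x)) \<longlonglongrightarrow> G f"
proof -
  have const: "(\<lambda>k. f) \<in> cell_families" if f: "f \<in> B" for f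
  proof -
    obtain K where "\<And>k. norm (cell_norm k f) \<le> K"
      using convergent_imp_Bseq[OF convergentI[OF vanish[OF f]]] by (auto simp: Bseq_def)
    then show ?thesis using f B(2) by (intro cell_familiesI[of _ K]) auto
  qed
  obtain L where L_le: "\<And>F. F \<in> cell_families \<Longrightarrow> L F \<le> C * family_norm F"
    and L_add: "\<And>F H. F \<in> cell_families \<Longrightarrow> H \<in> cell_families \<Longrightarrow> L (F + H) = L F + L H"
    and L_scale: "\<And>t F. F \<in> cell_families \<Longrightarrow> L (t *\<^sub>R F) = t * L F"
    and L_B: "\<And>f. f \<in> B \<Longrightarrow> L (\<lambda>k. f) = G f"
  proof -
    have dominated: "G f \<le> C * family_norm (\<lambda>k. f)" if "f \<in> B" for f
      using bound[OF that] by (simp only: family_norm_def)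
    have add: "(\<lambda>k::nat. f + h) = (\<lambda>k. f) + (\<lambda>k. h)" for f h :: "nat \<Rightarrow> 'a \<Rightarrow> complex"
      by (rule plus_fun_def[symmetric])
    have scale: "(\<lambda>k::nat. t *\<^sub>R f) = t *\<^sub>R (\<lambda>k. f)" for t and f :: "nat \<Rightarrow> 'a \<Rightarrow> complex"
      by (rule scaleR_fun_def[symmetric])
    show thesis
      by (rule sublinear_extension[where \<iota> = "\<lambda>f k. f" and G = G, OF subspace_cell_families
            sublinear_family_norm[OF C] B(1) const add scale Gadd Gscale dominated that])
  qed
  have L_abs: "\<bar>L F\<bar> \<le> C * family_norm F" if F: "F \<in> cell_families" for F
  proof -
    have "- L F = L ((-1) *\<^sub>R F)" unfolding L_scale[OF F] by simp
    also have "\<dots> \<le> C * family_norm ((-1) *\<^sub>R F)"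
      by (intro L_le subspace_scale[OF subspace_cell_families] F)
    also have "\<dots> \<le> C * (\<bar>-1\<bar> * family_norm F)"
      by (intro mult_left_mono family_norm_scale_le F C)
    finally show ?thesis using L_le[OF F] by simp
  qed
  have L0: "L 0 = 0" using L_scale[OF subspace_0[OF subspace_cell_families], of 0] by simp
  define good where "good k j h \<longleftrightarrow> h \<in> borel_measurable lebesgue \<and> integrable lebesgue h \<and> (\<forall>x. x \<notin> Q k \<longrightarrow> h x = 0) \<and>
      (\<forall>\<phi>\<in>borel_measurable lebesgue. bounded (range \<phi>) \<longrightarrow> L (single k j \<phi>) = (LINT x|lebesgue. Re (h x * \<phi> x)))"
    for k j h
  have "\<exists>h. good k j h" for k j
  proof -
    obtain h where "h \<in> borel_measurable lebesgue" "integrable lebesgue h" "\<And>x. x \<notin> Q k \<Longrightarrow> h x = 0"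
      "\<And>\<phi>. \<phi> \<in> borel_measurable lebesgue \<Longrightarrow> bounded (range \<phi>) \<Longrightarrow> L (single k j \<phi>) = (LINT x|lebesgue. Re (h x * \<phi> x))"
    proof (rule Riesz_representation_bounded[of p "Q k" "C * w k" "\<lambda>\<phi>. L (single k j \<phi>)"])
      show "0 \<le> C * w k" using C w[of k] by simp
      fix f h :: "'a \<Rightarrow> complex"
      assume f: "f \<in> borel_measurable lebesgue" "bounded (range f)"
      show "\<bar>L (single k j f)\<bar> \<le> C * w k * Lpr p (Q k) (\<lambda>x. norm (f x))"
        using order_trans[OF L_abs[OF single_cell_families[OF f]] mult_left_mono[OF family_norm_single C]]
        by (simp only: mult.assoc)
      show "L (single k j (\<lambda>x. of_real t * f x)) = t * L (single k j f)" for t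
      proof -
        have "single k j (\<lambda>x. of_real t * f x) = t *\<^sub>R single k j f"
          by (intro ext) (simp add: single_def scaleR_conv_of_real)
        then show ?thesis using L_scale[OF single_cell_families[OF f]] by simp
      qed
      assume h: "h \<in> borel_measurable lebesgue" "bounded (range h)"
      have "single k j (\<lambda>x. f x + h x) = single k j f + single k j h"
        by (intro ext) (simp add: single_def)
      then show "L (single k j (\<lambda>x. f x + h x)) = L (single k j f) + L (single k j h)"
        using L_add[OF single_cell_families[OF f] single_cell_families[OF h]] by (simp only:)
    qed (use p Q in auto)
    then show ?thesis unfolding good_def by blast
  qed
  then obtain g where good: "\<And>k j. good k j (g k j)" by metis
  have g_meas[measurable]: "\<And>k j. g k j \<in> borel_measurable lebesgue"
    and g_int: "\<And>k j. integrable lebesgue (g k j)"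
    and g_out: "\<And>k j x. x \<notin> Q k \<Longrightarrow> g k j x = 0"
    and L_g: "\<And>k j \<phi>. \<phi> \<in> borel_measurable lebesgue \<Longrightarrow> bounded (range \<phi>) \<Longrightarrow>
      L (single k j \<phi>) = (LINT x|lebesgue. Re (g k j x * \<phi> x))"
    using good unfolding good_def by blast+
  have g_mult_int: "integrable lebesgue (\<lambda>x. g k j x * \<phi> x)"
    if \<phi>: "\<phi> \<in> borel_measurable lebesgue" "bounded (range \<phi>)" for k j \<phi>
  proof -
    obtain D where D: "\<And>x. norm (\<phi> x) \<le> D" using \<phi>(2) by (auto simp: bounded_iff)
    show ?thesis
    proof (rule Bochner_Integration.integrable_bound[OF integrable_mult_right[OF g_int, of "of_real D"]])
      show "(\<lambda>x. g k j x * \<phi> x) \<in> borel_measurable lebesgue" using \<phi>(1) by measurable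
      have "norm (g k j x * \<phi> x) \<le> norm (of_real D * g k j x)" for x
        using mult_left_mono[OF order_trans[OF D[of x] abs_ge_self], of "norm (g k j x)"]
        by (simp add: norm_mult mult.commute)
      then show "AE x in lebesgue. norm (g k j x * \<phi> x) \<le> norm (of_real D * g k j x)" by simp
    qed
  qed
  have L_truncate: "truncate K m F \<in> cell_families"
    "L (truncate K m F) = (\<Sum>k\<in>K. LINT x|lebesgue. Re (\<Sum>j<m. g k j x * F k j x))"
    if "finite K" and F: "\<And>k. k \<in> K \<Longrightarrow> F k \<in> bfin" for K m F
  proof -
    have Fb: "F k j \<in> borel_measurable lebesgue" "bounded (range (F k j))" if "k \<in> K" for k j
      using F[OF that] by (auto elim!: bfinE simp: bounded_iff)
    note T = truncate_linear[OF L_add L0 that(1), of m F]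
    show "truncate K m F \<in> cell_families" using T Fb by blast
    have "L (truncate K m F) = (\<Sum>k\<in>K. \<Sum>j<m. L (single k j (F k j)))" using T Fb by blast
    also have "\<dots> = (\<Sum>k\<in>K. \<Sum>j<m. LINT x|lebesgue. Re (g k j x * F k j x))"
      by (intro sum.cong refl L_g Fb)
    also have "\<dots> = (\<Sum>k\<in>K. LINT x|lebesgue. (\<Sum>j<m. Re (g k j x * F k j x)))"
      by (intro sum.cong refl Bochner_Integration.integral_sum[symmetric] integrable_Re g_mult_int Fb)
    finally show "L (truncate K m F) = (\<Sum>k\<in>K. LINT x|lebesgue. Re (\<Sum>j<m. g k j x * F k j x))"
      by (simp only: Re_sum)
  qed
  \<comment> \<open>The densities may be unbounded and have infinitely many components, whereas
    families consist of bounded finite sequences. The cutoff at height and length \<open>N\<close>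
    makes the extremal sequences admissible, and monotone convergence removes it afterwards.\<close>
  define gt where "gt N k j x = (if j < N \<and> norm (g k j x) \<le> real N then g k j x else 0)" for N k j x
  define b where "b N k x = lqn q' (gt N k) x" for N k x
  have gt_meas[measurable]: "gt N k j \<in> borel_measurable lebesgue" for N k j
    unfolding gt_def by measurable
  have gt_bfin: "gt N k \<in> bfin" for N k
    unfolding bfin_def by (intro CollectI conjI allI gt_meas exI[of _ "real N"] exI[of _ N]) (auto simp: gt_def)
  have b_eq: "b N k x = (\<Sum>j<N. norm (gt N k j x) powr q') powr (1 / q')" for N k x
    unfolding b_def by (rule lqn_finite(2)) (simp add: gt_def)
  have b_meas[measurable]: "b N k \<in> borel_measurable lebesgue" for N k
    unfolding b_def[abs_def] by measurable
  have b_nn[simp]: "0 \<le> b N k x" for N k x by (simp add: b_def)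
  have b_out: "x \<notin> Q k \<Longrightarrow> b N k x = 0" for N k x
    by (simp add: b_eq gt_def g_out)
  have b_int: "set_integrable lebesgue (Q k) (\<lambda>x. b N k x powr p')" for N k
    unfolding b_def using p' q' gt_bfin by (intro bfin_set_integrable) auto
  have b_eq_ind: "indicator (Q k) x *\<^sub>R b N k x powr p' = b N k x powr p'" for N k x
    using p' b_out[of x k N] by (cases "x \<in> Q k") simp_all
  have b_int': "integrable lebesgue (\<lambda>x. b N k x powr p')" for N k
    using b_int[of k N] unfolding set_integrable_def b_eq_ind .
  define I where "I N k = (LINT x|lebesgue. b N k x powr p')" for N k
  have I_nn: "0 \<le> I N k" for N k unfolding I_def by (simp add: integral_nonneg_AE)
  have finite_bound: "(\<Sum>k<n. I N k powr (1 / p') / w k) \<le> C" for n N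
  proof -
    \<comment> \<open>Normalises the extremal sequence to weighted norm 1 on cell \<open>k\<close>.
      If \<open>I N k\<close> is 0, then \<theta> k is 0 by the convention for division, and so is
      the cell norm.\<close>
    define \<theta> where "\<theta> k = 1 / (w k * I N k powr (1 / p))" for k
    have \<theta>: "0 \<le> \<theta> k" for k using w[of k] by (simp add: \<theta>_def)
    define F where "F k j x = of_real (\<theta> k * norm (gt N k j x) powr (q' - 1) * b N k x powr (p' - q')) * cnj (sgn (gt N k j x))"
      for k j x
    have F0: "F k j = (\<lambda>_. 0)" if "N \<le> j" for k j
      using that by (auto simp: F_def gt_def fun_eq_iff)
    have F_lqn: "lqn q (F k) x = \<theta> k * b N k x powr (p' - 1)" for k x
    proof -
      have "lqn q (F k) x = (\<Sum>j<N. norm (F k j x) powr q) powr (1 / q)"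
        by (rule lqn_finite) (simp add: F0)
      also have "\<dots> = \<theta> k * b N k x powr (p' - 1)"
        unfolding F_def b_eq by (rule Hoelder_extremal(1)[OF q p' \<theta>])
      finally show ?thesis .
    qed
    have F_meas: "F k j \<in> borel_measurable lebesgue" for k j
      unfolding F_def[abs_def] by measurable
    have F_bfin: "F k \<in> bfin" for k
    proof -
      obtain D where D: "\<And>x. b N k x \<le> D"
        using bfin_lqn_bounded[OF gt_bfin, of q' N k] q' unfolding b_def by auto
      have "norm (F k j x) \<le> \<theta> k * D powr (p' - 1)" for j x
      proof -
        have "norm (F k j x) \<le> lqn q (F k) x"
          using q by (intro norm_le_lqn lqn_finite(1)[of N]) (auto simp: F0)
        also have "\<dots> \<le> \<theta> k * D powr (p' - 1)"
          unfolding F_lqn using D p' \<theta> by (intro mult_left_mono powr_mono2) auto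
        finally show ?thesis .
      qed
      then show ?thesis unfolding bfin_def using F_meas F0 by blast
    qed
    have sumF: "(\<Sum>j<N. g k j x * F k j x) = of_real (\<theta> k * b N k x powr p')" for k x
    proof -
      \<comment> \<open>Where \<open>gt\<close> differs from \<open>g\<close> it is 0, and there
        \<open>F\<close> is 0 too.\<close>
      have "(\<Sum>j<N. g k j x * F k j x) = (\<Sum>j<N. gt N k j x * F k j x)"
        by (intro sum.cong refl) (auto simp: gt_def F_def)
      also have "\<dots> = of_real (\<theta> k * b N k x powr p')"
        unfolding F_def b_eq by (rule Hoelder_extremal(2)[OF q p' \<theta>])
      finally show ?thesis .
    qed
    have cell1: "cell_norm k (truncate {..<n} N F k) \<le> 1" for k
    proof (cases "k < n")
      case True
      have e: "truncate {..<n} N F k = F k"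
        using True F0 by (auto simp: truncate_def fun_eq_iff)
      have "Lpr p (Q k) (lqn q (F k)) = \<theta> k * Lpr p (Q k) (\<lambda>x. b N k x powr (p' - 1))"
        unfolding F_lqn[abs_def] using p \<theta> by (intro Lpr_cmult) auto
      also have "Lpr p (Q k) (\<lambda>x. b N k x powr (p' - 1)) = I N k powr (1 / p)"
        unfolding Lpr_def I_def set_lebesgue_integral_def
        using conjugate_exponent(3)[OF p] by (simp only: powr_powr b_eq_ind)
      finally show ?thesis
        using w[of k] I_nn[of N k] unfolding e by (simp add: cell_norm_def \<theta>_def)
    qed (simp add: truncate_def cell_norm_eq_0)
    have "(\<Sum>k<n. I N k powr (1 / p') / w k) = (\<Sum>k<n. \<theta> k * I N k)"
    proof (intro sum.cong refl)
      fix k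
      have e: "1 / p' = 1 - 1 / p" using p by simp
      show "I N k powr (1 / p') / w k = \<theta> k * I N k"
        using I_nn[of N k] w[of k] by (cases "I N k = 0") (simp_all add: e \<theta>_def powr_diff)
    qed
    also have "\<dots> = L (truncate {..<n} N F)"
    proof -
      have "L (truncate {..<n} N F) = (\<Sum>k<n. LINT x|lebesgue. Re (\<Sum>j<N. g k j x * F k j x))"
        by (rule L_truncate(2)[OF finite_lessThan F_bfin])
      then show ?thesis by (simp add: sumF I_def)
    qed
    also have "\<dots> \<le> C * family_norm (truncate {..<n} N F)"
      by (rule L_le[OF L_truncate(1)[OF finite_lessThan F_bfin]])
    also have "\<dots> \<le> C" using mult_left_mono[OF family_norm_le[OF cell1] C] by (simp only: mult_1_right)
    finally show ?thesis .
  qed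
  have b_mono: "incseq (\<lambda>N. b N k x powr p')" for k x
  proof (rule incseq_SucI)
    fix N
    have "b N k x \<le> b (Suc N) k x"
      unfolding b_def
    proof (rule lqn_mono(2))
      show "norm (gt N k j x) \<le> norm (gt (Suc N) k j x)" for j by (simp add: gt_def)
    qed (use q' bfin_summable[OF gt_bfin] in simp_all)
    then show "b N k x powr p' \<le> b (Suc N) k x powr p'" using p' by (intro powr_mono2) auto
  qed
  have I_le: "I N k \<le> (C * w k) powr p'" for N k
  proof -
    have "I N k powr (1 / p') / w k \<le> (\<Sum>k<Suc k. I N k powr (1 / p') / w k)"
      using w[THEN less_imp_le] by (intro member_le_sum) auto
    then have "I N k powr (1 / p') \<le> C * w k"
      using finite_bound[where n = "Suc k" and N = N] w[of k] by (simp add: field_simps)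
    then have "(I N k powr (1 / p')) powr p' \<le> (C * w k) powr p'" using p' by (intro powr_mono2) auto
    then show ?thesis using p' I_nn by (simp add: powr_powr)
  qed
  have bdd: "AE x in lebesgue. \<exists>c. \<forall>N. b N k x powr p' \<le> c" for k
    by (rule monotone_bounded_integrals[OF b_int' _ b_mono, where D = "(C * w k) powr p'"])
      (use I_le in \<open>auto simp: I_def\<close>)
  have conv: "AE x in lebesgue. summable (\<lambda>j. norm (g k j x) powr q') \<and>
      (\<lambda>N. b N k x powr p') \<longlonglongrightarrow> lqn q' (g k) x powr p'" for k
    using bdd[of k]
  proof eventually_elim
    case (elim x)
    then obtain c where c: "\<And>N. b N k x powr p' \<le> c" by auto
    have bq: "b N k x powr q' = (\<Sum>j<N. norm (gt N k j x) powr q')" for N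
      using q' by (simp add: b_eq powr_powr sum_nonneg)
    have b_le: "b N k x \<le> c powr (1 / p')" for N
      using powr_mono2[OF _ _ c[of N], of "1 / p'"] p' by (simp add: powr_powr)
    \<comment> \<open>Once \<open>N\<close> exceeds both the length of a finite head and the size of
      its entries, the cutoff leaves that head untouched. Hence the cut-off norms dominate every
      finite partial sum eventually.\<close>
    have lower: "\<exists>N0. \<forall>N\<ge>N0. (\<Sum>j<n. norm (g k j x) powr q') \<le> b N k x powr q'" for n
    proof -
      obtain M where M: "\<And>j. j < n \<Longrightarrow> norm (g k j x) \<le> real M"
      proof -
        obtain M where "(\<Sum>j<n. norm (g k j x)) \<le> real M" using real_arch_simple by blast
        moreover have "norm (g k j x) \<le> (\<Sum>j<n. norm (g k j x))" if "j < n" for j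
          using that by (intro member_le_sum) auto
        ultimately show thesis using that order_trans by blast
      qed
      have "(\<Sum>j<n. norm (g k j x) powr q') \<le> b N k x powr q'" if "max n M \<le> N" for N
      proof -
        have "norm (gt N k j x) = norm (g k j x)" if "j < n" for j
          using M[OF that] that \<open>max n M \<le> N\<close> by (auto simp: gt_def)
        then have "(\<Sum>j<n. norm (g k j x) powr q') = (\<Sum>j<n. norm (gt N k j x) powr q')" by simp
        also have "\<dots> \<le> (\<Sum>j<N. norm (gt N k j x) powr q')" using that by (intro sum_mono2) auto
        finally show ?thesis by (simp add: bq)
      qed
      then show ?thesis by blast
    qed
    have "(\<Sum>j<n. norm (g k j x) powr q') \<le> (c powr (1 / p')) powr q'" for n
    proof -
      obtain N where "(\<Sum>j<n. norm (g k j x) powr q') \<le> b N k x powr q'" using lower by blast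
      also have "\<dots> \<le> (c powr (1 / p')) powr q'" using b_le q' by (intro powr_mono2) auto
      finally show ?thesis .
    qed
    then have s: "summable (\<lambda>j. norm (g k j x) powr q')"
      by (intro summableI_nonneg_bounded) auto
    have upper: "b N k x \<le> lqn q' (g k) x" for N
      unfolding b_def using q' s by (intro lqn_mono(2)) (simp_all add: gt_def)
    have "(\<lambda>N. b N k x powr q') \<longlonglongrightarrow> lqn q' (g k) x powr q'"
    proof (rule order_tendstoI)
      fix a assume "a < lqn q' (g k) x powr q'"
      also have "lqn q' (g k) x powr q' = (\<Sum>j. norm (g k j x) powr q')" using q' s by (simp add: lqn_powr)
      finally have "\<forall>\<^sub>F n in sequentially. a < (\<Sum>j<n. norm (g k j x) powr q')"
        using summable_LIMSEQ[OF s] by (rule order_tendstoD(1)[rotated])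
      then obtain n where n: "a < (\<Sum>j<n. norm (g k j x) powr q')" by (auto simp: eventually_sequentially)
      obtain N0 where "\<forall>N\<ge>N0. (\<Sum>j<n. norm (g k j x) powr q') \<le> b N k x powr q'" using lower by blast
      then show "\<forall>\<^sub>F N in sequentially. a < b N k x powr q'"
        using n by (auto simp: eventually_sequentially intro: less_le_trans)
    next
      fix a assume a: "lqn q' (g k) x powr q' < a"
      have "b N k x powr q' \<le> lqn q' (g k) x powr q'" for N using upper q' by (intro powr_mono2) auto
      then have "b N k x powr q' < a" for N using a by (rule le_less_trans)
      then show "\<forall>\<^sub>F N in sequentially. b N k x powr q' < a" by simp
    qed
    then have "(\<lambda>N. (b N k x powr q') powr (p' / q')) \<longlonglongrightarrow> (lqn q' (g k) x powr q') powr (p' / q')"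
      by (rule tendsto_powr'[OF _ tendsto_const]) (use p' q' in auto)
    then show ?case using s q' by (simp add: powr_powr)
  qed
  have lqn_int: "integrable lebesgue (\<lambda>x. lqn q' (g k) x powr p')"
    and I_lim: "(\<lambda>N. I N k) \<longlonglongrightarrow> (LINT x|lebesgue. lqn q' (g k) x powr p')" for k
  proof -
    have m: "AE x in lebesgue. incseq (\<lambda>N. b N k x powr p')" using b_mono by simp
    have lim: "AE x in lebesgue. (\<lambda>N. b N k x powr p') \<longlonglongrightarrow> lqn q' (g k) x powr p'"
      using conv[of k] by eventually_elim simp
    have Imono: "incseq (\<lambda>N. I N k)"
      unfolding I_def using b_mono b_int' by (auto simp: incseq_def intro!: integral_mono)
    obtain l where l: "(\<lambda>N. I N k) \<longlonglongrightarrow> l"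
      by (rule incseq_convergent[OF Imono allI[OF I_le]])
    have meas: "(\<lambda>x. lqn q' (g k) x powr p') \<in> borel_measurable lebesgue" by measurable
    note mc = b_int' _ lim l[unfolded I_def] meas
    have m': "AE x in lebesgue. mono (\<lambda>N. b N k x powr p')" using m by (simp add: incseq_def mono_def)
    show "integrable lebesgue (\<lambda>x. lqn q' (g k) x powr p')"
      by (rule integrable_monotone_convergence[OF b_int' m' lim l[unfolded I_def] meas])
    have "(LINT x|lebesgue. lqn q' (g k) x powr p') = l"
      by (rule integral_monotone_convergence[OF b_int' m' lim l[unfolded I_def] meas])
    then show "(\<lambda>N. I N k) \<longlonglongrightarrow> (LINT x|lebesgue. lqn q' (g k) x powr p')" using l by simp
  qed
  show thesis
  proof
    show "g k j \<in> borel_measurable lebesgue" for k j by (rule g_meas)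
    show "g k j x = 0" if "x \<notin> Q k" for k j x using that by (rule g_out)
    show "AE x in lebesgue. summable (\<lambda>j. norm (g k j x) powr q')" for k
      using conv[of k] by eventually_elim simp
    show "integrable lebesgue (\<lambda>x. lqn q' (g k) x powr p')" for k by (rule lqn_int)
    show "(\<Sum>k<n. Lpr p' UNIV (lqn q' (g k)) / w k) \<le> C" for n
    proof (rule LIMSEQ_le_const2)
      have "(\<lambda>N. \<Sum>k<n. I N k powr (1 / p') / w k) \<longlonglongrightarrow>
          (\<Sum>k<n. (LINT x|lebesgue. lqn q' (g k) x powr p') powr (1 / p') / w k)"
        using w p' I_nn by (intro tendsto_intros tendsto_powr' I_lim) (auto simp: less_imp_neq[symmetric])
      then show "(\<lambda>N. \<Sum>k<n. I N k powr (1 / p') / w k) \<longlonglongrightarrow> (\<Sum>k<n. Lpr p' UNIV (lqn q' (g k)) / w k)"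
        by (simp add: Lpr_def set_lebesgue_integral_def)
    qed (use finite_bound in auto)
    fix f assume f: "f \<in> B"
    then have fb: "f \<in> bfin" using B(2) by auto
    obtain m where m: "\<And>j. m \<le> j \<Longrightarrow> f j = (\<lambda>_. 0)" using bfinE[OF fb] by metis
    \<comment> \<open>The constant family with its first \<open>n\<close> cells removed. Its norm is
      governed by the cell norms of \<open>f\<close> from \<open>n\<close> on, so the functional
      tends to 0 along it, while the removed cells form a truncation on which the functional is an
      integral.\<close>
    define R where "R n = (\<lambda>k. if k < n then 0 else f)" for n :: nat
    have split: "(\<lambda>k. f) = truncate {..<n} m (\<lambda>k. f) + R n" for n
    proof (intro ext)
      fix k j x
      show "f j x = (truncate {..<n} m (\<lambda>k. f) + R n) k j x"
        using m[of j] by (cases "k < n"; cases "j < m") (simp_all add: truncate_def R_def)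
    qed
    have T: "truncate {..<n} m (\<lambda>k. f) \<in> cell_families" for n
      by (rule L_truncate(1)[OF finite_lessThan fb])
    have R_fam: "R n \<in> cell_families" for n
    proof (rule cell_familiesI)
      fix k
      show "R n k \<in> bfin" using fb by (simp add: R_def bfin_zero)
      show "cell_norm k (R n k) \<le> family_norm (\<lambda>k. f)"
      proof (cases "k < n")
        case True
        then show ?thesis
          using order_trans[OF cell_norm_nonneg cell_norm_le[OF const[OF f], of k]]
          by (simp add: R_def cell_norm_eq_0)
      next
        case False
        then show ?thesis using cell_norm_le[OF const[OF f], of k] by (simp add: R_def)
      qed
    qed
    have Gf: "G f = (\<Sum>k<n. LINT x|lebesgue. Re (\<Sum>j. g k j x * f j x)) + L (R n)" for n
    proof -
      have e: "(\<Sum>j<m. g k j x * f j x) = (\<Sum>j. g k j x * f j x)" for k x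
        by (rule suminf_finite[symmetric]) (auto simp: m not_less)
      have "G f = L (truncate {..<n} m (\<lambda>k. f)) + L (R n)"
        using L_B[OF f] L_add[OF T R_fam, of n n] split[of n] by (simp only:)
      also have "L (truncate {..<n} m (\<lambda>k. f)) = (\<Sum>k<n. LINT x|lebesgue. Re (\<Sum>j<m. g k j x * f j x))"
        by (rule L_truncate(2)[OF finite_lessThan fb])
      finally show ?thesis unfolding e .
    qed
    have "(\<lambda>n. L (R n)) \<longlonglongrightarrow> 0"
    proof (rule LIMSEQ_I)
      fix e :: real assume e: "e > 0"
      \<comment> \<open>\<open>C\<close> may be 0, hence the denominator C + 1.\<close>
      then have e': "e / (C + 1) > 0" using C by simp
      from LIMSEQ_D[OF vanish[OF f] e'] obtain n0 where n0: "\<And>k. k \<ge> n0 \<Longrightarrow> cell_norm k f < e / (C + 1)"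
        by auto
      have "norm (L (R n) - 0) < e" if "n \<ge> n0" for n
      proof -
        have "family_norm (R n) \<le> e / (C + 1)"
        proof (rule family_norm_le)
          fix k
          show "cell_norm k (R n k) \<le> e / (C + 1)"
            using n0[of k] that e' by (cases "k < n") (simp_all add: R_def cell_norm_eq_0 less_imp_le)
        qed
        then have "\<bar>L (R n)\<bar> \<le> C * (e / (C + 1))"
          using L_abs[OF R_fam, of n] mult_left_mono[OF _ C] order_trans by blast
        also have "\<dots> < e" using C e by (simp add: field_simps)
        finally show ?thesis by simp
      qed
      then show "\<exists>n0. \<forall>n\<ge>n0. norm (L (R n) - 0) < e" by blast
    qed
    then have "(\<lambda>n. G f - L (R n)) \<longlonglongrightarrow> G f - 0" by (intro tendsto_intros)
    moreover have "G f - L (R n) = (\<Sum>k<n. LINT x|lebesgue. Re (\<Sum>j. g k j x * f j x))" for n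
      using Gf[of n] by linarith
    ultimately show "(\<lambda>n. \<Sum>k<n. LINT x|lebesgue. Re (\<Sum>j. g k j x * f j x)) \<longlonglongrightarrow> G f"
      by simp
  qed
qed

end

section \<open>Morrey spaces\<close>

lemma dyadic_cube_eq_cbox:
  fixes M :: "int ^ 'n::finite"
  shows "dyadic_cube (J, M) = cbox (2 powr (- real_of_int J) *\<^sub>R ((\<chi> i. real_of_int (M $ i)) + (\<chi> i. - 1)))
    (2 powr (- real_of_int J) *\<^sub>R ((\<chi> i. real_of_int (M $ i)) + (\<chi> i. 1)))"
proof -
  have "dyadic_cube (J, M) = (\<lambda>x. (2 powr - real_of_int J) *\<^sub>R x +
      (2 powr - real_of_int J) *\<^sub>R (\<chi> i. real_of_int (M $ i))) ` cbox (\<chi> i. - 1) (\<chi> i. 1)"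
    unfolding dyadic_cube_def by (auto simp: algebra_simps)
  also have "\<dots> = cbox ((2 powr - real_of_int J) *\<^sub>R (\<chi> i. - 1) + (2 powr - real_of_int J) *\<^sub>R (\<chi> i. real_of_int (M $ i)))
      ((2 powr - real_of_int J) *\<^sub>R (\<chi> i. 1) + (2 powr - real_of_int J) *\<^sub>R (\<chi> i. real_of_int (M $ i)))"
  proof -
    have "cbox (\<chi> i. - 1) (\<chi> i. 1) \<noteq> ({} :: (real ^ 'n) set)"
      by (simp add: interval_ne_empty_cart)
    then show ?thesis by (subst image_affinity_cbox) simp
  qed
  finally show ?thesis by (simp add: algebra_simps)
qed

lemma dyadic_cube_lmeasurable [simp]: "dyadic_cube JM \<in> lmeasurable"
  by (cases JM) (simp add: dyadic_cube_eq_cbox)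

lemma measure_dyadic_cube:
  fixes M :: "int ^ 'n::finite"
  shows "measure lebesgue (dyadic_cube (J, M)) = 2 powr ((1 - real_of_int J) * real CARD('n))"
proof -
  have "measure lebesgue (dyadic_cube (J, M)) = (\<Prod>i\<in>(UNIV :: 'n set). 2 * 2 powr (- real_of_int J))"
    unfolding dyadic_cube_eq_cbox
    by (subst measure_completion, simp, subst content_cbox_cart)
      (auto simp: interval_ne_empty_cart algebra_simps intro!: prod.cong)
  also have "\<dots> = (2 powr (1 - real_of_int J)) ^ CARD('n)"
    by (simp add: powr_diff powr_minus field_simps)
  also have "\<dots> = 2 powr ((1 - real_of_int J) * real CARD('n))"
    by (simp add: powr_powr flip: powr_realpow)
  finally show ?thesis .
qed

lemma mem_dyadic_cube:
  fixes x :: "real ^ 'n::finite"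
  shows "x \<in> dyadic_cube (J, M) \<longleftrightarrow> (\<forall>i. \<bar>2 powr real_of_int J * x $ i - real_of_int (M $ i)\<bar> \<le> 1)"
proof -
  have *: "2 powr (- real_of_int J) * (m - 1) \<le> y \<and> y \<le> 2 powr (- real_of_int J) * (m + 1)
      \<longleftrightarrow> \<bar>2 powr real_of_int J * y - m\<bar> \<le> 1" for m y :: real
  proof -
    have *: "2 powr (- real_of_int J) = 1 / (2 :: real) powr real_of_int J" by (simp add: powr_minus_divide)
    have pos: "0 < (2 :: real) powr real_of_int J" by simp
    show ?thesis unfolding * using pos by (auto simp: abs_le_iff field_simps)
  qed
  show ?thesis
    unfolding dyadic_cube_eq_cbox mem_box_cart using * by (simp add: algebra_simps)
qed

text \<open>The bijection \<open>Ix\<close> enumerates the dyadic cubes, so that families over cubes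
  become sequences and the abstract results on cells apply.\<close>

locale morrey_setting =
  fixes p p' q q' r \<rho> u :: real and Ix :: "nat \<Rightarrow> int \<times> (int ^ 'n::finite)"
  assumes p: "1 < p" and r: "- real CARD('n) / p < r" "r < 0"
    and \<rho>: "r + \<rho> = - real CARD('n)"
    and q: "1 < q"
    and conj_p: "1 / p + 1 / p' = 1" and conj_q: "1 / q + 1 / q' = 1"
    and u: "u = - real CARD('n) / r"
    and Ix: "bij Ix"
begin

definition weight :: "int \<times> (int ^ 'n) \<Rightarrow> real" where
  "weight JM = 2 powr (real_of_int (fst JM) * (real CARD('n) / p + r))"

abbreviation "Q i \<equiv> dyadic_cube (Ix i)"
abbreviation "w i \<equiv> weight (Ix i)"

sublocale weighted_cells p p' q q' Q w
  by unfold_locales (use p q conj_p conj_q in \<open>auto simp: weight_def\<close>)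

lemma u_gt: "p < u" "1 < u"
proof -
  have "real CARD('n) > 0" by simp
  then show "p < u" using p r unfolding u by (simp add: field_simps)
  then show "1 < u" using p by simp
qed

lemma exponent_pos: "0 < real CARD('n) / p + r"
  using r by simp

lemma morrey_term_eq: "morrey_term p r f JM = weight JM * Lpr p (dyadic_cube JM) (\<lambda>x. norm (f x))"
  by (cases JM) (simp add: morrey_term_def weight_def Lp_norm_on_eq_Lpr)

text \<open>As r + \<rho> = -n and 1/p + 1/p' = 1, the exponents n/p' + \<rho> and n/p + r are
  opposite. The bound on an atom is thus the Morrey weight of its cube.\<close>

lemma atom_bound_eq_weight:
  "2 powr (- real_of_int J * (real CARD('n) / p' + \<rho>)) = weight (J, M)"
proof -
  have "1 / p' = 1 - 1 / p" using conj_p by simp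
  then have "real CARD('n) / p' = real CARD('n) - real CARD('n) / p"
    by (metis (no_types) mult.right_neutral right_diff_distrib times_divide_eq_right)
  then have e: "real CARD('n) / p' + \<rho> = - (real CARD('n) / p + r)" using \<rho> by simp
  show ?thesis unfolding e weight_def by (simp only: fst_conv minus_mult_minus)
qed

text \<open>Hoelder's inequality on the cube with exponent u / p gives the volume to the power 1/p -
  1/u, which is 2^((1 - J)(n/p + r)) because n / u = - r. The weight cancels the dependence on J;
  the constant that remains comes from the side length 2^(1 - J).\<close>

lemma Lu_embedding:
  fixes F :: "real ^ 'n \<Rightarrow> real"
  assumes [measurable]: "F \<in> borel_measurable lebesgue" and nn: "\<And>x. 0 \<le> F x"
    and int: "integrable lebesgue (\<lambda>x. F x powr u)"
  shows "set_integrable lebesgue (dyadic_cube JM) (\<lambda>x. F x powr p)"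
    and "weight JM * Lpr p (dyadic_cube JM) F \<le> 2 powr (real CARD('n) / p + r) * Lpr u UNIV F"
proof -
  obtain J M where JM: "JM = (J, M)" by (cases JM)
  let ?C = "dyadic_cube JM"
  have [measurable]: "?C \<in> sets lebesgue" by (simp add: fmeasurableD)
  define s where "s = u / p"
  have s: "1 < s" using u_gt p by (simp add: s_def)
  define s' where "s' = s / (s - 1)"
  have s': "1 / s + 1 / s' = 1" "1 / s' = 1 - 1 / s" using s by (simp_all add: s'_def field_simps)
  have s'0: "s' \<noteq> 0" using s by (simp add: s'_def)
  have e1: "(indicator ?C x * F x powr p) powr s = indicator ?C x *\<^sub>R F x powr u" for x
    using s p by (simp add: indicator_def powr_powr s_def)
  have e2: "indicator ?C x powr s' = (indicator ?C x :: real)" for x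
    using s'0 by (simp add: indicator_def)
  have i1: "integrable lebesgue (\<lambda>x. (indicator ?C x * F x powr p) powr s)"
    unfolding e1 by (rule integrable_mult_indicator[OF _ int]) simp
  have i2: "integrable lebesgue (\<lambda>x. indicator ?C x powr s')"
    unfolding e2 using dyadic_cube_lmeasurable[of JM] by (auto simp: fmeasurable_def)
  note H = Hoelder_integral[OF s s'(1) _ _ _ _ i1 i2]
  have "integrable lebesgue (\<lambda>x. indicator ?C x * F x powr p * indicator ?C x)"
    by (rule H(1)) auto
  moreover have e3: "indicator ?C x * F x powr p * indicator ?C x = indicator ?C x *\<^sub>R F x powr p" for x
    by (simp add: indicator_def)
  ultimately show "set_integrable lebesgue ?C (\<lambda>x. F x powr p)"
    by (simp only: set_integrable_def)
  let ?A = "LINT x|lebesgue. F x powr u"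
  have A: "0 \<le> ?A" by (simp add: integral_nonneg_AE)
  have m: "(LINT x|lebesgue. indicator ?C x :: real) = 2 powr ((1 - real_of_int J) * real CARD('n))"
    using measure_dyadic_cube[of J M] by (simp add: JM)
  have "(LINT x|lebesgue. indicator ?C x *\<^sub>R F x powr p)
      \<le> (LINT x|lebesgue. indicator ?C x *\<^sub>R F x powr u) powr (1 / s)
        * (LINT x|lebesgue. indicator ?C x :: real) powr (1 / s')"
    using H(2) unfolding e1 e2 e3 by (auto simp: powr_nonneg_iff)
  also have "\<dots> \<le> ?A powr (1 / s) * (2 powr ((1 - real_of_int J) * real CARD('n))) powr (1 / s')"
    unfolding m using s int
    by (intro mult_right_mono powr_mono2 integral_mono_AE integral_nonneg_AE integrable_mult_indicator)
      (auto simp: indicator_def)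
  finally have "(LINT x|lebesgue. indicator ?C x *\<^sub>R F x powr p) powr (1 / p)
      \<le> (?A powr (1 / s) * (2 powr ((1 - real_of_int J) * real CARD('n))) powr (1 / s')) powr (1 / p)"
    using p by (intro powr_mono2 integral_nonneg_AE) auto
  also have "\<dots> = ?A powr (1 / u) * 2 powr ((1 - real_of_int J) * (real CARD('n) / p + r))"
  proof -
    have c: "0 < real CARD('n)" by simp
    have "real CARD('n) / u = - r" using r c unfolding u by simp
    then have "real CARD('n) * (1 / s' * (1 / p)) = real CARD('n) / p + r"
      unfolding s'(2) s_def using p u_gt by (simp add: field_simps)
    moreover have "1 / s * (1 / p) = 1 / u" using p by (simp add: s_def)
    ultimately show ?thesis using A by (simp only: powr_mult powr_powr mult.assoc)
  qed
  finally have L: "Lpr p ?C F \<le> Lpr u UNIV F * 2 powr ((1 - real_of_int J) * (real CARD('n) / p + r))"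
    by (simp add: Lpr_def set_lebesgue_integral_def)
  have "weight JM * Lpr p ?C F
      \<le> weight JM * (Lpr u UNIV F * 2 powr ((1 - real_of_int J) * (real CARD('n) / p + r)))"
    using L by (intro mult_left_mono) (simp_all add: weight_def)
  also have "\<dots> = 2 powr (real CARD('n) / p + r) * Lpr u UNIV F"
  proof -
    have "weight JM * 2 powr ((1 - real_of_int J) * (real CARD('n) / p + r)) = 2 powr (real CARD('n) / p + r)"
    proof -
      have "real_of_int J * a + (1 - real_of_int J) * a = a" for a by (simp add: left_diff_distrib)
      then show ?thesis unfolding weight_def JM powr_add[symmetric] by simp
    qed
    then show ?thesis by (metis mult.assoc mult.commute)
  qed
  finally show "weight JM * Lpr p ?C F \<le> 2 powr (real CARD('n) / p + r) * Lpr u UNIV F" .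
qed

text \<open>Used below with \<open>D\<close> the cube, which is good for small cubes, and with
  \<open>D\<close> a ball around the support, which is good for large ones.\<close>

lemma Lpr_le_measure:
  fixes F :: "real ^ 'n \<Rightarrow> real"
  assumes F[measurable]: "F \<in> borel_measurable lebesgue" and nn: "\<And>x. 0 \<le> F x" and c: "0 \<le> c"
    and A[measurable]: "A \<in> sets lebesgue"
    and D: "D \<in> lmeasurable" and bd: "\<And>x. x \<in> A \<Longrightarrow> F x \<le> c * indicator D x"
  shows "Lpr p A F \<le> c * measure lebesgue D powr (1 / p)"
proof -
  have [measurable]: "D \<in> sets lebesgue" using D by auto
  have le: "indicator A x *\<^sub>R F x powr p \<le> c powr p * indicator D x" for x
    using bd[of x] nn[of x] p powr_mono2[of p "F x" c] by (cases "x \<in> A"; cases "x \<in> D") auto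
  have i: "integrable lebesgue (\<lambda>x. c powr p * indicator D x)"
    using D by (intro integrable_mult_right) (auto simp: fmeasurable_def)
  have "(LINT x|lebesgue. indicator A x *\<^sub>R F x powr p) \<le> (LINT x|lebesgue. c powr p * indicator D x)"
    using le i by (intro integral_mono_AE Bochner_Integration.integrable_bound[OF i]) (auto intro!: AE_I2)
  also have "\<dots> = c powr p * measure lebesgue D" by simp
  finally have "(LINT x|lebesgue. indicator A x *\<^sub>R F x powr p) powr (1 / p) \<le> (c powr p * measure lebesgue D) powr (1 / p)"
    using p by (intro powr_mono2 integral_nonneg_AE) auto
  also have "\<dots> = c * measure lebesgue D powr (1 / p)"
    using c p by (simp add: powr_mult powr_powr)
  finally show ?thesis by (simp add: Lpr_def set_lebesgue_integral_def)
qed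

text \<open>The volume of the cube bounds the term by a multiple of 2^(J r), small for large J since
  r < 0. The volume of the ball bounds it by a multiple of 2^(J (n/p + r)), small for very negative
  J since n/p + r > 0. For each of the finitely many remaining J, only finitely many cubes meet the
  ball.\<close>

lemma finite_large_terms:
  fixes F :: "real ^ 'n \<Rightarrow> real"
  assumes F[measurable]: "F \<in> borel_measurable lebesgue" and nn: "\<And>x. 0 \<le> F x" and c: "0 \<le> c"
    and bd: "\<And>x. F x \<le> c * indicator (cball 0 R) x" and e: "0 < e"
  shows "finite {JM. e \<le> weight JM * Lpr p (dyadic_cube JM) F}"
proof -
  let ?n = "real CARD('n)"
  let ?s = "?n / p + r" and ?V = "measure lebesgue (cball 0 R :: (real ^ 'n) set)"
  define K1 where "K1 = c * 2 powr (?n / p)"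
  define K2 where "K2 = c * ?V powr (1 / p)"
  define a where "a = log 2 (e / K2) / ?s"
  define b where "b = log 2 (e / K1) / r"
  \<comment> \<open>A cube of level J at most \<open>b\<close> that meets the ball has its
    coordinates M within distance 1 of 2^J x, hence bounded by \<open>m\<close>.\<close>
  define m where "m = 2 powr b * \<bar>R\<bar> + 1"
  have sub: "{JM. e \<le> weight JM * Lpr p (dyadic_cube JM) F}
      \<subseteq> {\<lfloor>a\<rfloor>..\<lceil>b\<rceil>} \<times> {M. \<forall>i. M $ i \<in> {-\<lceil>m\<rceil>..\<lceil>m\<rceil>}}"
  proof (rule subsetI, unfold mem_Collect_eq)
    fix JM :: "int \<times> (int ^ 'n)" assume big: "e \<le> weight JM * Lpr p (dyadic_cube JM) F"
    obtain J M where JM: "JM = (J, M)" by (cases JM)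
    have [measurable]: "dyadic_cube JM \<in> sets lebesgue" by (simp add: fmeasurableD)
    have W: "0 < weight JM" by (simp add: weight_def)
    have "Lpr p (dyadic_cube JM) F \<le> c * measure lebesgue (dyadic_cube JM) powr (1 / p)"
      using bd c order_trans[OF bd, of _ c] by (intro Lpr_le_measure F nn c) (auto simp: indicator_def)
    then have "weight JM * Lpr p (dyadic_cube JM) F \<le> weight JM * (c * measure lebesgue (dyadic_cube JM) powr (1 / p))"
      using W by (intro mult_left_mono) auto
    also have "\<dots> = K1 * 2 powr (real_of_int J * r)"
    proof -
      have "real_of_int J * ?s + (1 - real_of_int J) * ?n * (1 / p) = ?n / p + real_of_int J * r"
        by (simp add: algebra_simps)
      then have "weight JM * measure lebesgue (dyadic_cube JM) powr (1 / p) = 2 powr (?n / p) * 2 powr (real_of_int J * r)"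
        unfolding JM measure_dyadic_cube weight_def by (simp only: powr_powr fst_conv flip: powr_add)
      then show ?thesis unfolding K1_def by (metis mult.assoc mult.commute)
    qed
    finally have 1: "e \<le> K1 * 2 powr (real_of_int J * r)" using big by simp
    have "0 < K1" using 1 e zero_less_mult_pos2[of K1 "2 powr (real_of_int J * r)"] by simp
    then have "log 2 (e / K1) \<le> real_of_int J * r"
      using 1 e by (simp add: log_le_iff field_simps)
    then have Jb: "real_of_int J \<le> b" using r unfolding b_def by (simp add: field_simps)
    have "Lpr p (dyadic_cube JM) F \<le> c * ?V powr (1 / p)"
      using bd by (intro Lpr_le_measure F nn c) auto
    then have "weight JM * Lpr p (dyadic_cube JM) F \<le> K2 * 2 powr (real_of_int J * ?s)"
      using mult_left_mono[of _ _ "weight JM"] W unfolding K2_def weight_def JM by (simp add: mult.commute)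
    then have 2: "e \<le> K2 * 2 powr (real_of_int J * ?s)" using big by simp
    have "0 < K2" using 2 e zero_less_mult_pos2[of K2 "2 powr (real_of_int J * ?s)"] by simp
    then have "log 2 (e / K2) \<le> real_of_int J * ?s"
      using 2 e by (simp add: log_le_iff field_simps)
    then have Ja: "a \<le> real_of_int J" using exponent_pos unfolding a_def by (simp add: pos_divide_le_eq)
    have "\<exists>x\<in>dyadic_cube JM. x \<in> cball 0 R"
    proof (rule ccontr)
      assume "\<not> ?thesis"
      then have "Lpr p (dyadic_cube JM) F = Lpr p (dyadic_cube JM) (\<lambda>x. 0)"
      proof (intro Lpr_cong)
        fix x assume "x \<in> dyadic_cube JM"
        then have "x \<notin> cball 0 R" using \<open>\<not> (\<exists>x\<in>dyadic_cube JM. x \<in> cball 0 R)\<close> by blast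
        then show "F x = 0" using bd[of x] nn[of x] by simp
      qed
      then show False using big e p by (simp add: Lpr_def)
    qed
    then obtain x where x: "x \<in> dyadic_cube (J, M)" "norm x \<le> R" by (auto simp: JM)
    have "M $ i \<in> {-\<lceil>m\<rceil>..\<lceil>m\<rceil>}" for i
    proof -
      have "\<bar>x $ i\<bar> \<le> \<bar>R\<bar>" using component_le_norm_cart[of x i] x(2) by linarith
      moreover have "2 powr real_of_int J \<le> 2 powr b" using Jb by simp
      ultimately have "\<bar>2 powr real_of_int J * x $ i\<bar> \<le> 2 powr b * \<bar>R\<bar>"
        unfolding abs_mult by (intro mult_mono) auto
      moreover have "\<bar>2 powr real_of_int J * x $ i - real_of_int (M $ i)\<bar> \<le> 1"
        using x(1) by (simp add: mem_dyadic_cube)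
      ultimately have "\<bar>real_of_int (M $ i)\<bar> \<le> m" unfolding m_def by linarith
      then show ?thesis by (simp add: abs_le_iff) linarith
    qed
    moreover have "J \<in> {\<lfloor>a\<rfloor>..\<lceil>b\<rceil>}" using Ja Jb by (simp add: floor_le_iff le_ceiling_iff)
    ultimately show "JM \<in> {\<lfloor>a\<rfloor>..\<lceil>b\<rceil>} \<times> {M. \<forall>i. M $ i \<in> {-\<lceil>m\<rceil>..\<lceil>m\<rceil>}}"
      by (simp add: JM)
  qed
  have "{M :: int ^ 'n. \<forall>i. M $ i \<in> {-\<lceil>m\<rceil>..\<lceil>m\<rceil>}} \<subseteq> (\<lambda>f. \<chi> i. f i) ` (PiE UNIV (\<lambda>_. {-\<lceil>m\<rceil>..\<lceil>m\<rceil>}))"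
  proof
    fix M :: "int ^ 'n" assume "M \<in> {M. \<forall>i. M $ i \<in> {-\<lceil>m\<rceil>..\<lceil>m\<rceil>}}"
    then show "M \<in> (\<lambda>f. \<chi> i. f i) ` (PiE UNIV (\<lambda>_. {-\<lceil>m\<rceil>..\<lceil>m\<rceil>}))"
      by (intro image_eqI[of _ _ "\<lambda>i. M $ i"]) (auto simp: PiE_def)
  qed
  then have "finite {M :: int ^ 'n. \<forall>i. M $ i \<in> {-\<lceil>m\<rceil>..\<lceil>m\<rceil>}}"
    by (rule finite_subset) (intro finite_imageI finite_PiE, auto)
  then show ?thesis by (intro finite_subset[OF sub] finite_cartesian_product) auto
qed

lemma terms_tendsto_0:
  fixes F :: "real ^ 'n \<Rightarrow> real"
  assumes "F \<in> borel_measurable lebesgue" "\<And>x. 0 \<le> F x" "0 \<le> c"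
    "\<And>x. F x \<le> c * indicator (cball 0 R) x"
  shows "(\<lambda>k. w k * Lpr p (Q k) F) \<longlonglongrightarrow> 0"
proof (rule LIMSEQ_I)
  fix e :: real assume e: "0 < e"
  have "finite (Ix -` {JM. e \<le> weight JM * Lpr p (dyadic_cube JM) F})"
    using finite_large_terms[OF assms e] Ix by (intro finite_vimageI) (auto simp: bij_def)
  then obtain n where n: "\<forall>k\<in>Ix -` {JM. e \<le> weight JM * Lpr p (dyadic_cube JM) F}. k < n"
    unfolding finite_nat_set_iff_bounded ..
  have "\<not> e \<le> w k * Lpr p (Q k) F" if "k \<ge> n" for k
    using bspec[OF n, of k] that by auto
  moreover have "0 \<le> w k * Lpr p (Q k) F" for k by (simp add: weight_def)
  ultimately show "\<exists>no. \<forall>k\<ge>no. norm (w k * Lpr p (Q k) F - 0) < e"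
    by (intro exI[of _ n]) (simp add: not_le)
qed

section \<open>Membership and norm estimates in the Morrey spaces\<close>

abbreviation cubes :: "int \<times> (int ^ 'n) \<Rightarrow> (real ^ 'n) set" where "cubes \<equiv> dyadic_cube"
abbreviation N\<^sub>L :: "(nat \<Rightarrow> real ^ 'n \<Rightarrow> complex) \<Rightarrow> real" where "N\<^sub>L \<equiv> morrey_lq_norm p r q"
abbreviation L0 :: "(nat \<Rightarrow> real ^ 'n \<Rightarrow> complex) set" where "L0 \<equiv> morrey0_lq p r q"
abbreviation L\<^sub>u :: "(nat \<Rightarrow> real ^ 'n \<Rightarrow> complex) set" where "L\<^sub>u \<equiv> Lp_lq u q"

lemma cubes_sets [measurable, simp]: "cubes JM \<in> sets lebesgue"
  by (simp add: fmeasurableD)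

lemma compact_subset_cube:
  assumes "compact K"
  shows "\<exists>JM. K \<subseteq> cubes JM"
proof -
  obtain R where R: "K \<subseteq> cball 0 R" using bounded_subset_cballD compact_imp_bounded[OF assms] by blast
  obtain m :: nat where m: "\<bar>R\<bar> < 2 ^ m" using real_arch_pow[of 2 "\<bar>R\<bar>"] by auto
  have "K \<subseteq> cubes (- int m, 0)"
  proof
    fix x assume "x \<in> K"
    then have "norm x \<le> R" using R by (auto simp: dist_norm)
    then have "\<bar>x $ i\<bar> \<le> 2 ^ m" for i using component_le_norm_cart[of x i] m by linarith
    then have "\<bar>2 powr real_of_int (- int m) * x $ i\<bar> \<le> 1" for i
      by (simp add: abs_mult powr_minus_divide powr_realpow field_simps)
    then show "x \<in> cubes (- int m, 0)" by (simp add: mem_dyadic_cube)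
  qed
  then show ?thesis by blast
qed

text \<open>Every compact set lies in a single dyadic cube, so integrability over cubes already
  gives local integrability.\<close>

lemma morrey_spaceI:
  fixes f :: "real ^ 'n \<Rightarrow> complex"
  assumes "f \<in> borel_measurable lebesgue"
    and i: "\<And>JM. set_integrable lebesgue (cubes JM) (\<lambda>x. norm (f x) powr p)"
    and c: "\<And>JM. weight JM * Lpr p (cubes JM) (\<lambda>x. norm (f x)) \<le> c"
  shows "f \<in> morrey_space p r" "morrey_norm p r f \<le> c"
proof -
  have "set_integrable lebesgue K (\<lambda>x. norm (f x) powr p)" if K: "compact K" for K
  proof -
    obtain JM where "K \<subseteq> cubes JM" using compact_subset_cube[OF K] by blast
    moreover have "K \<in> sets lebesgue" using K by (simp add: fmeasurableD lmeasurable_compact)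
    ultimately show ?thesis using set_integrable_subset[OF i] by blast
  qed
  then show "f \<in> morrey_space p r"
    using assms(1) c unfolding morrey_space_def Lp_loc_def
    by (auto simp: morrey_term_eq intro!: bdd_aboveI2)
  show "morrey_norm p r f \<le> c" unfolding morrey_norm_def
    using c by (intro cSUP_least) (simp_all add: morrey_term_eq)
qed

lemma morrey_spaceD:
  fixes f :: "real ^ 'n \<Rightarrow> complex"
  assumes f: "f \<in> morrey_space p r"
  shows "f \<in> borel_measurable lebesgue" "set_integrable lebesgue (cubes JM) (\<lambda>x. norm (f x) powr p)"
    and "weight JM * Lpr p (cubes JM) (\<lambda>x. norm (f x)) \<le> morrey_norm p r f"
proof -
  have "compact (cubes JM)" by (cases JM) (simp add: dyadic_cube_eq_cbox)
  then show "f \<in> borel_measurable lebesgue" "set_integrable lebesgue (cubes JM) (\<lambda>x. norm (f x) powr p)"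
    using f by (auto simp: morrey_space_def Lp_loc_def)
  have "bdd_above (range (morrey_term p r f))" using f by (simp add: morrey_space_def)
  then show "weight JM * Lpr p (cubes JM) (\<lambda>x. norm (f x)) \<le> morrey_norm p r f"
    unfolding morrey_norm_def morrey_term_eq[symmetric] by (rule cSUP_upper[rotated]) simp
qed

text \<open>Control of the pointwise ell_q norm is enough: it dominates every component, which
  settles the membership of the components.\<close>

lemma morrey_lqI:
  fixes f :: "nat \<Rightarrow> real ^ 'n \<Rightarrow> complex"
  assumes m: "\<And>j. f j \<in> borel_measurable lebesgue"
    and s: "AE x in lebesgue. summable (\<lambda>j. norm (f j x) powr q)"
    and i: "\<And>JM. set_integrable lebesgue (cubes JM) (\<lambda>x. lqn q f x powr p)"
    and c: "\<And>JM. weight JM * Lpr p (cubes JM) (lqn q f) \<le> c"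
  shows "f \<in> morrey_lq p r q" "N\<^sub>L f \<le> c"
proof -
  have lq: "lq_fun q f = (\<lambda>x. of_real (lqn q f x))" by (simp add: lq_fun_eq_lqn fun_eq_iff)
  have [measurable]: "lqn q f \<in> borel_measurable lebesgue" using m by (rule lqn_measurable)
  have lqm: "lq_fun q f \<in> borel_measurable lebesgue" unfolding lq by measurable
  have e: "norm (lq_fun q f x) = lqn q f x" for x by (simp add: lq)
  have M: "lq_fun q f \<in> morrey_space p r" "morrey_norm p r (lq_fun q f) \<le> c"
    by (rule morrey_spaceI[OF lqm]; unfold e; fact i c)+
  have "f j \<in> morrey_space p r" for j
  proof (rule morrey_spaceI[OF m])
    fix JM
    have le: "AE x in lebesgue. x \<in> cubes JM \<longrightarrow> 0 \<le> norm (f j x) \<and> norm (f j x) \<le> lqn q f x"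
      using s
    proof eventually_elim
      case (elim x)
      then show ?case using norm_le_lqn[of q f x j] q by simp
    qed
    have fm: "(\<lambda>x. norm (f j x)) \<in> borel_measurable lebesgue" using m by measurable
    note L = Lpr_mono[OF _ cubes_sets fm i le]
    show "set_integrable lebesgue (cubes JM) (\<lambda>x. norm (f j x) powr p)" using L(1) p by simp
    have "weight JM * Lpr p (cubes JM) (\<lambda>x. norm (f j x)) \<le> weight JM * Lpr p (cubes JM) (lqn q f)"
      using L(2) p by (intro mult_left_mono) (simp_all add: weight_def)
    then show "weight JM * Lpr p (cubes JM) (\<lambda>x. norm (f j x)) \<le> c" using c[of JM] by linarith
  qed
  then show "f \<in> morrey_lq p r q" using M(1) s by (simp add: morrey_lq_def lq_valued_def)
  show "N\<^sub>L f \<le> c" using M(2) by (simp add: morrey_lq_norm_def)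
qed

lemma morrey_lqD:
  assumes f: "f \<in> morrey_lq p r q"
  shows "f j \<in> borel_measurable lebesgue" "AE x in lebesgue. summable (\<lambda>j. norm (f j x) powr q)"
    and "set_integrable lebesgue (cubes JM) (\<lambda>x. lqn q f x powr p)"
    and "weight JM * Lpr p (cubes JM) (lqn q f) \<le> N\<^sub>L f"
proof -
  have e: "norm (lq_fun q f x) = lqn q f x" for x by (simp add: lq_fun_eq_lqn)
  have M: "f j \<in> morrey_space p r" "lq_fun q f \<in> morrey_space p r"
    and "AE x in lebesgue. summable (\<lambda>j. norm (f j x) powr q)"
    using f by (auto simp: morrey_lq_def lq_valued_def)
  then show "AE x in lebesgue. summable (\<lambda>j. norm (f j x) powr q)" by simp
  show "f j \<in> borel_measurable lebesgue" using morrey_spaceD(1)[OF M(1)] .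
  show "set_integrable lebesgue (cubes JM) (\<lambda>x. lqn q f x powr p)"
    using morrey_spaceD(2)[OF M(2), of JM] unfolding e .
  show "weight JM * Lpr p (cubes JM) (lqn q f) \<le> N\<^sub>L f"
    using morrey_spaceD(3)[OF M(2), of JM] unfolding e morrey_lq_norm_def .
qed

lemma morrey_lq_norm_nonneg: "f \<in> morrey_lq p r q \<Longrightarrow> 0 \<le> N\<^sub>L f"
  using order_trans[OF _ morrey_lqD(4)[of f "(0, 0)"]] by (simp add: weight_def)

lemma morrey_lq_add:
  assumes f: "f \<in> morrey_lq p r q" and h: "h \<in> morrey_lq p r q"
  shows "(\<lambda>j x. f j x + h j x) \<in> morrey_lq p r q" "N\<^sub>L (\<lambda>j x. f j x + h j x) \<le> N\<^sub>L f + N\<^sub>L h"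
proof -
  let ?s = "\<lambda>j x. f j x + h j x"
  note [measurable] = morrey_lqD(1)[OF f] morrey_lqD(1)[OF h]
  have sm: "?s j \<in> borel_measurable lebesgue" for j by measurable
  have lm: "lqn q f \<in> borel_measurable lebesgue" "lqn q h \<in> borel_measurable lebesgue" "lqn q ?s \<in> borel_measurable lebesgue"
    by (rule lqn_measurable; measurable)+
  have s: "AE x in lebesgue. summable (\<lambda>j. norm (?s j x) powr q)"
    using morrey_lqD(2)[OF f] morrey_lqD(2)[OF h]
  proof eventually_elim
    case (elim x)
    then show ?case using lqn_add(1)[of q f x h] q by simp
  qed
  have le: "AE x in lebesgue. lqn q ?s x \<le> lqn q f x + lqn q h x"
    using morrey_lqD(2)[OF f] morrey_lqD(2)[OF h]
    by eventually_elim (rule lqn_add(2), use q in auto)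
  have le': "AE x in lebesgue. x \<in> cubes JM \<longrightarrow> 0 \<le> lqn q ?s x \<and> lqn q ?s x \<le> lqn q f x + lqn q h x" for JM
    using le by eventually_elim simp
  have T: "set_integrable lebesgue (cubes JM) (\<lambda>x. lqn q ?s x powr p)"
    "Lpr p (cubes JM) (lqn q ?s) \<le> Lpr p (cubes JM) (lqn q f) + Lpr p (cubes JM) (lqn q h)" for JM
    by (rule Lpr_triangle[OF _ cubes_sets lm morrey_lqD(3)[OF f] morrey_lqD(3)[OF h] _ _ le'], use p in simp_all)+
  have "weight JM * Lpr p (cubes JM) (lqn q ?s) \<le> N\<^sub>L f + N\<^sub>L h" for JM
  proof -
    have "0 \<le> weight JM" by (simp add: weight_def)
    from mult_left_mono[OF T(2)[of JM] this] show ?thesis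
      using morrey_lqD(4)[OF f, of JM] morrey_lqD(4)[OF h, of JM] by (simp add: distrib_left)
  qed
  with sm s T(1) show "?s \<in> morrey_lq p r q" "N\<^sub>L ?s \<le> N\<^sub>L f + N\<^sub>L h"
    by (intro morrey_lqI; blast)+
qed

lemma morrey_lq_cmult:
  assumes f: "f \<in> morrey_lq p r q"
  shows "(\<lambda>j x. c * f j x) \<in> morrey_lq p r q" "N\<^sub>L (\<lambda>j x. c * f j x) \<le> norm c * N\<^sub>L f"
proof -
  let ?s = "\<lambda>j x. c * f j x"
  note [measurable] = morrey_lqD(1)[OF f]
  have sm: "?s j \<in> borel_measurable lebesgue" for j by measurable
  have lm: "lqn q f \<in> borel_measurable lebesgue" "lqn q ?s \<in> borel_measurable lebesgue"
    by (rule lqn_measurable; measurable)+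
  have s: "AE x in lebesgue. summable (\<lambda>j. norm (?s j x) powr q)"
    using morrey_lqD(2)[OF f]
  proof eventually_elim
    case (elim x)
    then show ?case using lqn_cmult(1)[of q f x c] q by simp
  qed
  have le: "AE x in lebesgue. x \<in> cubes JM \<longrightarrow> 0 \<le> lqn q ?s x \<and> lqn q ?s x \<le> norm c * lqn q f x" for JM
    using morrey_lqD(2)[OF f]
  proof eventually_elim
    case (elim x)
    then show ?case using lqn_cmult(2)[of q f x c] q by simp
  qed
  have ci: "set_integrable lebesgue (cubes JM) (\<lambda>x. (norm c * lqn q f x) powr p)" for JM
    using set_integrable_mult_right[of "norm c powr p", OF morrey_lqD(3)[OF f, of JM]]
    by (simp add: powr_mult)
  have T: "set_integrable lebesgue (cubes JM) (\<lambda>x. lqn q ?s x powr p)"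
    "Lpr p (cubes JM) (lqn q ?s) \<le> Lpr p (cubes JM) (\<lambda>x. norm c * lqn q f x)" for JM
    by (rule Lpr_mono[OF _ cubes_sets lm(2) ci le], use p in simp)+
  have "weight JM * Lpr p (cubes JM) (lqn q ?s) \<le> norm c * N\<^sub>L f" for JM
  proof -
    have "0 \<le> weight JM" by (simp add: weight_def)
    then have "weight JM * Lpr p (cubes JM) (lqn q ?s) \<le> weight JM * (norm c * Lpr p (cubes JM) (lqn q f))"
      using T(2)[of JM] p by (intro mult_left_mono) (simp_all add: Lpr_cmult)
    also have "\<dots> = norm c * (weight JM * Lpr p (cubes JM) (lqn q f))" by simp
    also have "\<dots> \<le> norm c * N\<^sub>L f" by (intro mult_left_mono morrey_lqD(4) f) simp
    finally show ?thesis .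
  qed
  with sm s T(1) show "?s \<in> morrey_lq p r q" "N\<^sub>L ?s \<le> norm c * N\<^sub>L f"
    by (intro morrey_lqI; blast)+
qed

lemma morrey_lq_diff:
  fixes f h :: "nat \<Rightarrow> real ^ 'n \<Rightarrow> complex"
  assumes "f \<in> morrey_lq p r q" "h \<in> morrey_lq p r q"
  shows "(\<lambda>j x. f j x - h j x) \<in> morrey_lq p r q"
  using morrey_lq_add(1)[OF assms(1) morrey_lq_cmult(1)[where c = "-1", OF assms(2)]] by simp

lemma Lp_lqI:
  fixes f :: "nat \<Rightarrow> real ^ 'n \<Rightarrow> complex"
  assumes m: "\<And>j. f j \<in> borel_measurable lebesgue"
    and s: "AE x in lebesgue. summable (\<lambda>j. norm (f j x) powr q)"
    and i: "integrable lebesgue (\<lambda>x. lqn q f x powr u)"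
  shows "f \<in> L\<^sub>u"
proof -
  have lq: "lq_fun q f = (\<lambda>x. of_real (lqn q f x))" by (simp add: lq_fun_eq_lqn fun_eq_iff)
  have [measurable]: "lqn q f \<in> borel_measurable lebesgue" using m by (rule lqn_measurable)
  have "lq_fun q f \<in> Lp_space u" unfolding Lp_space_def lq using i by simp
  moreover have "f j \<in> Lp_space u" for j
  proof -
    note [measurable] = m[of j]
    have "integrable lebesgue (\<lambda>x. norm (f j x) powr u)"
    proof (rule Bochner_Integration.integrable_bound[OF i])
      show "AE x in lebesgue. norm (norm (f j x) powr u) \<le> norm (lqn q f x powr u)"
        using s
      proof eventually_elim
        case (elim x)
        then have "norm (f j x) \<le> lqn q f x" using norm_le_lqn[of q f x j] q by simp
        then show ?case using u_gt by (simp add: powr_mono2)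
      qed
    qed measurable
    then show ?thesis using m by (simp add: Lp_space_def)
  qed
  ultimately show ?thesis using s by (simp add: Lp_lq_def lq_valued_def)
qed

lemma Lp_lqD:
  assumes f: "f \<in> L\<^sub>u"
  shows "f j \<in> borel_measurable lebesgue" "AE x in lebesgue. summable (\<lambda>j. norm (f j x) powr q)"
    and "integrable lebesgue (\<lambda>x. lqn q f x powr u)"
  using f by (auto simp: Lp_lq_def lq_valued_def Lp_space_def lq_fun_eq_lqn)

lemma Lp_lq_norm_eq: "Lp_lq_norm u q f = Lpr u UNIV (lqn q f)"
  by (simp add: Lp_lq_norm_def Lp_norm_on_lq_fun)

lemma Lp_lq_subset_morrey_lq:
  fixes f :: "nat \<Rightarrow> real ^ 'n \<Rightarrow> complex"
  assumes f: "f \<in> L\<^sub>u"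
  shows "f \<in> morrey_lq p r q" "N\<^sub>L f \<le> 2 powr (real CARD('n) / p + r) * Lp_lq_norm u q f"
proof -
  have m: "lqn q f \<in> borel_measurable lebesgue" using Lp_lqD(1)[OF f] by (rule lqn_measurable)
  note E = Lu_embedding[OF m lqn_nonneg Lp_lqD(3)[OF f]]
  show "f \<in> morrey_lq p r q" "N\<^sub>L f \<le> 2 powr (real CARD('n) / p + r) * Lp_lq_norm u q f"
    unfolding Lp_lq_norm_eq by (rule morrey_lqI[OF Lp_lqD(1,2)[OF f] E])+
qed

text \<open>The subspace on which the functional is decomposed. It contains the test sequences and
  is dense in \<open>L0\<close>, its cell norms tend to 0, and unlike the test sequences it admits
  arbitrary bounded measurable components, as the argument for uniqueness requires.\<close>

definition bcs :: "(nat \<Rightarrow> real ^ 'n \<Rightarrow> complex) set" where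
  "bcs = {f \<in> bfin. \<exists>R. \<forall>j x. R < norm x \<longrightarrow> f j x = 0}"

lemma bcs_lqn_bound:
  assumes f: "f \<in> bcs"
  shows "\<exists>c R. 0 \<le> c \<and> (\<forall>x. lqn q f x \<le> c * indicator (cball 0 R) x)"
proof -
  obtain C where C: "\<And>x. lqn q f x \<le> C" using bfin_lqn_bounded[of f q] f q by (auto simp: bcs_def)
  obtain R where R: "\<And>j x. R < norm x \<Longrightarrow> f j x = 0" using f by (auto simp: bcs_def)
  have "0 \<le> C" using order_trans[OF lqn_nonneg C] .
  moreover have "lqn q f x \<le> C * indicator (cball 0 R) x" for x
    using C[of x] R[of x] by (cases "norm x \<le> R") (auto simp: indicator_def lqn_def not_le)
  ultimately show ?thesis by blast
qed

lemma subspace_bcs: "subspace bcs"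
proof (rule subspaceI)
  show "0 \<in> bcs" unfolding bcs_def using bfin_zero(2) by (auto simp: zero_fun_def)
  fix f h assume f: "f \<in> bcs" and h: "h \<in> bcs"
  obtain R R' where "\<And>j x. R < norm x \<Longrightarrow> f j x = 0" "\<And>j x. R' < norm x \<Longrightarrow> h j x = 0"
    using f h by (auto simp: bcs_def)
  then have "\<forall>j x. max R R' < norm x \<longrightarrow> (f + h) j x = 0" by simp
  then show "f + h \<in> bcs" using f h bfin_plus[of f h] unfolding bcs_def by blast
next
  fix f and t :: real assume f: "f \<in> bcs"
  then show "t *\<^sub>R f \<in> bcs" using bfin_scale[of f t] unfolding bcs_def by fastforce
qed

lemma bcs_cmult: 
  assumes "f \<in> bcs"
  shows "(\<lambda>j x. c * f j x) \<in> bcs"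
  using assms bfin_cmult[of f c] unfolding bcs_def by fastforce

lemma bcs_cell_norm_tendsto_0:
  assumes f: "f \<in> bcs"
  shows "(\<lambda>k. cell_norm k f) \<longlonglongrightarrow> 0"
proof -
  obtain c R where c: "0 \<le> c" "\<And>x. lqn q f x \<le> c * indicator (cball 0 R) x"
    using bcs_lqn_bound[OF f] by blast
  have "lqn q f \<in> borel_measurable lebesgue"
    using f bfin_measurable by (intro lqn_measurable) (auto simp: bcs_def)
  then show ?thesis unfolding cell_norm_def by (intro terms_tendsto_0[OF _ _ c]) auto
qed

lemma SUP_cell_norm: "(SUP k. cell_norm k f) = N\<^sub>L f"
proof -
  have "range (\<lambda>k. cell_norm k f) = range (morrey_term p r (lq_fun q f))"
  proof -
    have "cell_norm k f = morrey_term p r (lq_fun q f) (Ix k)" for k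
      by (simp add: cell_norm_def morrey_term_eq lq_fun_eq_lqn)
    then have "range (\<lambda>k. cell_norm k f) = morrey_term p r (lq_fun q f) ` range Ix"
      by (simp add: image_image)
    then show ?thesis using bij_is_surj[OF Ix] by simp
  qed
  then show ?thesis by (simp add: morrey_lq_norm_def morrey_norm_def)
qed

lemma bcs_subset_Lp_lq: "bcs \<subseteq> L\<^sub>u"
proof
  fix f assume f: "f \<in> bcs"
  then have b: "f \<in> bfin" by (simp add: bcs_def)
  obtain c R where c: "0 \<le> c" "\<And>x. lqn q f x \<le> c * indicator (cball 0 R) x"
    using bcs_lqn_bound[OF f] by blast
  show "f \<in> L\<^sub>u"
  proof (rule Lp_lqI[OF bfin_measurable[OF b]])
    show "AE x in lebesgue. summable (\<lambda>j. norm (f j x) powr q)" using bfin_summable[OF b] by simp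
    have m: "lqn q f \<in> borel_measurable lebesgue" using bfin_measurable[OF b] by (rule lqn_measurable)
    have "set_integrable lebesgue (cball 0 R) (\<lambda>x. lqn q f x powr u)"
      using c(2) u_gt order_trans[OF c(2), of _ c] c(1)
      by (intro set_integrable_bounded_powr[of _ _ _ c] m) (auto simp: indicator_def)
    moreover have "indicator (cball 0 R) x *\<^sub>R lqn q f x powr u = lqn q f x powr u" for x
      using c(2)[of x] lqn_nonneg[of q f x] u_gt by (cases "x \<in> cball 0 R") (auto simp del: lqn_nonneg)
    ultimately show "integrable lebesgue (\<lambda>x. lqn q f x powr u)" by (simp only: set_integrable_def)
  qed
qed

lemma test_sequence_bcs:
  assumes "\<And>j. f j \<in> test_functions" "\<And>j. j > k \<Longrightarrow> f j = (\<lambda>x. 0)"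
  shows "f \<in> bcs"
proof -
  have "\<forall>j. \<exists>C R. 0 \<le> C \<and> (\<forall>x. norm (f j x) \<le> C * indicator (cball 0 R) x)"
    using test_function_bounded_support assms(1) by blast
  then obtain C R where C: "\<And>j. 0 \<le> C j" "\<And>j x. norm (f j x) \<le> C j * indicator (cball 0 (R j)) x" by metis
  let ?C = "\<Sum>j\<le>k. C j" and ?R = "Max (R ` {..k})"
  have R: "R j \<le> ?R" if "j \<le> k" for j using that by (intro Max_ge) auto
  have CC: "C j \<le> ?C" if "j \<le> k" for j using that C(1) by (intro member_le_sum) auto
  have "norm (f j x) \<le> ?C" for j x
  proof (cases "j \<le> k")
    case True
    have "norm (f j x) \<le> C j" using C(2)[of j x] C(1)[of j] by (cases "x \<in> cball 0 (R j)") auto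
    then show ?thesis using CC[OF True] by simp
  next
    case False
    then show ?thesis using assms(2)[of j] C(1) by (simp add: sum_nonneg)
  qed
  moreover have "f j x = 0" if "?R < norm x" for j x
  proof (cases "j \<le> k")
    case True
    then have "R j < norm x" using R[OF True] that by (rule_tac le_less_trans)
    then have "x \<notin> cball 0 (R j)" by simp
    then show ?thesis using C(2)[of j x] by simp
  next
    case False
    then show ?thesis using assms(2)[of j] by simp
  qed
  moreover have "f j \<in> borel_measurable lebesgue" for j
    using assms(1)[of j] smooth_fun_measurable by (auto simp: test_functions_def)
  moreover have "\<forall>j\<ge>Suc k. f j = (\<lambda>_. 0)" using assms(2) by (auto simp: Suc_le_eq)
  ultimately show ?thesis unfolding bcs_def bfin_def by blast
qed

end

section \<open>Density of test sequences\<close>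

lemma Lpr_dominated_tendsto_0:
  fixes H :: "nat \<Rightarrow> 'a::euclidean_space \<Rightarrow> real"
  assumes s: "0 < s" and m: "\<And>i. H i \<in> borel_measurable lebesgue" and W: "integrable lebesgue (\<lambda>x. W x powr s)"
    and lim: "AE x in lebesgue. (\<lambda>i. H i x) \<longlonglongrightarrow> 0"
    and le: "\<And>i. AE x in lebesgue. 0 \<le> H i x \<and> H i x \<le> W x"
  shows "(\<lambda>i. Lpr s UNIV (H i)) \<longlonglongrightarrow> 0"
proof -
  have nn: "AE x in lebesgue. \<forall>i. 0 \<le> H i x" using le by (subst AE_all_countable) (auto elim: eventually_mono)
  have "(\<lambda>i. LINT x|lebesgue. H i x powr s) \<longlonglongrightarrow> (LINT x|(lebesgue :: 'a measure). 0)"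
  proof (rule integral_dominated_convergence[OF _ _ W])
    show "AE x in lebesgue. (\<lambda>i. H i x powr s) \<longlonglongrightarrow> 0"
      using lim nn
    proof eventually_elim
      case (elim x)
      have "(\<lambda>i. H i x powr s) \<longlonglongrightarrow> 0 powr s"
        by (rule tendsto_powr'[OF elim(1) tendsto_const]) (use s elim in auto)
      then show ?case by simp
    qed
    show "AE x in lebesgue. norm (H i x powr s) \<le> W x powr s" for i
      using le[of i] by eventually_elim (use s in \<open>auto intro!: powr_mono2\<close>)
  qed (use m in measurable)
  then have l: "(\<lambda>i. LINT x|lebesgue. H i x powr s) \<longlonglongrightarrow> 0" by simp
  have "(\<lambda>i. (LINT x|lebesgue. H i x powr s) powr (1 / s)) \<longlonglongrightarrow> 0 powr (1 / s)"
    by (rule tendsto_powr'[OF l tendsto_const]) (use s in \<open>auto intro!: always_eventually integral_nonneg_AE\<close>)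
  then show ?thesis by (simp add: Lpr_def set_lebesgue_integral_def)
qed

lemma Lp_space_add:
  assumes s: "1 \<le> s" and f: "f \<in> Lp_space s" and g: "g \<in> Lp_space s"
  shows "(\<lambda>x. f x + g x) \<in> Lp_space s"
    and "Lpr s UNIV (\<lambda>x. norm (f x + g x)) \<le> Lpr s UNIV (\<lambda>x. norm (f x)) + Lpr s UNIV (\<lambda>x. norm (g x))"
proof -
  have [measurable]: "f \<in> borel_measurable lebesgue" "g \<in> borel_measurable lebesgue"
    and i: "set_integrable lebesgue UNIV (\<lambda>x. norm (f x) powr s)" "set_integrable lebesgue UNIV (\<lambda>x. norm (g x) powr s)"
    using f g by (auto simp: Lp_space_def set_integrable_def)
  have m: "(\<lambda>x. norm (f x)) \<in> borel_measurable lebesgue" "(\<lambda>x. norm (g x)) \<in> borel_measurable lebesgue"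
    "(\<lambda>x. norm (f x + g x)) \<in> borel_measurable lebesgue" by measurable
  have le: "AE x in lebesgue. x \<in> UNIV \<longrightarrow> 0 \<le> norm (f x + g x) \<and> norm (f x + g x) \<le> norm (f x) + norm (g x)"
    by (simp add: norm_triangle_ineq)
  note T = Lpr_triangle[OF s _ m i _ _ le]
  have "set_integrable lebesgue UNIV (\<lambda>x. norm (f x + g x) powr s)" by (rule T(1)) auto
  then show "(\<lambda>x. f x + g x) \<in> Lp_space s" by (simp add: Lp_space_def set_integrable_def)
  show "Lpr s UNIV (\<lambda>x. norm (f x + g x)) \<le> Lpr s UNIV (\<lambda>x. norm (f x)) + Lpr s UNIV (\<lambda>x. norm (g x))"
    by (rule T(2)) auto
qed

lemma Lp_space_cmult:
  assumes s: "0 < s" and f: "f \<in> Lp_space s"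
  shows "(\<lambda>x. c * f x) \<in> Lp_space s"
    and "Lpr s UNIV (\<lambda>x. norm (c * f x)) = norm c * Lpr s UNIV (\<lambda>x. norm (f x))"
  using f s by (auto simp: Lp_space_def norm_mult powr_mult Lpr_cmult)

lemma Lp_space_diff:
  assumes "1 \<le> s" "f \<in> Lp_space s" "g \<in> Lp_space s"
  shows "(\<lambda>x. f x - g x) \<in> Lp_space s"
  using Lp_space_add(1)[OF assms(1,2) Lp_space_cmult(1)[OF _ assms(3), of "-1"]] assms(1) by simp

lemma bounded_support_Lp_space:
  fixes f :: "real ^ 'n::finite \<Rightarrow> complex"
  assumes s: "0 < s" and f[measurable]: "f \<in> borel_measurable lebesgue"
    and bd: "\<And>x. norm (f x) \<le> C * indicator (cball 0 R) x"
  shows "f \<in> Lp_space s" "integrable lebesgue (\<lambda>x. (C * indicator (cball 0 R :: (real ^ 'n) set) x) powr s)"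
proof -
  have e: "(C * indicator (cball 0 R) x) powr s = C powr s * indicator (cball 0 R) x" for x :: "real ^ 'n"
    using s by (simp add: indicator_def)
  show i: "integrable lebesgue (\<lambda>x. (C * indicator (cball 0 R :: (real ^ 'n) set) x) powr s)"
    unfolding e using lmeasurable_cball[of "0 :: real ^ 'n" R] by (intro integrable_mult_right) (auto simp: fmeasurable_def)
  have "integrable lebesgue (\<lambda>x. norm (f x) powr s)"
  proof (rule Bochner_Integration.integrable_bound[OF i])
    have "norm (f x) powr s \<le> (C * indicator (cball 0 R) x) powr s" for x
      using s bd[of x] by (intro powr_mono2) auto
    then show "AE x in lebesgue. norm (norm (f x) powr s) \<le> norm ((C * indicator (cball 0 R) x) powr s)" by simp
  qed measurable
  then show "f \<in> Lp_space s" by (simp add: Lp_space_def)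
qed

lemma test_functions_Lp_space: "0 < s \<Longrightarrow> \<phi> \<in> test_functions \<Longrightarrow> \<phi> \<in> Lp_space s"
  using test_function_bounded_support[of \<phi>] bounded_support_Lp_space(1)[of s \<phi>] smooth_fun_measurable
  by (auto simp: test_functions_def)

text \<open>Membership in the Lebesgue space is included so that the predicate can be the claim of
  an induction whose steps use the triangle inequality.\<close>

definition test_approximable :: "real \<Rightarrow> (real ^ 'n::finite \<Rightarrow> complex) \<Rightarrow> bool" where
  "test_approximable s f \<longleftrightarrow> f \<in> Lp_space s \<and>
     (\<forall>e>0. \<exists>\<psi>\<in>test_functions. Lpr s UNIV (\<lambda>x. norm (f x - \<psi> x)) \<le> e)"

lemma test_approximable_limit:
  assumes s: "1 \<le> s" and f: "f \<in> Lp_space s" and F: "\<And>i. test_approximable s (F i)"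
    and lim: "(\<lambda>i. Lpr s UNIV (\<lambda>x. norm (f x - F i x))) \<longlonglongrightarrow> 0"
  shows "test_approximable s f"
  unfolding test_approximable_def
proof (intro conjI allI impI f)
  fix e :: real assume e: "e > 0"
  obtain i where i: "Lpr s UNIV (\<lambda>x. norm (f x - F i x)) < e / 2"
    using order_tendstoD(2)[OF lim, of "e / 2"] e by (auto simp: eventually_sequentially)
  obtain \<psi> where \<psi>: "\<psi> \<in> test_functions" "Lpr s UNIV (\<lambda>x. norm (F i x - \<psi> x)) \<le> e / 2"
    using F[of i] e unfolding test_approximable_def by (meson half_gt_zero)
  have Fi: "F i \<in> Lp_space s" using F[of i] by (simp add: test_approximable_def)
  have "\<psi> \<in> Lp_space s" using \<psi>(1) s by (intro test_functions_Lp_space) auto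
  then have "Lpr s UNIV (\<lambda>x. norm ((f x - F i x) + (F i x - \<psi> x)))
      \<le> Lpr s UNIV (\<lambda>x. norm (f x - F i x)) + Lpr s UNIV (\<lambda>x. norm (F i x - \<psi> x))"
    by (intro Lp_space_add(2) Lp_space_diff s f Fi)
  then have "Lpr s UNIV (\<lambda>x. norm (f x - \<psi> x)) \<le> e" using i \<psi>(2) by simp
  then show "\<exists>\<psi>\<in>test_functions. Lpr s UNIV (\<lambda>x. norm (f x - \<psi> x)) \<le> e" using \<psi>(1) by blast
qed

lemma test_approximable_bounded_support:
  fixes f :: "real ^ 'n::finite \<Rightarrow> complex"
  assumes s: "1 \<le> s" and f: "f \<in> borel_measurable lebesgue" "\<And>x. norm (f x) \<le> C * indicator (cball 0 R) x"
  shows "test_approximable s f"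
proof (rule bounded_support_approximation_induct[OF _ _ _ _ f])
  show "test_approximable s \<phi>" if "\<phi> \<in> test_functions" for \<phi> :: "real ^ 'n \<Rightarrow> complex"
    unfolding test_approximable_def
  proof (intro conjI allI impI)
    show "\<phi> \<in> Lp_space s" using that s by (intro test_functions_Lp_space) auto
    show "\<exists>\<psi>\<in>test_functions. Lpr s UNIV (\<lambda>x. norm (\<phi> x - \<psi> x)) \<le> e" if "e > 0" for e
      using that \<open>\<phi> \<in> test_functions\<close> s by (intro bexI[of _ \<phi>]) (simp_all add: Lpr_def)
  qed
next
  fix f :: "real ^ 'n \<Rightarrow> complex" and c
  assume f: "test_approximable s f"
  show "test_approximable s (\<lambda>x. c * f x)"
    unfolding test_approximable_def
  proof (intro conjI allI impI)
    have fL: "f \<in> Lp_space s" using f by (simp add: test_approximable_def)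
    then show "(\<lambda>x. c * f x) \<in> Lp_space s" using s by (intro Lp_space_cmult) auto
    fix e :: real assume e: "e > 0"
    \<comment> \<open>The summand 1 avoids division by 0 for c = 0.\<close>
    have pos: "0 < norm c + 1" using norm_ge_zero[of c] by linarith
    with e have "e / (norm c + 1) > 0" by simp
    then obtain \<psi> where \<psi>: "\<psi> \<in> test_functions" "Lpr s UNIV (\<lambda>x. norm (f x - \<psi> x)) \<le> e / (norm c + 1)"
      using f unfolding test_approximable_def by meson
    have d: "(\<lambda>x. f x - \<psi> x) \<in> Lp_space s"
      using s by (intro Lp_space_diff[OF s fL test_functions_Lp_space[OF _ \<psi>(1)]]) simp
    have "Lpr s UNIV (\<lambda>x. norm (c * (f x - \<psi> x))) = norm c * Lpr s UNIV (\<lambda>x. norm (f x - \<psi> x))"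
      using s by (intro Lp_space_cmult(2) d) simp
    also have "\<dots> \<le> norm c * (e / (norm c + 1))" by (intro mult_left_mono \<psi>) simp
    also have "\<dots> \<le> e" using pos e by (simp add: field_simps)
    finally have "Lpr s UNIV (\<lambda>x. norm (c * f x - c * \<psi> x)) \<le> e" by (simp add: right_diff_distrib)
    then show "\<exists>\<psi>\<in>test_functions. Lpr s UNIV (\<lambda>x. norm (c * f x - \<psi> x)) \<le> e"
      using test_functions_cmult[OF \<psi>(1), of c] by (intro bexI[of _ "\<lambda>x. c * \<psi> x"])
  qed
next
  fix f g :: "real ^ 'n \<Rightarrow> complex"
  assume f: "test_approximable s f" and g: "test_approximable s g"
  then have L: "f \<in> Lp_space s" "g \<in> Lp_space s" by (auto simp: test_approximable_def)
  show "test_approximable s (\<lambda>x. f x + g x)"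
    unfolding test_approximable_def
  proof (intro conjI allI impI)
    show "(\<lambda>x. f x + g x) \<in> Lp_space s" using s L by (intro Lp_space_add)
    fix e :: real assume "e > 0"
    then have e: "e / 2 > 0" by simp
    obtain \<phi> \<psi> where \<phi>: "\<phi> \<in> test_functions" "Lpr s UNIV (\<lambda>x. norm (f x - \<phi> x)) \<le> e / 2"
      and \<psi>: "\<psi> \<in> test_functions" "Lpr s UNIV (\<lambda>x. norm (g x - \<psi> x)) \<le> e / 2"
      using f g e unfolding test_approximable_def by meson
    have "Lpr s UNIV (\<lambda>x. norm ((f x - \<phi> x) + (g x - \<psi> x)))
        \<le> Lpr s UNIV (\<lambda>x. norm (f x - \<phi> x)) + Lpr s UNIV (\<lambda>x. norm (g x - \<psi> x))"
      using s \<phi>(1) \<psi>(1) by (intro Lp_space_add(2) Lp_space_diff L test_functions_Lp_space) auto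
    then have "Lpr s UNIV (\<lambda>x. norm (f x + g x - (\<phi> x + \<psi> x))) \<le> e"
      using \<phi>(2) \<psi>(2) by (simp add: algebra_simps)
    then show "\<exists>\<psi>\<in>test_functions. Lpr s UNIV (\<lambda>x. norm (f x + g x - \<psi> x)) \<le> e"
      using test_functions_add[OF \<phi>(1) \<psi>(1)] by (intro bexI[of _ "\<lambda>x. \<phi> x + \<psi> x"])
  qed
next
  fix F :: "nat \<Rightarrow> real ^ 'n \<Rightarrow> complex" and f C R
  assume F: "\<And>i. test_approximable s (F i)" "\<And>i. F i \<in> borel_measurable lebesgue"
    "f \<in> borel_measurable lebesgue" "\<And>i x. norm (F i x) \<le> C * indicator (cball 0 R) x"
    "AE x in lebesgue. (\<lambda>i. F i x) \<longlonglongrightarrow> f x"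
  note [measurable] = F(2,3)
  have s0: "0 < s" using s by simp
  have fC: "AE x in lebesgue. norm (f x) \<le> C * indicator (cball 0 R) x"
    using F(5)
  proof eventually_elim
    case (elim x)
    show ?case by (rule tendsto_upperbound[OF tendsto_norm[OF elim]]) (use F(4) in auto)
  qed
  note W = bounded_support_Lp_space(2)[OF s0 F(2)[of 0] F(4)[of 0]]
  have fL: "f \<in> Lp_space s"
  proof -
    have "integrable lebesgue (\<lambda>x. norm (f x) powr s)"
    proof (rule Bochner_Integration.integrable_bound[OF W])
      show "AE x in lebesgue. norm (norm (f x) powr s) \<le> norm ((C * indicator (cball 0 R) x) powr s)"
        using fC by eventually_elim (use s in \<open>auto intro!: powr_mono2\<close>)
    qed measurable
    then show ?thesis using F(3) by (simp add: Lp_space_def)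
  qed
  show "test_approximable s f"
  proof (rule test_approximable_limit[OF s fL F(1)], rule Lpr_dominated_tendsto_0[OF s0])
    have "(2 * (C * indicator (cball 0 R) x)) powr s = 2 powr s * (C * indicator (cball 0 R) x) powr s" for x :: "real ^ 'n"
      by (simp only: powr_mult)
    then show "integrable lebesgue (\<lambda>x::real ^ 'n. (2 * (C * indicator (cball 0 R) x)) powr s)"
      using W by simp
    show "AE x in lebesgue. (\<lambda>i. norm (f x - F i x)) \<longlonglongrightarrow> 0"
      using F(5)
    proof eventually_elim
      case (elim x)
      from tendsto_norm[OF tendsto_diff[OF tendsto_const elim, of "f x"]] show ?case by simp
    qed
    show "AE x in lebesgue. 0 \<le> norm (f x - F i x) \<and> norm (f x - F i x) \<le> 2 * (C * indicator (cball 0 R) x)" for i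
      using fC
    proof eventually_elim
      case (elim x)
      then have "norm (f x - F i x) \<le> 2 * (C * indicator (cball 0 R) x)"
        using F(4)[of i x] norm_triangle_ineq4[of "f x" "F i x"] by linarith
      then show ?case by simp
    qed
  qed measurable
qed

lemma test_functions_dense:
  fixes f :: "real ^ 'n::finite \<Rightarrow> complex"
  assumes s: "1 \<le> s" and f: "f \<in> Lp_space s"
  shows "test_approximable s f"
proof -
  have [measurable]: "f \<in> borel_measurable lebesgue" and i: "integrable lebesgue (\<lambda>x. norm (f x) powr s)"
    using f by (auto simp: Lp_space_def)
  \<comment> \<open>Cutting off large values and large arguments together yields bounded functions
    of bounded support that are eventually equal to \<open>f\<close> at each point.\<close>
  define F where "F k x = (if norm (f x) \<le> real k \<and> norm x \<le> real k then f x else 0)" for k x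
  have Fm[measurable]: "F k \<in> borel_measurable lebesgue" for k
  proof -
    have [measurable]: "(\<lambda>x. norm x) \<in> borel_measurable (lebesgue :: (real ^ 'n) measure)"
      by (intro measurable_completion) simp
    show ?thesis unfolding F_def by measurable
  qed
  have ev: "\<forall>\<^sub>F k in sequentially. F k x = f x" for x
  proof -
    obtain k where "max (norm (f x)) (norm x) \<le> real k" using real_arch_simple by blast
    then show ?thesis by (intro eventually_sequentiallyI[of k]) (auto simp: F_def)
  qed
  show ?thesis
  proof (rule test_approximable_limit[OF s f])
    show "test_approximable s (F k)" for k
      by (rule test_approximable_bounded_support[OF s Fm, of _ "real k" "real k"]) (auto simp: F_def indicator_def)
    show "(\<lambda>k. Lpr s UNIV (\<lambda>x. norm (f x - F k x))) \<longlonglongrightarrow> 0"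
    proof (rule Lpr_dominated_tendsto_0[OF _ _ i])
      show "AE x in lebesgue. (\<lambda>k. norm (f x - F k x)) \<longlonglongrightarrow> 0"
      proof (intro AE_I2 tendsto_eventually)
        show "\<forall>\<^sub>F k in sequentially. norm (f x - F k x) = 0" for x
          using ev[of x] by eventually_elim simp
      qed
      show "AE x in lebesgue. 0 \<le> norm (f x - F k x) \<and> norm (f x - F k x) \<le> norm (f x)" for k
        by (simp add: F_def)
      show "(\<lambda>x. norm (f x - F k x)) \<in> borel_measurable lebesgue" for k by measurable
    qed (use s in simp)
  qed
qed

lemma Lpr_sum_le:
  fixes a :: "nat \<Rightarrow> 'a::euclidean_space \<Rightarrow> real"
  assumes s: "1 \<le> s" and m: "\<And>j. a j \<in> borel_measurable lebesgue" and nn: "\<And>j x. 0 \<le> a j x"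
    and i: "\<And>j. integrable lebesgue (\<lambda>x. a j x powr s)"
  shows "integrable lebesgue (\<lambda>x. (\<Sum>j<n. a j x) powr s) \<and> Lpr s UNIV (\<lambda>x. \<Sum>j<n. a j x) \<le> (\<Sum>j<n. Lpr s UNIV (a j))"
proof (induction n)
  case 0
  then show ?case using s by (simp add: Lpr_def)
next
  case (Suc n)
  note [measurable] = m
  have mm: "(\<lambda>x. \<Sum>j<n. a j x) \<in> borel_measurable lebesgue" "a n \<in> borel_measurable lebesgue"
    "(\<lambda>x. \<Sum>j<Suc n. a j x) \<in> borel_measurable lebesgue" by measurable
  have ii: "set_integrable lebesgue UNIV (\<lambda>x. (\<Sum>j<n. a j x) powr s)" "set_integrable lebesgue UNIV (\<lambda>x. a n x powr s)"
    using Suc i by (simp_all add: set_integrable_def)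
  have le: "AE x in lebesgue. x \<in> UNIV \<longrightarrow> 0 \<le> (\<Sum>j<Suc n. a j x) \<and> (\<Sum>j<Suc n. a j x) \<le> (\<Sum>j<n. a j x) + a n x"
    using nn by (auto intro!: AE_I2 add_nonneg_nonneg sum_nonneg)
  note T = Lpr_triangle[OF s _ mm ii _ _ le]
  have "set_integrable lebesgue UNIV (\<lambda>x. (\<Sum>j<Suc n. a j x) powr s)"
    by (rule T(1)) (auto simp: nn sum_nonneg)
  moreover have "Lpr s UNIV (\<lambda>x. \<Sum>j<Suc n. a j x) \<le> Lpr s UNIV (\<lambda>x. \<Sum>j<n. a j x) + Lpr s UNIV (a n)"
    by (rule T(2)) (auto simp: nn sum_nonneg)
  ultimately show ?case using Suc by (simp add: set_integrable_def)
qed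

text \<open>Comparison of the ell_q norm with the ell_1 norm on finitely many components, so that
  their approximation errors may be added one by one.\<close>

lemma lqn_le_sum:
  assumes "1 \<le> q"
  shows "summable (\<lambda>j. norm ((if j < k then a j else (\<lambda>_. 0)) x) powr q) \<and>
    lqn q (\<lambda>j. if j < k then a j else (\<lambda>_. 0)) x \<le> (\<Sum>j<k. norm (a j x))"
proof (induction k)
  case 0
  then show ?case using assms by (simp add: lqn_def)
next
  case (Suc k)
  let ?f = "\<lambda>j. if j < k then a j else (\<lambda>_. 0)" and ?g = "\<lambda>j. if j = k then a k else (\<lambda>_. 0)"
  have e: "(if j < Suc k then a j else (\<lambda>_. 0)) y = ?f j y + ?g j y" for j y
    by (auto simp: less_Suc_eq)
  have el: "lqn q (\<lambda>j. if j < Suc k then a j else (\<lambda>_. 0)) x = lqn q (\<lambda>j x. ?f j x + ?g j x) x"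
    unfolding lqn_def e ..
  note S = lqn_single[OF assms, where j = k and \<phi> = "a k" and x = x]
  note A = lqn_add[where f = ?f and g = ?g and x = x, OF assms conjunct1[OF Suc.IH] S(1)]
  show ?case unfolding el e using A conjunct2[OF Suc.IH] S(2) by simp
qed

context morrey_setting
begin

text \<open>The approximation is made in L_u(ell_q), where dominated convergence is available, and
  the embedding carries it to the Morrey norm. The k-th approximant replaces the first k + 1
  components by test functions and drops the others.\<close>

lemma Lp_lq_test_approximation:
  fixes f :: "nat \<Rightarrow> real ^ 'n \<Rightarrow> complex"
  assumes f: "f \<in> L\<^sub>u"
  shows "\<exists>F. (\<forall>j k. F k j \<in> test_functions) \<and> (\<forall>j k. j > k \<longrightarrow> F k j = (\<lambda>x. 0)) \<and>
    (\<lambda>k. N\<^sub>L (\<lambda>j x. f j x - F k j x)) \<longlonglongrightarrow> 0"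
proof -
  have u1: "1 \<le> u" and u0: "0 < u" using u_gt by auto
  have fm[measurable]: "f j \<in> borel_measurable lebesgue" for j using Lp_lqD(1)[OF f] .
  have fL: "f j \<in> Lp_space u" for j using f by (auto simp: Lp_lq_def lq_valued_def)
  have ex: "\<exists>\<psi>\<in>test_functions. Lpr u UNIV (\<lambda>x. norm (f j x - \<psi> x)) \<le> 1 / (real k + 1)\<^sup>2" for k j
  proof -
    \<comment> \<open>The error 1 / (k + 1)^2 for each of the k + 1 components adds up to 1 / (k +
      1).\<close>
    have pos: "0 < 1 / (real k + 1)\<^sup>2" by (simp add: add_nonneg_pos)
    have "\<forall>e>0. \<exists>\<psi>\<in>test_functions. Lpr u UNIV (\<lambda>x. norm (f j x - \<psi> x)) \<le> e"
      using test_functions_dense[OF u1 fL[of j]] unfolding test_approximable_def by (rule conjunct2)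
    from this[rule_format, OF pos] show ?thesis .
  qed
  define \<psi> where "\<psi> k j = (SOME \<psi>. \<psi> \<in> test_functions \<and>
    Lpr u UNIV (\<lambda>x. norm (f j x - \<psi> x)) \<le> 1 / (real k + 1)\<^sup>2)" for k j
  have \<psi>: "\<psi> k j \<in> test_functions" "Lpr u UNIV (\<lambda>x. norm (f j x - \<psi> k j x)) \<le> 1 / (real k + 1)\<^sup>2" for k j
    using someI_ex[OF ex[of j k, unfolded Bex_def]] unfolding \<psi>_def by blast+
  define F where "F k j = (if j < Suc k then \<psi> k j else (\<lambda>x. 0))" for k j
  have zero_test: "(\<lambda>x. 0) \<in> (test_functions :: (real ^ 'n \<Rightarrow> complex) set)"
    using test_functions_cmult[OF \<psi>(1)[of 0 0], of 0] by simp
  have Ft: "F k j \<in> test_functions" for k j using \<psi>(1) zero_test by (simp add: F_def)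
  have \<psi>m[measurable]: "\<psi> k j \<in> borel_measurable lebesgue" for k j
    using \<psi>(1)[of k j] smooth_fun_measurable by (auto simp: test_functions_def)
  have Fm[measurable]: "F k j \<in> borel_measurable lebesgue" for k j
    using Ft[of k j] smooth_fun_measurable by (auto simp: test_functions_def)
  define a where "a k j x = f j x - \<psi> k j x" for k j x
  have am[measurable]: "a k j \<in> borel_measurable lebesgue" for k j unfolding a_def by measurable
  have aL: "integrable lebesgue (\<lambda>x. norm (a k j x) powr u)" for k j
    using Lp_space_diff[OF u1 fL[of j] test_functions_Lp_space[OF u0 \<psi>(1)[of k j]]]
    by (simp add: Lp_space_def a_def)
  define A where "A k x = (\<Sum>j<Suc k. norm (a k j x))" for k x
  have Am[measurable]: "A k \<in> borel_measurable lebesgue" for k unfolding A_def by measurable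
  have A: "integrable lebesgue (\<lambda>x. A k x powr u)" "Lpr u UNIV (A k) \<le> 1 / (real k + 1)" for k
  proof -
    have S: "integrable lebesgue (\<lambda>x. A k x powr u) \<and> Lpr u UNIV (A k) \<le> (\<Sum>j<Suc k. Lpr u UNIV (\<lambda>x. norm (a k j x)))"
      unfolding A_def by (rule Lpr_sum_le[OF u1]) (use aL in auto)
    then show "integrable lebesgue (\<lambda>x. A k x powr u)" by blast
    have "(\<Sum>j<Suc k. Lpr u UNIV (\<lambda>x. norm (a k j x))) \<le> (\<Sum>j<Suc k. 1 / (real k + 1)\<^sup>2)"
      unfolding a_def by (intro sum_mono \<psi>(2))
    also have "\<dots> = 1 / (real k + 1)" by (simp add: power2_eq_square add.commute)
    finally show "Lpr u UNIV (A k) \<le> 1 / (real k + 1)" using S by linarith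
  qed
  \<comment> \<open>The dropped tail: its ell_q norm tends to 0 wherever that of \<open>f\<close> is
    finite and is dominated by it.\<close>
  define t where "t k j = (if j < Suc k then (\<lambda>x. 0) else f j)" for k j
  have tm[measurable]: "t k j \<in> borel_measurable lebesgue" for k j
    unfolding t_def using fm[of j] by (cases "j < Suc k") simp_all
  have Tm[measurable]: "lqn q (t k) \<in> borel_measurable lebesgue" for k using tm by (rule lqn_measurable)
  have ts: "summable (\<lambda>j. norm (t k j x) powr q)" and tle: "lqn q (t k) x \<le> lqn q f x"
    if "summable (\<lambda>j. norm (f j x) powr q)" for k x
  proof -
    have "norm (t k j x) \<le> norm (f j x)" for j by (simp add: t_def)
    then show "summable (\<lambda>j. norm (t k j x) powr q)" "lqn q (t k) x \<le> lqn q f x"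
      using q that lqn_mono[of q "t k" x f] by simp_all
  qed
  have Tle: "AE x in lebesgue. 0 \<le> lqn q (t k) x \<and> lqn q (t k) x \<le> lqn q f x" for k
    using Lp_lqD(2)[OF f] by eventually_elim (simp add: tle)
  have T0: "(\<lambda>k. Lpr u UNIV (lqn q (t k))) \<longlonglongrightarrow> 0"
  proof (rule Lpr_dominated_tendsto_0[OF u0 Tm Lp_lqD(3)[OF f] _ Tle])
    show "AE x in lebesgue. (\<lambda>k. lqn q (t k) x) \<longlonglongrightarrow> 0"
      using Lp_lqD(2)[OF f]
    proof eventually_elim
      case (elim x)
      have "(\<Sum>j. norm (t k j x) powr q) = (\<Sum>j. norm (f (j + Suc k) x) powr q)" for k
      proof -
        have "(\<Sum>j. norm (t k j x) powr q) = (\<Sum>j. norm (t k (j + Suc k) x) powr q) + (\<Sum>j<Suc k. norm (t k j x) powr q)"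
          using ts[OF elim] by (rule suminf_split_initial_segment)
        then show ?thesis by (simp add: t_def)
      qed
      moreover have "(\<lambda>k. \<Sum>j. norm (f (j + Suc k) x) powr q) \<longlonglongrightarrow> 0"
        using LIMSEQ_Suc[OF suminf_exist_split2[OF elim]] by simp
      ultimately have l: "(\<lambda>k. \<Sum>j. norm (t k j x) powr q) \<longlonglongrightarrow> 0" by simp
      have "(\<lambda>k. (\<Sum>j. norm (t k j x) powr q) powr (1 / q)) \<longlonglongrightarrow> 0 powr (1 / q)"
        by (rule tendsto_powr'[OF l tendsto_const])
          (use q ts[OF elim] in \<open>auto intro!: always_eventually suminf_nonneg\<close>)
      then show ?case by (simp add: lqn_def)
    qed
  qed
  define D where "D k j x = f j x - F k j x" for k j x
  have Dm: "D k j \<in> borel_measurable lebesgue" for k j unfolding D_def by measurable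
  have Dlm: "lqn q (D k) \<in> borel_measurable lebesgue" for k using Dm by (rule lqn_measurable)
  have Dx: "summable (\<lambda>j. norm (D k j x) powr q) \<and> lqn q (D k) x \<le> A k x + lqn q (t k) x"
    if s: "summable (\<lambda>j. norm (f j x) powr q)" for k x
  proof -
    let ?b = "\<lambda>j. if j < Suc k then a k j else (\<lambda>_. 0)"
    have e: "D k j y = ?b j y + t k j y" for j y by (simp add: D_def F_def a_def t_def)
    have el: "lqn q (D k) x = lqn q (\<lambda>j x. ?b j x + t k j x) x" unfolding lqn_def e ..
    have q1: "1 \<le> q" using q by simp
    note S = lqn_le_sum[OF q1, where a = "a k" and k = "Suc k" and x = x]
    note B = lqn_add[where f = ?b and g = "t k" and x = x, OF q1 conjunct1[OF S] ts[OF s]]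
    show ?thesis unfolding el e A_def using B conjunct2[OF S] by (intro conjI) (assumption, linarith)
  qed
  have Ds: "AE x in lebesgue. summable (\<lambda>j. norm (D k j x) powr q)" for k
    using Lp_lqD(2)[OF f] by eventually_elim (use Dx in blast)
  have Dle: "AE x in lebesgue. x \<in> UNIV \<longrightarrow> 0 \<le> lqn q (D k) x \<and> lqn q (D k) x \<le> A k x + lqn q (t k) x" for k
    using Lp_lqD(2)[OF f] by eventually_elim (use Dx in simp)
  have Ti: "set_integrable lebesgue UNIV (\<lambda>x. lqn q (t k) x powr u)" for k
  proof (rule Lpr_mono(1)[OF u0 _ Tm])
    show "set_integrable lebesgue UNIV (\<lambda>x. lqn q f x powr u)" using Lp_lqD(3)[OF f] by (simp add: set_integrable_def)
    show "AE x in lebesgue. x \<in> UNIV \<longrightarrow> 0 \<le> lqn q (t k) x \<and> lqn q (t k) x \<le> lqn q f x" using Tle by simp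
  qed simp
  have Ai: "set_integrable lebesgue UNIV (\<lambda>x. A k x powr u)" for k using A(1) by (simp add: set_integrable_def)
  have Ann: "0 \<le> A k x" for k x by (simp add: A_def sum_nonneg del: sum.lessThan_Suc)
  have DT: "set_integrable lebesgue UNIV (\<lambda>x. lqn q (D k) x powr u)"
    "Lpr u UNIV (lqn q (D k)) \<le> Lpr u UNIV (A k) + Lpr u UNIV (lqn q (t k))" for k
    by (rule Lpr_triangle[OF u1 _ Am Tm Dlm Ai Ti Ann lqn_nonneg Dle], simp)+
  have DL: "D k \<in> L\<^sub>u" for k using Dm Ds DT(1) by (intro Lp_lqI) (simp_all add: set_integrable_def)
  let ?c = "2 powr (real CARD('n) / p + r)"
  have Nle: "N\<^sub>L (D k) \<le> ?c * (1 / (real k + 1) + Lpr u UNIV (lqn q (t k)))" for k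
  proof -
    have "N\<^sub>L (D k) \<le> ?c * Lp_lq_norm u q (D k)" by (rule Lp_lq_subset_morrey_lq(2)[OF DL])
    also have "\<dots> \<le> ?c * (1 / (real k + 1) + Lpr u UNIV (lqn q (t k)))"
      unfolding Lp_lq_norm_eq using DT(2)[of k] A(2)[of k] by (intro mult_left_mono) auto
    finally show ?thesis .
  qed
  have "(\<lambda>k. 1 / (real k + 1)) \<longlonglongrightarrow> 0"
    using LIMSEQ_inverse_real_of_nat by (simp add: inverse_eq_divide add.commute)
  then have "(\<lambda>k. ?c * (1 / (real k + 1) + Lpr u UNIV (lqn q (t k)))) \<longlonglongrightarrow> ?c * (0 + 0)"
    by (intro tendsto_intros T0)
  then have lim: "(\<lambda>k. ?c * (1 / (real k + 1) + Lpr u UNIV (lqn q (t k)))) \<longlonglongrightarrow> 0" by simp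
  have "(\<lambda>k. N\<^sub>L (D k)) \<longlonglongrightarrow> 0"
  proof (rule tendsto_sandwich[OF _ _ tendsto_const lim])
    show "\<forall>\<^sub>F k in sequentially. 0 \<le> N\<^sub>L (D k)"
      using morrey_lq_norm_nonneg[OF Lp_lq_subset_morrey_lq(1)[OF DL]] by simp
    show "\<forall>\<^sub>F k in sequentially. N\<^sub>L (D k) \<le> ?c * (1 / (real k + 1) + Lpr u UNIV (lqn q (t k)))"
      using Nle by simp
  qed
  moreover have "F k j = (\<lambda>x. 0)" if "j > k" for k j using that by (simp add: F_def)
  ultimately show ?thesis using Ft unfolding D_def by (intro exI[of _ F] conjI allI impI)
qed

lemma Lp_lq_subset_morrey0_lq: "L\<^sub>u \<subseteq> L0"
proof
  fix f :: "nat \<Rightarrow> real ^ 'n \<Rightarrow> complex" assume "f \<in> L\<^sub>u"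
  then show "f \<in> L0"
    unfolding morrey0_lq_def using Lp_lq_test_approximation Lp_lq_subset_morrey_lq(1) by (intro CollectI conjI)
qed

end

section \<open>The predual space\<close>

text \<open>Beppo Levi for series: the integral of the sum is finite, hence so is the sum almost
  everywhere.\<close>

lemma summable_integral_AE_summable:
  fixes f :: "nat \<Rightarrow> 'a \<Rightarrow> real"
  assumes int: "\<And>i. integrable M (f i)" and nn: "\<And>i. AE x in M. 0 \<le> f i x" and s: "summable (\<lambda>i. LINT x|M. f i x)"
  shows "AE x in M. summable (\<lambda>i. f i x)"
proof -
  have [measurable]: "f i \<in> borel_measurable M" for i using int by auto
  have nn': "AE x in M. \<forall>i. 0 \<le> f i x" using nn by (simp add: AE_all_countable)
  have inn: "0 \<le> (LINT x|M. f i x)" for i using nn by (rule integral_nonneg_AE)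
  have "(\<integral>\<^sup>+x. (\<Sum>i. ennreal (f i x)) \<partial>M) = (\<Sum>i. \<integral>\<^sup>+x. ennreal (f i x) \<partial>M)"
    by (rule nn_integral_suminf) measurable
  also have "\<dots> = (\<Sum>i. ennreal (LINT x|M. f i x))"
    using int nn by (intro suminf_cong nn_integral_eq_integral) auto
  also have "\<dots> = ennreal (\<Sum>i. LINT x|M. f i x)" by (rule suminf_ennreal2[OF inn s])
  finally have "(\<integral>\<^sup>+x. (\<Sum>i. ennreal (f i x)) \<partial>M) \<noteq> \<infinity>" by simp
  then have "AE x in M. (\<Sum>i. ennreal (f i x)) \<noteq> \<infinity>"
    by (intro nn_integral_PInf_AE) measurable
  with nn' show ?thesis
  proof eventually_elim
    case (elim x)
    show ?case by (rule summable_suminf_not_top) (use elim in auto)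
  qed
qed

context weighted_cells
begin

text \<open>Hoelder's inequality on one cell. The norm of \<open>b\<close> carries the factor
  \<open>w k\<close> and that of \<open>F\<close> its reciprocal, so the weight cancels and only
  \<mu> * c is left.\<close>

lemma cell_pairing:
  assumes b[measurable]: "b \<in> borel_measurable lebesgue" "\<And>x. 0 \<le> b x"
    and off: "AE x in lebesgue. x \<notin> Q k \<longrightarrow> b x = 0"
    and bi: "integrable lebesgue (\<lambda>x. b x powr p')" and b_le: "Lpr p' UNIV b \<le> \<mu> * w k"
    and F[measurable]: "F \<in> borel_measurable lebesgue" "\<And>x. 0 \<le> F x"
    and Fi: "set_integrable lebesgue (Q k) (\<lambda>x. F x powr p)" and F_le: "w k * Lpr p (Q k) F \<le> c"
    and \<mu>: "0 \<le> \<mu>"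
  shows "integrable lebesgue (\<lambda>x. b x * F x)" "(LINT x|lebesgue. b x * F x) \<le> \<mu> * c"
proof -
  have e: "(indicator (Q k) x * F x) powr p = indicator (Q k) x *\<^sub>R F x powr p" for x
    using p by (simp add: indicator_def)
  have i1: "integrable lebesgue (\<lambda>x. (indicator (Q k) x * F x) powr p)"
    using Fi unfolding e set_integrable_def .
  note H = Hoelder_integral[OF p _ b(1) _ b(2) i1 bi]
  have ae: "AE x in lebesgue. (indicator (Q k) x * F x) * b x = b x * F x"
    using off by eventually_elim (auto simp: indicator_def)
  have "integrable lebesgue (\<lambda>x. (indicator (Q k) x * F x) * b x)"
    by (rule H(1)) (use F in auto)
  from this _ ae show "integrable lebesgue (\<lambda>x. b x * F x)"
    by (rule integrable_cong_AE_imp) measurable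
  have "(LINT x|lebesgue. b x * F x) = (LINT x|lebesgue. (indicator (Q k) x * F x) * b x)"
    using ae by (intro integral_cong_AE) (auto elim: eventually_mono)
  also have "\<dots> \<le> Lpr p (Q k) F * Lpr p' UNIV b"
    using H(2) F unfolding e Lpr_def set_lebesgue_integral_def by simp
  also have "\<dots> \<le> Lpr p (Q k) F * (\<mu> * w k)" by (intro mult_left_mono b_le) simp
  also have "\<dots> = \<mu> * (w k * Lpr p (Q k) F)" by simp
  also have "\<dots> \<le> \<mu> * c" by (intro mult_left_mono F_le \<mu>)
  finally show "(LINT x|lebesgue. b x * F x) \<le> \<mu> * c" .
qed

text \<open>\<open>b\<^sub>k\<close> plays the role of \<open>\<bar>\<lambda>\<^sub>k a\<^sub>k\<bar>\<close> in an atomic decomposition, and \<open>\<mu>\<^sub>k\<close> that of \<open>\<bar>\<lambda>\<^sub>k\<bar>\<close>;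
  admissible functions are those of Morrey norm at most \<open>c\<close>.\<close>

definition majorant :: "(nat \<Rightarrow> 'a \<Rightarrow> real) \<Rightarrow> (nat \<Rightarrow> real) \<Rightarrow> bool" where
  "majorant b \<mu> \<longleftrightarrow> (\<forall>k. b k \<in> borel_measurable lebesgue \<and> (\<forall>x. 0 \<le> b k x) \<and>
     (AE x in lebesgue. x \<notin> Q k \<longrightarrow> b k x = 0) \<and> integrable lebesgue (\<lambda>x. b k x powr p') \<and>
     Lpr p' UNIV (b k) \<le> \<mu> k * w k \<and> 0 \<le> \<mu> k) \<and> summable \<mu>"

definition admissible :: "('a \<Rightarrow> real) \<Rightarrow> real \<Rightarrow> bool" where
  "admissible F c \<longleftrightarrow> F \<in> borel_measurable lebesgue \<and> (\<forall>x. 0 \<le> F x) \<and>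
     (\<forall>k. set_integrable lebesgue (Q k) (\<lambda>x. F x powr p) \<and> w k * Lpr p (Q k) F \<le> c)"

lemma majorant_pairing:
  assumes b: "majorant b \<mu>" and F: "admissible F c"
  shows "\<And>k. integrable lebesgue (\<lambda>x. b k x * F x)"
    and "summable (\<lambda>k. LINT x|lebesgue. b k x * F x)"
    and "AE x in lebesgue. summable (\<lambda>k. b k x * F x)"
    and "integrable lebesgue (\<lambda>x. \<Sum>k. b k x * F x)"
    and "(LINT x|lebesgue. (\<Sum>k. b k x * F x)) \<le> c * (\<Sum>k. \<mu> k)"
proof -
  have bF: "integrable lebesgue (\<lambda>x. b k x * F x) \<and> (LINT x|lebesgue. b k x * F x) \<le> \<mu> k * c" for k
    using cell_pairing[of "b k" k "\<mu> k" F c] b F unfolding majorant_def admissible_def by blast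
  then show i: "\<And>k. integrable lebesgue (\<lambda>x. b k x * F x)" by blast
  have nn: "0 \<le> b k x * F x" for k x using b F by (simp add: majorant_def admissible_def)
  have \<mu>: "summable (\<lambda>k. \<mu> k * c)" using b by (intro summable_mult2) (simp add: majorant_def)
  show s: "summable (\<lambda>k. LINT x|lebesgue. b k x * F x)"
    by (rule summable_comparison_test'[OF \<mu>]) (use bF nn in \<open>simp add: integral_nonneg_AE\<close>)
  show ae: "AE x in lebesgue. summable (\<lambda>k. b k x * F x)"
    by (rule summable_integral_AE_summable[OF i _ s]) (simp add: nn)
  have ae': "AE x in lebesgue. summable (\<lambda>k. norm (b k x * F x))" using ae nn by simp
  have s': "summable (\<lambda>k. LINT x|lebesgue. norm (b k x * F x))" using s nn by simp
  show "integrable lebesgue (\<lambda>x. \<Sum>k. b k x * F x)" by (rule integrable_suminf[OF i ae' s'])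
  have "(LINT x|lebesgue. (\<Sum>k. b k x * F x)) = (\<Sum>k. LINT x|lebesgue. b k x * F x)"
    by (rule integral_suminf[OF i ae' s'])
  also have "\<dots> \<le> (\<Sum>k. \<mu> k * c)" using bF by (intro suminf_le s \<mu>) blast
  also have "\<dots> = c * (\<Sum>k. \<mu> k)"
    using b by (subst suminf_mult2[symmetric]) (simp_all add: majorant_def)
  finally show "(LINT x|lebesgue. (\<Sum>k. b k x * F x)) \<le> c * (\<Sum>k. \<mu> k)" .
qed

end

text \<open>Dominates Schwartz functions and has finite Morrey norm; pairing with it turns summability of atomic
  coefficients into convergence of tempered distributions.\<close>

definition decay :: "real ^ 'n::finite \<Rightarrow> real" where
  "decay x = 1 / (1 + norm x) ^ (2 * CARD('n))"

lemma decay_pos: "0 < decay x" and decay_le_1: "decay x \<le> 1"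
proof -
  have "1 \<le> 1 + norm x" by simp
  then have "1 \<le> (1 + norm x) ^ (2 * CARD('a))" by (rule one_le_power)
  moreover from this have "0 < (1 + norm x) ^ (2 * CARD('a))" by linarith
  ultimately show "0 < decay x" "decay x \<le> 1" by (simp_all add: decay_def)
qed

lemma decay_measurable [measurable]: "(decay :: real ^ 'n::finite \<Rightarrow> real) \<in> borel_measurable lebesgue"
proof -
  have "1 + norm x \<noteq> 0" for x :: "real ^ 'n" using norm_ge_zero[of x] by linarith
  then have "continuous_on UNIV (decay :: real ^ 'n \<Rightarrow> real)"
    unfolding decay_def[abs_def] by (intro continuous_intros) auto
  then show ?thesis using borel_measurable_continuous_onI by (intro measurable_completion) simp
qed

text \<open>Comparison with dyadic cubes around 0: on the m-th one the function is replaced by a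
  constant of order 2^(-2nm), against a volume of order 2^(nm). The sum of the products is geometric
  with ratio 2^(-n).\<close>

lemma integrable_decay: "integrable lebesgue (decay :: real ^ 'n::finite \<Rightarrow> real)"
proof (rule integrableI_nonneg)
  let ?n = "CARD('n)"
  define C :: "nat \<Rightarrow> (real ^ 'n) set" where "C m = dyadic_cube (- int m, 0)" for m
  define c :: "nat \<Rightarrow> real" where "c m = 2 ^ (2 * ?n) / 2 ^ (2 * ?n * m)" for m
  have Cm[measurable]: "C m \<in> sets lebesgue" for m by (simp add: C_def fmeasurableD)
  have memC: "x \<in> C m" if "norm x \<le> 2 ^ m" for x m
  proof -
    have "\<bar>x $ i\<bar> \<le> 2 ^ m" for i using component_le_norm_cart[of x i] that by linarith
    then have "\<bar>2 powr real_of_int (- int m) * x $ i\<bar> \<le> 1" for i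
      by (simp add: abs_mult powr_minus_divide powr_realpow field_simps)
    then show ?thesis by (simp add: C_def mem_dyadic_cube)
  qed
  have le: "ennreal (decay x) \<le> (\<Sum>m. ennreal (c m * indicator (C m) x))" for x :: "real ^ 'n"
  proof -
    \<comment> \<open>Minimality gives norm x > 2^(m - 1) unless m = 0. The factor 2^(2n) in
      \<open>c\<close> absorbs this shift by one and also covers the case m = 0.\<close>
    define m where "m = (LEAST m. norm x \<le> 2 ^ m)"
    obtain m0 :: nat where "norm x < 2 ^ m0" using real_arch_pow[of 2 "norm x"] by auto
    then have m: "norm x \<le> 2 ^ m" unfolding m_def by (rule LeastI[of "\<lambda>m. norm x \<le> 2 ^ m", OF less_imp_le])
    have "decay x \<le> c m"
    proof (cases m)
      case 0
      have "decay x \<le> 1" by (rule decay_le_1)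
      also have "(1::real) \<le> 2 ^ (2 * ?n)" by (rule one_le_power) simp
      also have "\<dots> = c m" by (simp add: c_def 0)
      finally show ?thesis .
    next
      case (Suc l)
      then have "\<not> norm x \<le> 2 ^ l"
        using not_less_Least[of l "\<lambda>m. norm x \<le> 2 ^ m"] unfolding m_def[symmetric] by simp
      then have "2 ^ l \<le> 1 + norm x" by simp
      then have "(2 ^ l) ^ (2 * ?n) \<le> (1 + norm x) ^ (2 * ?n)" by (intro power_mono) auto
      then have "decay x \<le> 1 / (2 ^ l) ^ (2 * ?n)"
        unfolding decay_def by (intro divide_left_mono mult_pos_pos zero_less_power add_pos_nonneg) auto
      also have "\<dots> = c m" by (simp add: c_def Suc power_mult[symmetric] power_add mult.commute)
      finally show ?thesis .
    qed
    then have "ennreal (decay x) \<le> ennreal (c m * indicator (C m) x)"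
      using memC[OF m] by (simp add: ennreal_leI)
    also have "\<dots> \<le> (\<Sum>m. ennreal (c m * indicator (C m) x))"
      using sum_le_suminf[of "\<lambda>m. ennreal (c m * indicator (C m) x)" "{m}"] by simp
    finally show ?thesis .
  qed
  have "(\<integral>\<^sup>+x. ennreal (decay (x :: real ^ 'n)) \<partial>lebesgue) \<le> (\<integral>\<^sup>+x. (\<Sum>m. ennreal (c m * indicator (C m) x)) \<partial>lebesgue)"
    by (intro nn_integral_mono le)
  also have "\<dots> = (\<Sum>m. \<integral>\<^sup>+x. ennreal (c m * indicator (C m) x) \<partial>lebesgue)"
    by (rule nn_integral_suminf) measurable
  also have "\<dots> = (\<Sum>m. ennreal (2 ^ (3 * ?n) * (1 / 2 ^ ?n) ^ m))"
  proof (rule suminf_cong)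
    fix m
    have c0: "0 \<le> c m" by (simp add: c_def)
    have "(\<integral>\<^sup>+x. ennreal (c m * indicator (C m) x) \<partial>lebesgue) = ennreal (c m) * emeasure lebesgue (C m)"
      using c0 by (simp add: ennreal_mult' ennreal_indicator nn_integral_cmult)
    also have "emeasure lebesgue (C m) = ennreal (measure lebesgue (C m))"
      unfolding C_def by (rule emeasure_eq_measure2[OF dyadic_cube_lmeasurable])
    also have "measure lebesgue (C m) = 2 ^ (?n + ?n * m)"
    proof -
      have "measure lebesgue (C m) = 2 powr (real (?n + ?n * m))"
        unfolding C_def measure_dyadic_cube by (simp add: algebra_simps)
      then show ?thesis by (simp only: powr_realpow)
    qed
    also have "ennreal (c m) * ennreal (2 ^ (?n + ?n * m)) = ennreal (c m * 2 ^ (?n + ?n * m))"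
      using c0 by (simp add: ennreal_mult')
    also have "c m * 2 ^ (?n + ?n * m) = 2 ^ (3 * ?n) * (1 / 2 ^ ?n) ^ m"
    proof -
      have "(2::real) ^ (2 * ?n * m) = 2 ^ (?n * m) * 2 ^ (?n * m)" by (simp flip: power_add add: mult_2 add_mult_distrib)
      moreover have "(2::real) ^ (3 * ?n) = 2 ^ (2 * ?n) * 2 ^ ?n" by (simp flip: power_add add: add_mult_distrib)
      moreover have "((1::real) / 2 ^ ?n) ^ m = 1 / 2 ^ (?n * m)" by (simp add: power_divide power_mult)
      ultimately show ?thesis by (simp add: c_def power_add)
    qed
    finally show "(\<integral>\<^sup>+x. ennreal (c m * indicator (C m) x) \<partial>lebesgue) = ennreal (2 ^ (3 * ?n) * (1 / 2 ^ ?n) ^ m)" .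
  qed
  also have "\<dots> = ennreal (\<Sum>m. 2 ^ (3 * ?n) * (1 / 2 ^ ?n) ^ m)"
  proof (rule suminf_ennreal2)
    have "(1::real) < 2 ^ ?n" by (simp add: one_less_power)
    then have "norm (1 / (2::real) ^ ?n) < 1" by simp
    then show "summable (\<lambda>m. (2::real) ^ (3 * ?n) * (1 / 2 ^ ?n) ^ m)"
      by (intro summable_mult summable_geometric)
  qed simp
  also have "\<dots> < \<infinity>" by simp
  finally show "(\<integral>\<^sup>+x. ennreal (decay (x :: real ^ 'n)) \<partial>lebesgue) < \<infinity>" .
qed (use decay_pos in \<open>auto intro: less_imp_le\<close>)

lemma schwartz_decay:
  fixes \<phi> :: "real ^ 'n::finite \<Rightarrow> complex"
  assumes "\<phi> \<in> schwartz_functions"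
  shows "\<exists>C. 0 \<le> C \<and> (\<forall>x. norm (\<phi> x) \<le> C * decay x)"
proof -
  have "bounded (range (\<lambda>x. (1 + norm x) ^ (2 * CARD('n)) *\<^sub>R iter_pderiv [] \<phi> x))"
    using assms unfolding schwartz_functions_def by blast
  then obtain C where C: "\<And>x. norm ((1 + norm x) ^ (2 * CARD('n)) *\<^sub>R \<phi> x) \<le> C"
    unfolding bounded_iff iter_pderiv_simps by blast
  have "norm (\<phi> x) \<le> C * decay x" for x
  proof -
    have pos: "0 < (1 + norm x) ^ (2 * CARD('n))" by (intro zero_less_power add_pos_nonneg) auto
    then have "(1 + norm x) ^ (2 * CARD('n)) * norm (\<phi> x) \<le> C" using C[of x] by simp
    then show ?thesis using pos by (simp add: decay_def field_simps)
  qed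
  moreover have "0 \<le> C" using order_trans[OF norm_ge_zero C] .
  ultimately show ?thesis by blast
qed

lemma schwartz_converges_decay:
  fixes \<Phi> :: "nat \<Rightarrow> real ^ 'n::finite \<Rightarrow> complex"
  assumes "schwartz_converges \<Phi> \<phi>" "0 < e"
  shows "\<forall>\<^sub>F k in sequentially. \<forall>x. norm (\<Phi> k x - \<phi> x) \<le> e * decay x"
proof -
  have "uniform_limit UNIV (\<lambda>k x. (1 + norm x) ^ (2 * CARD('n)) *\<^sub>R iter_pderiv [] (\<Phi> k) x)
      (\<lambda>x. (1 + norm x) ^ (2 * CARD('n)) *\<^sub>R iter_pderiv [] \<phi> x) sequentially"
    using assms(1) unfolding schwartz_converges_def by blast
  then have "\<forall>\<^sub>F k in sequentially. \<forall>x. dist ((1 + norm x) ^ (2 * CARD('n)) *\<^sub>R \<Phi> k x) ((1 + norm x) ^ (2 * CARD('n)) *\<^sub>R \<phi> x) < e"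
    using assms(2) unfolding uniform_limit_iff iter_pderiv_simps by simp
  then show ?thesis
  proof eventually_elim
    case (elim k)
    show ?case
    proof
      fix x :: "real ^ 'n"
      have pos: "0 < (1 + norm x) ^ (2 * CARD('n))" by (intro zero_less_power add_pos_nonneg) auto
      have "(1 + norm x) ^ (2 * CARD('n)) * norm (\<Phi> k x - \<phi> x) < e"
        using elim[rule_format, of x] pos by (simp add: dist_norm flip: scaleR_diff_right)
      then show "norm (\<Phi> k x - \<phi> x) \<le> e * decay x" using pos by (simp add: decay_def field_simps)
    qed
  qed
qed

section \<open>Membership in the predual space is equivalent to domination by a majorant\<close>

context morrey_setting
begin

lemma admissible_decay: "\<exists>c. admissible (decay :: real ^ 'n \<Rightarrow> real) c"
proof -
  have "integrable lebesgue (\<lambda>x :: real ^ 'n. decay x powr u)"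
  proof (rule Bochner_Integration.integrable_bound[OF integrable_decay])
    have "decay x powr u \<le> decay x" for x :: "real ^ 'n"
      using powr_mono'[of 1 u "decay x"] decay_pos[of x] decay_le_1[of x] u_gt by simp
    then have "norm (decay x powr u) \<le> norm (decay x)" for x :: "real ^ 'n"
      using decay_pos[of x] by simp
    then show "AE x :: real ^ 'n in lebesgue. norm (decay x powr u) \<le> norm (decay x)" by simp
  qed measurable
  note E = Lu_embedding[OF decay_measurable less_imp_le[OF decay_pos] this]
  show ?thesis unfolding admissible_def
    using E decay_measurable less_imp_le[OF decay_pos] by blast
qed

lemma admissible_indicator_cball: "\<exists>c. admissible (indicator (cball 0 R) :: real ^ 'n \<Rightarrow> real) c"
proof -
  have "integrable lebesgue (\<lambda>x :: real ^ 'n. indicator (cball 0 R) x powr u :: real)"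
    using bounded_support_Lp_space(2)[of u "\<lambda>x :: real ^ 'n. 0" 1 R] u_gt by simp
  note E = Lu_embedding[OF indicator_ball_box_measurable(1) indicator_pos_le this]
  show ?thesis unfolding admissible_def
    by (intro exI[of _ "2 powr (real CARD('n) / p + r) * Lpr u UNIV (indicator (cball (0 :: real ^ 'n) R))"] conjI allI E
        indicator_ball_box_measurable(1) indicator_pos_le)
qed

lemma admissible_lqn:
  assumes "f \<in> morrey_lq p r q"
  shows "admissible (lqn q f) (N\<^sub>L f)"
  unfolding admissible_def using morrey_lqD[OF assms] by (auto intro: lqn_measurable)

lemma admissible_cmult:
  assumes "admissible F c" "0 \<le> t"
  shows "admissible (\<lambda>x. t * F x) (t * c)"
proof -
  have "w k * Lpr p (Q k) (\<lambda>x. t * F x) \<le> t * c" for k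
  proof -
    have "w k * Lpr p (Q k) (\<lambda>x. t * F x) = t * (w k * Lpr p (Q k) F)"
      using p assms(2) by (simp add: Lpr_cmult)
    also have "\<dots> \<le> t * c" using assms by (intro mult_left_mono) (auto simp: admissible_def)
    finally show ?thesis .
  qed
  moreover have "set_integrable lebesgue (Q k) (\<lambda>x. (t * F x) powr p)" for k
    using assms set_integrable_mult_right[of "t powr p" lebesgue "Q k" "\<lambda>x. F x powr p"]
    by (simp add: powr_mult admissible_def)
  ultimately show ?thesis using assms by (auto simp: admissible_def)
qed

text \<open>The pairing with \<open>decay\<close> converges almost everywhere, and
  \<open>decay\<close> is strictly positive, so it may be divided out.\<close>

lemma majorant_AE_summable:
  assumes b: "majorant b \<mu>"
  shows "AE x in lebesgue. summable (\<lambda>k. b k x)"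
proof -
  obtain c where "admissible (decay :: real ^ 'n \<Rightarrow> real) c" using admissible_decay by blast
  from majorant_pairing(3)[OF b this] show ?thesis
  proof eventually_elim
    case (elim x)
    then have "summable (\<lambda>k. b k x * decay x * (1 / decay x))" by (rule summable_mult2)
    then show ?case using decay_pos[of x] by simp
  qed
qed

lemma majorized_pairing:
  fixes h :: "real ^ 'n \<Rightarrow> complex"
  assumes h[measurable]: "h \<in> borel_measurable lebesgue" and b: "majorant b \<mu>"
    and le: "AE x in lebesgue. norm (h x) \<le> (\<Sum>k. b k x)" and F: "admissible F c"
  shows "integrable lebesgue (\<lambda>x. norm (h x) * F x)"
    and "(LINT x|lebesgue. norm (h x) * F x) \<le> c * (\<Sum>k. \<mu> k)"
proof -
  have Fm[measurable]: "F \<in> borel_measurable lebesgue" and Fnn: "\<And>x. 0 \<le> F x"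
    using F by (auto simp: admissible_def)
  have le': "AE x in lebesgue. norm (h x) * F x \<le> (\<Sum>k. b k x * F x)"
    using le majorant_AE_summable[OF b]
  proof eventually_elim
    case (elim x)
    then show ?case using mult_right_mono[OF elim(1) Fnn[of x]] by (simp add: suminf_mult2)
  qed
  show i: "integrable lebesgue (\<lambda>x. norm (h x) * F x)"
  proof (rule Bochner_Integration.integrable_bound[OF majorant_pairing(4)[OF b F]])
    show "AE x in lebesgue. norm (norm (h x) * F x) \<le> norm (\<Sum>k. b k x * F x)"
      using le' by eventually_elim (use Fnn in \<open>auto simp: abs_mult\<close>)
  qed measurable
  have "(LINT x|lebesgue. norm (h x) * F x) \<le> (LINT x|lebesgue. (\<Sum>k. b k x * F x))"
    using le' i majorant_pairing(4)[OF b F] by (intro integral_mono_AE)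
  also have "\<dots> \<le> c * (\<Sum>k. \<mu> k)" by (rule majorant_pairing(5)[OF b F])
  finally show "(LINT x|lebesgue. norm (h x) * F x) \<le> c * (\<Sum>k. \<mu> k)" .
qed

lemma Ix_inv: "Ix (inv Ix JM) = JM" "inv Ix (Ix k) = k"
  using Ix by (simp_all add: bij_is_surj surj_f_inv_f bij_is_inj inv_f_f)

text \<open>Sums over all cubes are unconditional whereas series over the naturals are ordered;
  absolute convergence lets one pass from the second to the first.\<close>

lemma has_sum_Ix:
  fixes a :: "nat \<Rightarrow> 'b::banach"
  assumes s: "summable (\<lambda>k. norm (a k))" and S: "a sums S" and g: "\<And>k. g (Ix k) = a k"
  shows "(g has_sum S) UNIV"
proof -
  have "(a has_sum S) UNIV" by (rule norm_summable_imp_has_sum[OF s S])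
  then have "((\<lambda>k. g (Ix k)) has_sum S) UNIV" by (simp add: g)
  then show ?thesis using has_sum_reindex_bij_betw[OF Ix] by blast
qed

text \<open>The piece of \<open>h\<close> that belongs to cell \<open>k\<close> is dominated by
  \<open>b k\<close>, because the modulus of \<open>h\<close> is at most the sum of all
  \<open>b k\<close>. Divided by \<mu> k it obeys the norm bound of an atom, and the \<mu> k are the
  coefficients, whose sum bounds the norm.\<close>

lemma predual_spaceI:
  fixes h :: "real ^ 'n \<Rightarrow> complex"
  assumes h[measurable]: "h \<in> borel_measurable lebesgue" and b: "majorant b \<mu>"
    and le: "AE x in lebesgue. norm (h x) \<le> (\<Sum>k. b k x)"
  shows "h \<in> predual_space p' \<rho>" "predual_norm p' \<rho> h \<le> (\<Sum>k. \<mu> k)"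
proof -
  have b_meas[measurable]: "b k \<in> borel_measurable lebesgue" and b_nn: "0 \<le> b k x"
    and b_off: "AE x in lebesgue. x \<notin> Q k \<longrightarrow> b k x = 0" and b_int: "integrable lebesgue (\<lambda>x. b k x powr p')"
    and b_le: "Lpr p' UNIV (b k) \<le> \<mu> k * w k" and \<mu>_nn: "0 \<le> \<mu> k" and \<mu>_sum: "summable \<mu>" for k x
    using b by (auto simp: majorant_def)
  have wpos: "0 < w k" for k by (simp add: weight_def)
  obtain c where c: "admissible (decay :: real ^ 'n \<Rightarrow> real) c" using admissible_decay by blast
  note hd = majorized_pairing(1)[OF h b le c]
  have int: "integrable lebesgue (\<lambda>x. h x * \<psi> x)"
    and norm_int: "norm (LINT x|lebesgue. h x * \<psi> x) \<le> C * (LINT x|lebesgue. norm (h x) * decay x)"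
    if [measurable]: "\<psi> \<in> borel_measurable lebesgue" and C: "\<And>x. norm (\<psi> x) \<le> C * decay x" for \<psi> and C :: real
  proof -
    have le: "norm (h x * \<psi> x) \<le> C * (norm (h x) * decay x)" for x
      using mult_left_mono[OF C[of x], of "norm (h x)"] by (simp add: norm_mult mult_ac)
    show i: "integrable lebesgue (\<lambda>x. h x * \<psi> x)"
    proof (rule Bochner_Integration.integrable_bound[OF integrable_mult_right[OF hd, of C]])
      show "AE x in lebesgue. norm (h x * \<psi> x) \<le> norm (C * (norm (h x) * decay x))"
        using le order_trans[OF _ abs_ge_self] by (intro AE_I2) (simp only: real_norm_def, blast)
    qed measurable
    have "norm (LINT x|lebesgue. h x * \<psi> x) \<le> (LINT x|lebesgue. norm (h x * \<psi> x))" by simp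
    also have "\<dots> \<le> (LINT x|lebesgue. C * (norm (h x) * decay x))"
      using le i hd by (intro integral_mono integrable_norm integrable_mult_right)
    finally show "norm (LINT x|lebesgue. h x * \<psi> x) \<le> C * (LINT x|lebesgue. norm (h x) * decay x)" by simp
  qed
  have schwartz_meas: "\<phi> \<in> borel_measurable lebesgue" if "\<phi> \<in> schwartz_functions" for \<phi> :: "real ^ 'n \<Rightarrow> complex"
    using that unfolding schwartz_functions_def by (intro smooth_fun_measurable) simp
  have schwartz_int: "integrable lebesgue (\<lambda>x. h x * \<phi> x)" if \<phi>: "\<phi> \<in> schwartz_functions" for \<phi>
    using schwartz_decay[OF \<phi>] int[OF schwartz_meas[OF \<phi>]] by blast
  let ?T = "function_distribution h"
  have "tempered_distribution ?T"
    unfolding tempered_distribution_def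
  proof (intro conjI ballI allI impI)
    fix \<phi> \<psi> :: "real ^ 'n \<Rightarrow> complex" assume "\<phi> \<in> schwartz_functions" "\<psi> \<in> schwartz_functions"
    then show "?T (\<lambda>x. \<phi> x + \<psi> x) = ?T \<phi> + ?T \<psi>"
      using schwartz_int by (simp add: function_distribution_def distrib_left)
  next
    fix c and \<phi> :: "real ^ 'n \<Rightarrow> complex" assume "\<phi> \<in> schwartz_functions"
    then show "?T (\<lambda>x. c * \<phi> x) = c * ?T \<phi>"
      by (simp add: function_distribution_def mult.left_commute)
  next
    fix \<Phi> :: "nat \<Rightarrow> real ^ 'n \<Rightarrow> complex" and \<phi>
    assume \<phi>: "\<phi> \<in> schwartz_functions" and \<Phi>: "\<forall>k. \<Phi> k \<in> schwartz_functions"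
      and conv: "schwartz_converges \<Phi> \<phi>"
    let ?I = "LINT x|lebesgue. norm (h x) * decay x"
    have I: "0 \<le> ?I" using decay_pos by (intro integral_nonneg_AE AE_I2 mult_nonneg_nonneg) (auto intro: less_imp_le)
    show "(\<lambda>k. ?T (\<Phi> k)) \<longlonglongrightarrow> ?T \<phi>"
    proof (rule tendstoI)
      fix e :: real assume e: "0 < e"
      then have "0 < e / (?I + 1)" using I by simp
      from schwartz_converges_decay[OF conv this]
      show "\<forall>\<^sub>F k in sequentially. dist (?T (\<Phi> k)) (?T \<phi>) < e"
      proof eventually_elim
        case (elim k)
        have m: "(\<lambda>x. \<Phi> k x - \<phi> x) \<in> borel_measurable lebesgue"
          using schwartz_meas \<phi> \<Phi> by (intro borel_measurable_diff) auto
        have "?T (\<Phi> k) - ?T \<phi> = (LINT x|lebesgue. h x * (\<Phi> k x - \<phi> x))"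
          using schwartz_int \<phi> \<Phi> by (simp add: function_distribution_def right_diff_distrib)
        then have "norm (?T (\<Phi> k) - ?T \<phi>) \<le> e / (?I + 1) * ?I"
          using norm_int[OF m, of "e / (?I + 1)"] elim by simp
        also have "\<dots> < e" using e I by (simp add: field_simps)
        finally show ?case by (simp add: dist_norm)
      qed
    qed
  qed
  define S where "S x = (\<Sum>k. b k x)" for x
  have S_meas[measurable]: "S \<in> borel_measurable lebesgue" unfolding S_def by measurable
  \<comment> \<open>Division by 0 gives 0 here, which is the right value: S x = 0 forces h x = 0,
    and \<mu> k = 0 forces b k = 0 almost everywhere, so the atoms still sum to
    \<open>h\<close>.\<close>
  define atm where "atm k x = h x * of_real (b k x / (S x * \<mu> k))" for k x
  have at_meas[measurable]: "atm k \<in> borel_measurable lebesgue" for k unfolding atm_def by measurable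
  have S_pos: "AE x in lebesgue. summable (\<lambda>k. b k x) \<and> norm (h x) \<le> S x"
    using le majorant_AE_summable[OF b] unfolding S_def by eventually_elim simp
  have at_le: "AE x in lebesgue. norm (atm k x) \<le> (1 / \<mu> k) * b k x" for k
    using S_pos
  proof eventually_elim
    case (elim x)
    show ?case
    proof (cases "S x = 0 \<or> \<mu> k = 0")
      case True
      then show ?thesis using b_nn[of k x] \<mu>_nn[of k] by (auto simp: atm_def)
    next
      case False
      then have "0 < S x" "0 < \<mu> k" using elim norm_ge_zero[of "h x"] \<mu>_nn[of k] by (linarith, simp)
      then show ?thesis
        using mult_right_mono[of "norm (h x)" "S x" "b k x"] elim b_nn[of k x]
        by (simp add: atm_def norm_mult norm_divide field_simps)
    qed
  qed
  \<comment> \<open>A vanishing coefficient forces the norm of \<open>b k\<close> to vanish, so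
    nothing of \<open>h\<close> is lost where \<mu> k = 0.\<close>
  have \<mu>_at: "AE x in lebesgue. \<forall>k. \<mu> k = 0 \<longrightarrow> b k x = 0"
  proof -
    have "AE x in lebesgue. \<mu> k = 0 \<longrightarrow> b k x = 0" for k
    proof (cases "\<mu> k = 0")
      case True
      then have "Lpr p' UNIV (b k) = 0" using b_le[of k] Lpr_nonneg[of p' UNIV "b k"] by simp
      then have "(LINT x|lebesgue. b k x powr p') = 0"
        by (simp add: Lpr_def set_lebesgue_integral_def)
      then have "AE x in lebesgue. b k x powr p' = 0"
        using integral_nonneg_eq_0_iff_AE[OF b_int] by simp
      then show ?thesis by eventually_elim simp
    qed simp
    then show ?thesis by (simp add: AE_all_countable)
  qed
  have expand: "AE x in lebesgue. (\<lambda>k. of_real (\<mu> k) * atm k x) sums h x"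
    using S_pos \<mu>_at
  proof eventually_elim
    case (elim x)
    have e: "of_real (\<mu> k) * atm k x = h x / of_real (S x) * of_real (b k x)" for k
      using elim(2)[rule_format, of k] by (cases "\<mu> k = 0") (simp_all add: atm_def field_simps)
    have "(\<lambda>k. b k x) sums S x" unfolding S_def using elim(1) by (simp add: summable_sums)
    then have "(\<lambda>k. h x / of_real (S x) * of_real (b k x)) sums (h x / of_real (S x) * of_real (S x))"
      by (intro sums_mult sums_of_real)
    moreover have "h x / of_real (S x) * of_real (S x) = h x"
      using elim(1) by (cases "S x = 0") auto
    ultimately show ?case unfolding e by simp
  qed
  define cf where "cf JM = complex_of_real (\<mu> (inv Ix JM))" for JM
  define af where "af JM = atm (inv Ix JM)" for JM
  have rep: "predual_representation p' \<rho> ?T cf af"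
    unfolding predual_representation_def
  proof (intro conjI allI ballI)
    fix J M
    let ?k = "inv Ix (J, M)"
    have Qk: "Q ?k = dyadic_cube (J, M)" "w ?k = weight (J, M)" by (simp_all add: Ix_inv)
    have gi: "set_integrable lebesgue UNIV (\<lambda>x. ((1 / \<mu> ?k) * b ?k x) powr p')"
      using b_int[of ?k] integrable_mult_right[of "(1 / \<mu> ?k) powr p'" lebesgue "\<lambda>x. b ?k x powr p'"]
      by (simp add: set_integrable_def powr_mult powr_divide)
    have al: "AE x in lebesgue. x \<in> UNIV \<longrightarrow> 0 \<le> norm (atm ?k x) \<and> norm (atm ?k x) \<le> (1 / \<mu> ?k) * b ?k x"
      using at_le by eventually_elim simp
    have nm: "(\<lambda>x. norm (atm ?k x)) \<in> borel_measurable lebesgue" by measurable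
    have p'0: "0 < p'" using p' by simp
    note L = Lpr_mono[OF p'0 _ nm gi al]
    show "af (J, M) \<in> Lp_space p'"
      using L(1) by (simp add: af_def Lp_space_def set_integrable_def)
    show "AE x in lebesgue. x \<notin> dyadic_cube (J, M) \<longrightarrow> af (J, M) x = 0"
      using b_off[of ?k] unfolding Qk by eventually_elim (simp add: af_def atm_def)
    have "Lpr p' UNIV (\<lambda>x. norm (atm ?k x)) \<le> Lpr p' UNIV (\<lambda>x. (1 / \<mu> ?k) * b ?k x)" by (rule L(2)) simp
    also have "\<dots> = (1 / \<mu> ?k) * Lpr p' UNIV (b ?k)" using \<mu>_nn[of ?k] p'0 by (intro Lpr_cmult) auto
    also have "\<dots> \<le> (1 / \<mu> ?k) * (\<mu> ?k * w ?k)" using \<mu>_nn[of ?k] by (intro mult_left_mono b_le) simp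
    also have "\<dots> \<le> w ?k" using wpos[of ?k] by (cases "\<mu> ?k = 0") auto
    finally show "Lp_norm_on p' UNIV (af (J, M)) \<le> 2 powr (- real_of_int J * (real CARD('n) / p' + \<rho>))"
      unfolding atom_bound_eq_weight[of J M] Lp_norm_on_eq_Lpr af_def Qk .
  next
    have "((\<lambda>JM. norm (cf JM)) has_sum (\<Sum>k. \<mu> k)) UNIV"
      by (rule has_sum_Ix[where a = \<mu>]) (use \<mu>_sum \<mu>_nn in \<open>auto simp: cf_def Ix_inv summable_sums\<close>)
    then show "(\<lambda>JM. norm (cf JM)) summable_on UNIV" by (rule has_sum_imp_summable)
  next
    fix \<phi> :: "real ^ 'n \<Rightarrow> complex" assume \<phi>: "\<phi> \<in> schwartz_functions"
    note [measurable] = schwartz_meas[OF \<phi>]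
    obtain C where C: "0 \<le> C" "\<And>x. norm (\<phi> x) \<le> C * decay x" using schwartz_decay[OF \<phi>] by blast
    note adm = admissible_cmult[OF c C(1)]
    let ?f = "\<lambda>k x. of_real (\<mu> k) * atm k x * \<phi> x"
    have f_le: "AE x in lebesgue. norm (?f k x) \<le> b k x * (C * decay x)" for k
      using at_le[of k] \<mu>_at
    proof eventually_elim
      case (elim x)
      have "\<mu> k * norm (atm k x) \<le> b k x"
      proof (cases "\<mu> k = 0")
        case False
        then show ?thesis using mult_left_mono[OF elim(1) \<mu>_nn[of k]] by simp
      qed (use b_nn in simp)
      then show ?case unfolding norm_mult using C(2)[of x] \<mu>_nn[of k] b_nn
        by (intro mult_mono) auto
    qed
    have f_int: "integrable lebesgue (?f k)" for k
    proof (rule Bochner_Integration.integrable_bound[OF majorant_pairing(1)[OF b adm]])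
      show "AE x in lebesgue. norm (?f k x) \<le> norm (b k x * (C * decay x))"
        using f_le[of k] by eventually_elim (simp add: order_trans[OF _ abs_ge_self])
    qed measurable
    have f_sum: "summable (\<lambda>k. LINT x|lebesgue. norm (?f k x))"
    proof (rule summable_comparison_test'[OF majorant_pairing(2)[OF b adm]])
      fix k
      have "(LINT x|lebesgue. norm (?f k x)) \<le> (LINT x|lebesgue. b k x * (C * decay x))"
        using f_le f_int majorant_pairing(1)[OF b adm] by (intro integral_mono_AE integrable_norm)
      then show "norm (LINT x|lebesgue. norm (?f k x)) \<le> (LINT x|lebesgue. b k x * (C * decay x))" by simp
    qed
    have f_ae: "AE x in lebesgue. summable (\<lambda>k. norm (?f k x))"
      by (rule summable_integral_AE_summable[OF integrable_norm[OF f_int] _ f_sum]) simp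
    have "(\<lambda>k. LINT x|lebesgue. ?f k x) sums (LINT x|lebesgue. (\<Sum>k. ?f k x))"
      by (rule sums_integral[OF f_int f_ae f_sum])
    also have "(LINT x|lebesgue. (\<Sum>k. ?f k x)) = ?T \<phi>"
      unfolding function_distribution_def
    proof (rule integral_cong_AE)
      show "AE x in lebesgue. (\<Sum>k. ?f k x) = h x * \<phi> x"
        using expand by eventually_elim (intro sums_unique[symmetric] sums_mult2)
    qed measurable
    finally have s: "(\<lambda>k. LINT x|lebesgue. ?f k x) sums ?T \<phi>" .
    have n: "summable (\<lambda>k. norm (LINT x|lebesgue. ?f k x))"
      by (rule summable_comparison_test'[OF f_sum]) simp
    show "((\<lambda>JM. cf JM * function_distribution (af JM) \<phi>) has_sum ?T \<phi>) UNIV"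
      by (rule has_sum_Ix[OF n s]) (simp add: cf_def af_def Ix_inv function_distribution_def mult.assoc)
  qed
  with \<open>tempered_distribution ?T\<close> have "?T \<in> predual_dist_space p' \<rho>"
    unfolding predual_dist_space_def by blast
  then show "h \<in> predual_space p' \<rho>" unfolding predual_space_def using h schwartz_int by blast
  have "predual_norm p' \<rho> h \<le> infsum (\<lambda>JM. norm (cf JM)) UNIV"
    unfolding predual_norm_def predual_dist_norm_def
    by (rule cInf_lower) (use rep in \<open>auto intro!: bdd_belowI[of _ 0] infsum_nonneg\<close>)
  also have "infsum (\<lambda>JM. norm (cf JM)) UNIV = (\<Sum>k. \<mu> k)"
    by (intro infsumI has_sum_Ix[where a = \<mu>]) (use \<mu>_sum \<mu>_nn in \<open>auto simp: cf_def Ix_inv summable_sums\<close>)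
  finally show "predual_norm p' \<rho> h \<le> (\<Sum>k. \<mu> k)" .
qed

text \<open>A bump that is positive on the ball has a positive minimum there by compactness;
  dividing by it bounds \<open>h\<close> through an integrable product.\<close>

lemma schwartz_multiple_locally_integrable:
  fixes h :: "real ^ 'n \<Rightarrow> complex"
  assumes h[measurable]: "h \<in> borel_measurable lebesgue"
    and int: "\<And>\<phi>. \<phi> \<in> schwartz_functions \<Longrightarrow> integrable lebesgue (\<lambda>x. h x * \<phi> x)"
  shows "set_integrable lebesgue (cball 0 R) h"
proof -
  let ?a = "(\<chi> i. - (\<bar>R\<bar> + 1)) :: real ^ 'n" and ?b = "(\<chi> i. (\<bar>R\<bar> + 1)) :: real ^ 'n"
  define \<phi> where "\<phi> = box_bump ?a ?b 0"
  have \<phi>: "\<phi> \<in> test_functions" unfolding \<phi>_def by (rule box_bump_test_function)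
  then have i: "integrable lebesgue (\<lambda>x. h x * \<phi> x)"
    using int test_functions_subset_schwartz by blast
  have pos: "0 < norm (\<phi> x)" if "x \<in> cball 0 R" for x
  proof -
    have "x \<in> box ?a ?b" using cball_subset_symmetric_box that by blast
    then have "flat_fun (1 / Suc 0) 1 (x $ i - ?a $ i) \<noteq> 0 \<and> flat_fun (1 / Suc 0) 1 (?b $ i - x $ i) \<noteq> 0" for i
      by (simp add: flat_fun_def mem_box_cart)
    then have "\<phi> x \<noteq> 0" unfolding \<phi>_def box_bump_def by simp
    then show ?thesis by simp
  qed
  have "\<exists>d>0. \<forall>x\<in>cball 0 R. d \<le> norm (\<phi> x)"
  proof (cases "cball 0 R = ({} :: (real ^ 'n) set)")
    case True
    then show ?thesis by (intro exI[of _ 1]) simp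
  next
    case False
    have "continuous_on (cball 0 R) (\<lambda>x. norm (\<phi> x))"
      using \<phi> by (intro continuous_on_norm smooth_fun_continuous) (simp add: test_functions_def)
    then obtain y where "y \<in> cball 0 R" "\<And>x. x \<in> cball 0 R \<Longrightarrow> norm (\<phi> y) \<le> norm (\<phi> x)"
      using continuous_attains_inf[OF compact_cball False] by blast
    then show ?thesis using pos by blast
  qed
  then obtain d where d: "0 < d" "\<And>x. x \<in> cball 0 R \<Longrightarrow> d \<le> norm (\<phi> x)" by blast
  show ?thesis unfolding set_integrable_def
  proof (rule Bochner_Integration.integrable_bound)
    show "integrable lebesgue (\<lambda>x. (1 / d) * norm (h x * \<phi> x))" using i by (intro integrable_mult_right integrable_norm)
    have "norm (indicator (cball 0 R) x *\<^sub>R h x) \<le> (1 / d) * norm (h x * \<phi> x)" for x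
    proof (cases "x \<in> cball 0 R")
      case True
      then show ?thesis using mult_left_mono[OF d(2)[OF True], of "norm (h x)"] d(1)
        by (simp add: norm_mult field_simps del: mem_cball)
    qed (use d in simp)
    then show "AE x in lebesgue. norm (indicator (cball 0 R) x *\<^sub>R h x) \<le> norm ((1 / d) * norm (h x * \<phi> x))"
      using order_trans[OF _ abs_ge_self] by (intro AE_I2) (simp only: real_norm_def, blast)
  qed measurable
qed

text \<open>The moduli of the weighted atoms form a majorant, so the atomic series converges almost
  everywhere to a function \<open>g\<close>, whose integrals against test functions are the values
  of the distribution of \<open>h\<close>. Hence \<open>h\<close> equals \<open>g\<close> almost
  everywhere and inherits its domination. The slack \<open>e\<close> is there because the norm is an
  infimum over representations.\<close>

lemma predual_spaceD:
  fixes h :: "real ^ 'n \<Rightarrow> complex"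
  assumes h: "h \<in> predual_space p' \<rho>" and e: "0 < e"
  shows "\<exists>b \<mu>. majorant b \<mu> \<and> (AE x in lebesgue. norm (h x) \<le> (\<Sum>k. b k x)) \<and> (\<Sum>k. \<mu> k) \<le> predual_norm p' \<rho> h + e"
proof -
  let ?T = "function_distribution h"
  have hm[measurable]: "h \<in> borel_measurable lebesgue"
    and hint: "\<And>\<phi>. \<phi> \<in> schwartz_functions \<Longrightarrow> integrable lebesgue (\<lambda>x. h x * \<phi> x)"
    and ex: "\<exists>c a. predual_representation p' \<rho> ?T c a"
    using h by (auto simp: predual_space_def predual_dist_space_def)
  let ?S = "{infsum (\<lambda>JM. norm (c JM)) UNIV | c. \<exists>a. predual_representation p' \<rho> ?T c a}"
  have ne: "?S \<noteq> {}" using ex by blast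
  have lt: "Inf ?S < predual_norm p' \<rho> h + e" using e by (simp add: predual_norm_def predual_dist_norm_def)
  from cInf_lessD[OF ne lt] obtain s where s: "s \<in> ?S" "s < predual_norm p' \<rho> h + e" ..
  then obtain c a where rep: "predual_representation p' \<rho> ?T c a" and s_eq: "s = infsum (\<lambda>JM. norm (c JM)) UNIV" by blast
  have aL: "a JM \<in> Lp_space p'" and a_off: "AE x in lebesgue. x \<notin> dyadic_cube JM \<longrightarrow> a JM x = 0"
    and a_le: "Lpr p' UNIV (\<lambda>x. norm (a JM x)) \<le> weight JM" for JM
  proof -
    obtain J M where JM: "JM = (J, M)" by (cases JM)
    show "a JM \<in> Lp_space p'" "AE x in lebesgue. x \<notin> dyadic_cube JM \<longrightarrow> a JM x = 0"
      using rep unfolding JM predual_representation_def by blast+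
    have "Lp_norm_on p' UNIV (a (J, M)) \<le> 2 powr (- real_of_int J * (real CARD('n) / p' + \<rho>))"
      using rep unfolding predual_representation_def by blast
    then show "Lpr p' UNIV (\<lambda>x. norm (a JM x)) \<le> weight JM"
      unfolding JM atom_bound_eq_weight[of J M] Lp_norm_on_eq_Lpr .
  qed
  have c_sum: "(\<lambda>JM. norm (c JM)) summable_on UNIV"
    and T_sum: "\<And>\<phi>. \<phi> \<in> schwartz_functions \<Longrightarrow> ((\<lambda>JM. c JM * function_distribution (a JM) \<phi>) has_sum ?T \<phi>) UNIV"
    using rep unfolding predual_representation_def by blast+
  define \<mu> where "\<mu> k = norm (c (Ix k))" for k
  define b where "b k x = norm (c (Ix k) * a (Ix k) x)" for k x
  have \<mu>_has_sum: "(\<mu> has_sum s) UNIV"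
    unfolding \<mu>_def s_eq using has_sum_infsum[OF c_sum] has_sum_reindex_bij_betw[OF Ix, of "\<lambda>JM. norm (c JM)"] by blast
  then have \<mu>_sums: "\<mu> sums s" by (rule has_sum_imp_sums)
  have p'0: "0 < p'" using p' by simp
  have am[measurable]: "a JM \<in> borel_measurable lebesgue" for JM using aL[of JM] by (simp add: Lp_space_def)
  have maj: "majorant b \<mu>"
    unfolding majorant_def
  proof (intro conjI allI)
    fix k
    have ca: "(\<lambda>x. c (Ix k) * a (Ix k) x) \<in> Lp_space p'" by (rule Lp_space_cmult[OF p'0 aL])
    show "b k \<in> borel_measurable lebesgue" unfolding b_def by measurable
    show "0 \<le> b k x" for x by (simp add: b_def)
    show "AE x in lebesgue. x \<notin> Q k \<longrightarrow> b k x = 0" using a_off[of "Ix k"] by eventually_elim (simp add: b_def)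
    show "integrable lebesgue (\<lambda>x. b k x powr p')" using ca unfolding b_def Lp_space_def by blast
    have "Lpr p' UNIV (b k) = \<mu> k * Lpr p' UNIV (\<lambda>x. norm (a (Ix k) x))"
      unfolding b_def \<mu>_def by (rule Lp_space_cmult(2)[OF p'0 aL])
    also have "\<dots> \<le> \<mu> k * w k" by (intro mult_left_mono a_le) (simp add: \<mu>_def)
    finally show "Lpr p' UNIV (b k) \<le> \<mu> k * w k" .
    show "0 \<le> \<mu> k" by (simp add: \<mu>_def)
    show "summable \<mu>" using \<mu>_sums by (rule sums_summable)
  qed
  have bm[measurable]: "b k \<in> borel_measurable lebesgue" for k unfolding b_def by measurable
  define g where "g x = (\<Sum>k. c (Ix k) * a (Ix k) x)" for x
  have g_meas[measurable]: "g \<in> borel_measurable lebesgue" unfolding g_def by measurable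
  have g_le: "AE x in lebesgue. norm (g x) \<le> (\<Sum>k. b k x)"
    using majorant_AE_summable[OF maj]
  proof eventually_elim
    case (elim x)
    then show ?case unfolding g_def b_def by (rule summable_norm)
  qed
  \<comment> \<open>Indicators of balls have finite Morrey norm, so pairing with them yields local
    integrability of \<open>g\<close>.\<close>
  have g_loc: "set_integrable lebesgue (cball 0 R) g" for R
  proof -
    obtain d where "admissible (indicator (cball 0 R) :: real ^ 'n \<Rightarrow> real) d"
      using admissible_indicator_cball by blast
    from majorized_pairing(1)[OF g_meas maj g_le this]
    have i: "integrable lebesgue (\<lambda>x. norm (g x) * indicator (cball 0 R) x)" .
    show ?thesis unfolding set_integrable_def
    proof (rule Bochner_Integration.integrable_bound[OF i])
      show "AE x in lebesgue. norm (indicator (cball 0 R) x *\<^sub>R g x) \<le> norm (norm (g x) * indicator (cball 0 R) x)"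
        by (simp add: indicator_def)
    qed measurable
  qed
  have gT: "(LINT x|lebesgue. g x * \<phi> x) = ?T \<phi>" and g_int: "integrable lebesgue (\<lambda>x. g x * \<phi> x)"
    if \<phi>: "\<phi> \<in> test_functions" for \<phi>
  proof -
    have \<phi>S: "\<phi> \<in> schwartz_functions" using \<phi> test_functions_subset_schwartz by blast
    have [measurable]: "\<phi> \<in> borel_measurable lebesgue"
      using \<phi> smooth_fun_measurable by (auto simp: test_functions_def)
    obtain C where C: "0 \<le> C" "\<And>x. norm (\<phi> x) \<le> C * decay x" using schwartz_decay[OF \<phi>S] by blast
    obtain d where d: "admissible (decay :: real ^ 'n \<Rightarrow> real) d" using admissible_decay by blast
    note adm = admissible_cmult[OF d C(1)]
    let ?f = "\<lambda>k x. c (Ix k) * a (Ix k) x * \<phi> x"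
    have f_le: "norm (?f k x) \<le> b k x * (C * decay x)" for k x
      using C(2)[of x] unfolding norm_mult[of _ "\<phi> x"] b_def by (intro mult_left_mono) auto
    have f_int: "integrable lebesgue (?f k)" for k
    proof (rule Bochner_Integration.integrable_bound[OF majorant_pairing(1)[OF maj adm]])
      show "AE x in lebesgue. norm (?f k x) \<le> norm (b k x * (C * decay x))"
        using f_le[of k] order_trans[OF _ abs_ge_self] by (intro AE_I2) (simp only: real_norm_def, blast)
    qed measurable
    have f_sum: "summable (\<lambda>k. LINT x|lebesgue. norm (?f k x))"
    proof (rule summable_comparison_test'[OF majorant_pairing(2)[OF maj adm]])
      fix k
      have "(LINT x|lebesgue. norm (?f k x)) \<le> (LINT x|lebesgue. b k x * (C * decay x))"
        using f_le f_int majorant_pairing(1)[OF maj adm] by (intro integral_mono integrable_norm)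
      then show "norm (LINT x|lebesgue. norm (?f k x)) \<le> (LINT x|lebesgue. b k x * (C * decay x))" by simp
    qed
    have f_ae: "AE x in lebesgue. summable (\<lambda>k. norm (?f k x))"
      by (rule summable_integral_AE_summable[OF integrable_norm[OF f_int] _ f_sum]) simp
    have eq: "AE x in lebesgue. (\<Sum>k. ?f k x) = g x * \<phi> x"
      using majorant_AE_summable[OF maj]
    proof eventually_elim
      case (elim x)
      then have "summable (\<lambda>k. c (Ix k) * a (Ix k) x)" unfolding b_def by (rule summable_norm_cancel)
      then show ?case unfolding g_def by (simp add: suminf_mult2)
    qed
    have s1: "(\<lambda>k. LINT x|lebesgue. ?f k x) sums (LINT x|lebesgue. (\<Sum>k. ?f k x))"
      by (rule sums_integral[OF f_int f_ae f_sum])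
    have gi:  "(LINT x|lebesgue. (\<Sum>k. ?f k x)) = (LINT x|lebesgue. g x * \<phi> x)"
      by (rule integral_cong_AE[OF _ _ eq]) measurable
    have s2: "(\<lambda>k. LINT x|lebesgue. ?f k x) sums ?T \<phi>"
    proof -
      have "((\<lambda>k. c (Ix k) * function_distribution (a (Ix k)) \<phi>) has_sum ?T \<phi>) UNIV"
        using T_sum[OF \<phi>S] has_sum_reindex_bij_betw[OF Ix, of "\<lambda>JM. c JM * function_distribution (a JM) \<phi>"] by blast
      from has_sum_imp_sums[OF this] show ?thesis by (simp add: function_distribution_def mult.assoc)
    qed
    show "(LINT x|lebesgue. g x * \<phi> x) = ?T \<phi>" using sums_unique2[OF s1 s2] gi by (simp only:)
    from integrable_suminf[OF f_int f_ae f_sum] _ eq show "integrable lebesgue (\<lambda>x. g x * \<phi> x)"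
      by (rule integrable_cong_AE_imp) measurable
  qed
  \<comment> \<open>Convergence of distributions says nothing about points; the passage to functions
    is made here, by orthogonality to all test functions.\<close>
  have "AE x in lebesgue. h x - g x = 0"
  proof (rule AE_eq_0_if_orthogonal_test_functions)
    show "(\<lambda>x. h x - g x) \<in> borel_measurable lebesgue" by measurable
    show "set_integrable lebesgue (cball 0 R) (\<lambda>x. h x - g x)" for R
      by (intro set_integral_diff schwartz_multiple_locally_integrable hm hint g_loc)
    show "(LINT x|lebesgue. (h x - g x) * \<phi> x) = 0" if \<phi>: "\<phi> \<in> test_functions" for \<phi>
    proof -
      have "\<phi> \<in> schwartz_functions" using \<phi> test_functions_subset_schwartz by blast
      then show ?thesis
        using gT[OF \<phi>] g_int[OF \<phi>] hint by (simp add: left_diff_distrib function_distribution_def)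
    qed
  qed
  with g_le have "AE x in lebesgue. norm (h x) \<le> (\<Sum>k. b k x)" by eventually_elim simp
  moreover have "(\<Sum>k. \<mu> k) \<le> predual_norm p' \<rho> h + e" using sums_unique[OF \<mu>_sums] s(2) by simp
  ultimately show ?thesis using maj by blast
qed

lemma predual_norm_nonneg:
  assumes "h \<in> predual_space p' \<rho>"
  shows "0 \<le> predual_norm p' \<rho> h"
  unfolding predual_norm_def predual_dist_norm_def
  by (rule cInf_greatest) (use assms in \<open>auto simp: predual_space_def predual_dist_space_def intro: infsum_nonneg\<close>)

lemma predual_pairing:
  fixes h :: "real ^ 'n \<Rightarrow> complex"
  assumes h: "h \<in> predual_space p' \<rho>" and F: "admissible F c"
  shows "integrable lebesgue (\<lambda>x. norm (h x) * F x)"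
    and "(LINT x|lebesgue. norm (h x) * F x) \<le> predual_norm p' \<rho> h * c"
proof -
  have hm: "h \<in> borel_measurable lebesgue" using h by (simp add: predual_space_def)
  have c: "0 \<le> c"
  proof -
    have "0 \<le> w 0 * Lpr p (Q 0) F" by (simp add: weight_def)
    also have "\<dots> \<le> c" using F unfolding admissible_def by blast
    finally show ?thesis .
  qed
  show "integrable lebesgue (\<lambda>x. norm (h x) * F x)"
    using predual_spaceD[OF h zero_less_one] majorized_pairing(1)[OF hm _ _ F] by blast
  show "(LINT x|lebesgue. norm (h x) * F x) \<le> predual_norm p' \<rho> h * c"
  proof (rule field_le_epsilon)
    fix e :: real assume e: "0 < e"
    \<comment> \<open>After multiplication by \<open>c\<close> the slack stays below
      \<open>e\<close>, also for c = 0.\<close>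
    then have "0 < e / (c + 1)" using c by simp
    from predual_spaceD[OF h this] obtain b \<mu> where b: "majorant b \<mu>" "AE x in lebesgue. norm (h x) \<le> (\<Sum>k. b k x)"
      "(\<Sum>k. \<mu> k) \<le> predual_norm p' \<rho> h + e / (c + 1)" by blast
    have "(LINT x|lebesgue. norm (h x) * F x) \<le> c * (\<Sum>k. \<mu> k)" by (rule majorized_pairing(2)[OF hm b(1,2) F])
    also have "\<dots> \<le> c * (predual_norm p' \<rho> h + e / (c + 1))" using b(3) c by (rule mult_left_mono)
    also have "\<dots> \<le> predual_norm p' \<rho> h * c + e" using c e by (simp add: field_simps)
    finally show "(LINT x|lebesgue. norm (h x) * F x) \<le> predual_norm p' \<rho> h * c + e" .
  qed
qed

end

section \<open>Duality\<close>

text \<open>Minkowski's inequality for infinitely many summands: finite sums first, then the limit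
  in the number of summands for a fixed finite number of components, then the limit in the
  components.\<close>

lemma lqn_series_le:
  fixes a :: "nat \<Rightarrow> nat \<Rightarrow> 'a \<Rightarrow> complex"
  assumes q: "1 \<le> q" and a: "\<And>k. summable (\<lambda>j. norm (a k j x) powr q)" and s: "summable (\<lambda>k. lqn q (a k) x)"
  shows "summable (\<lambda>j. norm (\<Sum>k. a k j x) powr q)"
    and "lqn q (\<lambda>j x. \<Sum>k. a k j x) x \<le> (\<Sum>k. lqn q (a k) x)"
proof -
  define S where "S = (\<Sum>k. lqn q (a k) x)"
  have S0: "0 \<le> S" unfolding S_def by (intro suminf_nonneg s) simp
  have P: "summable (\<lambda>j. norm (\<Sum>k<K. a k j x) powr q) \<and>
      lqn q (\<lambda>j x. \<Sum>k<K. a k j x) x \<le> (\<Sum>k<K. lqn q (a k) x)" for K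
  proof (induction K)
    case 0
    then show ?case using q by (simp add: lqn_def)
  next
    case (Suc K)
    note A = lqn_add[where f = "\<lambda>j x. \<Sum>k<K. a k j x" and g = "a K" and x = x, OF q conjunct1[OF Suc.IH] a]
    show ?case unfolding sum.lessThan_Suc using A conjunct2[OF Suc.IH] by (intro conjI) (assumption, linarith)
  qed
  have term_sum: "summable (\<lambda>k. a k j x)" for j
  proof (rule summable_norm_cancel, rule summable_comparison_test'[OF s])
    show "norm (norm (a k j x)) \<le> lqn q (a k) x" for k using norm_le_lqn[where f = "a k" and x = x and j = j, OF q a] by simp
  qed
  \<comment> \<open>Only finitely many components are kept, so the limit over the partial sums in
    \<open>k\<close> can be taken term by term.\<close>
  have bound: "(\<Sum>j<m. norm (\<Sum>k. a k j x) powr q) \<le> S powr q" for m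
  proof (rule LIMSEQ_le_const2)
    show "(\<lambda>K. \<Sum>j<m. norm (\<Sum>k<K. a k j x) powr q) \<longlonglongrightarrow> (\<Sum>j<m. norm (\<Sum>k. a k j x) powr q)"
    proof (rule tendsto_sum)
      fix j
      show "(\<lambda>K. norm (\<Sum>k<K. a k j x) powr q) \<longlonglongrightarrow> norm (\<Sum>k. a k j x) powr q"
        by (rule tendsto_powr'[OF tendsto_norm[OF summable_LIMSEQ[OF term_sum]] tendsto_const]) (use q in auto)
    qed
    have "(\<Sum>j<m. norm (\<Sum>k<K. a k j x) powr q) \<le> S powr q" for K
    proof -
      have "(\<Sum>j<m. norm (\<Sum>k<K. a k j x) powr q) \<le> (\<Sum>j. norm (\<Sum>k<K. a k j x) powr q)"
        using P[of K] by (intro sum_le_suminf) auto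
      also have "\<dots> = lqn q (\<lambda>j x. \<Sum>k<K. a k j x) x powr q"
        by (rule lqn_powr[where f = "\<lambda>j x. \<Sum>k<K. a k j x" and x = x, OF q conjunct1[OF P], symmetric])
      also have "\<dots> \<le> S powr q"
      proof (rule powr_mono2)
        have "(\<Sum>k<K. lqn q (a k) x) \<le> S" unfolding S_def by (intro sum_le_suminf s) auto
        then show "lqn q (\<lambda>j x. \<Sum>k<K. a k j x) x \<le> S" using P[of K] by linarith
      qed (use q in auto)
      finally show ?thesis .
    qed
    then show "\<exists>N. \<forall>K\<ge>N. (\<Sum>j<m. norm (\<Sum>k<K. a k j x) powr q) \<le> S powr q" by blast
  qed
  show sm: "summable (\<lambda>j. norm (\<Sum>k. a k j x) powr q)"
    by (rule summableI_nonneg_bounded[OF _ bound]) simp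
  have "(\<Sum>j. norm (\<Sum>k. a k j x) powr q) \<le> S powr q" by (rule suminf_le_const[OF sm bound])
  then have "(\<Sum>j. norm (\<Sum>k. a k j x) powr q) powr (1 / q) \<le> (S powr q) powr (1 / q)"
    using q by (intro powr_mono2 suminf_nonneg sm) auto
  then show "lqn q (\<lambda>j x. \<Sum>k. a k j x) x \<le> (\<Sum>k. lqn q (a k) x)"
    using q S0 by (simp add: lqn_def powr_powr S_def)
qed

context morrey_setting
begin

abbreviation H :: "(nat \<Rightarrow> real ^ 'n \<Rightarrow> complex) set" where "H \<equiv> predual_lq p' \<rho> q'"
abbreviation N\<^sub>H :: "(nat \<Rightarrow> real ^ 'n \<Rightarrow> complex) \<Rightarrow> real" where "N\<^sub>H \<equiv> predual_lq_norm p' \<rho> q'"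

text \<open>One majorant serves the pointwise ell_q' norm and every component, since each component
  lies below that norm.\<close>

lemma predual_lqI:
  fixes g :: "nat \<Rightarrow> real ^ 'n \<Rightarrow> complex"
  assumes m: "\<And>j. g j \<in> borel_measurable lebesgue"
    and s: "AE x in lebesgue. summable (\<lambda>j. norm (g j x) powr q')"
    and b: "majorant b \<mu>" and le: "AE x in lebesgue. lqn q' g x \<le> (\<Sum>k. b k x)"
  shows "g \<in> H" "N\<^sub>H g \<le> (\<Sum>k. \<mu> k)"
proof -
  have lq: "lq_fun q' g = (\<lambda>x. of_real (lqn q' g x))" by (simp add: lq_fun_eq_lqn fun_eq_iff)
  have [measurable]: "lqn q' g \<in> borel_measurable lebesgue" using m by (rule lqn_measurable)
  have lm: "lq_fun q' g \<in> borel_measurable lebesgue" unfolding lq by measurable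
  have le1: "AE x in lebesgue. norm (lq_fun q' g x) \<le> (\<Sum>k. b k x)" using le by (simp add: lq)
  have le2: "AE x in lebesgue. norm (g j x) \<le> (\<Sum>k. b k x)" for j
    using s le
  proof eventually_elim
    case (elim x)
    then show ?case using norm_le_lqn[of q' g x j] q' by simp
  qed
  show "g \<in> H" unfolding predual_lq_def lq_valued_def
    using predual_spaceI(1)[OF m b le2] predual_spaceI(1)[OF lm b le1] s by blast
  show "N\<^sub>H g \<le> (\<Sum>k. \<mu> k)" unfolding predual_lq_norm_def by (rule predual_spaceI(2)[OF lm b le1])
qed

lemma predual_lqD:
  assumes "g \<in> H"
  shows "g j \<in> predual_space p' \<rho>" "g j \<in> borel_measurable lebesgue"
    and "AE x in lebesgue. summable (\<lambda>j. norm (g j x) powr q')" "lq_fun q' g \<in> predual_space p' \<rho>"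
  using assms by (auto simp: predual_lq_def lq_valued_def predual_space_def)

lemma predual_lq_norm_nonneg: "g \<in> H \<Longrightarrow> 0 \<le> N\<^sub>H g"
  unfolding predual_lq_norm_def by (intro predual_norm_nonneg predual_lqD)

text \<open>Hoelder's inequality for the series at each point leaves the product of the two
  pointwise norms, to which the scalar estimate for the predual space applies.\<close>

lemma pairing_bound:
  assumes g: "g \<in> H" and f: "f \<in> morrey_lq p r q"
  shows "AE x in lebesgue. summable (\<lambda>j. g j x * f j x)"
    and "integrable lebesgue (\<lambda>x. \<Sum>j. g j x * f j x)"
    and "norm (pairing g f) \<le> N\<^sub>H g * N\<^sub>L f"
proof -
  note [measurable] = predual_lqD(2)[OF g] morrey_lqD(1)[OF f]
  have e: "norm (lq_fun q' g x) = lqn q' g x" for x by (simp add: lq_fun_eq_lqn)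
  note P = predual_pairing[OF predual_lqD(4)[OF g] admissible_lqn[OF f], unfolded e]
  have hoelder: "AE x in lebesgue. summable (\<lambda>j. norm (g j x * f j x)) \<and>
      norm (\<Sum>j. g j x * f j x) \<le> lqn q' g x * lqn q f x"
    using predual_lqD(3)[OF g] morrey_lqD(2)[OF f]
  proof eventually_elim
    case (elim x)
    note h = lqn_Hoelder[where f = f and g = g and x = x, OF q conj_q elim(2) elim(1)]
    show ?case using h summable_norm[OF h(1)] by simp
  qed
  show "AE x in lebesgue. summable (\<lambda>j. g j x * f j x)"
    using hoelder by eventually_elim (blast intro: summable_norm_cancel)
  show i: "integrable lebesgue (\<lambda>x. \<Sum>j. g j x * f j x)"
  proof (rule Bochner_Integration.integrable_bound[OF P(1)])
    show "AE x in lebesgue. norm (\<Sum>j. g j x * f j x) \<le> norm (lqn q' g x * lqn q f x)"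
      using hoelder by eventually_elim simp
  qed measurable
  have "norm (pairing g f) \<le> (LINT x|lebesgue. norm (\<Sum>j. g j x * f j x))"
    unfolding pairing_def by (rule integral_norm_bound)
  also have "\<dots> \<le> (LINT x|lebesgue. lqn q' g x * lqn q f x)"
    using hoelder i P(1) by (intro integral_mono_AE integrable_norm) (auto elim: eventually_mono)
  also have "\<dots> \<le> N\<^sub>H g * N\<^sub>L f" using P(2) by (simp add: predual_lq_norm_def)
  finally show "norm (pairing g f) \<le> N\<^sub>H g * N\<^sub>L f" .
qed

lemma pairing_exists_predual: "g \<in> H \<Longrightarrow> f \<in> morrey_lq p r q \<Longrightarrow> pairing_exists g f"
  unfolding pairing_exists_def using pairing_bound by blast

lemma pairing_add:
  assumes g: "g \<in> H" and f: "f \<in> morrey_lq p r q" and h: "h \<in> morrey_lq p r q"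
  shows "pairing g (\<lambda>j x. f j x + h j x) = pairing g f + pairing g h"
proof -
  note [measurable] = predual_lqD(2)[OF g] morrey_lqD(1)[OF f] morrey_lqD(1)[OF h]
  have "pairing g (\<lambda>j x. f j x + h j x) = (LINT x|lebesgue. (\<Sum>j. g j x * f j x) + (\<Sum>j. g j x * h j x))"
    unfolding pairing_def
  proof (rule integral_cong_AE)
    show "AE x in lebesgue. (\<Sum>j. g j x * (f j x + h j x)) = (\<Sum>j. g j x * f j x) + (\<Sum>j. g j x * h j x)"
      using pairing_bound(1)[OF g f] pairing_bound(1)[OF g h]
    proof eventually_elim
      case (elim x)
      then show ?case by (subst suminf_add) (simp_all add: distrib_left)
    qed
  qed measurable
  also have "\<dots> = pairing g f + pairing g h"
    unfolding pairing_def by (intro Bochner_Integration.integral_add pairing_bound(2) g f h)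
  finally show ?thesis .
qed

lemma pairing_cmult:
  assumes g: "g \<in> H" and f: "f \<in> morrey_lq p r q"
  shows "pairing g (\<lambda>j x. c * f j x) = c * pairing g f"
proof -
  note [measurable] = predual_lqD(2)[OF g] morrey_lqD(1)[OF f]
  have "pairing g (\<lambda>j x. c * f j x) = (LINT x|lebesgue. c * (\<Sum>j. g j x * f j x))"
    unfolding pairing_def
  proof (rule integral_cong_AE)
    show "AE x in lebesgue. (\<Sum>j. g j x * (c * f j x)) = c * (\<Sum>j. g j x * f j x)"
      using pairing_bound(1)[OF g f]
    proof eventually_elim
      case (elim x)
      then show ?case by (subst suminf_mult[symmetric]) (simp_all add: mult.left_commute)
    qed
  qed measurable
  then show ?thesis by (simp add: pairing_def)
qed

section \<open>The closure of the test sequences and its bounded functionals\<close>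

lemma morrey0_subset: "f \<in> L0 \<Longrightarrow> f \<in> morrey_lq p r q"
  by (simp add: morrey0_lq_def)

lemma bcs_subset_L0: "f \<in> bcs \<Longrightarrow> f \<in> L0"
  by (rule subsetD[OF Lp_lq_subset_morrey0_lq subsetD[OF bcs_subset_Lp_lq]])

lemma morrey0_approximation:
  assumes "f \<in> L0"
  shows "\<exists>F. (\<forall>k. F k \<in> bcs) \<and> (\<lambda>k. N\<^sub>L (\<lambda>j x. f j x - F k j x)) \<longlonglongrightarrow> 0"
proof -
  obtain F where F: "\<And>j k. F k j \<in> test_functions" "\<And>j k. j > k \<Longrightarrow> F k j = (\<lambda>x. 0)"
    "(\<lambda>k. N\<^sub>L (\<lambda>j x. f j x - F k j x)) \<longlonglongrightarrow> 0"
    using assms unfolding morrey0_lq_def by blast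
  have "F k \<in> bcs" for k by (rule test_sequence_bcs[where f = "F k" and k = k]) (rule F(1), erule F(2))
  then show ?thesis using F(3) by blast
qed

lemma morrey0_add:
  assumes f: "f \<in> L0" and h: "h \<in> L0"
  shows "(\<lambda>j x. f j x + h j x) \<in> L0"
proof -
  obtain F where F: "\<And>j k. F k j \<in> test_functions" "\<And>j k. j > k \<Longrightarrow> F k j = (\<lambda>x. 0)"
    "(\<lambda>k. N\<^sub>L (\<lambda>j x. f j x - F k j x)) \<longlonglongrightarrow> 0"
    using f unfolding morrey0_lq_def by blast
  obtain K where K: "\<And>j k. K k j \<in> test_functions" "\<And>j k. j > k \<Longrightarrow> K k j = (\<lambda>x. 0)"
    "(\<lambda>k. N\<^sub>L (\<lambda>j x. h j x - K k j x)) \<longlonglongrightarrow> 0"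
    using h unfolding morrey0_lq_def by blast
  define E where "E k j x = F k j x + K k j x" for k j x
  have FK: "F k \<in> morrey_lq p r q" "K k \<in> morrey_lq p r q" for k
  proof -
    have "F k \<in> bcs" by (rule test_sequence_bcs[where f = "F k" and k = k]) (rule F(1), erule F(2))
    then show "F k \<in> morrey_lq p r q" by (intro morrey0_subset bcs_subset_L0)
    have "K k \<in> bcs" by (rule test_sequence_bcs[where f = "K k" and k = k]) (rule K(1), erule K(2))
    then show "K k \<in> morrey_lq p r q" by (intro morrey0_subset bcs_subset_L0)
  qed
  have d: "(\<lambda>j x. f j x - F k j x) \<in> morrey_lq p r q" "(\<lambda>j x. h j x - K k j x) \<in> morrey_lq p r q" for k
    by (intro morrey_lq_diff morrey0_subset f h FK)+
  have e: "(\<lambda>j x. (f j x + h j x) - E k j x) = (\<lambda>j x. (f j x - F k j x) + (h j x - K k j x))" for k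
    by (simp add: E_def fun_eq_iff)
  have "(\<lambda>k. N\<^sub>L (\<lambda>j x. (f j x + h j x) - E k j x)) \<longlonglongrightarrow> 0"
  proof (rule tendsto_sandwich[OF _ _ tendsto_const])
    show "(\<lambda>k. N\<^sub>L (\<lambda>j x. f j x - F k j x) + N\<^sub>L (\<lambda>j x. h j x - K k j x)) \<longlonglongrightarrow> 0"
      using tendsto_add[OF F(3) K(3)] by simp
    show "\<forall>\<^sub>F k in sequentially. 0 \<le> N\<^sub>L (\<lambda>j x. (f j x + h j x) - E k j x)"
      unfolding e by (intro always_eventually allI morrey_lq_norm_nonneg morrey_lq_add(1) d)
    show "\<forall>\<^sub>F k in sequentially. N\<^sub>L (\<lambda>j x. (f j x + h j x) - E k j x)
        \<le> N\<^sub>L (\<lambda>j x. f j x - F k j x) + N\<^sub>L (\<lambda>j x. h j x - K k j x)"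
      unfolding e by (intro always_eventually allI morrey_lq_add(2) d)
  qed
  moreover have "E k j \<in> test_functions" for k j
    unfolding E_def by (rule test_functions_add[OF F(1) K(1)])
  moreover have "E k j = (\<lambda>x. 0)" if "j > k" for k j using F(2)[OF that] K(2)[OF that] by (simp add: E_def fun_eq_iff)
  ultimately show ?thesis
    unfolding morrey0_lq_def
    by (intro CollectI conjI morrey_lq_add(1) morrey0_subset f h exI[of _ E] allI impI)
qed

lemma morrey0_cmult:
  assumes f: "f \<in> L0"
  shows "(\<lambda>j x. c * f j x) \<in> L0"
proof -
  obtain F where F: "\<And>j k. F k j \<in> test_functions" "\<And>j k. j > k \<Longrightarrow> F k j = (\<lambda>x. 0)"
    "(\<lambda>k. N\<^sub>L (\<lambda>j x. f j x - F k j x)) \<longlonglongrightarrow> 0"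
    using f unfolding morrey0_lq_def by blast
  define E where "E k j x = c * F k j x" for k j x
  have FK: "F k \<in> morrey_lq p r q" for k
  proof -
    have "F k \<in> bcs" by (rule test_sequence_bcs[where f = "F k" and k = k]) (rule F(1), erule F(2))
    then show "F k \<in> morrey_lq p r q" by (intro morrey0_subset bcs_subset_L0)
  qed
  have d: "(\<lambda>j x. f j x - F k j x) \<in> morrey_lq p r q" for k by (intro morrey_lq_diff morrey0_subset f FK)
  have e: "(\<lambda>j x. c * f j x - E k j x) = (\<lambda>j x. c * (f j x - F k j x))" for k
    by (simp add: E_def fun_eq_iff right_diff_distrib)
  have "(\<lambda>k. N\<^sub>L (\<lambda>j x. c * f j x - E k j x)) \<longlonglongrightarrow> 0"
  proof (rule tendsto_sandwich[OF _ _ tendsto_const])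
    show "(\<lambda>k. norm c * N\<^sub>L (\<lambda>j x. f j x - F k j x)) \<longlonglongrightarrow> 0"
      using tendsto_mult[OF tendsto_const F(3), of "norm c"] by simp
    show "\<forall>\<^sub>F k in sequentially. 0 \<le> N\<^sub>L (\<lambda>j x. c * f j x - E k j x)"
      unfolding e by (intro always_eventually allI morrey_lq_norm_nonneg morrey_lq_cmult(1) d)
    show "\<forall>\<^sub>F k in sequentially. N\<^sub>L (\<lambda>j x. c * f j x - E k j x) \<le> norm c * N\<^sub>L (\<lambda>j x. f j x - F k j x)"
      unfolding e by (intro always_eventually allI morrey_lq_cmult(2) d)
  qed
  moreover have "E k j \<in> test_functions" for k j
    unfolding E_def by (rule test_functions_cmult[OF F(1)])
  moreover have "E k j = (\<lambda>x. 0)" if "j > k" for k j using F(2)[OF that] by (simp add: E_def fun_eq_iff)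
  ultimately show ?thesis
    unfolding morrey0_lq_def
    by (intro CollectI conjI morrey_lq_cmult(1) morrey0_subset f exI[of _ E] allI impI)
qed

lemma zero_L0: "(\<lambda>j x. 0) \<in> L0" and zero_norm: "N\<^sub>L (\<lambda>j x. 0) \<le> 0"
proof -
  have "(\<lambda>j x. 0) \<in> bcs" using bfin_zero(1) unfolding bcs_def by auto
  then show z: "(\<lambda>j x. 0) \<in> L0" by (rule bcs_subset_L0)
  show "N\<^sub>L (\<lambda>j x. 0) \<le> 0" using morrey_lq_cmult(2)[OF morrey0_subset[OF z], of 0] by simp
qed

lemma dual_spaceD:
  assumes "G \<in> dual_space L0 N\<^sub>L"
  shows "f \<in> L0 \<Longrightarrow> h \<in> L0 \<Longrightarrow> G (\<lambda>j x. f j x + h j x) = G f + G h"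
    and "f \<in> L0 \<Longrightarrow> G (\<lambda>j x. c * f j x) = c * G f"
    and "\<exists>C. \<forall>f\<in>L0. norm (G f) \<le> C * N\<^sub>L f"
  using assms unfolding dual_space_def by blast+

lemma dual_norm_upper:
  assumes G: "G \<in> dual_space L0 N\<^sub>L" and f: "f \<in> L0"
  shows "norm (G f) \<le> dual_norm L0 N\<^sub>L G * N\<^sub>L f" and "0 \<le> dual_norm L0 N\<^sub>L G"
proof -
  obtain C where C: "\<And>f. f \<in> L0 \<Longrightarrow> norm (G f) \<le> C * N\<^sub>L f" using dual_spaceD(3)[OF G] by blast
  have Nf: "0 \<le> N\<^sub>L f" if "f \<in> L0" for f using that by (intro morrey_lq_norm_nonneg morrey0_subset)
  have bdd: "bdd_above ((\<lambda>f. norm (G f)) ` {f \<in> L0. N\<^sub>L f \<le> 1})"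
  proof (rule bdd_aboveI2)
    fix f assume "f \<in> {f \<in> L0. N\<^sub>L f \<le> 1}"
    then have f: "f \<in> L0" "N\<^sub>L f \<le> 1" by auto
    have "norm (G f) \<le> C * N\<^sub>L f" by (rule C[OF f(1)])
    also have "\<dots> \<le> \<bar>C\<bar> * 1" using f Nf[OF f(1)] by (intro mult_mono) auto
    finally show "norm (G f) \<le> \<bar>C\<bar>" by simp
  qed
  have up: "norm (G f) \<le> dual_norm L0 N\<^sub>L G" if "f \<in> L0" "N\<^sub>L f \<le> 1" for f
    unfolding dual_norm_def using that by (intro cSUP_upper bdd) simp
  show "0 \<le> dual_norm L0 N\<^sub>L G"
    using order_trans[OF norm_ge_zero up[OF zero_L0]] zero_norm by simp
  show "norm (G f) \<le> dual_norm L0 N\<^sub>L G * N\<^sub>L f"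
  proof (cases "N\<^sub>L f = 0")
    \<comment> \<open>No rescaling to norm 1 is possible in this case; boundedness of
      \<open>G\<close> makes \<open>G f\<close> vanish.\<close>
    case True
    then show ?thesis using C[OF f] by simp
  next
    case False
    then have pos: "0 < N\<^sub>L f" using Nf[OF f] by simp
    let ?t = "complex_of_real (1 / N\<^sub>L f)"
    have "N\<^sub>L (\<lambda>j x. ?t * f j x) \<le> norm ?t * N\<^sub>L f" by (rule morrey_lq_cmult(2)[OF morrey0_subset[OF f]])
    also have "\<dots> = 1" using pos by (simp add: norm_divide)
    finally have "norm (G (\<lambda>j x. ?t * f j x)) \<le> dual_norm L0 N\<^sub>L G" by (intro up morrey0_cmult f)
    then show ?thesis unfolding dual_spaceD(2)[OF G f] using pos by (simp add: norm_mult norm_divide field_simps)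
  qed
qed

lemma dual_norm_le:
  assumes "\<And>f. f \<in> L0 \<Longrightarrow> N\<^sub>L f \<le> 1 \<Longrightarrow> norm (G f) \<le> D"
  shows "dual_norm L0 N\<^sub>L G \<le> D"
  unfolding dual_norm_def
proof (rule cSUP_least)
  have "(\<lambda>j x. 0) \<in> {f \<in> L0. N\<^sub>L f \<le> 1}" using zero_L0 zero_norm by simp
  then show "{f \<in> L0. N\<^sub>L f \<le> 1} \<noteq> {}" by blast
qed (use assms in blast)

lemma pairing_dual_space:
  assumes g: "g \<in> H"
  shows "pairing g \<in> dual_space L0 N\<^sub>L"
  unfolding dual_space_def
proof (intro CollectI conjI ballI allI)
  show "pairing g (\<lambda>j x. f j x + h j x) = pairing g f + pairing g h" if "f \<in> L0" "h \<in> L0" for f h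
    by (rule pairing_add[OF g morrey0_subset[OF that(1)] morrey0_subset[OF that(2)]])
  show "pairing g (\<lambda>j x. c * f j x) = c * pairing g f" if "f \<in> L0" for c f
    by (rule pairing_cmult[OF g morrey0_subset[OF that]])
  show "\<exists>C. \<forall>f\<in>L0. norm (pairing g f) \<le> C * N\<^sub>L f"
    by (intro exI[of _ "N\<^sub>H g"] ballI pairing_bound(3) g morrey0_subset)
qed

lemma dual_space_eq_on_dense:
  assumes G: "G \<in> dual_space L0 N\<^sub>L" and G': "G' \<in> dual_space L0 N\<^sub>L"
    and eq: "\<And>f. f \<in> bcs \<Longrightarrow> G f = G' f" and f: "f \<in> L0"
  shows "G f = G' f"
proof -
  obtain F where F: "\<And>k. F k \<in> bcs" "(\<lambda>k. N\<^sub>L (\<lambda>j x. f j x - F k j x)) \<longlonglongrightarrow> 0"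
    using morrey0_approximation[OF f] by blast
  define d where "d k = (\<lambda>j x. f j x - F k j x)" for k
  have d: "d k \<in> L0" for k
    unfolding d_def using morrey0_add[OF f morrey0_cmult[OF bcs_subset_L0[OF F(1)], of "-1"]] by simp
  have split: "K f = K (d k) + K (F k)" if "K \<in> dual_space L0 N\<^sub>L" for K k
    using dual_spaceD(1)[OF that d bcs_subset_L0[OF F(1)], of k k] by (simp add: d_def)
  let ?D = "dual_norm L0 N\<^sub>L G + dual_norm L0 N\<^sub>L G'"
  have "norm (G f - G' f) \<le> ?D * N\<^sub>L (d k)" for k
  proof -
    have "G f - G' f = G (d k) - G' (d k)" using split[OF G, of k] split[OF G', of k] eq[OF F(1)] by simp
    then have "norm (G f - G' f) \<le> norm (G (d k)) + norm (G' (d k))" using norm_triangle_ineq4 by simp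
    also have "\<dots> \<le> ?D * N\<^sub>L (d k)"
      using dual_norm_upper(1)[OF G d, of k] dual_norm_upper(1)[OF G' d, of k] by (simp add: distrib_right)
    finally show ?thesis .
  qed
  moreover have "(\<lambda>k. ?D * N\<^sub>L (d k)) \<longlonglongrightarrow> ?D * 0" using F(2) unfolding d_def by (intro tendsto_intros)
  ultimately have "norm (G f - G' f) \<le> ?D * 0" by (intro LIMSEQ_le_const) auto
  then show ?thesis by simp
qed

lemma bcs_single:
  assumes "\<phi> \<in> borel_measurable lebesgue" "\<And>x. norm (\<phi> x) \<le> C * indicator (cball 0 R) x"
  shows "(\<lambda>i. if i = j then \<phi> else (\<lambda>_. 0)) \<in> bcs"
proof -
  have "norm (\<phi> x) \<le> \<bar>C\<bar>" for x using assms(2)[of x] by (cases "x \<in> cball 0 R") (auto simp del: mem_cball)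
  moreover have "\<phi> x = 0" if "R < norm x" for x using assms(2)[of x] that by simp
  ultimately show ?thesis unfolding bcs_def using bfin_single[OF assms(1)] by auto
qed

text \<open>Sequences with a single nonzero component isolate one component of the difference, and
  this component may be tested with any bounded function of bounded support.\<close>

lemma representation_unique:
  assumes g: "g \<in> H" and g': "g' \<in> H" and eq: "\<And>f. f \<in> bcs \<Longrightarrow> pairing g f = pairing g' f"
  shows "ae_equal g g'"
  unfolding ae_equal_def
proof
  fix j
  have single: "(\<Sum>i. k i x * (if i = j then \<phi> else (\<lambda>_. 0)) x) = k j x * \<phi> x"
    for k :: "nat \<Rightarrow> real ^ 'n \<Rightarrow> complex" and \<phi> x
    by (subst suminf_finite[of "{j}"]) auto
  have loc: "set_integrable lebesgue (cball 0 R) (k j)" if "k \<in> H" for k R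
    using predual_lqD(1)[OF that, of j] schwartz_multiple_locally_integrable[of "k j" R]
    unfolding predual_space_def by blast
  have "AE x in lebesgue. g j x - g' j x = 0"
  proof (rule AE_eq_0_if_orthogonal_bounded)
    show "(\<lambda>x. g j x - g' j x) \<in> borel_measurable lebesgue"
      by (intro borel_measurable_diff predual_lqD(2) g g')
    show "set_integrable lebesgue (cball 0 R) (\<lambda>x. g j x - g' j x)" for R
      by (intro set_integral_diff loc g g')
    fix \<phi> :: "real ^ 'n \<Rightarrow> complex" and C R
    assume \<phi>: "\<phi> \<in> borel_measurable lebesgue" "\<And>x. norm (\<phi> x) \<le> C * indicator (cball 0 R) x"
    have "(LINT x|lebesgue. g j x * \<phi> x) = (LINT x|lebesgue. g' j x * \<phi> x)"
      using eq[OF bcs_single[OF \<phi>, of j]] unfolding pairing_def single .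
    moreover have "integrable lebesgue (\<lambda>x. k j x * \<phi> x)" if "k \<in> H" for k
      by (rule integrable_mult_bounded_support[OF predual_lqD(2)[OF that] loc[OF that] \<phi>])
    ultimately show "(LINT x|lebesgue. (g j x - g' j x) * \<phi> x) = 0"
      using g g' by (simp add: left_diff_distrib)
  qed
  then show "AE x in lebesgue. g j x = g' j x" by simp
qed

text \<open>The majorant is returned together with \<open>g\<close> because the estimate of the
  predual norm has to be carried over to every other representative of the same functional.\<close>

lemma dual_representation:
  assumes G: "G \<in> dual_space L0 N\<^sub>L"
  shows "\<exists>g b \<mu>. g \<in> H \<and> (\<forall>f\<in>L0. G f = pairing g f) \<and> majorant b \<mu> \<and>
    (AE x in lebesgue. lqn q' g x \<le> (\<Sum>k. b k x)) \<and> (\<Sum>k. \<mu> k) \<le> dual_norm L0 N\<^sub>L G"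
proof -
  let ?C = "dual_norm L0 N\<^sub>L G"
  have C: "0 \<le> ?C" by (rule dual_norm_upper(2)[OF G zero_L0])
  obtain a where a_meas[measurable]: "\<And>k j. a k j \<in> borel_measurable lebesgue"
    and a_off: "\<And>k j x. x \<notin> Q k \<Longrightarrow> a k j x = 0"
    and a_sum: "\<And>k. AE x in lebesgue. summable (\<lambda>j. norm (a k j x) powr q')"
    and a_int: "\<And>k. integrable lebesgue (\<lambda>x. lqn q' (a k) x powr p')"
    and a_le: "\<And>n. (\<Sum>k<n. Lpr p' UNIV (lqn q' (a k)) / w k) \<le> ?C"
    and a_lim: "\<And>f. f \<in> bcs \<Longrightarrow> (\<lambda>n. \<Sum>k<n. LINT x|lebesgue. Re (\<Sum>j. a k j x * f j x)) \<longlonglongrightarrow> Re (G f)"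
  proof (rule functional_decomposition[OF C subspace_bcs, of "\<lambda>f. Re (G f)"])
    show "bcs \<subseteq> bfin" by (auto simp: bcs_def)
    fix f assume f: "f \<in> bcs"
    show "(\<lambda>k. cell_norm k f) \<longlonglongrightarrow> 0" by (rule bcs_cell_norm_tendsto_0[OF f])
    have "Re (G f) \<le> norm (G f)" by (rule complex_Re_le_cmod)
    also have "\<dots> \<le> ?C * N\<^sub>L f" by (rule dual_norm_upper(1)[OF G bcs_subset_L0[OF f]])
    finally show "Re (G f) \<le> ?C * (SUP k. cell_norm k f)" unfolding SUP_cell_norm .
    show "Re (G (t *\<^sub>R f)) = t * Re (G f)" for t
    proof -
      have e: "t *\<^sub>R f = (\<lambda>j x. of_real t * f j x)" by (intro ext) (simp add: scaleR_conv_of_real)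
      show ?thesis unfolding e dual_spaceD(2)[OF G bcs_subset_L0[OF f]] by simp
    qed
    fix h assume h: "h \<in> bcs"
    have e: "f + h = (\<lambda>j x. f j x + h j x)" by (intro ext) simp
    show "Re (G (f + h)) = Re (G f) + Re (G h)"
      unfolding e dual_spaceD(1)[OF G bcs_subset_L0[OF f] bcs_subset_L0[OF h]] by simp
  qed blast
  define b where "b k = lqn q' (a k)" for k
  \<comment> \<open>The smallest coefficient for which \<open>b k / \<mu> k\<close> obeys the norm
    bound of an atom; the decomposition bounds the sum of these by the norm of the
    functional.\<close>
  define \<mu> where "\<mu> k = Lpr p' UNIV (b k) / w k" for k
  have wpos: "0 < w k" for k by (simp add: weight_def)
  have \<mu>_nn: "0 \<le> \<mu> k" for k using wpos[of k] by (simp add: \<mu>_def less_imp_le)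
  have \<mu>_le: "(\<Sum>k<n. \<mu> k) \<le> ?C" for n using a_le[of n] by (simp only: \<mu>_def b_def)
  have \<mu>_sum: "summable \<mu>" by (rule summableI_nonneg_bounded[OF \<mu>_nn \<mu>_le])
  have \<mu>C: "(\<Sum>k. \<mu> k) \<le> ?C" by (rule suminf_le_const[OF \<mu>_sum \<mu>_le])
  have maj: "majorant b \<mu>"
    unfolding majorant_def
  proof (intro conjI allI)
    fix k
    show "b k \<in> borel_measurable lebesgue" unfolding b_def by (rule lqn_measurable) measurable
    show "0 \<le> b k x" for x by (simp add: b_def)
    show "AE x in lebesgue. x \<notin> Q k \<longrightarrow> b k x = 0" using q' by (simp add: b_def lqn_def a_off)
    show "integrable lebesgue (\<lambda>x. b k x powr p')" unfolding b_def by (rule a_int)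
    show "Lpr p' UNIV (b k) \<le> \<mu> k * w k" using wpos[of k] by (simp add: \<mu>_def)
    show "0 \<le> \<mu> k" by (rule \<mu>_nn)
    show "summable \<mu>" by (rule \<mu>_sum)
  qed
  define g where "g j x = (\<Sum>k. a k j x)" for j x
  have g_meas: "g j \<in> borel_measurable lebesgue" for j unfolding g_def by measurable
  have good: "AE x in lebesgue. (\<forall>k. summable (\<lambda>j. norm (a k j x) powr q')) \<and> summable (\<lambda>k. b k x)"
  proof -
    have "AE x in lebesgue. \<forall>k. summable (\<lambda>j. norm (a k j x) powr q')" using a_sum by (subst AE_all_countable) blast
    then show ?thesis using majorant_AE_summable[OF maj] by eventually_elim blast
  qed
  have q1: "1 \<le> q'" using q' by simp
  have g_sum: "AE x in lebesgue. summable (\<lambda>j. norm (g j x) powr q')"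
    and g_le: "AE x in lebesgue. lqn q' g x \<le> (\<Sum>k. b k x)"
  proof -
    have "AE x in lebesgue. summable (\<lambda>j. norm (g j x) powr q') \<and> lqn q' g x \<le> (\<Sum>k. b k x)"
      using good
    proof eventually_elim
      case (elim x)
      have ge: "g = (\<lambda>j x. \<Sum>k. a k j x)" by (simp add: g_def fun_eq_iff)
      have "summable (\<lambda>k. lqn q' (a k) x)" using elim by (simp add: b_def)
      note L = lqn_series_le[of q' a x, OF q1 elim[THEN conjunct1, rule_format] this]
      show ?case unfolding ge b_def using L by blast
    qed
    then show "AE x in lebesgue. summable (\<lambda>j. norm (g j x) powr q')" "AE x in lebesgue. lqn q' g x \<le> (\<Sum>k. b k x)"
      by (auto elim: eventually_mono)
  qed
  have gH: "g \<in> H" by (rule predual_lqI(1)[OF g_meas g_sum maj g_le])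
  have re: "Re (G f) = Re (pairing g f)" if f: "f \<in> bcs" for f
  proof -
    have fL: "f \<in> morrey_lq p r q" by (rule morrey0_subset[OF bcs_subset_L0[OF f]])
    note [measurable] = morrey_lqD(1)[OF fL]
    note adm = admissible_lqn[OF fL]
    have fb: "f \<in> bfin" using f by (simp add: bcs_def)
    obtain m where m: "\<And>j. m \<le> j \<Longrightarrow> f j = (\<lambda>_. 0)" using bfinE[OF fb] by metis
    have fin: "(\<Sum>j. k j x * f j x) = (\<Sum>j<m. k j x * f j x)" for k :: "nat \<Rightarrow> real ^ 'n \<Rightarrow> complex" and x
      by (rule suminf_finite) (auto simp: m not_less)
    let ?t = "\<lambda>k x. \<Sum>j. a k j x * f j x"
    have t_le: "AE x in lebesgue. norm (?t k x) \<le> b k x * lqn q f x" for k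
      using a_sum[of k]
    proof eventually_elim
      case (elim x)
      note h = lqn_Hoelder[where f = f and g = "a k" and x = x, OF q conj_q bfin_summable[OF fb] elim]
      show ?case using summable_norm[OF h(1)] h(2) unfolding b_def by linarith
    qed
    have t_int: "integrable lebesgue (?t k)" for k
    proof (rule Bochner_Integration.integrable_bound[OF majorant_pairing(1)[OF maj adm]])
      show "AE x in lebesgue. norm (?t k x) \<le> norm (b k x * lqn q f x)"
        using t_le[of k] by eventually_elim (simp add: order_trans[OF _ abs_ge_self])
    qed measurable
    have t_norm: "summable (\<lambda>k. LINT x|lebesgue. norm (?t k x))"
    proof (rule summable_comparison_test'[OF majorant_pairing(2)[OF maj adm]])
      fix k
      have "(LINT x|lebesgue. norm (?t k x)) \<le> (LINT x|lebesgue. b k x * lqn q f x)"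
        using t_le t_int majorant_pairing(1)[OF maj adm] by (intro integral_mono_AE integrable_norm)
      then show "norm (LINT x|lebesgue. norm (?t k x)) \<le> (LINT x|lebesgue. b k x * lqn q f x)" by simp
    qed
    have t_ae: "AE x in lebesgue. summable (\<lambda>k. norm (?t k x))"
      by (rule summable_integral_AE_summable[OF integrable_norm[OF t_int] _ t_norm]) simp
    have s: "(\<lambda>k. LINT x|lebesgue. ?t k x) sums (LINT x|lebesgue. (\<Sum>k. ?t k x))"
      by (rule sums_integral[OF t_int t_ae t_norm])
    have swap: "(LINT x|lebesgue. (\<Sum>k. ?t k x)) = pairing g f"
      unfolding pairing_def
    proof (rule integral_cong_AE)
      show "AE x in lebesgue. (\<Sum>k. ?t k x) = (\<Sum>j. g j x * f j x)"
        using good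
      proof eventually_elim
        case (elim x)
        have as: "summable (\<lambda>k. a k j x)" for j
        proof (rule summable_norm_cancel, rule summable_comparison_test'[OF elim[THEN conjunct2]])
          show "norm (norm (a k j x)) \<le> b k x" for k
            unfolding b_def using norm_le_lqn[where f = "a k" and x = x and j = j, OF q1 elim[THEN conjunct1, rule_format]] by simp
        qed
        \<comment> \<open>Only finitely many components of \<open>f\<close> are nonzero, so
          exchanging the two sums needs convergence in \<open>k\<close> only.\<close>
        have "(\<Sum>k. ?t k x) = (\<Sum>k. \<Sum>j<m. a k j x * f j x)" by (simp only: fin)
        also have "\<dots> = (\<Sum>j<m. \<Sum>k. a k j x * f j x)"
          by (rule suminf_sum) (intro summable_mult2 as)
        also have "\<dots> = (\<Sum>j<m. g j x * f j x)"
          unfolding g_def by (intro sum.cong refl suminf_mult2[symmetric] as)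
        finally show ?case by (simp only: fin)
      qed
      show "(\<lambda>x. \<Sum>k. ?t k x) \<in> borel_measurable lebesgue" by measurable
      show "(\<lambda>x. \<Sum>j. g j x * f j x) \<in> borel_measurable lebesgue" using g_meas by measurable
    qed
    have "(\<lambda>n. \<Sum>k<n. LINT x|lebesgue. ?t k x) \<longlonglongrightarrow> pairing g f"
      using s unfolding swap sums_def .
    then have "(\<lambda>n. Re (\<Sum>k<n. LINT x|lebesgue. ?t k x)) \<longlonglongrightarrow> Re (pairing g f)" by (rule tendsto_Re)
    also have "(\<lambda>n. Re (\<Sum>k<n. LINT x|lebesgue. ?t k x)) = (\<lambda>n. \<Sum>k<n. LINT x|lebesgue. Re (?t k x))"
      unfolding Re_sum by (intro ext sum.cong refl integral_Re[symmetric] t_int)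
    finally show ?thesis using LIMSEQ_unique[OF a_lim[OF f]] by blast
  qed
  have "G f = pairing g f" if f: "f \<in> bcs" for f
  proof (rule complex_eqI)
    show "Re (G f) = Re (pairing g f)" by (rule re[OF f])
    \<comment> \<open>The identity of real parts at \<i> f is that of imaginary parts at
      \<open>f\<close>; \<open>bcs\<close> is closed under complex multiples.\<close>
    have "Re (\<i> * G f) = Re (\<i> * pairing g f)"
      using re[OF bcs_cmult[OF f, of \<i>]]
      unfolding dual_spaceD(2)[OF G bcs_subset_L0[OF f]] pairing_cmult[OF gH morrey0_subset[OF bcs_subset_L0[OF f]]] .
    then show "Im (G f) = Im (pairing g f)" by simp
  qed
  then have "\<forall>f\<in>L0. G f = pairing g f"
    using dual_space_eq_on_dense[OF G pairing_dual_space[OF gH]] by blast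
  then show ?thesis using gH maj g_le \<mu>C by blast
qed

text \<open>One inequality is the estimate of the pairing. For the other, the representation theorem
  gives some g' whose majorant is bounded by the dual norm, and uniqueness identifies it with
  \<open>g\<close> almost everywhere, so that majorant bounds the predual norm of \<open>g\<close>
  as well.\<close>

lemma dual_norm_pairing:
  assumes g: "g \<in> H" and G: "G \<in> dual_space L0 N\<^sub>L" and eq: "\<And>f. f \<in> L0 \<Longrightarrow> G f = pairing g f"
  shows "dual_norm L0 N\<^sub>L G = N\<^sub>H g"
proof (rule antisym)
  show "dual_norm L0 N\<^sub>L G \<le> N\<^sub>H g"
  proof (rule dual_norm_le)
    fix f assume f: "f \<in> L0" "N\<^sub>L f \<le> 1"
    have "norm (G f) \<le> N\<^sub>H g * N\<^sub>L f" unfolding eq[OF f(1)] by (rule pairing_bound(3)[OF g morrey0_subset[OF f(1)]])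
    also have "\<dots> \<le> N\<^sub>H g * 1" by (intro mult_left_mono f predual_lq_norm_nonneg g)
    finally show "norm (G f) \<le> N\<^sub>H g" by simp
  qed
  obtain g' b \<mu> where g': "g' \<in> H" "\<forall>f\<in>L0. G f = pairing g' f" "majorant b \<mu>"
    "AE x in lebesgue. lqn q' g' x \<le> (\<Sum>k. b k x)" "(\<Sum>k. \<mu> k) \<le> dual_norm L0 N\<^sub>L G"
    using dual_representation[OF G] by blast
  have "ae_equal g g'"
    by (rule representation_unique[OF g g'(1)]) (use g'(2) eq bcs_subset_L0 in auto)
  then have "AE x in lebesgue. \<forall>j. g j x = g' j x" unfolding ae_equal_def by (simp add: AE_all_countable)
  then have le: "AE x in lebesgue. lqn q' g x \<le> (\<Sum>k. b k x)"
    using g'(4)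
  proof eventually_elim
    case (elim x)
    then have "lqn q' g x = lqn q' g' x" by (simp add: lqn_def)
    then show ?case using elim by simp
  qed
  have "N\<^sub>H g \<le> (\<Sum>k. \<mu> k)" by (rule predual_lqI(2)[OF predual_lqD(2,3)[OF g] g'(3) le])
  then show "N\<^sub>H g \<le> dual_norm L0 N\<^sub>L G" using g'(5) by linarith
qed

text \<open>In the extended reals the equation includes that the supremum is finite. Every real
  upper bound dominates the dual norm of the pairing, which is the predual norm of
  \<open>g\<close>.\<close>

lemma SUP_ereal_pairing:
  assumes g: "g \<in> H"
  shows "ereal (N\<^sub>H g) = (SUP f\<in>{f \<in> L0. N\<^sub>L f \<le> 1}. ereal (norm (pairing g f)))"
proof (rule SUP_eqI[symmetric])
  note P = pairing_dual_space[OF g]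
  have dn: "dual_norm L0 N\<^sub>L (pairing g) = N\<^sub>H g" by (rule dual_norm_pairing[OF g P refl])
  fix f assume "f \<in> {f \<in> L0. N\<^sub>L f \<le> 1}"
  then have f: "f \<in> L0" "N\<^sub>L f \<le> 1" by auto
  have "norm (pairing g f) \<le> N\<^sub>H g * N\<^sub>L f" by (rule pairing_bound(3)[OF g morrey0_subset[OF f(1)]])
  also have "\<dots> \<le> N\<^sub>H g * 1" by (intro mult_left_mono f predual_lq_norm_nonneg g)
  finally show "ereal (norm (pairing g f)) \<le> ereal (N\<^sub>H g)" by simp
next
  note P = pairing_dual_space[OF g]
  have dn: "dual_norm L0 N\<^sub>L (pairing g) = N\<^sub>H g" by (rule dual_norm_pairing[OF g P refl])
  fix y assume y: "\<And>f. f \<in> {f \<in> L0. N\<^sub>L f \<le> 1} \<Longrightarrow> ereal (norm (pairing g f)) \<le> y"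
  show "ereal (N\<^sub>H g) \<le> y"
  proof (cases y)
    case (real s)
    have "dual_norm L0 N\<^sub>L (pairing g) \<le> s"
    proof (rule dual_norm_le)
      fix f assume "f \<in> L0" "N\<^sub>L f \<le> 1"
      then show "norm (pairing g f) \<le> s" using y[of f] real by simp
    qed
    then show ?thesis using dn real by simp
  next
    \<comment> \<open>The zero sequence lies in the unit ball, so no upper bound is
      -\<infinity>.\<close>
    case MInf
    have "(\<lambda>j x. 0) \<in> {f \<in> L0. N\<^sub>L f \<le> 1}" using zero_L0 zero_norm by simp
    from y[OF this] show ?thesis using MInf by simp
  qed simp
qed

end

text \<open>\<open>dual_space\<close> prescribes the behaviour of a functional on \<open>L0\<close>
  alone, so uniqueness of the functional that belongs to \<open>g\<close> is asserted for its values
  on \<open>L0\<close>. Conversely, \<open>g\<close> is determined up to almost everywhere equality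
  of its components. The last part speaks of all of \<open>L0\<close>, where the integral exists as
  well.\<close>

theorem theorem3p3:
  fixes p p' q q' r \<rho> u :: real
    and L\<^sub>u L0 H :: "(nat \<Rightarrow> real ^ 'n::finite \<Rightarrow> complex) set"
    and N\<^sub>L N\<^sub>H :: "(nat \<Rightarrow> real ^ 'n \<Rightarrow> complex) \<Rightarrow> real"
  assumes p: "1 < p" and r: "- real CARD('n) / p < r" "r < 0"
    and \<rho>: "r + \<rho> = - real CARD('n)"
    and q: "1 < q"
    and p': "1 / p + 1 / p' = 1" and q': "1 / q + 1 / q' = 1"
  defines "u \<equiv> - real CARD('n) / r"
    and "L\<^sub>u \<equiv> Lp_lq u q"
    and "L0 \<equiv> morrey0_lq p r q"
    and "N\<^sub>L \<equiv> morrey_lq_norm p r q"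
    and "H \<equiv> predual_lq p' \<rho> q'"
    and "N\<^sub>H \<equiv> predual_lq_norm p' \<rho> q'"
  shows "(L\<^sub>u \<subseteq> L0 \<and> (\<exists>C. \<forall>f\<in>L\<^sub>u. N\<^sub>L f \<le> C * Lp_lq_norm u q f)) \<and>
    (\<forall>G\<in>dual_space L0 N\<^sub>L.
       \<exists>g\<in>H. represents_on L\<^sub>u g G \<and> dual_norm L0 N\<^sub>L G = N\<^sub>H g \<and>
         (\<forall>g'\<in>H. represents_on L\<^sub>u g' G \<longrightarrow> ae_equal g' g)) \<and>
    (\<forall>g\<in>H.
       \<exists>G\<in>dual_space L0 N\<^sub>L. represents_on L\<^sub>u g G \<and> dual_norm L0 N\<^sub>L G = N\<^sub>H g \<and>
         (\<forall>G'\<in>dual_space L0 N\<^sub>L. represents_on L\<^sub>u g G' \<longrightarrow> (\<forall>f\<in>L0. G' f = G f))) \<and>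
    (\<forall>g\<in>H.
       (\<forall>f\<in>L0. pairing_exists g f) \<and>
       ereal (N\<^sub>H g) = (SUP f\<in>{f \<in> L0. N\<^sub>L f \<le> 1}. ereal (norm (pairing g f))))"
proof -
  define Ix where "Ix = (from_nat_into UNIV :: nat \<Rightarrow> int \<times> (int ^ 'n))"
  \<comment> \<open>A bijective enumeration by the naturals exists because the index set of the
    cubes is countable and infinite.\<close>
  have "infinite (UNIV :: (int \<times> (int ^ 'n)) set)"
  proof
    assume "finite (UNIV :: (int \<times> (int ^ 'n)) set)"
    then have "finite (range (fst :: int \<times> (int ^ 'n) \<Rightarrow> int))" by (rule finite_imageI)
    then show False by (simp add: infinite_UNIV_int)
  qed
  then have Ix: "bij Ix" unfolding Ix_def by (intro bij_betw_from_nat_into) auto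
  interpret morrey_setting p p' q q' r \<rho> u Ix
    by (rule morrey_setting.intro) (fact p r \<rho> q p' q' Ix | simp add: u_def)+
  note defs = L\<^sub>u_def L0_def N\<^sub>L_def H_def N\<^sub>H_def
  have rep: "represents_on (Lp_lq u q) g G"
    if "g \<in> predual_lq p' \<rho> q'" "\<forall>f\<in>morrey0_lq p r q. G f = pairing g f"
    for g :: "nat \<Rightarrow> real ^ 'n \<Rightarrow> complex" and G
    unfolding represents_on_def
  proof (intro ballI conjI)
    fix f :: "nat \<Rightarrow> real ^ 'n \<Rightarrow> complex" assume f: "f \<in> Lp_lq u q"
    show "pairing_exists g f" by (rule pairing_exists_predual[OF that(1) Lp_lq_subset_morrey_lq(1)[OF f]])
    show "G f = pairing g f" using that(2) subsetD[OF Lp_lq_subset_morrey0_lq f] by blast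
  qed
  have rep_bcs: "G f = pairing g f" if "represents_on (Lp_lq u q) g G" "f \<in> bcs"
    for g :: "nat \<Rightarrow> real ^ 'n \<Rightarrow> complex" and G f
    using that(1) subsetD[OF bcs_subset_Lp_lq that(2)] unfolding represents_on_def by blast
  show ?thesis
    unfolding defs
  proof (intro conjI ballI)
    show "(Lp_lq u q :: (nat \<Rightarrow> real ^ 'n \<Rightarrow> complex) set) \<subseteq> morrey0_lq p r q" by (rule Lp_lq_subset_morrey0_lq)
    show "\<exists>C. \<forall>f\<in>Lp_lq u q. morrey_lq_norm p r q (f :: nat \<Rightarrow> real ^ 'n \<Rightarrow> complex) \<le> C * Lp_lq_norm u q f"
      using Lp_lq_subset_morrey_lq(2) by blast
  next
    fix G :: "(nat \<Rightarrow> real ^ 'n \<Rightarrow> complex) \<Rightarrow> complex"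
    assume G: "G \<in> dual_space (morrey0_lq p r q) (morrey_lq_norm p r q)"
    obtain g where g: "g \<in> predual_lq p' \<rho> q'" "\<forall>f\<in>morrey0_lq p r q. G f = pairing g f"
      using dual_representation[OF G] by blast
    show "\<exists>g\<in>predual_lq p' \<rho> q'. represents_on (Lp_lq u q) g G \<and>
        dual_norm (morrey0_lq p r q) (morrey_lq_norm p r q) G = predual_lq_norm p' \<rho> q' g \<and>
        (\<forall>g'\<in>predual_lq p' \<rho> q'. represents_on (Lp_lq u q) g' G \<longrightarrow> ae_equal g' g)"
    proof (intro bexI[OF _ g(1)] conjI ballI impI)
      show "represents_on (Lp_lq u q) g G" by (rule rep[OF g])
      show "dual_norm (morrey0_lq p r q) (morrey_lq_norm p r q) G = predual_lq_norm p' \<rho> q' g"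
        by (rule dual_norm_pairing[OF g(1) G]) (use g(2) in blast)
      fix g' assume g': "g' \<in> predual_lq p' \<rho> q'" "represents_on (Lp_lq u q) g' G"
      show "ae_equal g' g"
      proof (rule representation_unique[OF g'(1) g(1)])
        fix f assume f: "f \<in> bcs"
        have "pairing g' f = G f" by (rule rep_bcs[OF g'(2) f, symmetric])
        also have "\<dots> = pairing g f" using g(2) bcs_subset_L0[OF f] by blast
        finally show "pairing g' f = pairing g f" .
      qed
    qed
  next
    fix g :: "nat \<Rightarrow> real ^ 'n \<Rightarrow> complex"
    assume g: "g \<in> predual_lq p' \<rho> q'"
    note P = pairing_dual_space[OF g]
    show "\<exists>G\<in>dual_space (morrey0_lq p r q) (morrey_lq_norm p r q). represents_on (Lp_lq u q) g G \<and>
        dual_norm (morrey0_lq p r q) (morrey_lq_norm p r q) G = predual_lq_norm p' \<rho> q' g \<and>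
        (\<forall>G'\<in>dual_space (morrey0_lq p r q) (morrey_lq_norm p r q).
          represents_on (Lp_lq u q) g G' \<longrightarrow> (\<forall>f\<in>morrey0_lq p r q. G' f = G f))"
    proof (intro bexI[OF _ P] conjI ballI impI)
      show "represents_on (Lp_lq u q) g (pairing g)" by (rule rep[OF g]) simp
      show "dual_norm (morrey0_lq p r q) (morrey_lq_norm p r q) (pairing g) = predual_lq_norm p' \<rho> q' g"
        by (rule dual_norm_pairing[OF g P refl])
      fix G' and f :: "nat \<Rightarrow> real ^ 'n \<Rightarrow> complex"
      assume G': "G' \<in> dual_space (morrey0_lq p r q) (morrey_lq_norm p r q)" "represents_on (Lp_lq u q) g G'"
        and f: "f \<in> morrey0_lq p r q"
      show "G' f = pairing g f"
        \<comment> \<open>\<open>bcs\<close> lies in \<open>L\<^sub>u\<close> and is dense in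
          \<open>L0\<close>, so agreement of the two functionals on \<open>L\<^sub>u\<close> extends
          to \<open>L0\<close>.\<close>
        by (rule dual_space_eq_on_dense[OF G'(1) P rep_bcs[OF G'(2)] f])
    qed
  next
    fix g f :: "nat \<Rightarrow> real ^ 'n \<Rightarrow> complex"
    assume g: "g \<in> predual_lq p' \<rho> q'" and f: "f \<in> morrey0_lq p r q"
    show "pairing_exists g f" by (rule pairing_exists_predual[OF g morrey0_subset[OF f]])
  next
    fix g :: "nat \<Rightarrow> real ^ 'n \<Rightarrow> complex"
    assume g: "g \<in> predual_lq p' \<rho> q'"
    show "ereal (predual_lq_norm p' \<rho> q' g)
        = (SUP f\<in>{f \<in> morrey0_lq p r q. morrey_lq_norm p r q f \<le> 1}. ereal (norm (pairing g f)))"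
      by (rule SUP_ereal_pairing[OF g])
  qed
qed

end
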